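(* Let $k$ be a field with algebraic closure $\bar k$, let $G$ be a finite group, let $[\alpha]\in H^2(G,k^* )$ (trivial $G$-action on $k^*$) be an element of order $m$ represented by a 2-cocycle $\alpha$, and let $f:G\to k^*$ be a 1-cochain with $\alpha^m(\sigma,\tau)=f(\sigma)f(\tau)/f(\sigma\tau)$ for all $\sigma,\tau\in G$. Then there is a finite dimensional cocommutative Hopf algebra $A$ over $k$ of dimension $m|G|$ such that: (1) The twisted group algebra $k^{\alpha}G$ is a homomorphic image (as a $k$-algebra) of $A$; and when the characteristic of $k$ does not divide $|G|$, $A$ is semisimple. (2) If the characteristic of $k$ does not divide $m$, then $A$ is a form of the group algebra $\bar k\widehat{G}$, i.e. $A\otimes_k\bar k\cong \bar k\widehat{G}$ as Hopf algebras over $\bar k$, where $\widehat{G}$ is the central extension of $G$ by $\mathbb{Z}/m\mathbb{Z}$ induced by $[\alpha]$ (and $f$).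
   Context: For a 2-cocycle $\alpha\in Z^2(G,k^* )$, the twisted group algebra $k^\alpha G$ is the $k$-algebra with $k$-basis $\{U_\sigma\}_{\sigma\in G}$ and multiplication $U_\sigma U_\tau=\alpha(\sigma,\tau)U_{\sigma\tau}$. Up to isomorphism it depends only on $[\alpha]\in H^2(G,k^* )$. Central extension $\widehat{G}$ (when $\mathrm{char}(k)\nmid m$): choose $g:G\to\bar k^*$ with $g(\sigma)^m=f(\sigma)$ for all $\sigma\in G$ and put $\bar\alpha(\sigma,\tau)=\alpha(\sigma,\tau)\,g(\sigma\tau)/(g(\sigma)g(\tau))$, i.e. $\bar\alpha=\alpha/dg$ with $dg(\sigma,\tau)=g(\sigma)g(\tau)/g(\sigma\tau)$. Then $\bar\alpha$ is a 2-cocycle of $G$ with values in the group of $m$-th roots of unity of $\bar k$, which is isomorphic to $\mathbb{Z}/m\mathbb{Z}$, and $\widehat{G}$ is the corresponding central extension $1\to\mathbb{Z}/m\mathbb{Z}\to\widehat{G}\to G\to 1$; it does not depend, up to equivalence of extensions, on the choice of $g$. A Hopf algebra is called semisimple if it is semisimple as an algebra. The group algebra $\bar k\widehat G$ has its usual Hopf algebra structure. *)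

theory Defs
  imports
    "HOL-Algebra.Algebraic_Closure"
    "HOL-Algebra.Product_Groups"
    "HOL-Algebra.Elementary_Groups"
    "Jordan_Normal_Form.Missing_VectorSpace"
begin

section \<open>Cohomology with trivial action\<close>

definition cochains2 :: "('g, 'm) monoid_scheme \<Rightarrow> ('c, 'n) monoid_scheme \<Rightarrow> ('g \<times> 'g \<Rightarrow> 'c) monoid"
  where "cochains2 G M = product_group (carrier G \<times> carrier G) (\<lambda>_. M)"

definition coboundary ::
    "('g, 'm) monoid_scheme \<Rightarrow> ('c, 'n) monoid_scheme \<Rightarrow> ('g \<Rightarrow> 'c) \<Rightarrow> 'g \<times> 'g \<Rightarrow> 'c"
  where "coboundary G M g =
    (\<lambda>(\<sigma>, \<tau>) \<in> carrier G \<times> carrier G. g \<sigma> \<otimes>\<^bsub>M\<^esub> g \<tau> \<otimes>\<^bsub>M\<^esub> inv\<^bsub>M\<^esub> (g (\<sigma> \<otimes>\<^bsub>G\<^esub> \<tau>)))"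

definition cocycles2 :: "('g, 'm) monoid_scheme \<Rightarrow> ('c, 'n) monoid_scheme \<Rightarrow> ('g \<times> 'g \<Rightarrow> 'c) monoid"
  where "cocycles2 G M = (cochains2 G M)
    \<lparr>carrier := {\<alpha> \<in> carrier (cochains2 G M).
      \<forall>\<rho>\<in>carrier G. \<forall>\<sigma>\<in>carrier G. \<forall>\<tau>\<in>carrier G.
        \<alpha> (\<rho>, \<sigma>) \<otimes>\<^bsub>M\<^esub> \<alpha> (\<rho> \<otimes>\<^bsub>G\<^esub> \<sigma>, \<tau>) = \<alpha> (\<sigma>, \<tau>) \<otimes>\<^bsub>M\<^esub> \<alpha> (\<rho>, \<sigma> \<otimes>\<^bsub>G\<^esub> \<tau>)}\<rparr>"

definition coboundaries2 :: "('g, 'm) monoid_scheme \<Rightarrow> ('c, 'n) monoid_scheme \<Rightarrow> ('g \<times> 'g \<Rightarrow> 'c) set"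
  where "coboundaries2 G M = coboundary G M ` (carrier G \<rightarrow> carrier M)"

definition cohomology2 :: "('g, 'm) monoid_scheme \<Rightarrow> ('c, 'n) monoid_scheme \<Rightarrow> ('g \<times> 'g \<Rightarrow> 'c) set monoid"
  where "cohomology2 G M = cocycles2 G M Mod coboundaries2 G M"

definition cohomology_class ::
    "('g, 'm) monoid_scheme \<Rightarrow> ('c, 'n) monoid_scheme \<Rightarrow> ('g \<times> 'g \<Rightarrow> 'c) \<Rightarrow> ('g \<times> 'g \<Rightarrow> 'c) set"
  where "cohomology_class G M \<alpha> = coboundaries2 G M #>\<^bsub>cocycles2 G M\<^esub> \<alpha>"


section \<open>Tensor products\<close>

text \<open>Only the module part of the record matters in \<open>free_module\<close>, \<open>quotient_module\<close> and
  \<open>tensor_module\<close>; the ring multiplication and unit are left unspecified there.\<close>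

definition free_module :: "('k, 'r) ring_scheme \<Rightarrow> 'x set \<Rightarrow> ('k, 'x \<Rightarrow> 'k) module"
  where "free_module R S =
    \<lparr>carrier = {p. (\<forall>x. p x \<in> carrier R) \<and> finite {x. p x \<noteq> \<zero>\<^bsub>R\<^esub>} \<and> {x. p x \<noteq> \<zero>\<^bsub>R\<^esub>} \<subseteq> S},
     monoid.mult = undefined, one = undefined,
     zero = (\<lambda>x. \<zero>\<^bsub>R\<^esub>), add = (\<lambda>p q x. p x \<oplus>\<^bsub>R\<^esub> q x),
     smult = (\<lambda>a p x. a \<otimes>\<^bsub>R\<^esub> p x)\<rparr>"

definition basis_vec :: "('k, 'r) ring_scheme \<Rightarrow> 'x \<Rightarrow> 'x \<Rightarrow> 'k"
  where "basis_vec R x = (\<lambda>y. if y = x then \<one>\<^bsub>R\<^esub> else \<zero>\<^bsub>R\<^esub>)"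

definition quotient_module :: "('k, 'v, 'm) module_scheme \<Rightarrow> 'v set \<Rightarrow> ('k, 'v set) module"
  where "quotient_module M N =
    \<lparr>carrier = a_rcosets\<^bsub>M\<^esub> N, monoid.mult = undefined, one = undefined,
     zero = N, add = set_add M,
     smult = (\<lambda>a C. \<Union>x\<in>C. N +>\<^bsub>M\<^esub> (a \<odot>\<^bsub>M\<^esub> x))\<rparr>"

definition tensor_relations ::
    "('k, 'r) ring_scheme \<Rightarrow> ('k, 'v, 'm) module_scheme \<Rightarrow> ('k, 'w, 'n) module_scheme \<Rightarrow> ('v \<times> 'w \<Rightarrow> 'k) set"
  where "tensor_relations R V W =
    (let F = free_module R (carrier V \<times> carrier W); \<delta> = basis_vec R in
     module.span R F
      ({\<delta> (v \<oplus>\<^bsub>V\<^esub> v', w) \<ominus>\<^bsub>F\<^esub> (\<delta> (v, w) \<oplus>\<^bsub>F\<^esub> \<delta> (v', w)) | v v' w.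
          v \<in> carrier V \<and> v' \<in> carrier V \<and> w \<in> carrier W} \<union>
       {\<delta> (v, w \<oplus>\<^bsub>W\<^esub> w') \<ominus>\<^bsub>F\<^esub> (\<delta> (v, w) \<oplus>\<^bsub>F\<^esub> \<delta> (v, w')) | v w w'.
          v \<in> carrier V \<and> w \<in> carrier W \<and> w' \<in> carrier W} \<union>
       {\<delta> (a \<odot>\<^bsub>V\<^esub> v, w) \<ominus>\<^bsub>F\<^esub> a \<odot>\<^bsub>F\<^esub> \<delta> (v, w) | a v w.
          a \<in> carrier R \<and> v \<in> carrier V \<and> w \<in> carrier W} \<union>
       {\<delta> (v, a \<odot>\<^bsub>W\<^esub> w) \<ominus>\<^bsub>F\<^esub> a \<odot>\<^bsub>F\<^esub> \<delta> (v, w) | a v w.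
          a \<in> carrier R \<and> v \<in> carrier V \<and> w \<in> carrier W}))"

definition tensor_module ::
    "('k, 'r) ring_scheme \<Rightarrow> ('k, 'v, 'm) module_scheme \<Rightarrow> ('k, 'w, 'n) module_scheme
      \<Rightarrow> ('k, ('v \<times> 'w \<Rightarrow> 'k) set) module"
  where "tensor_module R V W =
    quotient_module (free_module R (carrier V \<times> carrier W)) (tensor_relations R V W)"

definition pure_tensor ::
    "('k, 'r) ring_scheme \<Rightarrow> ('k, 'v, 'm) module_scheme \<Rightarrow> ('k, 'w, 'n) module_scheme
      \<Rightarrow> 'v \<Rightarrow> 'w \<Rightarrow> ('v \<times> 'w \<Rightarrow> 'k) set"
  where "pure_tensor R V W v w =
    tensor_relations R V W +>\<^bsub>free_module R (carrier V \<times> carrier W)\<^esub> basis_vec R (v, w)"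

text \<open>\<open>tensor_lift R U \<beta>\<close> is the linear map into \<open>U\<close> induced by a bilinear map \<open>\<beta>\<close>: the linear
  extension of \<open>\<beta>\<close> to the free module is constant on each coset of the tensor relations, and
  \<open>the_elem\<close> picks that value.\<close>

definition tensor_lift ::
    "('k, 'r) ring_scheme \<Rightarrow> ('k, 'u, 'm) module_scheme \<Rightarrow> ('v \<Rightarrow> 'w \<Rightarrow> 'u) \<Rightarrow> ('v \<times> 'w \<Rightarrow> 'k) set \<Rightarrow> 'u"
  where "tensor_lift R U \<beta> t =
    the_elem ((\<lambda>p. \<Oplus>\<^bsub>U\<^esub>x\<in>{x. p x \<noteq> \<zero>\<^bsub>R\<^esub>}. p x \<odot>\<^bsub>U\<^esub> \<beta> (fst x) (snd x)) ` t)"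

definition tensor_map ::
    "('k, 'r) ring_scheme \<Rightarrow> ('k, 'v2, 'm) module_scheme \<Rightarrow> ('k, 'w2, 'n) module_scheme
      \<Rightarrow> ('v \<Rightarrow> 'v2) \<Rightarrow> ('w \<Rightarrow> 'w2) \<Rightarrow> ('v \<times> 'w \<Rightarrow> 'k) set \<Rightarrow> ('v2 \<times> 'w2 \<Rightarrow> 'k) set"
  where "tensor_map R V' W' \<phi> \<psi> =
    tensor_lift R (tensor_module R V' W') (\<lambda>v w. pure_tensor R V' W' (\<phi> v) (\<psi> w))"

definition tensor_assoc ::
    "('k, 'r) ring_scheme \<Rightarrow> ('k, 'u, 'l) module_scheme \<Rightarrow> ('k, 'v, 'm) module_scheme
      \<Rightarrow> ('k, 'w, 'n) module_scheme \<Rightarrow> (('u \<times> 'v \<Rightarrow> 'k) set \<times> 'w \<Rightarrow> 'k) set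
      \<Rightarrow> ('u \<times> ('v \<times> 'w \<Rightarrow> 'k) set \<Rightarrow> 'k) set"
  where "tensor_assoc R U V W =
    (let VW = tensor_module R V W; T = tensor_module R U VW in
     tensor_lift R T (\<lambda>t w. tensor_lift R T (\<lambda>u v. pure_tensor R U VW u (pure_tensor R V W v w)) t))"

definition tensor_swap ::
    "('k, 'r) ring_scheme \<Rightarrow> ('k, 'v, 'm) module_scheme \<Rightarrow> ('k, 'w, 'n) module_scheme
      \<Rightarrow> ('v \<times> 'w \<Rightarrow> 'k) set \<Rightarrow> ('w \<times> 'v \<Rightarrow> 'k) set"
  where "tensor_swap R V W =
    tensor_lift R (tensor_module R W V) (\<lambda>v w. pure_tensor R W V w v)"


section \<open>Algebras over a field\<close>

text \<open>The library locale \<open>algebra\<close> is restricted to commutative algebras.\<close>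

locale assoc_algebra = vectorspace K A + A: ring A for K and A +
  assumes smult_mult_left:
      "\<lbrakk>a \<in> carrier K; x \<in> carrier A; y \<in> carrier A\<rbrakk> \<Longrightarrow>
        (a \<odot>\<^bsub>A\<^esub> x) \<otimes>\<^bsub>A\<^esub> y = a \<odot>\<^bsub>A\<^esub> (x \<otimes>\<^bsub>A\<^esub> y)"
    and smult_mult_right:
      "\<lbrakk>a \<in> carrier K; x \<in> carrier A; y \<in> carrier A\<rbrakk> \<Longrightarrow>
        x \<otimes>\<^bsub>A\<^esub> (a \<odot>\<^bsub>A\<^esub> y) = a \<odot>\<^bsub>A\<^esub> (x \<otimes>\<^bsub>A\<^esub> y)"

definition algebra_hom ::
    "('k, 'r) ring_scheme \<Rightarrow> ('k, 'a, 'm) module_scheme \<Rightarrow> ('k, 'b, 'n) module_scheme \<Rightarrow> ('a \<Rightarrow> 'b) set"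
  where "algebra_hom R A B = ring_hom A B \<inter> module_hom R A B"

definition regular_algebra :: "('k, 'r) ring_scheme \<Rightarrow> ('k, 'k) module"
  where "regular_algebra R =
    \<lparr>carrier = carrier R, monoid.mult = monoid.mult R, one = \<one>\<^bsub>R\<^esub>, zero = \<zero>\<^bsub>R\<^esub>, add = add R, smult = monoid.mult R\<rparr>"

definition tensor_algebra ::
    "('k, 'r) ring_scheme \<Rightarrow> ('k, 'a, 'm) module_scheme \<Rightarrow> ('k, 'b, 'n) module_scheme
      \<Rightarrow> ('k, ('a \<times> 'b \<Rightarrow> 'k) set) module"
  where "tensor_algebra R A B =
    (let T = tensor_module R A B in
     T\<lparr>monoid.mult := (\<lambda>s t. tensor_lift R T (\<lambda>a b.
                  tensor_lift R T (\<lambda>a' b'. pure_tensor R A B (a \<otimes>\<^bsub>A\<^esub> a') (b \<otimes>\<^bsub>B\<^esub> b')) t) s),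
       one := pure_tensor R A B \<one>\<^bsub>A\<^esub> \<one>\<^bsub>B\<^esub>\<rparr>)"

definition left_ideal :: "'a set \<Rightarrow> ('a, 'm) ring_scheme \<Rightarrow> bool"
  where "left_ideal I A \<longleftrightarrow>
    subgroup I (add_monoid A) \<and> (\<forall>a\<in>carrier A. \<forall>x\<in>I. a \<otimes>\<^bsub>A\<^esub> x \<in> I)"

text \<open>A ring is semisimple if its left regular module is, i.e. if every left ideal is a direct
  summand.\<close>

definition semisimple_ring :: "('a, 'm) ring_scheme \<Rightarrow> bool"
  where "semisimple_ring A \<longleftrightarrow>
    (\<forall>I. left_ideal I A \<longrightarrow>
      (\<exists>J. left_ideal J A \<and> I \<inter> J = {\<zero>\<^bsub>A\<^esub>} \<and> I <+>\<^bsub>A\<^esub> J = carrier A))"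

text \<open>The order of 1 in the additive group; \<open>ord\<close> is 0 for elements of infinite order.\<close>

definition characteristic :: "('k, 'r) ring_scheme \<Rightarrow> nat"
  where "characteristic R = group.ord (add_monoid R) \<one>\<^bsub>R\<^esub>"

text \<open>The cocycle need not be normalized, so the unit is \<open>\<alpha>(1,1)\<^sup>-\<^sup>1 U\<^sub>1\<close>.\<close>

definition twisted_group_algebra ::
    "('k, 'r) ring_scheme \<Rightarrow> ('g, 'm) monoid_scheme \<Rightarrow> ('g \<times> 'g \<Rightarrow> 'k) \<Rightarrow> ('k, 'g \<Rightarrow> 'k) module"
  where "twisted_group_algebra R G \<alpha> =
    (let F = free_module R (carrier G) in
     F\<lparr>monoid.mult := (\<lambda>p q. \<Oplus>\<^bsub>F\<^esub>\<sigma>\<in>{\<sigma>. p \<sigma> \<noteq> \<zero>\<^bsub>R\<^esub>}. \<Oplus>\<^bsub>F\<^esub>\<tau>\<in>{\<tau>. q \<tau> \<noteq> \<zero>\<^bsub>R\<^esub>}.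
                  (p \<sigma> \<otimes>\<^bsub>R\<^esub> q \<tau> \<otimes>\<^bsub>R\<^esub> \<alpha> (\<sigma>, \<tau>)) \<odot>\<^bsub>F\<^esub> basis_vec R (\<sigma> \<otimes>\<^bsub>G\<^esub> \<tau>)),
       one := inv\<^bsub>R\<^esub> (\<alpha> (\<one>\<^bsub>G\<^esub>, \<one>\<^bsub>G\<^esub>)) \<odot>\<^bsub>F\<^esub> basis_vec R \<one>\<^bsub>G\<^esub>\<rparr>)"


section \<open>Hopf algebras\<close>

record ('k, 'a) hopf_algebra = "('k, 'a) module" +
  comult :: "'a \<Rightarrow> ('a \<times> 'a \<Rightarrow> 'k) set"
  counit :: "'a \<Rightarrow> 'k"
  antipode :: "'a \<Rightarrow> 'a"

locale hopf_algebra = assoc_algebra K H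
  for K :: "('k, 'r) ring_scheme" and H :: "('k, 'a, 'm) hopf_algebra_scheme" +
  assumes comult_hom: "comult H \<in> algebra_hom K H (tensor_algebra K H H)"
    and counit_hom: "counit H \<in> algebra_hom K H (regular_algebra K)"
    and coassoc: "x \<in> carrier H \<Longrightarrow>
      tensor_assoc K H H H (tensor_map K (tensor_module K H H) H (comult H) id (comult H x))
        = tensor_map K H (tensor_module K H H) id (comult H) (comult H x)"
    and counit_left: "x \<in> carrier H \<Longrightarrow>
      tensor_lift K H (\<lambda>y z. counit H y \<odot>\<^bsub>H\<^esub> z) (comult H x) = x"
    and counit_right: "x \<in> carrier H \<Longrightarrow>
      tensor_lift K H (\<lambda>y z. counit H z \<odot>\<^bsub>H\<^esub> y) (comult H x) = x"
    and antipode_hom: "antipode H \<in> module_hom K H H"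
    and antipode_left: "x \<in> carrier H \<Longrightarrow>
      tensor_lift K H (\<lambda>y z. antipode H y \<otimes>\<^bsub>H\<^esub> z) (comult H x) = counit H x \<odot>\<^bsub>H\<^esub> \<one>\<^bsub>H\<^esub>"
    and antipode_right: "x \<in> carrier H \<Longrightarrow>
      tensor_lift K H (\<lambda>y z. y \<otimes>\<^bsub>H\<^esub> antipode H z) (comult H x) = counit H x \<odot>\<^bsub>H\<^esub> \<one>\<^bsub>H\<^esub>"

definition cocommutative :: "('k, 'r) ring_scheme \<Rightarrow> ('k, 'a, 'm) hopf_algebra_scheme \<Rightarrow> bool"
  where "cocommutative R H \<longleftrightarrow> (\<forall>x\<in>carrier H. tensor_swap R H H (comult H x) = comult H x)"

definition hopf_iso ::
    "('k, 'r) ring_scheme \<Rightarrow> ('k, 'a, 'm) hopf_algebra_scheme \<Rightarrow> ('k, 'b, 'n) hopf_algebra_scheme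
      \<Rightarrow> ('a \<Rightarrow> 'b) set"
  where "hopf_iso R A B =
    {\<phi> \<in> algebra_hom R A B. bij_betw \<phi> (carrier A) (carrier B) \<and>
      (\<forall>x\<in>carrier A. comult B (\<phi> x) = tensor_map R B B \<phi> \<phi> (comult A x) \<and>
        counit B (\<phi> x) = counit A x \<and> antipode B (\<phi> x) = \<phi> (antipode A x))}"

definition group_hopf_algebra ::
    "('k, 'r) ring_scheme \<Rightarrow> ('g, 'm) monoid_scheme \<Rightarrow> ('k, 'g \<Rightarrow> 'k) hopf_algebra"
  where "group_hopf_algebra R G =
    (let A = twisted_group_algebra R G (\<lambda>_. \<one>\<^bsub>R\<^esub>); T = tensor_module R A A; \<delta> = basis_vec R in
     \<lparr>carrier = carrier A, monoid.mult = monoid.mult A, one = \<one>\<^bsub>A\<^esub>, zero = \<zero>\<^bsub>A\<^esub>, add = add A, smult = smult A,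
      comult = (\<lambda>p. \<Oplus>\<^bsub>T\<^esub>g\<in>{g. p g \<noteq> \<zero>\<^bsub>R\<^esub>}. p g \<odot>\<^bsub>T\<^esub> pure_tensor R A A (\<delta> g) (\<delta> g)),
      counit = (\<lambda>p. \<Oplus>\<^bsub>R\<^esub>g\<in>{g. p g \<noteq> \<zero>\<^bsub>R\<^esub>}. p g),
      antipode = (\<lambda>p. \<Oplus>\<^bsub>A\<^esub>g\<in>{g. p g \<noteq> \<zero>\<^bsub>R\<^esub>}. p g \<odot>\<^bsub>A\<^esub> \<delta> (inv\<^bsub>G\<^esub> g))\<rparr>)"

text \<open>The Hopf algebra \<open>A \<otimes>\<^sub>k L\<close> over an extension field \<open>L\<close> of \<open>k\<close> (with \<open>k \<subseteq> L\<close>):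
  \<open>\<Delta>(a \<otimes> x) = \<Sum> x \<cdot> ((a\<^sub>1 \<otimes> 1) \<otimes>\<^sub>L (a\<^sub>2 \<otimes> 1))\<close>, \<open>\<epsilon>(a \<otimes> x) = \<epsilon>(a) x\<close>, \<open>S(a \<otimes> x) = S(a) \<otimes> x\<close>.\<close>

definition base_change_algebra ::
    "('k, 'r) ring_scheme \<Rightarrow> ('k, 's) ring_scheme \<Rightarrow> ('k, 'a, 'm) module_scheme
      \<Rightarrow> ('k, ('a \<times> 'k \<Rightarrow> 'k) set) module"
  where "base_change_algebra k L A =
    (let T = tensor_algebra k A (regular_algebra L) in
     T\<lparr>smult := (\<lambda>c. tensor_map k A (regular_algebra L) id (\<lambda>x. c \<otimes>\<^bsub>L\<^esub> x))\<rparr>)"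

definition base_change ::
    "('k, 'r) ring_scheme \<Rightarrow> ('k, 's) ring_scheme \<Rightarrow> ('k, 'a, 'm) hopf_algebra_scheme
      \<Rightarrow> ('k, ('a \<times> 'k \<Rightarrow> 'k) set) hopf_algebra"
  where "base_change k L A =
    (let B = base_change_algebra k L A;
         BB = tensor_module L B B;
         \<iota> = (\<lambda>a. pure_tensor k A (regular_algebra L) a \<one>\<^bsub>L\<^esub>) in
     \<lparr>carrier = carrier B, monoid.mult = monoid.mult B, one = \<one>\<^bsub>B\<^esub>, zero = \<zero>\<^bsub>B\<^esub>, add = add B, smult = smult B,
      comult = tensor_lift k BB (\<lambda>a x. x \<odot>\<^bsub>BB\<^esub>
                 tensor_lift k BB (\<lambda>a1 a2. pure_tensor L B B (\<iota> a1) (\<iota> a2)) (comult A a)),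
      counit = tensor_lift k (regular_algebra L) (\<lambda>a x. counit A a \<otimes>\<^bsub>L\<^esub> x),
      antipode = tensor_map k A (regular_algebra L) (antipode A) id\<rparr>)"


section \<open>The central extension\<close>

definition roots_of_unity_group :: "('k, 'r) ring_scheme \<Rightarrow> nat \<Rightarrow> 'k monoid"
  where "roots_of_unity_group L m =
    (units_of L)\<lparr>carrier := {z \<in> carrier (units_of L). z [^]\<^bsub>L\<^esub> m = \<one>\<^bsub>L\<^esub>}\<rparr>"

text \<open>The unit again allows for an unnormalized cocycle.\<close>

definition central_extension ::
    "('c, 'n) monoid_scheme \<Rightarrow> ('g, 'm) monoid_scheme \<Rightarrow> ('g \<times> 'g \<Rightarrow> 'c) \<Rightarrow> ('c \<times> 'g) monoid"
  where "central_extension C G \<beta> =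
    \<lparr>carrier = carrier C \<times> carrier G,
     monoid.mult = (\<lambda>(z, \<sigma>) (w, \<tau>). (z \<otimes>\<^bsub>C\<^esub> w \<otimes>\<^bsub>C\<^esub> \<beta> (\<sigma>, \<tau>), \<sigma> \<otimes>\<^bsub>G\<^esub> \<tau>)),
     one = (inv\<^bsub>C\<^esub> (\<beta> (\<one>\<^bsub>G\<^esub>, \<one>\<^bsub>G\<^esub>)), \<one>\<^bsub>G\<^esub>)\<rparr>"

text \<open>\<open>1 \<rightarrow> \<mu>\<^sub>m(L) \<rightarrow> hat G \<rightarrow> G \<rightarrow> 1\<close> with cocycle \<open>\<alpha> / dg\<close>. It is used when \<open>char L\<close> does not
  divide \<open>m\<close>, where \<open>\<mu>\<^sub>m(L)\<close> is cyclic of order \<open>m\<close>.\<close>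

definition hat_group ::
    "('k, 'r) ring_scheme \<Rightarrow> ('g, 'n) monoid_scheme \<Rightarrow> nat \<Rightarrow> ('g \<times> 'g \<Rightarrow> 'k) \<Rightarrow> ('g \<Rightarrow> 'k)
      \<Rightarrow> ('k \<times> 'g) monoid"
  where "hat_group L G m \<alpha> g =
    central_extension (roots_of_unity_group L m) G
      (\<lambda>x\<in>carrier G \<times> carrier G. \<alpha> x \<otimes>\<^bsub>L\<^esub> inv\<^bsub>units_of L\<^esub> (coboundary G (units_of L) g x))"

end

theory Submission
  imports Defs
begin

text \<open>Over the algebraic closure, assume that the characteristic does not divide \<open>m\<close>. The central
  subgroup \<open>\<mu>\<^sub>m\<close> of \<open>hat G\<close> then has \<open>m\<close> characters \<open>z \<mapsto> z\<^sup>i\<close>, with idempotents \<open>e\<^sub>i\<close>, and they cut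
  the group algebra of \<open>hat G\<close> into the twisted group algebras of the cocycles \<open>(\<alpha> / dg)\<^sup>i\<close>. If
  \<open>u\<^sub>\<sigma>\<close> denotes the lift of \<open>\<sigma>\<close>, then the elements \<open>U\<^sub>\<sigma>\<^sub>,\<^sub>n = g(\<sigma>)\<^sup>n u\<^sub>\<sigma> e\<^sub>n\<close> multiply by \<open>\<alpha>\<^sup>n\<close>, which has
  values in \<open>k\<close>; since \<open>u\<^sub>\<sigma>\<close> is group-like and \<open>\<Delta> e\<^sub>n = \<Sum>\<^sub>a e\<^sub>a \<otimes> e\<^sub>n\<^sub>-\<^sub>a\<close> over the residues \<open>a\<close> mod \<open>m\<close>,
  one gets \<open>\<Delta> U\<^sub>\<sigma>\<^sub>,\<^sub>n = \<Sum>\<^sub>a U\<^sub>\<sigma>\<^sub>,\<^sub>a \<otimes> U\<^sub>\<sigma>\<^sub>,\<^sub>n\<^sub>-\<^sub>a\<close>. Here \<open>U\<^sub>\<sigma>\<^sub>,\<^sub>n\<close> makes sense for every integer \<open>n\<close>, and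
  shifting \<open>n\<close> by \<open>m\<close> multiplies it by \<open>g(\<sigma>)\<^sup>m = f(\<sigma>)\<close>, again an element of \<open>k\<close>. So all structure
  constants in the basis \<open>U\<^sub>\<sigma>\<^sub>,\<^sub>i\<close>, \<open>0 \<le> i < m\<close>, lie in \<open>k\<close>, and they make sense in every characteristic.

  The Hopf algebra \<open>A\<close> (called \<open>H\<close> below) is therefore the product over \<open>0 \<le> i < m\<close> of the twisted
  group algebras of \<open>\<alpha>\<^sup>i\<close>, with this comultiplication. With all integers allowed as indices its axioms
  carry no case distinctions: each is an identity of sums over the residues mod \<open>m\<close>, proved by a
  shift or a reflection of the summation index (\<open>finsum_residues\<close>); the result is
  \<open>H_hopf_algebra\<close>. The component of index 1 is the twisted group algebra of \<open>\<alpha>\<close>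
  (\<open>proj_algebra_hom\<close>, \<open>proj_surj\<close>), and Maschke averaging in all components at once proves
  semisimplicity (\<open>H_semisimple\<close>).

  After extension of scalars the group element \<open>(z, \<sigma>)\<close> of \<open>hat G\<close> is recovered as
  \<open>\<Sum>\<^sub>n (z / g(\<sigma>))\<^sup>n U\<^sub>\<sigma>\<^sub>,\<^sub>n\<close>. That these elements are group-like and multiply as in \<open>hat G\<close> is once more
  a shift of indices. The linear map \<open>\<psi>\<close> which they define has as its inverse \<open>\<phi>\<close> the finite Fourier
  transform on \<open>\<mu>\<^sub>m\<close>, and \<open>\<phi>_hopf_iso\<close> follows; this step needs \<open>|\<mu>\<^sub>m| = m\<close>, i.e. that \<open>T\<^sup>m - 1\<close> has
  only simple roots.

  Of tensor products only the universal property enters: bilinear maps induce linear maps, and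
  linear maps which agree on the pure tensors of generators are equal (\<open>tensor_hom_eqI\<close>).\<close>

section \<open>Linear maps and generating sets\<close>

lemma module_homI:
  assumes "\<And>x. x \<in> carrier M \<Longrightarrow> h x \<in> carrier N"
    and "\<And>x y. \<lbrakk>x \<in> carrier M; y \<in> carrier M\<rbrakk> \<Longrightarrow> h (x \<oplus>\<^bsub>M\<^esub> y) = h x \<oplus>\<^bsub>N\<^esub> h y"
    and "\<And>a x. \<lbrakk>a \<in> carrier R; x \<in> carrier M\<rbrakk> \<Longrightarrow> h (a \<odot>\<^bsub>M\<^esub> x) = a \<odot>\<^bsub>N\<^esub> h x"
  shows "h \<in> module_hom R M N"
  using assms unfolding module_hom_def by auto

lemma module_hom_closedD: "\<lbrakk>h \<in> module_hom R M N; x \<in> carrier M\<rbrakk> \<Longrightarrow> h x \<in> carrier N"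
  unfolding module_hom_def by auto

lemma module_hom_zero:
  assumes "module R M" "module R N" "h \<in> module_hom R M N"
  shows "h \<zero>\<^bsub>M\<^esub> = \<zero>\<^bsub>N\<^esub>"
proof -
  interpret M: module R M by fact
  interpret N: module R N by fact
  have "h \<zero>\<^bsub>M\<^esub> = h (\<zero>\<^bsub>R\<^esub> \<odot>\<^bsub>M\<^esub> \<zero>\<^bsub>M\<^esub>)" by simp
  also have "\<dots> = \<zero>\<^bsub>R\<^esub> \<odot>\<^bsub>N\<^esub> h \<zero>\<^bsub>M\<^esub>"
    using assms(3) by (intro module_hom_smult) auto
  also have "\<dots> = \<zero>\<^bsub>N\<^esub>" using assms(3) by (simp add: module_hom_closedD)
  finally show ?thesis .
qed

lemma module_hom_finsum:
  assumes "module R M" "module R N" "h \<in> module_hom R M N" "\<And>i. i \<in> I \<Longrightarrow> v i \<in> carrier M"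
  shows "h (\<Oplus>\<^bsub>M\<^esub>i\<in>I. v i) = (\<Oplus>\<^bsub>N\<^esub>i\<in>I. h (v i))"
proof -
  interpret M: module R M by fact
  interpret N: module R N by fact
  have *: "v \<in> I \<rightarrow> carrier M" using assms(4) by auto
  show ?thesis
  proof (cases "finite I")
    case True
    then show ?thesis using *
    proof (induction I rule: finite_induct)
      case empty
      then show ?case by (simp add: module_hom_zero[OF assms(1-3)])
    next
      case (insert i I)
      then have "h (\<Oplus>\<^bsub>M\<^esub>i\<in>insert i I. v i) = h (v i \<oplus>\<^bsub>M\<^esub> (\<Oplus>\<^bsub>M\<^esub>i\<in>I. v i))" by simp
      also have "\<dots> = h (v i) \<oplus>\<^bsub>N\<^esub> h (\<Oplus>\<^bsub>M\<^esub>i\<in>I. v i)"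
        using insert.prems by (intro module_hom_add[OF assms(3)]) auto
      also have "\<dots> = (\<Oplus>\<^bsub>N\<^esub>i\<in>insert i I. h (v i))"
        using insert by (subst N.finsum_insert) (auto simp: Pi_iff module_hom_closedD[OF assms(3)])
      finally show ?case .
    qed
  next
    case False
    then show ?thesis by (simp add: module_hom_zero[OF assms(1-3)] finsum_def finprod_def)
  qed
qed

lemma module_hom_id: "(\<lambda>x. x) \<in> module_hom R M M"
  by (rule module_homI) auto

lemma module_hom_compose:
  assumes "h \<in> module_hom R M N" "h' \<in> module_hom R N P"
  shows "(\<lambda>x. h' (h x)) \<in> module_hom R M P"
  using assms unfolding module_hom_def by (auto simp: Pi_iff)

lemma module_hom_sum_of_maps:
  assumes "module R M" "module R N" "\<And>i. i \<in> I \<Longrightarrow> h i \<in> module_hom R M N"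
  shows "(\<lambda>x. \<Oplus>\<^bsub>N\<^esub>i\<in>I. h i x) \<in> module_hom R M N"
proof -
  interpret M: module R M by fact
  interpret N: module R N by fact
  note cl = module_hom_closedD[OF assms(3)]
  show ?thesis
  proof (rule module_homI)
    show "(\<Oplus>\<^bsub>N\<^esub>i\<in>I. h i x) \<in> carrier N" if "x \<in> carrier M" for x
      using that cl by (intro N.finsum_closed) auto
  next
    fix x y assume x: "x \<in> carrier M" "y \<in> carrier M"
    have "(\<Oplus>\<^bsub>N\<^esub>i\<in>I. h i (x \<oplus>\<^bsub>M\<^esub> y)) = (\<Oplus>\<^bsub>N\<^esub>i\<in>I. h i x \<oplus>\<^bsub>N\<^esub> h i y)"
      using x cl by (intro N.finsum_cong') (auto simp: module_hom_add[OF assms(3)])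
    also have "\<dots> = (\<Oplus>\<^bsub>N\<^esub>i\<in>I. h i x) \<oplus>\<^bsub>N\<^esub> (\<Oplus>\<^bsub>N\<^esub>i\<in>I. h i y)"
      using x cl by (intro N.finsum_addf) auto
    finally show "(\<Oplus>\<^bsub>N\<^esub>i\<in>I. h i (x \<oplus>\<^bsub>M\<^esub> y)) = \<dots>" .
  next
    fix a x assume x: "a \<in> carrier R" "x \<in> carrier M"
    have "(\<Oplus>\<^bsub>N\<^esub>i\<in>I. h i (a \<odot>\<^bsub>M\<^esub> x)) = (\<Oplus>\<^bsub>N\<^esub>i\<in>I. a \<odot>\<^bsub>N\<^esub> h i x)"
      using x cl by (intro N.finsum_cong') (auto simp: module_hom_smult[OF assms(3)])
    also have "\<dots> = a \<odot>\<^bsub>N\<^esub> (\<Oplus>\<^bsub>N\<^esub>i\<in>I. h i x)"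
    proof (cases "finite I")
      case True
      then show ?thesis using x cl by (intro N.finsum_smult_ldistr[symmetric]) auto
    next
      case False
      then show ?thesis using x by (simp add: finsum_def finprod_def)
    qed
    finally show "(\<Oplus>\<^bsub>N\<^esub>i\<in>I. h i (a \<odot>\<^bsub>M\<^esub> x)) = \<dots>" .
  qed
qed

lemma module_hom_add_maps:
  assumes "module R N" "h \<in> module_hom R M N" "h' \<in> module_hom R M N"
  shows "(\<lambda>x. h x \<oplus>\<^bsub>N\<^esub> h' x) \<in> module_hom R M N"
proof -
  interpret N: module R N by fact
  show ?thesis
    using assms(2,3)
    by (intro module_homI)
      (auto simp: module_hom_closedD module_hom_add module_hom_smult N.smult_r_distr N.a_ac)
qed

lemma module_hom_smult_map:
  assumes "module R N" "h \<in> module_hom R M N" "c \<in> carrier R"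
  shows "(\<lambda>x. c \<odot>\<^bsub>N\<^esub> h x) \<in> module_hom R M N"
proof -
  interpret N: module R N by fact
  show ?thesis
    using assms(2,3)
    by (intro module_homI)
      (auto simp: module_hom_closedD module_hom_add module_hom_smult N.smult_r_distr
        N.smult_assoc1[symmetric] N.R.m_comm)
qed

text \<open>Linear identities are reduced to generators throughout. Defining the span as a closure gives the
  rule induction for this, which a definition by explicit linear combinations would not.\<close>

definition lspan :: "('k, 'r) ring_scheme \<Rightarrow> ('k, 'v, 'm) module_scheme \<Rightarrow> 'v set \<Rightarrow> 'v set"
  where "lspan R M E = \<Inter>{N. \<zero>\<^bsub>M\<^esub> \<in> N \<and> E \<subseteq> N \<and> (\<forall>x\<in>N. \<forall>y\<in>N. x \<oplus>\<^bsub>M\<^esub> y \<in> N) \<and>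
    (\<forall>a\<in>carrier R. \<forall>x\<in>N. a \<odot>\<^bsub>M\<^esub> x \<in> N)}"

lemma lspan_zero: "\<zero>\<^bsub>M\<^esub> \<in> lspan R M E"
  and lspan_base: "x \<in> E \<Longrightarrow> x \<in> lspan R M E"
  and lspan_add: "\<lbrakk>x \<in> lspan R M E; y \<in> lspan R M E\<rbrakk> \<Longrightarrow> x \<oplus>\<^bsub>M\<^esub> y \<in> lspan R M E"
  and lspan_smult: "\<lbrakk>a \<in> carrier R; x \<in> lspan R M E\<rbrakk> \<Longrightarrow> a \<odot>\<^bsub>M\<^esub> x \<in> lspan R M E"
  unfolding lspan_def by blast+

lemma lspan_induct [consumes 1, case_names zero base add smult, induct set: lspan]:
  assumes "v \<in> lspan R M E" and "P \<zero>\<^bsub>M\<^esub>" and "\<And>x. x \<in> E \<Longrightarrow> P x"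
    and "\<And>x y. \<lbrakk>x \<in> lspan R M E; P x; y \<in> lspan R M E; P y\<rbrakk> \<Longrightarrow> P (x \<oplus>\<^bsub>M\<^esub> y)"
    and "\<And>a x. \<lbrakk>a \<in> carrier R; x \<in> lspan R M E; P x\<rbrakk> \<Longrightarrow> P (a \<odot>\<^bsub>M\<^esub> x)"
  shows "P v"
proof -
  let ?N = "{x \<in> lspan R M E. P x}"
  have "\<zero>\<^bsub>M\<^esub> \<in> ?N \<and> E \<subseteq> ?N \<and> (\<forall>x\<in>?N. \<forall>y\<in>?N. x \<oplus>\<^bsub>M\<^esub> y \<in> ?N) \<and> (\<forall>a\<in>carrier R. \<forall>x\<in>?N. a \<odot>\<^bsub>M\<^esub> x \<in> ?N)"
    using assms(2-5) by (auto intro: lspan_zero lspan_base lspan_add lspan_smult)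
  then have "lspan R M E \<subseteq> ?N" unfolding lspan_def[of R M E] by (intro Inter_lower) auto
  then show ?thesis using assms(1) by auto
qed

definition generates :: "('k, 'r) ring_scheme \<Rightarrow> ('k, 'v, 'm) module_scheme \<Rightarrow> 'v set \<Rightarrow> bool"
  where "generates R M E \<longleftrightarrow> E \<subseteq> carrier M \<and> carrier M \<subseteq> lspan R M E"

lemma generates_carrier: "generates R M (carrier M)"
  unfolding generates_def by (auto intro: lspan_base)

lemma generatesI:
  assumes "E \<subseteq> carrier M" "\<And>x. x \<in> carrier M \<Longrightarrow> x \<in> lspan R M E"
  shows "generates R M E"
  using assms unfolding generates_def by auto

lemma lspan_closed:
  assumes "module R M" "E \<subseteq> carrier M" "x \<in> lspan R M E"
  shows "x \<in> carrier M"
proof -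
  interpret M: module R M by fact
  show ?thesis using assms(3) by induction (use assms(2) in auto)
qed

lemma lspan_finsum:
  assumes "module R M" "E \<subseteq> carrier M" "finite I" "\<And>i. i \<in> I \<Longrightarrow> v i \<in> lspan R M E"
  shows "(\<Oplus>\<^bsub>M\<^esub>i\<in>I. v i) \<in> lspan R M E"
proof -
  interpret M: module R M by fact
  show ?thesis using assms(3,4)
  proof (induction I rule: finite_induct)
    case empty
    then show ?case by (simp add: lspan_zero)
  next
    case (insert i I)
    then have "v \<in> I \<rightarrow> carrier M" "v i \<in> carrier M"
      using lspan_closed[OF assms(1,2)] by auto
    then show ?case using insert by (auto intro: lspan_add)
  qed
qed

lemma hom_eqI:
  assumes "generates R M E" "module R M" "module R N" "h \<in> module_hom R M N" "h' \<in> module_hom R M N"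
    and "\<And>x. x \<in> E \<Longrightarrow> h x = h' x" and "v \<in> carrier M"
  shows "h v = h' v"
proof -
  have E: "E \<subseteq> carrier M" and "v \<in> lspan R M E"
    using assms(1,7) by (auto simp: generates_def)
  from this(2) show ?thesis
  proof induction
    case zero
    then show ?case using assms(2-5) by (simp add: module_hom_zero)
  next
    case (base x)
    then show ?case using assms(6) by auto
  next
    case (add x y)
    then show ?case
      using lspan_closed[OF assms(2) E] by (simp add: module_hom_add[OF assms(4)] module_hom_add[OF assms(5)])
  next
    case (smult a x)
    then show ?case
      using lspan_closed[OF assms(2) E] by (simp add: module_hom_smult[OF assms(4)] module_hom_smult[OF assms(5)])
  qed
qed

definition bilinear ::
    "('k, 'r) ring_scheme \<Rightarrow> ('k, 'v, 'm) module_scheme \<Rightarrow> ('k, 'w, 'n) module_scheme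
      \<Rightarrow> ('k, 'u, 'l) module_scheme \<Rightarrow> ('v \<Rightarrow> 'w \<Rightarrow> 'u) \<Rightarrow> bool"
  where "bilinear R V W U \<beta> \<longleftrightarrow>
    (\<forall>w\<in>carrier W. (\<lambda>v. \<beta> v w) \<in> module_hom R V U) \<and> (\<forall>v\<in>carrier V. \<beta> v \<in> module_hom R W U)"

lemma bilinearI:
  assumes "\<And>w. w \<in> carrier W \<Longrightarrow> (\<lambda>v. \<beta> v w) \<in> module_hom R V U"
    and "\<And>v. v \<in> carrier V \<Longrightarrow> (\<lambda>w. \<beta> v w) \<in> module_hom R W U"
  shows "bilinear R V W U \<beta>"
  using assms unfolding bilinear_def by auto

lemma bilinear_left: "\<lbrakk>bilinear R V W U \<beta>; w \<in> carrier W\<rbrakk> \<Longrightarrow> (\<lambda>v. \<beta> v w) \<in> module_hom R V U"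
  and bilinear_right: "\<lbrakk>bilinear R V W U \<beta>; v \<in> carrier V\<rbrakk> \<Longrightarrow> \<beta> v \<in> module_hom R W U"
  unfolding bilinear_def by auto

lemma bilinear_closed:
  "\<lbrakk>bilinear R V W U \<beta>; v \<in> carrier V; w \<in> carrier W\<rbrakk> \<Longrightarrow> \<beta> v w \<in> carrier U"
  by (auto simp: bilinear_def module_hom_closedD)

lemma bilinear_flip: "bilinear R V W U \<beta> \<Longrightarrow> bilinear R W V U (\<lambda>w v. \<beta> v w)"
  unfolding bilinear_def by auto

lemma bilinear_eqI:
  assumes "generates R V E" "generates R W Y" "module R V" "module R W" "module R U"
    and "bilinear R V W U \<beta>" "bilinear R V W U \<beta>'"
    and "\<And>x y. \<lbrakk>x \<in> E; y \<in> Y\<rbrakk> \<Longrightarrow> \<beta> x y = \<beta>' x y" and "v \<in> carrier V" "w \<in> carrier W"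
  shows "\<beta> v w = \<beta>' v w"
proof -
  have "\<beta> x w = \<beta>' x w" if x: "x \<in> E" for x
  proof -
    have V: "x \<in> carrier V" using x assms(1) by (auto simp: generates_def)
    show ?thesis
      by (rule hom_eqI[OF assms(2,4,5) bilinear_right[OF assms(6) V] bilinear_right[OF assms(7) V] _ assms(10)])
        (rule assms(8)[OF x])
  qed
  then show ?thesis
    by (rule hom_eqI[OF assms(1,3,5) bilinear_left[OF assms(6,10)] bilinear_left[OF assms(7,10)] _ assms(9)])
qed

lemma bilinear_compose_hom:
  assumes "bilinear R V W U \<beta>" "h \<in> module_hom R U U'"
  shows "bilinear R V W U' (\<lambda>v w. h (\<beta> v w))"
  by (rule bilinearI)
    (simp_all add: module_hom_compose[OF bilinear_left[OF assms(1)] assms(2)]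
      module_hom_compose[OF bilinear_right[OF assms(1)] assms(2)])

lemma bilinear_precompose:
  assumes "bilinear R V W U \<beta>" "h \<in> module_hom R V' V" "h' \<in> module_hom R W' W"
  shows "bilinear R V' W' U (\<lambda>v w. \<beta> (h v) (h' w))"
proof (rule bilinearI)
  fix w assume "w \<in> carrier W'"
  then show "(\<lambda>v. \<beta> (h v) (h' w)) \<in> module_hom R V' U"
    using assms by (intro module_hom_compose[OF assms(2) bilinear_left[OF assms(1)]] module_hom_closedD[OF assms(3)])
next
  fix v assume "v \<in> carrier V'"
  then show "(\<lambda>w. \<beta> (h v) (h' w)) \<in> module_hom R W' U"
    using assms by (intro module_hom_compose[OF assms(3) bilinear_right[OF assms(1)]] module_hom_closedD[OF assms(2)])
qed

section \<open>Free modules\<close>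

text \<open>Several records below share the additive structure and scalar action of a free module but
  carry their own multiplication.\<close>

definition free_on :: "('k, 'r) ring_scheme \<Rightarrow> 'x set \<Rightarrow> ('k, 'x \<Rightarrow> 'k, 'm) module_scheme \<Rightarrow> bool"
  where "free_on R S M \<longleftrightarrow> carrier M = carrier (free_module R S) \<and> zero M = zero (free_module R S)
    \<and> add M = add (free_module R S) \<and> smult M = smult (free_module R S)"

lemma free_on_free_module: "free_on R S (free_module R S)"
  by (simp add: free_on_def)

text \<open>Summation over the support is the shape in which \<open>tensor_lift\<close> and the maps of a
  group algebra are given.\<close>

definition lin_ext ::
    "('k, 'r) ring_scheme \<Rightarrow> ('k, 'u, 'm) module_scheme \<Rightarrow> ('x \<Rightarrow> 'u) \<Rightarrow> ('x \<Rightarrow> 'k) \<Rightarrow> 'u"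
  where "lin_ext R U b p = (\<Oplus>\<^bsub>U\<^esub>x\<in>{x. p x \<noteq> \<zero>\<^bsub>R\<^esub>}. p x \<odot>\<^bsub>U\<^esub> b x)"

lemma (in cring) free_on_module:
  assumes "free_on R S M"
  shows "module R M"
proof -
  have M: "carrier M = {p. (\<forall>x. p x \<in> carrier R) \<and> finite {x. p x \<noteq> \<zero>} \<and> {x. p x \<noteq> \<zero>} \<subseteq> S}"
    "\<zero>\<^bsub>M\<^esub> = (\<lambda>x. \<zero>)" "p \<oplus>\<^bsub>M\<^esub> q = (\<lambda>x. p x \<oplus> q x)" "a \<odot>\<^bsub>M\<^esub> p = (\<lambda>x. a \<otimes> p x)" for p q a
    using assms by (simp_all add: free_on_def free_module_def)
  have supp: "finite {x. p x \<oplus> q x \<noteq> \<zero>} \<and> {x. p x \<oplus> q x \<noteq> \<zero>} \<subseteq> S" if "p \<in> carrier M" "q \<in> carrier M" for p q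
  proof -
    have "{x. p x \<oplus> q x \<noteq> \<zero>} \<subseteq> {x. p x \<noteq> \<zero>} \<union> {x. q x \<noteq> \<zero>}" by auto
    then show ?thesis using that by (auto simp: M intro: finite_subset)
  qed
  have supp2: "finite {x. a \<otimes> p x \<noteq> \<zero>} \<and> {x. a \<otimes> p x \<noteq> \<zero>} \<subseteq> S" if "p \<in> carrier M" "a \<in> carrier R" for p a
  proof -
    have "{x. a \<otimes> p x \<noteq> \<zero>} \<subseteq> {x. p x \<noteq> \<zero>}" using that by auto
    then show ?thesis using that by (auto simp: M intro: finite_subset)
  qed
  have ab: "abelian_group M"
  proof (rule abelian_groupI)
    fix p assume p: "p \<in> carrier M"
    have "(\<lambda>x. \<ominus> p x) \<in> carrier M"
    proof -
      have "{x. \<ominus> p x \<noteq> \<zero>} = {x. p x \<noteq> \<zero>}"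
        using p by (auto simp: M)
      then show ?thesis using p by (auto simp: M)
    qed
    moreover have "(\<lambda>x. \<ominus> p x) \<oplus>\<^bsub>M\<^esub> p = \<zero>\<^bsub>M\<^esub>" using p by (auto simp: M l_neg)
    ultimately show "\<exists>y\<in>carrier M. y \<oplus>\<^bsub>M\<^esub> p = \<zero>\<^bsub>M\<^esub>" by blast
  next
    fix p q assume "p \<in> carrier M" "q \<in> carrier M"
    with supp[OF this] show "p \<oplus>\<^bsub>M\<^esub> q \<in> carrier M" by (auto simp: M)
  qed (auto simp: M a_ac)
  show ?thesis
  proof (rule moduleI)
    show "cring R" ..
  next
    fix a p assume a: "a \<in> carrier R" and p: "p \<in> carrier M"
    with supp2[OF p a] show "a \<odot>\<^bsub>M\<^esub> p \<in> carrier M" by (auto simp: M)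
  qed (auto simp: ab M l_distr r_distr m_assoc)
qed

locale based_module = module R M for R :: "('k, 'r) ring_scheme" (structure) and S :: "'x set"
    and M :: "('k, 'x \<Rightarrow> 'k, 'm) module_scheme" +
  assumes free: "free_on R S M"

lemma (in cring) based_moduleI: "free_on R S M \<Longrightarrow> based_module R S M"
  by (simp add: based_module_def based_module_axioms_def free_on_module)

context based_module
begin

lemma carrier_iff: "p \<in> carrier M \<longleftrightarrow> (\<forall>x. p x \<in> carrier R) \<and> finite {x. p x \<noteq> \<zero>} \<and> {x. p x \<noteq> \<zero>} \<subseteq> S"
  and zero_fun: "\<zero>\<^bsub>M\<^esub> = (\<lambda>x. \<zero>)" 
  and add_fun: "p \<oplus>\<^bsub>M\<^esub> q = (\<lambda>x. p x \<oplus> q x)" 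
  and smult_fun: "a \<odot>\<^bsub>M\<^esub> p = (\<lambda>x. a \<otimes> p x)"
  using free by (simp_all add: free_on_def free_module_def)

lemma basis_vec_closed: "x \<in> S \<Longrightarrow> basis_vec R x \<in> carrier M"
  by (auto simp: carrier_iff basis_vec_def split: if_splits)

lemma finsum_fun:
  assumes "finite I" "\<And>i. i \<in> I \<Longrightarrow> v i \<in> carrier M"
  shows "(\<Oplus>\<^bsub>M\<^esub>i\<in>I. v i) x = (\<Oplus>i\<in>I. v i x)"
  using assms
proof (induction I rule: finite_induct)
  case empty
  then show ?case by (simp add: zero_fun)
next
  case (insert i I)
  then have "v \<in> I \<rightarrow> carrier M" "v i \<in> carrier M" by auto
  moreover have "(\<lambda>i. v i x) \<in> I \<rightarrow> carrier R" "v i x \<in> carrier R"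
    using insert.prems by (auto simp: carrier_iff)
  ultimately show ?case using insert by (simp add: add_fun)
qed

lemma basis_expansion:
  assumes "p \<in> carrier M" 
  shows "p = (\<Oplus>\<^bsub>M\<^esub>x\<in>{x. p x \<noteq> \<zero>}. p x \<odot>\<^bsub>M\<^esub> basis_vec R x)"
proof
  fix y
  have p: "finite {x. p x \<noteq> \<zero>}" "{x. p x \<noteq> \<zero>} \<subseteq> S" "\<And>x. p x \<in> carrier R"
    using assms by (auto simp: carrier_iff)
  have "(\<Oplus>\<^bsub>M\<^esub>x\<in>{x. p x \<noteq> \<zero>}. p x \<odot>\<^bsub>M\<^esub> basis_vec R x) y
      = (\<Oplus>x\<in>{x. p x \<noteq> \<zero>}. (p x \<odot>\<^bsub>M\<^esub> basis_vec R x) y)"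
    using p by (intro finsum_fun) (auto intro!: basis_vec_closed)
  also have "\<dots> = (\<Oplus>x\<in>{x. p x \<noteq> \<zero>}. if y = x then p x else \<zero>)"
    using p by (intro R.finsum_cong') (auto simp: smult_fun basis_vec_def)
  also have "\<dots> = p y"
  proof (cases "p y = \<zero>")
    case True
    then have "(\<Oplus>x\<in>{x. p x \<noteq> \<zero>}. if y = x then p x else \<zero>) = (\<Oplus>x\<in>{x. p x \<noteq> \<zero>}. \<zero>)"
      by (intro R.finsum_cong') auto
    then show ?thesis using True by simp
  next
    case False
    then show ?thesis using p by (subst R.finsum_singleton) auto
  qed
  finally show "p y = (\<Oplus>\<^bsub>M\<^esub>x\<in>{x. p x \<noteq> \<zero>}. p x \<odot>\<^bsub>M\<^esub> basis_vec R x) y" by simp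
qed

lemma generates_basis: "generates R M (basis_vec R ` S)"
proof (rule generatesI)
  show E: "basis_vec R ` S \<subseteq> carrier M" by (auto intro: basis_vec_closed)
  fix p assume p: "p \<in> carrier M"
  have "(\<Oplus>\<^bsub>M\<^esub>x\<in>{x. p x \<noteq> \<zero>}. p x \<odot>\<^bsub>M\<^esub> basis_vec R x) \<in> lspan R M (basis_vec R ` S)"
    using p by (intro lspan_finsum[OF module_axioms E])
      (auto simp: carrier_iff intro!: lspan_smult[OF _ lspan_base])
  then show "p \<in> lspan R M (basis_vec R ` S)" using basis_expansion[OF p] by simp
qed

lemma lin_ext_superset:
  assumes "module R U" "p \<in> carrier M" "\<And>x. x \<in> S \<Longrightarrow> b x \<in> carrier U"
    and "finite T" "{x. p x \<noteq> \<zero>} \<subseteq> T" "T \<subseteq> S"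
  shows "lin_ext R U b p = (\<Oplus>\<^bsub>U\<^esub>x\<in>T. p x \<odot>\<^bsub>U\<^esub> b x)"
proof -
  interpret U: module R U by fact
  have "\<And>x. p x \<in> carrier R" using assms by (auto simp: carrier_iff)
  then show ?thesis unfolding lin_ext_def
    using assms by (intro U.add.finprod_mono_neutral_cong_left) auto
qed

lemma lin_ext_basis_vec:
  assumes "module R U" "b x \<in> carrier U" "\<one> \<noteq> \<zero>"
  shows "lin_ext R U b (basis_vec R x) = b x"
proof -
  interpret U: module R U by fact
  have "{y. basis_vec R x y \<noteq> \<zero>} = {x}" using assms(3) by (auto simp: basis_vec_def)
  then show ?thesis using assms(2) by (simp add: lin_ext_def basis_vec_def)
qed

lemma lin_ext_hom:
  assumes U: "module R U" and b: "\<And>x. x \<in> S \<Longrightarrow> b x \<in> carrier U"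
  shows "lin_ext R U b \<in> module_hom R M U"
proof (rule module_homI)
  interpret U: module R U by fact
  show "lin_ext R U b p \<in> carrier U" if "p \<in> carrier M" for p
    using that b unfolding lin_ext_def by (intro U.finsum_closed) (auto simp: carrier_iff)
next
  interpret U: module R U by fact
  fix p q assume pq: "p \<in> carrier M" "q \<in> carrier M"
  let ?T = "{x. p x \<noteq> \<zero>} \<union> {x. q x \<noteq> \<zero>}"
  have T: "finite ?T" "?T \<subseteq> S" using pq by (auto simp: carrier_iff)
  have c: "\<And>x. p x \<in> carrier R" "\<And>x. q x \<in> carrier R" using pq by (auto simp: carrier_iff)
  have "lin_ext R U b (p \<oplus>\<^bsub>M\<^esub> q) = (\<Oplus>\<^bsub>U\<^esub>x\<in>?T. (p \<oplus>\<^bsub>M\<^esub> q) x \<odot>\<^bsub>U\<^esub> b x)"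
    using pq T by (intro lin_ext_superset[OF U M.a_closed b]) (auto simp: add_fun)
  also have "\<dots> = (\<Oplus>\<^bsub>U\<^esub>x\<in>?T. p x \<odot>\<^bsub>U\<^esub> b x \<oplus>\<^bsub>U\<^esub> q x \<odot>\<^bsub>U\<^esub> b x)"
    using T c by (intro U.finsum_cong') (auto simp: add_fun U.smult_l_distr b subset_iff)
  also have "\<dots> = (\<Oplus>\<^bsub>U\<^esub>x\<in>?T. p x \<odot>\<^bsub>U\<^esub> b x) \<oplus>\<^bsub>U\<^esub> (\<Oplus>\<^bsub>U\<^esub>x\<in>?T. q x \<odot>\<^bsub>U\<^esub> b x)"
    using T c b by (intro U.finsum_addf) auto
  also have "\<dots> = lin_ext R U b p \<oplus>\<^bsub>U\<^esub> lin_ext R U b q"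
    using pq T by (auto simp: lin_ext_superset[OF U _ b, where T = ?T])
  finally show "lin_ext R U b (p \<oplus>\<^bsub>M\<^esub> q) = lin_ext R U b p \<oplus>\<^bsub>U\<^esub> lin_ext R U b q" .
next
  interpret U: module R U by fact
  fix a p assume a: "a \<in> carrier R" and p: "p \<in> carrier M"
  let ?T = "{x. p x \<noteq> \<zero>}"
  have T: "finite ?T" "?T \<subseteq> S" and c: "\<And>x. p x \<in> carrier R" using p by (auto simp: carrier_iff)
  have "lin_ext R U b (a \<odot>\<^bsub>M\<^esub> p) = (\<Oplus>\<^bsub>U\<^esub>x\<in>?T. (a \<odot>\<^bsub>M\<^esub> p) x \<odot>\<^bsub>U\<^esub> b x)"
    using a p T by (intro lin_ext_superset[OF U smult_closed b]) (auto simp: smult_fun)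
  also have "\<dots> = (\<Oplus>\<^bsub>U\<^esub>x\<in>?T. a \<odot>\<^bsub>U\<^esub> (p x \<odot>\<^bsub>U\<^esub> b x))"
    using T a c b by (intro U.finsum_cong') (auto simp: smult_fun U.smult_assoc1 subset_iff)
  also have "\<dots> = a \<odot>\<^bsub>U\<^esub> lin_ext R U b p"
    unfolding lin_ext_def using T a c b by (intro U.finsum_smult_ldistr[symmetric]) auto
  finally show "lin_ext R U b (a \<odot>\<^bsub>M\<^esub> p) = a \<odot>\<^bsub>U\<^esub> lin_ext R U b p" .
qed

end

section \<open>Quotient modules\<close>

lemma module_hom_minus:
  assumes "module R M" "module R N" "h \<in> module_hom R M N" "x \<in> carrier M" "y \<in> carrier M"
  shows "h (x \<ominus>\<^bsub>M\<^esub> y) = h x \<ominus>\<^bsub>N\<^esub> h y"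
proof -
  interpret M: module R M by fact
  interpret N: module R N by fact
  have "\<ominus>\<^bsub>M\<^esub> y = (\<ominus>\<^bsub>R\<^esub> \<one>\<^bsub>R\<^esub>) \<odot>\<^bsub>M\<^esub> y" using assms(5) by (simp add: M.smult_l_minus)
  then have "h (\<ominus>\<^bsub>M\<^esub> y) = (\<ominus>\<^bsub>R\<^esub> \<one>\<^bsub>R\<^esub>) \<odot>\<^bsub>N\<^esub> h y"
    using assms(5) by (simp add: module_hom_smult[OF assms(3)])
  also have "\<dots> = \<ominus>\<^bsub>N\<^esub> h y"
    using module_hom_closedD[OF assms(3,5)] by (simp add: N.smult_l_minus)
  finally show ?thesis
    using assms(4,5) by (simp add: a_minus_def module_hom_add[OF assms(3)])
qed

lemma (in abelian_group) minus_eq_zero_iff: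
  assumes "x \<in> carrier G" "y \<in> carrier G"
  shows "x \<ominus> y = \<zero> \<longleftrightarrow> x = y"
proof
  assume "x \<ominus> y = \<zero>"
  then have "\<ominus> (\<ominus> y) = x" using assms by (intro minus_equality) (auto simp: a_minus_def)
  then show "x = y" using assms by simp
qed (use assms in \<open>simp add: a_minus_def r_neg\<close>)

locale module_quotient = module R M for R (structure) and M (structure) +
  fixes N
  assumes sub: "N \<subseteq> carrier M" and zero_in: "\<zero>\<^bsub>M\<^esub> \<in> N"
    and add_in: "\<lbrakk>x \<in> N; y \<in> N\<rbrakk> \<Longrightarrow> x \<oplus>\<^bsub>M\<^esub> y \<in> N"
    and smult_in: "\<lbrakk>a \<in> carrier R; x \<in> N\<rbrakk> \<Longrightarrow> a \<odot>\<^bsub>M\<^esub> x \<in> N"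
begin

lemma uminus_in: "x \<in> N \<Longrightarrow> \<ominus>\<^bsub>M\<^esub> x \<in> N"
  using smult_in[of "\<ominus>\<^bsub>R\<^esub> \<one>\<^bsub>R\<^esub>" x] sub smult_l_minus[of "\<one>\<^bsub>R\<^esub>" x] by auto

lemma abelian_subgroup: "abelian_subgroup N M"
proof (rule abelian_subgroupI3)
  show "additive_subgroup N M"
    using sub zero_in add_in uminus_in
    by (intro additive_subgroup.intro) (unfold_locales, auto simp: a_inv_def[symmetric])
qed (rule M.abelian_group_axioms)

sublocale sg: abelian_subgroup N M by (rule abelian_subgroup)

abbreviation "Q \<equiv> quotient_module M N"
abbreviation "cls p \<equiv> N +>\<^bsub>M\<^esub> p"

lemma cls_eqI: "\<lbrakk>p \<in> carrier M; q \<in> carrier M; p \<ominus>\<^bsub>M\<^esub> q \<in> N\<rbrakk> \<Longrightarrow> cls p = cls q"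
  using sg.a_rcos_module_rev[of q p] sg.a_repr_independence'[of p q] by (simp add: a_minus_def)

lemma mem_cls: "\<lbrakk>p \<in> carrier M; q \<in> cls p\<rbrakk> \<Longrightarrow> q \<in> carrier M \<and> q \<ominus>\<^bsub>M\<^esub> p \<in> N"
  using M.a_r_coset_subset_G[OF sub, of p] sg.a_rcos_module_imp[of p q]
  by (auto simp: a_minus_def)

lemma cls_self: "p \<in> carrier M \<Longrightarrow> p \<in> cls p"
  using sg.a_rcos_self by blast

lemma quotient_carrier: "carrier Q = cls ` carrier M"
  by (auto simp: quotient_module_def A_RCOSETS_def')

lemma cls_zero: "\<zero>\<^bsub>Q\<^esub> = cls \<zero>\<^bsub>M\<^esub>"
  using sub by (simp add: quotient_module_def)

lemma cls_add: "\<lbrakk>p \<in> carrier M; q \<in> carrier M\<rbrakk> \<Longrightarrow> cls (p \<oplus>\<^bsub>M\<^esub> q) = cls p \<oplus>\<^bsub>Q\<^esub> cls q"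
  by (simp add: quotient_module_def sg.a_rcos_sum)

lemma cls_smult:
  assumes "a \<in> carrier R" "p \<in> carrier M"
  shows "cls (a \<odot>\<^bsub>M\<^esub> p) = a \<odot>\<^bsub>Q\<^esub> cls p"
proof -
  have "cls (a \<odot>\<^bsub>M\<^esub> q) = cls (a \<odot>\<^bsub>M\<^esub> p)" if "q \<in> cls p" for q
  proof (rule cls_eqI)
    have q: "q \<in> carrier M" "q \<ominus>\<^bsub>M\<^esub> p \<in> N" using mem_cls[OF assms(2) that] by auto
    show "a \<odot>\<^bsub>M\<^esub> q \<ominus>\<^bsub>M\<^esub> a \<odot>\<^bsub>M\<^esub> p \<in> N"
      using smult_in[OF assms(1) q(2)] q(1) assms
      by (simp add: a_minus_def smult_r_distr smult_r_minus)
    show "a \<odot>\<^bsub>M\<^esub> q \<in> carrier M" "a \<odot>\<^bsub>M\<^esub> p \<in> carrier M" using q(1) assms by auto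
  qed
  moreover have "p \<in> cls p" using cls_self assms by auto
  ultimately have "(\<Union>q\<in>cls p. cls (a \<odot>\<^bsub>M\<^esub> q)) = cls (a \<odot>\<^bsub>M\<^esub> p)" by blast
  then show ?thesis by (simp add: quotient_module_def)
qed

lemma quotient_is_module: "module R Q"
proof -
  have ab: "abelian_group Q"
  proof (rule abelian_groupI)
    fix x assume "x \<in> carrier Q"
    then obtain p where p: "p \<in> carrier M" "x = cls p" by (auto simp: quotient_carrier)
    have "cls (\<ominus>\<^bsub>M\<^esub> p) \<oplus>\<^bsub>Q\<^esub> x = \<zero>\<^bsub>Q\<^esub>"
      using p by (simp add: cls_zero cls_add[symmetric] M.l_neg)
    then show "\<exists>y\<in>carrier Q. y \<oplus>\<^bsub>Q\<^esub> x = \<zero>\<^bsub>Q\<^esub>" using p by (auto simp: quotient_carrier)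
  qed (auto simp: quotient_carrier cls_zero cls_add[symmetric] M.a_ac)
  show ?thesis
    by (rule moduleI)
      (auto simp: ab R.is_cring quotient_carrier cls_add[symmetric] cls_smult[symmetric]
        smult_l_distr smult_r_distr smult_assoc1)
qed

text \<open>A linear map which vanishes on \<open>N\<close> is constant on each coset, so the image of a coset
  is a singleton.\<close>

lemma the_elem_cls:
  assumes "module R U" "h \<in> module_hom R M U" "\<And>n. n \<in> N \<Longrightarrow> h n = \<zero>\<^bsub>U\<^esub>" "p \<in> carrier M"
  shows "the_elem (h ` cls p) = h p"
proof -
  interpret U: module R U by fact
  have "h q = h p" if "q \<in> cls p" for q
  proof -
    have q: "q \<in> carrier M" "q \<ominus>\<^bsub>M\<^esub> p \<in> N" using mem_cls[OF assms(4) that] by auto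
    then have "h q \<ominus>\<^bsub>U\<^esub> h p = \<zero>\<^bsub>U\<^esub>"
      using assms(3,4) by (simp add: module_hom_minus[OF module_axioms assms(1,2), symmetric])
    then show ?thesis
      using q(1) assms(4) module_hom_closedD[OF assms(2)] by (simp add: U.M.minus_eq_zero_iff)
  qed
  then have "h ` cls p = {h p}" using cls_self[OF assms(4)] by blast
  then show ?thesis by simp
qed

end

section \<open>Tensor products\<close>

context field
begin

context
  fixes V :: "('a, 'v, 'm) module_scheme" and W :: "('a, 'w, 'n) module_scheme"
  assumes V: "module R V" and W: "module R W"
begin

interpretation V: module R V by (rule V)
interpretation W: module R W by (rule W)

private abbreviation "F \<equiv> free_module R (carrier V \<times> carrier W)"
private abbreviation "T \<equiv> tensor_module R V W"
private abbreviation "pt \<equiv> pure_tensor R V W"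

private lemma F: "based_module R (carrier V \<times> carrier W) F"
  by (intro based_moduleI free_on_free_module)

interpretation F: based_module R "carrier V \<times> carrier W" F by (rule F)

private lemma \<delta>_closed: "\<lbrakk>v \<in> carrier V; w \<in> carrier W\<rbrakk> \<Longrightarrow> basis_vec R (v, w) \<in> carrier F"
  by (rule F.basis_vec_closed) auto

text \<open>The generators of the tensor relations, named so that membership in the span can be stated.\<close>

private definition "rels =
      {basis_vec R (v \<oplus>\<^bsub>V\<^esub> v', w) \<ominus>\<^bsub>F\<^esub> (basis_vec R (v, w) \<oplus>\<^bsub>F\<^esub> basis_vec R (v', w)) | v v' w.
          v \<in> carrier V \<and> v' \<in> carrier V \<and> w \<in> carrier W} \<union>
       {basis_vec R (v, w \<oplus>\<^bsub>W\<^esub> w') \<ominus>\<^bsub>F\<^esub> (basis_vec R (v, w) \<oplus>\<^bsub>F\<^esub> basis_vec R (v, w')) | v w w'.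
          v \<in> carrier V \<and> w \<in> carrier W \<and> w' \<in> carrier W} \<union>
       {basis_vec R (a \<odot>\<^bsub>V\<^esub> v, w) \<ominus>\<^bsub>F\<^esub> a \<odot>\<^bsub>F\<^esub> basis_vec R (v, w) | a v w.
          a \<in> carrier R \<and> v \<in> carrier V \<and> w \<in> carrier W} \<union>
       {basis_vec R (v, a \<odot>\<^bsub>W\<^esub> w) \<ominus>\<^bsub>F\<^esub> a \<odot>\<^bsub>F\<^esub> basis_vec R (v, w) | a v w.
          a \<in> carrier R \<and> v \<in> carrier V \<and> w \<in> carrier W}"

private lemma tensor_relations_rels: "tensor_relations R V W = F.span rels"
  by (simp add: tensor_relations_def rels_def Let_def)

private lemma rels_carrier: "rels \<subseteq> carrier F"
  unfolding rels_def by (auto intro!: \<delta>_closed F.M.minus_closed F.M.a_closed F.smult_closed)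

private lemma quotient: "module_quotient R F (tensor_relations R V W)"
proof -
  have s: "LinearCombinations.submodule R (F.span rels) F"
    by (rule F.span_is_submodule[OF rels_carrier])
  show ?thesis
    unfolding tensor_relations_rels
    using LinearCombinations.submodule.subset[OF s] LinearCombinations.submodule.zero_closed[OF s]
      LinearCombinations.submodule.m_closed[OF s] LinearCombinations.submodule.smult_closed[OF s]
    by unfold_locales auto
qed

interpretation q: module_quotient R F "tensor_relations R V W" by (rule quotient)

private lemma T_eq: "T = quotient_module F (tensor_relations R V W)"
  by (simp add: tensor_module_def)

private lemma rels_in: "r \<in> rels \<Longrightarrow> r \<in> tensor_relations R V W"
  using F.in_own_span[OF rels_carrier] by (auto simp: tensor_relations_rels)

lemma tensor_is_module: "module R (tensor_module R V W)"
  unfolding T_eq by (rule q.quotient_is_module)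

lemma pure_tensor_closed: "\<lbrakk>v \<in> carrier V; w \<in> carrier W\<rbrakk> \<Longrightarrow> pure_tensor R V W v w \<in> carrier (tensor_module R V W)"
  by (simp add: T_eq q.quotient_carrier pure_tensor_def \<delta>_closed)

lemma pure_tensor_bilinear: "bilinear R V W (tensor_module R V W) (pure_tensor R V W)"
proof (rule bilinearI; rule module_homI)
  fix v v' w assume c: "v \<in> carrier V" "v' \<in> carrier V" "w \<in> carrier W"
  then have "basis_vec R (v \<oplus>\<^bsub>V\<^esub> v', w) \<ominus>\<^bsub>F\<^esub> (basis_vec R (v, w) \<oplus>\<^bsub>F\<^esub> basis_vec R (v', w)) \<in> rels"
    unfolding rels_def by blast
  from rels_in[OF this] show "pt (v \<oplus>\<^bsub>V\<^esub> v') w = pt v w \<oplus>\<^bsub>T\<^esub> pt v' w"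
    using c unfolding pure_tensor_def T_eq by (simp add: q.cls_add[symmetric] \<delta>_closed q.cls_eqI)
next
  fix v w w' assume c: "v \<in> carrier V" "w \<in> carrier W" "w' \<in> carrier W"
  then have "basis_vec R (v, w \<oplus>\<^bsub>W\<^esub> w') \<ominus>\<^bsub>F\<^esub> (basis_vec R (v, w) \<oplus>\<^bsub>F\<^esub> basis_vec R (v, w')) \<in> rels"
    unfolding rels_def by blast
  from rels_in[OF this] show "pt v (w \<oplus>\<^bsub>W\<^esub> w') = pt v w \<oplus>\<^bsub>T\<^esub> pt v w'"
    using c unfolding pure_tensor_def T_eq by (simp add: q.cls_add[symmetric] \<delta>_closed q.cls_eqI)
next
  fix a v w assume c: "a \<in> carrier R" "v \<in> carrier V" "w \<in> carrier W"
  then have "basis_vec R (a \<odot>\<^bsub>V\<^esub> v, w) \<ominus>\<^bsub>F\<^esub> a \<odot>\<^bsub>F\<^esub> basis_vec R (v, w) \<in> rels"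
    unfolding rels_def by blast
  from rels_in[OF this] show "pt (a \<odot>\<^bsub>V\<^esub> v) w = a \<odot>\<^bsub>T\<^esub> pt v w"
    using c unfolding pure_tensor_def T_eq by (simp add: q.cls_smult[symmetric] \<delta>_closed q.cls_eqI)
next
  fix a v w assume c: "a \<in> carrier R" "v \<in> carrier V" "w \<in> carrier W"
  then have "basis_vec R (v, a \<odot>\<^bsub>W\<^esub> w) \<ominus>\<^bsub>F\<^esub> a \<odot>\<^bsub>F\<^esub> basis_vec R (v, w) \<in> rels"
    unfolding rels_def by blast
  from rels_in[OF this] show "pt v (a \<odot>\<^bsub>W\<^esub> w) = a \<odot>\<^bsub>T\<^esub> pt v w"
    using c unfolding pure_tensor_def T_eq by (simp add: q.cls_smult[symmetric] \<delta>_closed q.cls_eqI)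
qed (auto intro: pure_tensor_closed)

context
  fixes U :: "('a, 'u, 'l) module_scheme" and \<beta>
  assumes U: "module R U" and \<beta>: "bilinear R V W U \<beta>"
begin

interpretation U: module R U by (rule U)

private abbreviation "ext \<equiv> lin_ext R U (\<lambda>x. \<beta> (fst x) (snd x))"

private lemma \<beta>_closed: "\<lbrakk>v \<in> carrier V; w \<in> carrier W\<rbrakk> \<Longrightarrow> \<beta> v w \<in> carrier U"
  using bilinear_closed[OF \<beta>] by auto

private lemma ext_hom: "ext \<in> module_hom R F U"
  by (rule F.lin_ext_hom[OF U]) (auto intro: \<beta>_closed)

private lemma ext_\<delta>: "\<lbrakk>v \<in> carrier V; w \<in> carrier W\<rbrakk> \<Longrightarrow> ext (basis_vec R (v, w)) = \<beta> v w"
  by (subst F.lin_ext_basis_vec[OF U]) (auto intro: \<beta>_closed)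

private lemma ext_rels:
  assumes "r \<in> rels" shows "ext r = \<zero>\<^bsub>U\<^esub>"
proof -
  note left = bilinear_left[OF \<beta>] and right = bilinear_right[OF \<beta>]
  note s = module_hom_minus[OF F.module_axioms U ext_hom] module_hom_add[OF ext_hom] module_hom_smult[OF ext_hom]
    \<delta>_closed ext_\<delta> \<beta>_closed module_hom_add[OF left] module_hom_smult[OF left]
    module_hom_add[OF right] module_hom_smult[OF right] U.M.minus_eq_zero_iff
  show ?thesis
    using assms unfolding rels_def by (elim UnE CollectE exE conjE; simp add: s)
qed

private lemma ext_relations:
  assumes "r \<in> tensor_relations R V W" shows "ext r = \<zero>\<^bsub>U\<^esub>"
proof -
  obtain a A where A: "finite A" "A \<subseteq> rels" "a \<in> A \<rightarrow> carrier R" "r = (\<Oplus>\<^bsub>F\<^esub>v\<in>A. a v \<odot>\<^bsub>F\<^esub> v)"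
    using assms unfolding tensor_relations_rels F.span_def F.lincomb_def by auto
  have "ext r = (\<Oplus>\<^bsub>U\<^esub>v\<in>A. ext (a v \<odot>\<^bsub>F\<^esub> v))"
    unfolding A(4) using A rels_carrier by (intro module_hom_finsum[OF F.module_axioms U ext_hom]) auto
  also have "\<dots> = (\<Oplus>\<^bsub>U\<^esub>v\<in>A. \<zero>\<^bsub>U\<^esub>)"
  proof (rule U.finsum_cong')
    fix v assume v: "v \<in> A"
    then have "v \<in> rels" "v \<in> carrier F" "a v \<in> carrier R" using A rels_carrier by auto
    then show "ext (a v \<odot>\<^bsub>F\<^esub> v) = \<zero>\<^bsub>U\<^esub>"
      by (simp add: module_hom_smult[OF ext_hom] ext_rels)
  qed auto
  finally show ?thesis by simp
qed

private lemma tensor_lift_cls: "p \<in> carrier F \<Longrightarrow> tensor_lift R U \<beta> (q.cls p) = ext p"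
  unfolding tensor_lift_def lin_ext_def[symmetric]
  by (rule q.the_elem_cls[OF U ext_hom ext_relations])

lemma tensor_lift_hom: "tensor_lift R U \<beta> \<in> module_hom R (tensor_module R V W) U"
proof (rule module_homI)
  fix s assume "s \<in> carrier T"
  then obtain p where p: "p \<in> carrier F" "s = q.cls p" by (auto simp: T_eq q.quotient_carrier)
  then show "tensor_lift R U \<beta> s \<in> carrier U" by (simp add: tensor_lift_cls module_hom_closedD[OF ext_hom])
next
  fix s t assume "s \<in> carrier T" "t \<in> carrier T"
  then obtain p p' where p: "p \<in> carrier F" "s = q.cls p" "p' \<in> carrier F" "t = q.cls p'"
    by (auto simp: T_eq q.quotient_carrier)
  have "s \<oplus>\<^bsub>T\<^esub> t = q.cls (p \<oplus>\<^bsub>F\<^esub> p')" using p by (simp add: T_eq q.cls_add)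
  then show "tensor_lift R U \<beta> (s \<oplus>\<^bsub>T\<^esub> t) = tensor_lift R U \<beta> s \<oplus>\<^bsub>U\<^esub> tensor_lift R U \<beta> t"
    using p by (simp add: tensor_lift_cls module_hom_add[OF ext_hom])
next
  fix a s assume "a \<in> carrier R" "s \<in> carrier T"
  then obtain p where p: "a \<in> carrier R" "p \<in> carrier F" "s = q.cls p"
    by (auto simp: T_eq q.quotient_carrier)
  have "a \<odot>\<^bsub>T\<^esub> s = q.cls (a \<odot>\<^bsub>F\<^esub> p)" using p by (simp add: T_eq q.cls_smult)
  then show "tensor_lift R U \<beta> (a \<odot>\<^bsub>T\<^esub> s) = a \<odot>\<^bsub>U\<^esub> tensor_lift R U \<beta> s"
    using p by (simp add: tensor_lift_cls module_hom_smult[OF ext_hom])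
qed

lemma tensor_lift_pure:
  "\<lbrakk>v \<in> carrier V; w \<in> carrier W\<rbrakk> \<Longrightarrow> tensor_lift R U \<beta> (pure_tensor R V W v w) = \<beta> v w"
  by (simp add: pure_tensor_def tensor_lift_cls \<delta>_closed ext_\<delta>)

end

text \<open>The pure tensors generate by construction; those of generators suffice because a pure tensor is
  linear in each entry separately.\<close>

lemma tensor_generates:
  assumes "generates R V E" "generates R W D"
  shows "generates R (tensor_module R V W) ((\<lambda>(v, w). pure_tensor R V W v w) ` (E \<times> D))"
proof -
  interpret T: module R T by (rule tensor_is_module)
  let ?G = "(\<lambda>(v, w). pt v w) ` (E \<times> D)"
  let ?L = "lspan R T ?G"
  have E: "E \<subseteq> carrier V" "D \<subseteq> carrier W" using assms by (auto simp: generates_def)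
  have G: "?G \<subseteq> carrier T" using E by (auto intro: pure_tensor_closed)
  note left = bilinear_left[OF pure_tensor_bilinear] and right = bilinear_right[OF pure_tensor_bilinear]
  have 1: "pt v w \<in> ?L" if v: "v \<in> E" and w: "w \<in> lspan R W D" for v w
    using w
  proof induction
    case zero
    have "pt v \<zero>\<^bsub>W\<^esub> = \<zero>\<^bsub>T\<^esub>"
      by (rule module_hom_zero[OF W tensor_is_module right]) (use v E in auto)
    then show ?case by (simp only: lspan_zero)
  next
    case (base w)
    then show ?case using v by (auto intro: lspan_base)
  next
    case (add w w')
    then show ?case using v E lspan_closed[OF W E(2)] 
      by (subst module_hom_add[OF right]) (auto intro: lspan_add)
  next
    case (smult a w)
    then show ?case using v E lspan_closed[OF W E(2)] 
      by (subst module_hom_smult[OF right]) (auto intro: lspan_smult)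
  qed
  have 2: "pt v w \<in> ?L" if v: "v \<in> lspan R V E" and w: "w \<in> carrier W" for v w
    using v
  proof induction
    case zero
    then show ?case
      using w module_hom_zero[OF V tensor_is_module left, of w] by (auto intro: lspan_zero)
  next
    case (base v)
    then show ?case using w 1 assms(2) by (auto simp: generates_def)
  next
    case (add v v')
    then show ?case using w lspan_closed[OF V E(1)] 
      by (subst module_hom_add[OF left]) (auto intro: lspan_add)
  next
    case (smult a v)
    then show ?case using w lspan_closed[OF V E(1)] 
      by (subst module_hom_smult[OF left]) (auto intro: lspan_smult)
  qed
  have 3: "pt v w \<in> ?L" if "v \<in> carrier V" "w \<in> carrier W" for v w
    using 2 that assms(1) by (auto simp: generates_def)
  show ?thesis
  proof (rule generatesI[OF G])
    fix t assume "t \<in> carrier T"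
    then obtain p where p: "p \<in> carrier F" "t = q.cls p" by (auto simp: T_eq q.quotient_carrier)
    have "p \<in> lspan R F (basis_vec R ` (carrier V \<times> carrier W))"
      using F.generates_basis p by (auto simp: generates_def)
    then have "q.cls p \<in> ?L"
    proof induction
      case zero
      then show ?case by (metis lspan_zero T_eq q.cls_zero)
    next
      case (base x)
      then show ?case using 3 by (auto simp: pure_tensor_def)
    next
      case (add x y)
      then show ?case using lspan_closed[OF F.module_axioms _ add(1)] lspan_closed[OF F.module_axioms _ add(2)]
        by (auto simp: q.cls_add T_eq[symmetric] image_subset_iff \<delta>_closed intro: lspan_add)
    next
      case (smult a x)
      then show ?case using lspan_closed[OF F.module_axioms _ smult(2)]
        by (auto simp: q.cls_smult T_eq[symmetric] image_subset_iff \<delta>_closed intro: lspan_smult)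
    qed
    then show "t \<in> ?L" using p by simp
  qed
qed

lemma tensor_hom_eqI:
  assumes "generates R V E" "generates R W D" "module R U"
    and "h \<in> module_hom R (tensor_module R V W) U" "h' \<in> module_hom R (tensor_module R V W) U"
    and "\<And>v w. \<lbrakk>v \<in> E; w \<in> D\<rbrakk> \<Longrightarrow> h (pure_tensor R V W v w) = h' (pure_tensor R V W v w)"
    and "t \<in> carrier (tensor_module R V W)"
  shows "h t = h' t"
  by (rule hom_eqI[OF tensor_generates[OF assms(1,2)] tensor_is_module assms(3-5) _ assms(7)])
    (auto intro: assms(6))

text \<open>Lifting depends linearly on the bilinear map which is lifted. This is what makes iterated lifts
  bilinear, as they occur in the associator and in the multiplication of a tensor product of
  algebras.\<close>

lemma tensor_lift_param:
  assumes U: "module R U" and \<beta>: "\<And>a. a \<in> carrier P \<Longrightarrow> bilinear R V W U (\<beta> a)" and P: "module R P"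
    and param: "\<And>v w. \<lbrakk>v \<in> carrier V; w \<in> carrier W\<rbrakk> \<Longrightarrow> (\<lambda>a. \<beta> a v w) \<in> module_hom R P U"
    and t: "t \<in> carrier (tensor_module R V W)"
  shows "(\<lambda>a. tensor_lift R U (\<beta> a) t) \<in> module_hom R P U"
proof (rule module_homI)
  interpret U: module R U by (rule U)
  interpret P: module R P by (rule P)
  note lh = tensor_lift_hom[OF U \<beta>] and lp = tensor_lift_pure[OF U \<beta>]
  note eqI = tensor_hom_eqI[OF generates_carrier generates_carrier U]
  show "tensor_lift R U (\<beta> a) t \<in> carrier U" if "a \<in> carrier P" for a
    using module_hom_closedD[OF lh[OF that] t] .
  show "tensor_lift R U (\<beta> (a \<oplus>\<^bsub>P\<^esub> b)) t = tensor_lift R U (\<beta> a) t \<oplus>\<^bsub>U\<^esub> tensor_lift R U (\<beta> b) t"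
    if ab: "a \<in> carrier P" "b \<in> carrier P" for a b
    by (rule eqI[OF lh module_hom_add_maps[OF U lh lh] _ t])
      (use ab in \<open>auto simp: lp module_hom_add[OF param]\<close>)
  show "tensor_lift R U (\<beta> (c \<odot>\<^bsub>P\<^esub> a)) t = c \<odot>\<^bsub>U\<^esub> tensor_lift R U (\<beta> a) t"
    if ca: "c \<in> carrier R" "a \<in> carrier P" for c a
    by (rule eqI[OF lh module_hom_smult_map[OF U lh] _ t])
      (use ca in \<open>auto simp: lp module_hom_smult[OF param]\<close>)
qed

end

end

section \<open>Maps between tensor products\<close>

context field
begin

lemma tensor_map_bilinear:
  assumes "module R V'" "module R W'" "\<phi> \<in> module_hom R V V'" "\<psi> \<in> module_hom R W W'"
  shows "bilinear R V W (tensor_module R V' W') (\<lambda>v w. pure_tensor R V' W' (\<phi> v) (\<psi> w))"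
  by (rule bilinear_precompose[OF pure_tensor_bilinear[OF assms(1,2)] assms(3,4)])

lemma tensor_map_hom:
  assumes "module R V" "module R W" "module R V'" "module R W'"
    and "\<phi> \<in> module_hom R V V'" "\<psi> \<in> module_hom R W W'"
  shows "tensor_map R V' W' \<phi> \<psi> \<in> module_hom R (tensor_module R V W) (tensor_module R V' W')"
  unfolding tensor_map_def
  by (rule tensor_lift_hom[OF assms(1,2) tensor_is_module[OF assms(3,4)] tensor_map_bilinear[OF assms(3-6)]])

lemma tensor_map_pure:
  assumes "module R V" "module R W" "module R V'" "module R W'"
    and "\<phi> \<in> module_hom R V V'" "\<psi> \<in> module_hom R W W'" "v \<in> carrier V" "w \<in> carrier W"
  shows "tensor_map R V' W' \<phi> \<psi> (pure_tensor R V W v w) = pure_tensor R V' W' (\<phi> v) (\<psi> w)"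
  unfolding tensor_map_def
  by (rule tensor_lift_pure[OF assms(1,2) tensor_is_module[OF assms(3,4)] tensor_map_bilinear[OF assms(3-6)] assms(7,8)])

lemma tensor_swap_hom:
  assumes "module R V" "module R W"
  shows "tensor_swap R V W \<in> module_hom R (tensor_module R V W) (tensor_module R W V)"
  unfolding tensor_swap_def
  by (rule tensor_lift_hom[OF assms tensor_is_module[OF assms(2,1)]
        bilinear_flip[OF pure_tensor_bilinear[OF assms(2,1)]]])

lemma tensor_swap_pure:
  assumes "module R V" "module R W" "v \<in> carrier V" "w \<in> carrier W"
  shows "tensor_swap R V W (pure_tensor R V W v w) = pure_tensor R W V w v"
  unfolding tensor_swap_def
  by (rule tensor_lift_pure[OF assms(1,2) tensor_is_module[OF assms(2,1)]
        bilinear_flip[OF pure_tensor_bilinear[OF assms(2,1)]] assms(3,4)])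

context
  fixes U :: "('a, 'u, 'l) module_scheme" and V :: "('a, 'v, 'm) module_scheme"
    and W :: "('a, 'w, 'n) module_scheme"
  assumes U: "module R U" and V: "module R V" and W: "module R W"
begin

private abbreviation "VW \<equiv> tensor_module R V W"
private abbreviation "UV \<equiv> tensor_module R U V"
private abbreviation "UVW \<equiv> tensor_module R U VW"

private lemma VW: "module R VW" and UV: "module R UV" and UVW: "module R UVW"
  by (auto intro!: tensor_is_module U V W)

private lemma assoc_inner:
  assumes "w \<in> carrier W"
  shows "bilinear R U V UVW (\<lambda>u v. pure_tensor R U VW u (pure_tensor R V W v w))"
  by (rule bilinear_precompose[OF pure_tensor_bilinear[OF U VW] module_hom_id
        bilinear_left[OF pure_tensor_bilinear[OF V W] assms]])

private lemma assoc_outer: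
  "bilinear R UV W UVW
    (\<lambda>t w. tensor_lift R UVW (\<lambda>u v. pure_tensor R U VW u (pure_tensor R V W v w)) t)"
proof (rule bilinearI)
  show "(\<lambda>t. tensor_lift R UVW (\<lambda>u v. pure_tensor R U VW u (pure_tensor R V W v w)) t) \<in> module_hom R UV UVW"
    if "w \<in> carrier W" for w
    by (rule tensor_lift_hom[OF U V UVW assoc_inner[OF that]])
  show "(\<lambda>w. tensor_lift R UVW (\<lambda>u v. pure_tensor R U VW u (pure_tensor R V W v w)) t) \<in> module_hom R W UVW"
    if "t \<in> carrier UV" for t
  proof (rule tensor_lift_param[OF U V UVW assoc_inner W _ that])
    fix u v assume "u \<in> carrier U" "v \<in> carrier V"
    then show "(\<lambda>w. pure_tensor R U VW u (pure_tensor R V W v w)) \<in> module_hom R W UVW"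
      by (intro module_hom_compose[OF bilinear_right[OF pure_tensor_bilinear[OF V W]]
            bilinear_right[OF pure_tensor_bilinear[OF U VW]]])
  qed
qed

lemma tensor_assoc_hom:
  "tensor_assoc R U V W \<in> module_hom R (tensor_module R (tensor_module R U V) W)
    (tensor_module R U (tensor_module R V W))"
  unfolding tensor_assoc_def Let_def by (rule tensor_lift_hom[OF UV W UVW assoc_outer])

lemma tensor_assoc_pure:
  assumes "u \<in> carrier U" "v \<in> carrier V" "w \<in> carrier W"
  shows "tensor_assoc R U V W (pure_tensor R (tensor_module R U V) W (pure_tensor R U V u v) w)
    = pure_tensor R U (tensor_module R V W) u (pure_tensor R V W v w)"
  unfolding tensor_assoc_def Let_def
  by (simp add: tensor_lift_pure[OF UV W UVW assoc_outer] pure_tensor_closed[OF U V] assms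
      tensor_lift_pure[OF U V UVW assoc_inner])

end

lemma tensor_algebra_simps:
  "carrier (tensor_algebra R A B) = carrier (tensor_module R A B)"
  "zero (tensor_algebra R A B) = zero (tensor_module R A B)"
  "add (tensor_algebra R A B) = add (tensor_module R A B)"
  "smult (tensor_algebra R A B) = smult (tensor_module R A B)"
  "one (tensor_algebra R A B) = pure_tensor R A B \<one>\<^bsub>A\<^esub> \<one>\<^bsub>B\<^esub>"
  by (simp_all add: tensor_algebra_def Let_def)

context
  fixes A :: "('a, 'v, 'm) module_scheme" and B :: "('a, 'w, 'n) module_scheme"
  assumes A: "module R A" and B: "module R B"
    and mA: "bilinear R A A A (monoid.mult A)" and mB: "bilinear R B B B (monoid.mult B)"
begin

private abbreviation "AB \<equiv> tensor_module R A B"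
private abbreviation "\<mu> a b a' b' \<equiv> pure_tensor R A B (a \<otimes>\<^bsub>A\<^esub> a') (b \<otimes>\<^bsub>B\<^esub> b')"

private lemma AB: "module R AB" by (rule tensor_is_module[OF A B])

private lemmas pb = pure_tensor_bilinear[OF A B]

private lemma mult_inner:
  assumes "a \<in> carrier A" "b \<in> carrier B"
  shows "bilinear R A B AB (\<lambda>a' b'. \<mu> a b a' b')"
  by (rule bilinear_precompose[OF pb bilinear_right[OF mA assms(1)] bilinear_right[OF mB assms(2)]])

private lemma mult_outer:
  assumes t: "t \<in> carrier AB"
  shows "bilinear R A B AB (\<lambda>a b. tensor_lift R AB (\<mu> a b) t)"
proof (rule bilinearI)
  fix b assume b: "b \<in> carrier B"
  show "(\<lambda>a. tensor_lift R AB (\<mu> a b) t) \<in> module_hom R A AB"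
  proof (rule tensor_lift_param[OF A B AB mult_inner A _ t])
    fix a' b' assume c: "a' \<in> carrier A" "b' \<in> carrier B"
    show "(\<lambda>a. \<mu> a b a' b') \<in> module_hom R A AB"
      by (rule module_hom_compose[OF bilinear_left[OF mA c(1)] bilinear_left[OF pb]])
        (rule bilinear_closed[OF mB b c(2)])
  qed (auto intro: b)
next
  fix a assume a: "a \<in> carrier A"
  show "(\<lambda>b. tensor_lift R AB (\<mu> a b) t) \<in> module_hom R B AB"
  proof (rule tensor_lift_param[OF A B AB mult_inner B _ t])
    fix a' b' assume c: "a' \<in> carrier A" "b' \<in> carrier B"
    show "(\<lambda>b. \<mu> a b a' b') \<in> module_hom R B AB"
      by (rule module_hom_compose[OF bilinear_left[OF mB c(2)] bilinear_right[OF pb]])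
        (rule bilinear_closed[OF mA a c(1)])
  qed (auto intro: a)
qed

private lemma mult_eq: "s \<otimes>\<^bsub>tensor_algebra R A B\<^esub> t = tensor_lift R AB (\<lambda>a b. tensor_lift R AB (\<mu> a b) t) s"
  by (simp add: tensor_algebra_def Let_def)

lemma tensor_algebra_mult_bilinear:
  "bilinear R (tensor_module R A B) (tensor_module R A B) (tensor_module R A B) (monoid.mult (tensor_algebra R A B))"
proof (rule bilinearI)
  show "(\<lambda>s. s \<otimes>\<^bsub>tensor_algebra R A B\<^esub> t) \<in> module_hom R AB AB" if "t \<in> carrier AB" for t
    unfolding mult_eq by (rule tensor_lift_hom[OF A B AB mult_outer[OF that]])
  show "(\<lambda>t. s \<otimes>\<^bsub>tensor_algebra R A B\<^esub> t) \<in> module_hom R AB AB" if "s \<in> carrier AB" for s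
    unfolding mult_eq
    by (rule tensor_lift_param[OF A B AB mult_outer AB tensor_lift_hom[OF A B AB mult_inner] that])
qed

lemma tensor_algebra_mult_pure:
  assumes "a \<in> carrier A" "b \<in> carrier B" "a' \<in> carrier A" "b' \<in> carrier B"
  shows "pure_tensor R A B a b \<otimes>\<^bsub>tensor_algebra R A B\<^esub> pure_tensor R A B a' b'
    = pure_tensor R A B (a \<otimes>\<^bsub>A\<^esub> a') (b \<otimes>\<^bsub>B\<^esub> b')"
  unfolding mult_eq
  by (simp add: tensor_lift_pure[OF A B AB mult_outer] tensor_lift_pure[OF A B AB mult_inner]
      pure_tensor_closed[OF A B] assms)

end

end

section \<open>Multiplications given by structure constants\<close>

definition bilin_ext ::
    "('k, 'r) ring_scheme \<Rightarrow> ('k, 'u, 'm) module_scheme \<Rightarrow> ('x \<Rightarrow> 'y \<Rightarrow> 'u) \<Rightarrow> ('x \<Rightarrow> 'k) \<Rightarrow> ('y \<Rightarrow> 'k) \<Rightarrow> 'u"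
  where "bilin_ext R U \<mu> p q = lin_ext R U (\<lambda>x. lin_ext R U (\<mu> x) q) p"

lemma (in based_module) bilin_ext_bilinear:
  assumes U: "module R U" and \<mu>: "\<And>x y. \<lbrakk>x \<in> S; y \<in> S\<rbrakk> \<Longrightarrow> \<mu> x y \<in> carrier U"
  shows "bilinear R M M U (bilin_ext R U \<mu>)"
proof (rule bilinearI)
  have h: "lin_ext R U (\<mu> x) \<in> module_hom R M U" if "x \<in> S" for x
    using that by (intro lin_ext_hom[OF U]) (auto intro: \<mu>)
  show "(\<lambda>p. bilin_ext R U \<mu> p q) \<in> module_hom R M U" if "q \<in> carrier M" for q
    unfolding bilin_ext_def by (rule lin_ext_hom[OF U]) (rule module_hom_closedD[OF h that])
  show "bilin_ext R U \<mu> p \<in> module_hom R M U" if p: "p \<in> carrier M" for p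
    unfolding bilin_ext_def lin_ext_def[of R U "\<lambda>x. lin_ext R U (\<mu> x) q" p for q]
    by (rule module_hom_sum_of_maps[OF module_axioms U], rule module_hom_smult_map[OF U h])
      (use p in \<open>auto simp: carrier_iff\<close>)
qed

lemma (in based_module) bilin_ext_basis_vec:
  assumes U: "module R U" and "\<And>x y. \<lbrakk>x \<in> S; y \<in> S\<rbrakk> \<Longrightarrow> \<mu> x y \<in> carrier U" and "\<one> \<noteq> \<zero>"
    and "x \<in> S" "y \<in> S"
  shows "bilin_ext R U \<mu> (basis_vec R x) (basis_vec R y) = \<mu> x y"
  using assms by (simp add: bilin_ext_def lin_ext_basis_vec[OF U])

lemma twisted_group_algebra_simps:
  "carrier (twisted_group_algebra R G \<alpha>) = carrier (free_module R (carrier G))"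
  "zero (twisted_group_algebra R G \<alpha>) = zero (free_module R (carrier G))"
  "add (twisted_group_algebra R G \<alpha>) = add (free_module R (carrier G))"
  "smult (twisted_group_algebra R G \<alpha>) = smult (free_module R (carrier G))"
  "one (twisted_group_algebra R G \<alpha>) =
    inv\<^bsub>R\<^esub> (\<alpha> (\<one>\<^bsub>G\<^esub>, \<one>\<^bsub>G\<^esub>)) \<odot>\<^bsub>free_module R (carrier G)\<^esub> basis_vec R \<one>\<^bsub>G\<^esub>"
  by (simp_all add: twisted_group_algebra_def Let_def)

lemma free_on_twisted_group_algebra: "free_on R (carrier G) (twisted_group_algebra R G \<alpha>)"
  by (simp add: free_on_def twisted_group_algebra_simps)

text \<open>Recognizing the double sum as a bilinear extension reduces all questions about the product to
  basis vectors.\<close>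

lemma (in field) twisted_group_algebra_mult:
  assumes "group G" and \<alpha>: "\<And>\<sigma> \<tau>. \<lbrakk>\<sigma> \<in> carrier G; \<tau> \<in> carrier G\<rbrakk> \<Longrightarrow> \<alpha> (\<sigma>, \<tau>) \<in> carrier R"
    and p: "p \<in> carrier (twisted_group_algebra R G \<alpha>)" and q: "q \<in> carrier (twisted_group_algebra R G \<alpha>)"
  shows "p \<otimes>\<^bsub>twisted_group_algebra R G \<alpha>\<^esub> q =
    bilin_ext R (twisted_group_algebra R G \<alpha>)
      (\<lambda>\<sigma> \<tau>. \<alpha> (\<sigma>, \<tau>) \<odot>\<^bsub>twisted_group_algebra R G \<alpha>\<^esub> basis_vec R (\<sigma> \<otimes>\<^bsub>G\<^esub> \<tau>)) p q"
proof -
  interpret G: group G by fact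
  let ?A = "twisted_group_algebra R G \<alpha>" and ?F = "free_module R (carrier G)"
  interpret A: based_module R "carrier G" ?A by (intro based_moduleI free_on_twisted_group_algebra)
  have fs: "finsum ?F = finsum ?A"
    by (intro ext) (simp add: finsum_def twisted_group_algebra_simps)
  have pq: "\<And>x. p x \<in> carrier R" "\<And>x. q x \<in> carrier R" "finite {x. p x \<noteq> \<zero>}" "finite {x. q x \<noteq> \<zero>}"
    "{x. p x \<noteq> \<zero>} \<subseteq> carrier G" "{x. q x \<noteq> \<zero>} \<subseteq> carrier G"
    using p q by (auto simp: A.carrier_iff)
  have "p \<otimes>\<^bsub>?A\<^esub> q = (\<Oplus>\<^bsub>?A\<^esub>\<sigma>\<in>{\<sigma>. p \<sigma> \<noteq> \<zero>}. \<Oplus>\<^bsub>?A\<^esub>\<tau>\<in>{\<tau>. q \<tau> \<noteq> \<zero>}.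
      (p \<sigma> \<otimes> q \<tau> \<otimes> \<alpha> (\<sigma>, \<tau>)) \<odot>\<^bsub>?A\<^esub> basis_vec R (\<sigma> \<otimes>\<^bsub>G\<^esub> \<tau>))"
    unfolding fs[symmetric] twisted_group_algebra_simps by (simp add: twisted_group_algebra_def Let_def)
  also have "\<dots> = (\<Oplus>\<^bsub>?A\<^esub>\<sigma>\<in>{\<sigma>. p \<sigma> \<noteq> \<zero>}. p \<sigma> \<odot>\<^bsub>?A\<^esub> (\<Oplus>\<^bsub>?A\<^esub>\<tau>\<in>{\<tau>. q \<tau> \<noteq> \<zero>}.
      q \<tau> \<odot>\<^bsub>?A\<^esub> (\<alpha> (\<sigma>, \<tau>) \<odot>\<^bsub>?A\<^esub> basis_vec R (\<sigma> \<otimes>\<^bsub>G\<^esub> \<tau>))))"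
  proof (rule A.finsum_cong'[OF refl])
    fix \<sigma> assume "\<sigma> \<in> {\<sigma>. p \<sigma> \<noteq> \<zero>}"
    then have \<sigma>: "\<sigma> \<in> carrier G" using pq by auto
    have c: "\<alpha> (\<sigma>, \<tau>) \<in> carrier R" "basis_vec R (\<sigma> \<otimes>\<^bsub>G\<^esub> \<tau>) \<in> carrier ?A" if "q \<tau> \<noteq> \<zero>" for \<tau>
      using that \<sigma> pq by (auto intro!: \<alpha> A.basis_vec_closed)
    have "(\<Oplus>\<^bsub>?A\<^esub>\<tau>\<in>{\<tau>. q \<tau> \<noteq> \<zero>}. (p \<sigma> \<otimes> q \<tau> \<otimes> \<alpha> (\<sigma>, \<tau>)) \<odot>\<^bsub>?A\<^esub> basis_vec R (\<sigma> \<otimes>\<^bsub>G\<^esub> \<tau>))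
        = (\<Oplus>\<^bsub>?A\<^esub>\<tau>\<in>{\<tau>. q \<tau> \<noteq> \<zero>}. p \<sigma> \<odot>\<^bsub>?A\<^esub> (q \<tau> \<odot>\<^bsub>?A\<^esub> (\<alpha> (\<sigma>, \<tau>) \<odot>\<^bsub>?A\<^esub> basis_vec R (\<sigma> \<otimes>\<^bsub>G\<^esub> \<tau>))))"
      using pq c by (intro A.finsum_cong') (auto simp: A.smult_assoc1 m_assoc)
    also have "\<dots> = p \<sigma> \<odot>\<^bsub>?A\<^esub> (\<Oplus>\<^bsub>?A\<^esub>\<tau>\<in>{\<tau>. q \<tau> \<noteq> \<zero>}.
        q \<tau> \<odot>\<^bsub>?A\<^esub> (\<alpha> (\<sigma>, \<tau>) \<odot>\<^bsub>?A\<^esub> basis_vec R (\<sigma> \<otimes>\<^bsub>G\<^esub> \<tau>)))"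
      using pq c by (intro A.finsum_smult_ldistr[symmetric]) auto
    finally show "(\<Oplus>\<^bsub>?A\<^esub>\<tau>\<in>{\<tau>. q \<tau> \<noteq> \<zero>}. (p \<sigma> \<otimes> q \<tau> \<otimes> \<alpha> (\<sigma>, \<tau>)) \<odot>\<^bsub>?A\<^esub> basis_vec R (\<sigma> \<otimes>\<^bsub>G\<^esub> \<tau>)) = \<dots>" .
  next
    show "(\<lambda>\<sigma>. p \<sigma> \<odot>\<^bsub>?A\<^esub> (\<Oplus>\<^bsub>?A\<^esub>\<tau>\<in>{\<tau>. q \<tau> \<noteq> \<zero>}. q \<tau> \<odot>\<^bsub>?A\<^esub> (\<alpha> (\<sigma>, \<tau>) \<odot>\<^bsub>?A\<^esub> basis_vec R (\<sigma> \<otimes>\<^bsub>G\<^esub> \<tau>))))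
      \<in> {\<sigma>. p \<sigma> \<noteq> \<zero>} \<rightarrow> carrier ?A"
      using pq by (auto intro!: A.smult_closed A.finsum_closed \<alpha> A.basis_vec_closed)
  qed
  finally show ?thesis by (simp add: bilin_ext_def lin_ext_def)
qed

lemma (in field) twisted_group_algebra_bilinear:
  assumes "group G" and \<alpha>: "\<And>\<sigma> \<tau>. \<lbrakk>\<sigma> \<in> carrier G; \<tau> \<in> carrier G\<rbrakk> \<Longrightarrow> \<alpha> (\<sigma>, \<tau>) \<in> carrier R"
  defines "A \<equiv> twisted_group_algebra R G \<alpha>"
  shows "bilinear R A A A (monoid.mult A)"
    and "\<lbrakk>g \<in> carrier G; h \<in> carrier G\<rbrakk> \<Longrightarrow>
      basis_vec R g \<otimes>\<^bsub>A\<^esub> basis_vec R h = \<alpha> (g, h) \<odot>\<^bsub>A\<^esub> basis_vec R (g \<otimes>\<^bsub>G\<^esub> h)"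
proof -
  interpret G: group G by fact
  interpret A: based_module R "carrier G" A unfolding A_def by (intro based_moduleI free_on_twisted_group_algebra)
  let ?\<mu> = "\<lambda>\<sigma> \<tau>. \<alpha> (\<sigma>, \<tau>) \<odot>\<^bsub>A\<^esub> basis_vec R (\<sigma> \<otimes>\<^bsub>G\<^esub> \<tau>)"
  have \<mu>: "?\<mu> \<sigma> \<tau> \<in> carrier A" if "\<sigma> \<in> carrier G" "\<tau> \<in> carrier G" for \<sigma> \<tau>
    using that by (auto intro!: \<alpha> A.basis_vec_closed)
  have eq: "p \<otimes>\<^bsub>A\<^esub> q = bilin_ext R A ?\<mu> p q" if "p \<in> carrier A" "q \<in> carrier A" for p q
    using twisted_group_algebra_mult[where G = G and \<alpha> = \<alpha>, OF assms(1) \<alpha>] that unfolding A_def by blast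
  note b = A.bilin_ext_bilinear[of A ?\<mu>, OF A.module_axioms \<mu>]
  show "bilinear R A A A (monoid.mult A)"
    using b unfolding bilinear_def module_hom_def by (auto simp: eq Pi_iff)
  show "\<lbrakk>g \<in> carrier G; h \<in> carrier G\<rbrakk> \<Longrightarrow> basis_vec R g \<otimes>\<^bsub>A\<^esub> basis_vec R h = ?\<mu> g h"
    by (subst eq) (auto intro!: A.basis_vec_closed A.bilin_ext_basis_vec[OF A.module_axioms \<mu>])
qed

section \<open>Integer powers of units and sums over residues\<close>

text \<open>The exponents below take both signs, so powers are formed in the group of units, where integer
  powers exist.\<close>

definition unit_pow :: "('k, 'r) ring_scheme \<Rightarrow> 'k \<Rightarrow> int \<Rightarrow> 'k"
  where "unit_pow R x n = x [^]\<^bsub>units_of R\<^esub> n"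

context cring
begin

lemma unit_pow_closed [simp, intro]: "x \<in> Units R \<Longrightarrow> unit_pow R x n \<in> Units R"
  using group.int_pow_closed[OF units_group, of x n] by (simp add: unit_pow_def units_of_carrier)

lemma unit_pow_carrier [simp, intro]: "x \<in> Units R \<Longrightarrow> unit_pow R x n \<in> carrier R"
  by (simp add: Units_closed)

lemma unit_pow_0 [simp]: "unit_pow R x 0 = \<one>"
  by (simp add: unit_pow_def units_of_one)

lemma unit_pow_1 [simp]: "x \<in> Units R \<Longrightarrow> unit_pow R x 1 = x"
  using group.int_pow_1[OF units_group, of x] by (simp add: unit_pow_def units_of_carrier)

lemma unit_pow_one [simp]: "unit_pow R \<one> n = \<one>"
  using group.int_pow_one[OF units_group, of n] by (simp add: unit_pow_def units_of_one)

lemma unit_pow_add: "x \<in> Units R \<Longrightarrow> unit_pow R x (a + b) = unit_pow R x a \<otimes> unit_pow R x b"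
  using group.int_pow_mult[OF units_group, of x a b] by (simp add: unit_pow_def units_of_carrier units_of_mult)

lemma unit_pow_mult_base:
  "\<lbrakk>x \<in> Units R; y \<in> Units R\<rbrakk> \<Longrightarrow> unit_pow R (x \<otimes> y) a = unit_pow R x a \<otimes> unit_pow R y a"
  using comm_group.int_pow_distrib[OF units_comm_group, of x y a]
  by (simp add: unit_pow_def units_of_carrier units_of_mult)

lemma unit_pow_mult: "x \<in> Units R \<Longrightarrow> unit_pow R x (a * b) = unit_pow R (unit_pow R x a) b"
  using group.int_pow_pow[OF units_group, of x a b] by (simp add: unit_pow_def units_of_carrier)

lemma unit_pow_int: "x \<in> Units R \<Longrightarrow> unit_pow R x (int n) = x [^] n"
  using units_of_pow[of x n] by (simp add: unit_pow_def int_pow_int)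

lemma unit_pow_neg_cancel [simp]:
  assumes "x \<in> Units R"
  shows "unit_pow R x (- n) \<otimes> unit_pow R x n = \<one>" "unit_pow R x n \<otimes> unit_pow R x (- n) = \<one>"
  using assms by (simp_all flip: unit_pow_add)

lemma unit_pow_inv: "x \<in> Units R \<Longrightarrow> unit_pow R (inv x) n = unit_pow R x (- n)"
  using group.int_pow_inv[OF units_group, of x n] group.int_pow_neg[OF units_group, of x n]
  by (simp add: unit_pow_def units_of_carrier units_of_inv)

end

text \<open>A summand depending only on the residue of the index may be summed along any permutation of the
  residues; \<open>a - c\<close> and \<open>c - a\<close> are the two that occur.\<close>

lemma (in abelian_monoid) finsum_residues:
  assumes per: "\<And>n. g (n mod d) = g n" and "\<And>n. g n \<in> carrier G" and d: "d > (0::int)"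
  shows finsum_residues_shift: "(\<Oplus>a\<in>{0..<d}. g (a - c)) = (\<Oplus>a\<in>{0..<d}. g a)"
    and finsum_residues_reflect: "(\<Oplus>a\<in>{0..<d}. g (c - a)) = (\<Oplus>a\<in>{0..<d}. g a)"
proof -
  have *: "(\<Oplus>a\<in>{0..<d}. g (r a)) = (\<Oplus>a\<in>{0..<d}. g a)"
    if inj: "inj_on (\<lambda>a. r a mod d) {0..<d}" for r
  proof -
    have "(\<lambda>a. r a mod d) ` {0..<d} = {0..<d}"
      using inj d by (intro card_subset_eq) (auto simp: card_image)
    then have "(\<Oplus>a\<in>{0..<d}. g a) = (\<Oplus>a\<in>(\<lambda>a. r a mod d) ` {0..<d}. g a)" by simp
    also have "\<dots> = (\<Oplus>a\<in>{0..<d}. g (r a mod d))"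
      using inj assms(2) by (intro finsum_reindex) auto
    finally show ?thesis by (simp add: per)
  qed
  have eqI: "a = b" if "a \<in> {0..<d}" "b \<in> {0..<d}" "d dvd a - b" for a b
    using that by (metis atLeastLessThan_iff mod_eq_dvd_iff mod_pos_pos_trivial)
  show "(\<Oplus>a\<in>{0..<d}. g (a - c)) = (\<Oplus>a\<in>{0..<d}. g a)"
  proof (rule *, rule inj_onI, rule eqI)
    fix a b assume "(a - c) mod d = (b - c) mod d"
    then have "d dvd (a - c) - (b - c)" by (simp only: mod_eq_dvd_iff)
    then show "d dvd a - b" by simp
  qed auto
  show "(\<Oplus>a\<in>{0..<d}. g (c - a)) = (\<Oplus>a\<in>{0..<d}. g a)"
  proof (rule *, rule inj_onI, rule eqI)
    fix a b assume "(c - a) mod d = (c - b) mod d"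
    then have "d dvd (c - a) - (c - b)" by (simp only: mod_eq_dvd_iff)
    then show "d dvd a - b" by (simp add: dvd_diff_commute)
  qed auto
qed

lemma (in abelian_monoid) finsum_single:
  assumes "finite I" "i \<in> I" "x i \<in> carrier G" "\<And>j. \<lbrakk>j \<in> I; j \<noteq> i\<rbrakk> \<Longrightarrow> x j = \<zero>"
  shows "(\<Oplus>j\<in>I. x j) = x i"
proof -
  have cl: "x j \<in> carrier G" if "j \<in> I" for j
    using that assms(3,4) by (cases "j = i") auto
  have "(\<Oplus>j\<in>I. x j) = (\<Oplus>j\<in>I. if i = j then x j else \<zero>)"
    using cl assms(4) by (intro finsum_cong') auto
  also have "\<dots> = x i" using cl assms by (intro finsum_singleton) auto
  finally show ?thesis .
qed

lemma (in abelian_monoid) finsum_swap: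
  assumes "finite I" "finite J" "\<And>i j. \<lbrakk>i \<in> I; j \<in> J\<rbrakk> \<Longrightarrow> x i j \<in> carrier G"
  shows "(\<Oplus>i\<in>I. \<Oplus>j\<in>J. x i j) = (\<Oplus>j\<in>J. \<Oplus>i\<in>I. x i j)"
  using assms(1,3)
proof (induction I rule: finite_induct)
  case empty
  then show ?case by simp
next
  case (insert i I)
  have "(\<Oplus>i\<in>insert i I. \<Oplus>j\<in>J. x i j) = (\<Oplus>j\<in>J. x i j) \<oplus> (\<Oplus>j\<in>J. \<Oplus>i\<in>I. x i j)"
    using insert by (subst finsum_insert) (auto intro!: finsum_closed)
  also have "\<dots> = (\<Oplus>j\<in>J. x i j \<oplus> (\<Oplus>i\<in>I. x i j))"
    using insert by (intro finsum_addf[symmetric]) (auto intro!: finsum_closed)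
  also have "\<dots> = (\<Oplus>j\<in>J. \<Oplus>i\<in>insert i I. x i j)"
    using insert by (intro finsum_cong') (auto intro!: finsum_closed simp: Pi_iff)
  finally show ?case .
qed

section \<open>The Hopf algebra of a cocycle of finite order\<close>

lemma tensor_cong:
  assumes "carrier V = carrier V'" "add V = add V'" "smult V = smult V'"
    and "carrier W = carrier W'" "add W = add W'" "smult W = smult W'"
  shows tensor_module_cong: "tensor_module R V W = tensor_module R V' W'"
    and pure_tensor_cong: "pure_tensor R V W = pure_tensor R V' W'"
  using assms by (simp_all add: tensor_module_def tensor_relations_def pure_tensor_def fun_eq_iff)

lemma lin_ext_cong:
  assumes "carrier V = carrier V'" "add V = add V'" "zero V = zero V'" "smult V = smult V'"
  shows "lin_ext R V = lin_ext R V'"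
  using assms by (intro ext) (simp add: lin_ext_def finsum_def finprod_def)

text \<open>The condition \<open>\<alpha>_pow_m\<close> says that \<open>\<alpha>\<^sup>m\<close> is the
  coboundary of \<open>f\<close>, cleared of inverses.\<close>

locale twisting = K: field k + G: group G
  for k :: "('k, 'r) ring_scheme" and G :: "('g, 's) monoid_scheme" +
  fixes \<alpha> :: "'g \<times> 'g \<Rightarrow> 'k" and f :: "'g \<Rightarrow> 'k" and m :: nat
  assumes finite_G: "finite (carrier G)"
    and \<alpha>_unit: "\<lbrakk>\<sigma> \<in> carrier G; \<tau> \<in> carrier G\<rbrakk> \<Longrightarrow> \<alpha> (\<sigma>, \<tau>) \<in> Units k"
    and cocycle: "\<lbrakk>\<rho> \<in> carrier G; \<sigma> \<in> carrier G; \<tau> \<in> carrier G\<rbrakk> \<Longrightarrow>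
      \<alpha> (\<rho>, \<sigma>) \<otimes>\<^bsub>k\<^esub> \<alpha> (\<rho> \<otimes>\<^bsub>G\<^esub> \<sigma>, \<tau>) = \<alpha> (\<sigma>, \<tau>) \<otimes>\<^bsub>k\<^esub> \<alpha> (\<rho>, \<sigma> \<otimes>\<^bsub>G\<^esub> \<tau>)"
    and f_unit: "\<sigma> \<in> carrier G \<Longrightarrow> f \<sigma> \<in> Units k"
    and \<alpha>_pow_m: "\<lbrakk>\<sigma> \<in> carrier G; \<tau> \<in> carrier G\<rbrakk> \<Longrightarrow>
      \<alpha> (\<sigma>, \<tau>) [^]\<^bsub>k\<^esub> m \<otimes>\<^bsub>k\<^esub> f (\<sigma> \<otimes>\<^bsub>G\<^esub> \<tau>) = f \<sigma> \<otimes>\<^bsub>k\<^esub> f \<tau>"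
    and m_pos: "m > 0"
begin

abbreviation up :: "'k \<Rightarrow> int \<Rightarrow> 'k" where "up \<equiv> unit_pow k"
abbreviation Z :: "int set" where "Z \<equiv> {0..<int m}"
abbreviation S :: "('g \<times> nat) set" where "S \<equiv> carrier G \<times> {0..<m}"
abbreviation F :: "('k, 'g \<times> nat \<Rightarrow> 'k) module" where "F \<equiv> free_module k S"

text \<open>The element \<open>U \<sigma> n\<close> plays the role of \<open>g(\<sigma>)\<^sup>n
  u\<^sub>\<sigma> e\<^sub>n\<close>: replacing \<open>n\<close> by its residue costs the factor
  \<open>g(\<sigma>)\<^sup>m = f(\<sigma>)\<close> as often as \<open>m\<close> is removed.\<close>

definition U :: "'g \<Rightarrow> int \<Rightarrow> 'g \<times> nat \<Rightarrow> 'k"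
  where "U \<sigma> n = up (f \<sigma>) (n div int m) \<odot>\<^bsub>F\<^esub> basis_vec k (\<sigma>, nat (n mod int m))"

text \<open>The inverse of \<open>U \<sigma> n\<close> in the component of index \<open>n\<close>. The value
  \<open>\<alpha>(1,1)\<close> enters because the cocycle need not be normalized; for the same
  reason \<open>U_unit n\<close>, the unit of that component, is not \<open>U 1 n\<close>.\<close>

definition U_inv :: "'g \<Rightarrow> int \<Rightarrow> 'g \<times> nat \<Rightarrow> 'k"
  where "U_inv \<sigma> n =
    (up (\<alpha> (\<one>\<^bsub>G\<^esub>, \<one>\<^bsub>G\<^esub>)) (- n) \<otimes>\<^bsub>k\<^esub> up (\<alpha> (\<sigma>, inv\<^bsub>G\<^esub> \<sigma>)) (- n)) \<odot>\<^bsub>F\<^esub> U (inv\<^bsub>G\<^esub> \<sigma>) n"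

definition U_unit :: "int \<Rightarrow> 'g \<times> nat \<Rightarrow> 'k"
  where "U_unit n = up (\<alpha> (\<one>\<^bsub>G\<^esub>, \<one>\<^bsub>G\<^esub>)) (- n) \<odot>\<^bsub>F\<^esub> U \<one>\<^bsub>G\<^esub> n"

definition mult_const :: "'g \<times> nat \<Rightarrow> 'g \<times> nat \<Rightarrow> 'g \<times> nat \<Rightarrow> 'k"
  where "mult_const x y = (if snd x = snd y
    then up (\<alpha> (fst x, fst y)) (int (snd x)) \<odot>\<^bsub>F\<^esub> basis_vec k (fst x \<otimes>\<^bsub>G\<^esub> fst y, snd x) else \<zero>\<^bsub>F\<^esub>)"

text \<open>The coefficients are those of \<open>g(\<sigma>)\<^sup>i u\<^sub>\<sigma> e\<^sub>i\<close> in the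
  group algebra of the central extension: the counit is the trivial character, which sees the
  component of \<open>e\<^sub>0\<close> only, and the antipode sends \<open>u\<^sub>\<sigma>
  e\<^sub>i\<close> to \<open>u\<^sub>\<sigma>\<^sup>-\<^sup>1 e\<^sub>-\<^sub>i\<close>.\<close>

definition H :: "('k, 'g \<times> nat \<Rightarrow> 'k) hopf_algebra"
  where "H = \<lparr>carrier = carrier F, monoid.mult = bilin_ext k F mult_const, one = \<Oplus>\<^bsub>F\<^esub>n\<in>Z. U_unit n,
    zero = zero F, add = add F, smult = smult F,
    comult = lin_ext k (tensor_module k F F)
      (\<lambda>x. \<Oplus>\<^bsub>tensor_module k F F\<^esub>a\<in>Z. pure_tensor k F F (U (fst x) a) (U (fst x) (int (snd x) - a))),
    counit = lin_ext k (regular_algebra k) (\<lambda>x. if snd x = 0 then \<one>\<^bsub>k\<^esub> else \<zero>\<^bsub>k\<^esub>),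
    antipode = lin_ext k F (\<lambda>x. U_inv (fst x) (- int (snd x)))\<rparr>"

abbreviation T :: "('k, (('g \<times> nat \<Rightarrow> 'k) \<times> ('g \<times> nat \<Rightarrow> 'k) \<Rightarrow> 'k) set) module"
  where "T \<equiv> tensor_module k H H"
abbreviation pt :: "('g \<times> nat \<Rightarrow> 'k) \<Rightarrow> ('g \<times> nat \<Rightarrow> 'k) \<Rightarrow> (('g \<times> nat \<Rightarrow> 'k) \<times> ('g \<times> nat \<Rightarrow> 'k) \<Rightarrow> 'k) set"
  where "pt \<equiv> pure_tensor k H H"

lemma H_module_part: "carrier H = carrier F" "zero H = zero F" "add H = add F" "smult H = smult F"
  by (simp_all add: H_def)

lemma finsum_H: "finsum F = finsum H"
  by (intro ext) (simp add: finsum_def finprod_def H_module_part)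

lemma tensor_F_H: "tensor_module k F F = T" "pure_tensor k F F = pt"
  by (rule tensor_cong; simp add: H_module_part)+

sublocale H: based_module k S H
  by (rule K.based_moduleI) (simp add: free_on_def H_module_part)

lemma H_module: "module k H" by (rule H.module_axioms)

lemma T_module: "module k T" by (rule K.tensor_is_module[OF H_module H_module])

sublocale T: module k T by (rule T_module)

lemmas pt_bilinear = K.pure_tensor_bilinear[OF H_module H_module]
lemmas pt_closed [simp] = K.pure_tensor_closed[OF H_module H_module]

lemma H_field_eqs:
  "monoid.mult H = bilin_ext k H mult_const"
  "\<one>\<^bsub>H\<^esub> = (\<Oplus>\<^bsub>H\<^esub>n\<in>Z. U_unit n)"
  "comult H = lin_ext k T (\<lambda>x. \<Oplus>\<^bsub>T\<^esub>a\<in>Z. pt (U (fst x) a) (U (fst x) (int (snd x) - a)))"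
  "counit H = lin_ext k (regular_algebra k) (\<lambda>x. if snd x = 0 then \<one>\<^bsub>k\<^esub> else \<zero>\<^bsub>k\<^esub>)"
  "antipode H = lin_ext k H (\<lambda>x. U_inv (fst x) (- int (snd x)))"
proof -
  have l: "lin_ext k F = lin_ext k H" by (rule lin_ext_cong) (simp_all add: H_module_part)
  have b: "bilin_ext k F = bilin_ext k H" by (intro ext) (simp add: bilin_ext_def l)
  show "monoid.mult H = bilin_ext k H mult_const" unfolding b[symmetric] by (simp add: H_def)
  show "\<one>\<^bsub>H\<^esub> = (\<Oplus>\<^bsub>H\<^esub>n\<in>Z. U_unit n)" unfolding finsum_H[symmetric] by (simp add: H_def)
  show "comult H = lin_ext k T (\<lambda>x. \<Oplus>\<^bsub>T\<^esub>a\<in>Z. pt (U (fst x) a) (U (fst x) (int (snd x) - a)))"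
    unfolding tensor_F_H[symmetric] by (simp add: H_def)
  show "counit H = lin_ext k (regular_algebra k) (\<lambda>x. if snd x = 0 then \<one>\<^bsub>k\<^esub> else \<zero>\<^bsub>k\<^esub>)" by (simp add: H_def)
  show "antipode H = lin_ext k H (\<lambda>x. U_inv (fst x) (- int (snd x)))" unfolding l[symmetric] by (simp add: H_def)
qed

lemma U_eq: "U \<sigma> n = up (f \<sigma>) (n div int m) \<odot>\<^bsub>H\<^esub> basis_vec k (\<sigma>, nat (n mod int m))"
  by (simp add: U_def H_module_part)

lemma U_inv_eq: "U_inv \<sigma> n =
    (up (\<alpha> (\<one>\<^bsub>G\<^esub>, \<one>\<^bsub>G\<^esub>)) (- n) \<otimes>\<^bsub>k\<^esub> up (\<alpha> (\<sigma>, inv\<^bsub>G\<^esub> \<sigma>)) (- n)) \<odot>\<^bsub>H\<^esub> U (inv\<^bsub>G\<^esub> \<sigma>) n"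
  by (simp add: U_inv_def H_module_part)

lemma U_unit_eq: "U_unit n = up (\<alpha> (\<one>\<^bsub>G\<^esub>, \<one>\<^bsub>G\<^esub>)) (- n) \<odot>\<^bsub>H\<^esub> U \<one>\<^bsub>G\<^esub> n"
  by (simp add: U_unit_def H_module_part)

lemma mod_Z [simp]: "n mod int m \<in> Z" "nat (n mod int m) < m"
  using m_pos by (auto simp: nat_less_iff)

lemma basis_closed: "\<lbrakk>\<sigma> \<in> carrier G; i < m\<rbrakk> \<Longrightarrow> basis_vec k (\<sigma>, i) \<in> carrier H"
  by (rule H.basis_vec_closed) auto

lemma U_closed [simp]: "\<sigma> \<in> carrier G \<Longrightarrow> U \<sigma> n \<in> carrier H"
  by (simp add: U_eq basis_closed f_unit)

lemma U_inv_closed [simp]: "\<sigma> \<in> carrier G \<Longrightarrow> U_inv \<sigma> n \<in> carrier H"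
  by (simp add: U_inv_eq \<alpha>_unit)

lemma U_unit_closed [simp]: "U_unit n \<in> carrier H"
  by (simp add: U_unit_eq \<alpha>_unit)

lemma basis_vec_eq_U: "i < m \<Longrightarrow> basis_vec k (\<sigma>, i) = U \<sigma> (int i)" if "\<sigma> \<in> carrier G"
  using that by (simp add: U_eq basis_closed)

definition gens :: "('g \<times> nat \<Rightarrow> 'k) set" where "gens = (\<lambda>(\<sigma>, n). U \<sigma> n) ` (carrier G \<times> Z)"

lemma gens_generate: "generates k H gens"
proof -
  have "basis_vec k ` S \<subseteq> gens"
    unfolding gens_def
  proof clarify
    fix \<sigma> i assume "\<sigma> \<in> carrier G" "i \<in> {0..<m}"
    then show "basis_vec k (\<sigma>, i) \<in> (\<lambda>(\<sigma>, n). U \<sigma> n) ` (carrier G \<times> Z)"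
      by (intro image_eqI[of _ _ "(\<sigma>, int i)"]) (auto simp: basis_vec_eq_U)
  qed
  moreover have "gens \<subseteq> basis_vec k ` S"
    unfolding gens_def
  proof clarify
    fix \<sigma> n assume "\<sigma> \<in> carrier G" "n \<in> Z"
    then show "U \<sigma> n \<in> basis_vec k ` S"
      by (intro image_eqI[of _ _ "(\<sigma>, nat n)"]) (auto simp: basis_vec_eq_U)
  qed
  ultimately have "gens = basis_vec k ` S" by blast
  then show ?thesis using H.generates_basis by simp
qed

lemma gensE:
  assumes "x \<in> gens" obtains \<sigma> n where "\<sigma> \<in> carrier G" "n \<in> Z" "x = U \<sigma> n"
  using assms unfolding gens_def by auto

lemma U_shift: "\<sigma> \<in> carrier G \<Longrightarrow> U \<sigma> (n + int m * q) = up (f \<sigma>) q \<odot>\<^bsub>H\<^esub> U \<sigma> n"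
  using m_pos by (simp add: U_eq H.smult_assoc1[symmetric] basis_closed f_unit K.unit_pow_add add.commute)

lemma U_div_mod: "\<sigma> \<in> carrier G \<Longrightarrow> U \<sigma> n = up (f \<sigma>) (n div int m) \<odot>\<^bsub>H\<^esub> U \<sigma> (n mod int m)"
  using U_shift[of \<sigma> "n mod int m" "n div int m"] by simp

subsection \<open>The algebra\<close>

lemma mult_const_eq: "mult_const x y = (if snd x = snd y
    then up (\<alpha> (fst x, fst y)) (int (snd x)) \<odot>\<^bsub>H\<^esub> basis_vec k (fst x \<otimes>\<^bsub>G\<^esub> fst y, snd x) else \<zero>\<^bsub>H\<^esub>)"
  by (simp add: mult_const_def H_module_part)

lemma mult_const_closed: "\<lbrakk>x \<in> S; y \<in> S\<rbrakk> \<Longrightarrow> mult_const x y \<in> carrier H"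
  by (auto simp: mult_const_eq basis_closed \<alpha>_unit)

lemma mult_bilinear: "bilinear k H H H (monoid.mult H)"
  unfolding H_field_eqs(1) by (rule H.bilin_ext_bilinear[OF H_module mult_const_closed])

lemma mult_closed [simp]: "\<lbrakk>x \<in> carrier H; y \<in> carrier H\<rbrakk> \<Longrightarrow> x \<otimes>\<^bsub>H\<^esub> y \<in> carrier H"
  by (rule bilinear_closed[OF mult_bilinear])

lemma mult_basis_vec:
  "\<lbrakk>\<sigma> \<in> carrier G; \<tau> \<in> carrier G; i < m; j < m\<rbrakk> \<Longrightarrow>
    basis_vec k (\<sigma>, i) \<otimes>\<^bsub>H\<^esub> basis_vec k (\<tau>, j) = mult_const (\<sigma>, i) (\<tau>, j)"
  unfolding H_field_eqs(1)
  by (rule H.bilin_ext_basis_vec[OF H_module mult_const_closed]) auto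

lemma smult_mult_left:
  "\<lbrakk>a \<in> carrier k; x \<in> carrier H; y \<in> carrier H\<rbrakk> \<Longrightarrow> (a \<odot>\<^bsub>H\<^esub> x) \<otimes>\<^bsub>H\<^esub> y = a \<odot>\<^bsub>H\<^esub> (x \<otimes>\<^bsub>H\<^esub> y)"
  using module_hom_smult[OF bilinear_left[OF mult_bilinear]] by blast

lemma smult_mult_right:
  "\<lbrakk>a \<in> carrier k; x \<in> carrier H; y \<in> carrier H\<rbrakk> \<Longrightarrow> x \<otimes>\<^bsub>H\<^esub> (a \<odot>\<^bsub>H\<^esub> y) = a \<odot>\<^bsub>H\<^esub> (x \<otimes>\<^bsub>H\<^esub> y)"
  using module_hom_smult[OF bilinear_right[OF mult_bilinear]] by blast

lemma mult_zero [simp]: "x \<in> carrier H \<Longrightarrow> x \<otimes>\<^bsub>H\<^esub> \<zero>\<^bsub>H\<^esub> = \<zero>\<^bsub>H\<^esub>" "x \<in> carrier H \<Longrightarrow> \<zero>\<^bsub>H\<^esub> \<otimes>\<^bsub>H\<^esub> x = \<zero>\<^bsub>H\<^esub>"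
  using module_hom_zero[OF H_module H_module bilinear_right[OF mult_bilinear]]
    module_hom_zero[OF H_module H_module bilinear_left[OF mult_bilinear]] by auto

lemma finsum_mult_left:
  "\<lbrakk>\<And>i. i \<in> I \<Longrightarrow> x i \<in> carrier H; y \<in> carrier H\<rbrakk> \<Longrightarrow> (\<Oplus>\<^bsub>H\<^esub>i\<in>I. x i) \<otimes>\<^bsub>H\<^esub> y = (\<Oplus>\<^bsub>H\<^esub>i\<in>I. x i \<otimes>\<^bsub>H\<^esub> y)"
  by (rule module_hom_finsum[OF H_module H_module bilinear_left[OF mult_bilinear]])

lemma finsum_mult_right:
  "\<lbrakk>\<And>i. i \<in> I \<Longrightarrow> x i \<in> carrier H; y \<in> carrier H\<rbrakk> \<Longrightarrow> y \<otimes>\<^bsub>H\<^esub> (\<Oplus>\<^bsub>H\<^esub>i\<in>I. x i) = (\<Oplus>\<^bsub>H\<^esub>i\<in>I. y \<otimes>\<^bsub>H\<^esub> x i)"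
  by (rule module_hom_finsum[OF H_module H_module bilinear_right[OF mult_bilinear]])

text \<open>The power \<open>q\<close> of the hypothesis on \<open>\<alpha>\<^sup>m\<close>. It accounts for
  the factors of \<open>f\<close> whenever an index is replaced by its residue.\<close>

lemma \<alpha>_pow_unit:
  assumes "\<sigma> \<in> carrier G" "\<tau> \<in> carrier G"
  shows "up (\<alpha> (\<sigma>, \<tau>)) (int m * q) \<otimes>\<^bsub>k\<^esub> up (f (\<sigma> \<otimes>\<^bsub>G\<^esub> \<tau>)) q = up (f \<sigma>) q \<otimes>\<^bsub>k\<^esub> up (f \<tau>) q"
proof -
  have "up (\<alpha> (\<sigma>, \<tau>)) (int m * q) \<otimes>\<^bsub>k\<^esub> up (f (\<sigma> \<otimes>\<^bsub>G\<^esub> \<tau>)) q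
      = up (\<alpha> (\<sigma>, \<tau>) [^]\<^bsub>k\<^esub> m \<otimes>\<^bsub>k\<^esub> f (\<sigma> \<otimes>\<^bsub>G\<^esub> \<tau>)) q"
    using assms \<alpha>_unit f_unit
    by (simp add: K.unit_pow_mult K.unit_pow_mult_base K.unit_pow_int[symmetric])
  also have "\<dots> = up (f \<sigma> \<otimes>\<^bsub>k\<^esub> f \<tau>) q" by (simp add: \<alpha>_pow_m assms)
  finally show ?thesis using assms f_unit by (simp add: K.unit_pow_mult_base)
qed

text \<open>For \<open>0 \<le> n < m\<close> this is the definition of the product; the shift by
  \<open>m\<close> is compatible with it because \<open>\<alpha>\<^sup>m\<close> is the coboundary
  of \<open>f\<close>.\<close>

lemma U_mult:
  assumes "\<sigma> \<in> carrier G" "\<tau> \<in> carrier G"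
  shows "U \<sigma> n \<otimes>\<^bsub>H\<^esub> U \<tau> n = up (\<alpha> (\<sigma>, \<tau>)) n \<odot>\<^bsub>H\<^esub> U (\<sigma> \<otimes>\<^bsub>G\<^esub> \<tau>) n"
proof -
  let ?q = "n div int m" and ?r = "n mod int m"
  note [simp] = assms \<alpha>_unit f_unit basis_closed
  have s: "up (\<alpha> (\<sigma>, \<tau>)) n \<otimes>\<^bsub>k\<^esub> up (f (\<sigma> \<otimes>\<^bsub>G\<^esub> \<tau>)) ?q
      = up (f \<tau>) ?q \<otimes>\<^bsub>k\<^esub> (up (f \<sigma>) ?q \<otimes>\<^bsub>k\<^esub> up (\<alpha> (\<sigma>, \<tau>)) ?r)"
  proof -
    have "up (\<alpha> (\<sigma>, \<tau>)) n = up (\<alpha> (\<sigma>, \<tau>)) (int m * ?q) \<otimes>\<^bsub>k\<^esub> up (\<alpha> (\<sigma>, \<tau>)) ?r"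
      by (simp flip: K.unit_pow_add)
    then have "up (\<alpha> (\<sigma>, \<tau>)) n \<otimes>\<^bsub>k\<^esub> up (f (\<sigma> \<otimes>\<^bsub>G\<^esub> \<tau>)) ?q
        = (up (\<alpha> (\<sigma>, \<tau>)) (int m * ?q) \<otimes>\<^bsub>k\<^esub> up (f (\<sigma> \<otimes>\<^bsub>G\<^esub> \<tau>)) ?q) \<otimes>\<^bsub>k\<^esub> up (\<alpha> (\<sigma>, \<tau>)) ?r"
      by (simp add: K.m_ac)
    then show ?thesis by (simp add: \<alpha>_pow_unit) (simp add: K.m_ac)
  qed
  have "U \<sigma> n \<otimes>\<^bsub>H\<^esub> U \<tau> n = up (f \<tau>) ?q \<odot>\<^bsub>H\<^esub> (up (f \<sigma>) ?q \<odot>\<^bsub>H\<^esub> (up (\<alpha> (\<sigma>, \<tau>)) ?r \<odot>\<^bsub>H\<^esub>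
      basis_vec k (\<sigma> \<otimes>\<^bsub>G\<^esub> \<tau>, nat ?r)))"
    unfolding U_eq using m_pos
    by (simp add: smult_mult_left smult_mult_right mult_basis_vec mult_const_eq)
  also have "\<dots> = up (\<alpha> (\<sigma>, \<tau>)) n \<odot>\<^bsub>H\<^esub> U (\<sigma> \<otimes>\<^bsub>G\<^esub> \<tau>) n"
    unfolding U_eq by (simp add: H.smult_assoc1[symmetric] s)
  finally show ?thesis .
qed

lemma U_mult_distinct:
  assumes "\<sigma> \<in> carrier G" "\<tau> \<in> carrier G" "n mod int m \<noteq> n' mod int m"
  shows "U \<sigma> n \<otimes>\<^bsub>H\<^esub> U \<tau> n' = \<zero>\<^bsub>H\<^esub>"
proof -
  have "nat (n mod int m) \<noteq> nat (n' mod int m)" using assms(3) m_pos by (simp add: nat_eq_iff)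
  then show ?thesis
    unfolding U_eq using assms(1,2)
    by (simp add: smult_mult_left smult_mult_right mult_basis_vec mult_const_eq f_unit basis_closed)
qed

text \<open>The cocycle identity at \<open>(1, 1, \<tau>)\<close> and at \<open>(\<tau>, 1, 1)\<close>.\<close>

lemma \<alpha>_one: assumes "\<tau> \<in> carrier G"
  shows "\<alpha> (\<one>\<^bsub>G\<^esub>, \<tau>) = \<alpha> (\<one>\<^bsub>G\<^esub>, \<one>\<^bsub>G\<^esub>)" "\<alpha> (\<tau>, \<one>\<^bsub>G\<^esub>) = \<alpha> (\<one>\<^bsub>G\<^esub>, \<one>\<^bsub>G\<^esub>)"
proof -
  have nz: "\<alpha> (\<sigma>, \<tau>) \<in> carrier k - {\<zero>\<^bsub>k\<^esub>}" if "\<sigma> \<in> carrier G" "\<tau> \<in> carrier G" for \<sigma> \<tau>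
    using \<alpha>_unit[OF that] K.field_Units by auto
  have "\<alpha> (\<one>\<^bsub>G\<^esub>, \<one>\<^bsub>G\<^esub>) \<otimes>\<^bsub>k\<^esub> \<alpha> (\<one>\<^bsub>G\<^esub>, \<tau>) = \<alpha> (\<one>\<^bsub>G\<^esub>, \<tau>) \<otimes>\<^bsub>k\<^esub> \<alpha> (\<one>\<^bsub>G\<^esub>, \<tau>)"
    using cocycle[of "\<one>\<^bsub>G\<^esub>" "\<one>\<^bsub>G\<^esub>" \<tau>] assms by simp
  then show "\<alpha> (\<one>\<^bsub>G\<^esub>, \<tau>) = \<alpha> (\<one>\<^bsub>G\<^esub>, \<one>\<^bsub>G\<^esub>)"
    using nz[of "\<one>\<^bsub>G\<^esub>" \<tau>] nz[of "\<one>\<^bsub>G\<^esub>" "\<one>\<^bsub>G\<^esub>"] assms by (simp add: K.m_rcancel)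
  have "\<alpha> (\<tau>, \<one>\<^bsub>G\<^esub>) \<otimes>\<^bsub>k\<^esub> \<alpha> (\<tau>, \<one>\<^bsub>G\<^esub>) = \<alpha> (\<one>\<^bsub>G\<^esub>, \<one>\<^bsub>G\<^esub>) \<otimes>\<^bsub>k\<^esub> \<alpha> (\<tau>, \<one>\<^bsub>G\<^esub>)"
    using cocycle[of \<tau> "\<one>\<^bsub>G\<^esub>" "\<one>\<^bsub>G\<^esub>"] assms by simp
  then show "\<alpha> (\<tau>, \<one>\<^bsub>G\<^esub>) = \<alpha> (\<one>\<^bsub>G\<^esub>, \<one>\<^bsub>G\<^esub>)"
    using nz[of \<tau> "\<one>\<^bsub>G\<^esub>"] nz[of "\<one>\<^bsub>G\<^esub>" "\<one>\<^bsub>G\<^esub>"] assms by (simp add: K.m_rcancel)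
qed

text \<open>The cocycle identity at \<open>(\<sigma>, \<sigma>\<^sup>-\<^sup>1, \<sigma>)\<close>.\<close>

lemma \<alpha>_inv: assumes \<sigma>: "\<sigma> \<in> carrier G"
  shows "\<alpha> (inv\<^bsub>G\<^esub> \<sigma>, \<sigma>) = \<alpha> (\<sigma>, inv\<^bsub>G\<^esub> \<sigma>)"
proof -
  have nz: "\<alpha> (\<sigma>, \<tau>) \<in> carrier k - {\<zero>\<^bsub>k\<^esub>}" if "\<sigma> \<in> carrier G" "\<tau> \<in> carrier G" for \<sigma> \<tau>
    using \<alpha>_unit[OF that] K.field_Units by auto
  have "\<alpha> (\<sigma>, inv\<^bsub>G\<^esub> \<sigma>) \<otimes>\<^bsub>k\<^esub> \<alpha> (\<one>\<^bsub>G\<^esub>, \<one>\<^bsub>G\<^esub>) = \<alpha> (inv\<^bsub>G\<^esub> \<sigma>, \<sigma>) \<otimes>\<^bsub>k\<^esub> \<alpha> (\<one>\<^bsub>G\<^esub>, \<one>\<^bsub>G\<^esub>)"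
    using cocycle[of \<sigma> "inv\<^bsub>G\<^esub> \<sigma>" \<sigma>] \<sigma> by (simp add: \<alpha>_one[OF \<sigma>])
  then show ?thesis
    using nz[of "\<one>\<^bsub>G\<^esub>" "\<one>\<^bsub>G\<^esub>"] nz[of \<sigma> "inv\<^bsub>G\<^esub> \<sigma>"] nz[of "inv\<^bsub>G\<^esub> \<sigma>" \<sigma>] \<sigma> by (simp add: K.m_rcancel)
qed

lemma U_inv_mult: assumes \<sigma>: "\<sigma> \<in> carrier G"
  shows "U_inv \<sigma> n \<otimes>\<^bsub>H\<^esub> U \<sigma> n = U_unit n" "U \<sigma> n \<otimes>\<^bsub>H\<^esub> U_inv \<sigma> n = U_unit n"
proof -
  note [simp] = \<sigma> \<alpha>_unit smult_mult_left smult_mult_right U_mult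
  have s: "up (\<alpha> (\<one>\<^bsub>G\<^esub>, \<one>\<^bsub>G\<^esub>)) (- n) \<otimes>\<^bsub>k\<^esub> up (\<alpha> (\<sigma>, inv\<^bsub>G\<^esub> \<sigma>)) (- n) \<otimes>\<^bsub>k\<^esub> up (\<alpha> (\<sigma>, inv\<^bsub>G\<^esub> \<sigma>)) n
      = up (\<alpha> (\<one>\<^bsub>G\<^esub>, \<one>\<^bsub>G\<^esub>)) (- n)"
    by (simp add: K.m_assoc)
  show "U_inv \<sigma> n \<otimes>\<^bsub>H\<^esub> U \<sigma> n = U_unit n"
    by (simp add: U_inv_eq U_unit_eq H.smult_assoc1[symmetric] \<alpha>_inv s)
  show "U \<sigma> n \<otimes>\<^bsub>H\<^esub> U_inv \<sigma> n = U_unit n"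
    by (simp add: U_inv_eq U_unit_eq H.smult_assoc1[symmetric] s)
qed

lemma U_inv_mult_distinct:
  assumes "\<sigma> \<in> carrier G" "\<tau> \<in> carrier G" "n mod int m \<noteq> n' mod int m"
  shows "U_inv \<sigma> n \<otimes>\<^bsub>H\<^esub> U \<tau> n' = \<zero>\<^bsub>H\<^esub>" "U \<tau> n' \<otimes>\<^bsub>H\<^esub> U_inv \<sigma> n = \<zero>\<^bsub>H\<^esub>"
  using assms assms(3)[symmetric]
  by (simp_all add: U_inv_eq smult_mult_left smult_mult_right \<alpha>_unit U_mult_distinct)

lemma U_unit_mult:
  assumes \<sigma>: "\<sigma> \<in> carrier G"
  shows "U_unit n \<otimes>\<^bsub>H\<^esub> U \<sigma> n = U \<sigma> n" "U \<sigma> n \<otimes>\<^bsub>H\<^esub> U_unit n = U \<sigma> n"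
  using \<sigma> by (simp_all add: U_unit_eq smult_mult_left smult_mult_right U_mult \<alpha>_unit \<alpha>_one[OF \<sigma>] H.smult_assoc1[symmetric])

lemma U_unit_mult_distinct:
  assumes "\<sigma> \<in> carrier G" "n mod int m \<noteq> n' mod int m"
  shows "U_unit n \<otimes>\<^bsub>H\<^esub> U \<sigma> n' = \<zero>\<^bsub>H\<^esub>" "U \<sigma> n' \<otimes>\<^bsub>H\<^esub> U_unit n = \<zero>\<^bsub>H\<^esub>"
  using assms assms(2)[symmetric]
  by (simp_all add: U_unit_eq smult_mult_left smult_mult_right U_mult_distinct \<alpha>_unit)

lemma \<alpha>_one_pow: "up (\<alpha> (\<one>\<^bsub>G\<^esub>, \<one>\<^bsub>G\<^esub>)) (int m * q) = up (f \<one>\<^bsub>G\<^esub>) q"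
proof -
  have "up (f \<one>\<^bsub>G\<^esub>) q \<in> carrier k - {\<zero>\<^bsub>k\<^esub>}" "up (\<alpha> (\<one>\<^bsub>G\<^esub>, \<one>\<^bsub>G\<^esub>)) (int m * q) \<in> carrier k"
    using K.unit_pow_closed[OF f_unit[OF G.one_closed], of q] by (simp_all add: \<alpha>_unit K.field_Units[symmetric])
  then show ?thesis
    using \<alpha>_pow_unit[of "\<one>\<^bsub>G\<^esub>" "\<one>\<^bsub>G\<^esub>" q] by (simp add: K.m_rcancel)
qed

text \<open>The unit of a component depends on the residue of the index only, since
  \<open>\<alpha>(1,1)\<^sup>m = f(1)\<close>.\<close>

lemma U_unit_periodic: "U_unit (n mod int m) = U_unit n"
proof -
  let ?q = "n div int m" and ?r = "n mod int m"
  have n: "- n = int m * (- ?q) + - ?r" by (simp add: algebra_simps)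
  have "up (\<alpha> (\<one>\<^bsub>G\<^esub>, \<one>\<^bsub>G\<^esub>)) (- n) = up (f \<one>\<^bsub>G\<^esub>) (- ?q) \<otimes>\<^bsub>k\<^esub> up (\<alpha> (\<one>\<^bsub>G\<^esub>, \<one>\<^bsub>G\<^esub>)) (- ?r)"
    by (subst n) (simp only: K.unit_pow_add[OF \<alpha>_unit[OF G.one_closed G.one_closed]] \<alpha>_one_pow)
  then have "up (\<alpha> (\<one>\<^bsub>G\<^esub>, \<one>\<^bsub>G\<^esub>)) (- n) \<otimes>\<^bsub>k\<^esub> up (f \<one>\<^bsub>G\<^esub>) ?q
      = up (\<alpha> (\<one>\<^bsub>G\<^esub>, \<one>\<^bsub>G\<^esub>)) (- ?r) \<otimes>\<^bsub>k\<^esub> (up (f \<one>\<^bsub>G\<^esub>) (- ?q) \<otimes>\<^bsub>k\<^esub> up (f \<one>\<^bsub>G\<^esub>) ?q)"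
    by (simp add: K.m_ac f_unit \<alpha>_unit del: K.unit_pow_neg_cancel)
  then have "up (\<alpha> (\<one>\<^bsub>G\<^esub>, \<one>\<^bsub>G\<^esub>)) (- n) \<otimes>\<^bsub>k\<^esub> up (f \<one>\<^bsub>G\<^esub>) ?q = up (\<alpha> (\<one>\<^bsub>G\<^esub>, \<one>\<^bsub>G\<^esub>)) (- ?r)"
    by (simp add: f_unit \<alpha>_unit)
  then show ?thesis
    unfolding U_unit_eq U_div_mod[OF G.one_closed, of n]
    by (simp add: H.smult_assoc1[symmetric] \<alpha>_unit f_unit)
qed

lemma Z_mod: "\<lbrakk>n \<in> Z; n' \<in> Z\<rbrakk> \<Longrightarrow> n mod int m = n' mod int m \<longleftrightarrow> n = n'"
  by simp

lemma one_mult_U: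
  assumes "\<sigma> \<in> carrier G" "n \<in> Z"
  shows "\<one>\<^bsub>H\<^esub> \<otimes>\<^bsub>H\<^esub> U \<sigma> n = U \<sigma> n" "U \<sigma> n \<otimes>\<^bsub>H\<^esub> \<one>\<^bsub>H\<^esub> = U \<sigma> n"
proof -
  have "(\<Oplus>\<^bsub>H\<^esub>a\<in>Z. U_unit a \<otimes>\<^bsub>H\<^esub> U \<sigma> n) = U_unit n \<otimes>\<^bsub>H\<^esub> U \<sigma> n"
    by (rule H.M.finsum_single) (use assms in \<open>auto intro: U_unit_mult_distinct(1)\<close>)
  then show "\<one>\<^bsub>H\<^esub> \<otimes>\<^bsub>H\<^esub> U \<sigma> n = U \<sigma> n"
    unfolding H_field_eqs(2) using assms by (simp add: finsum_mult_left U_unit_mult)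
  have "(\<Oplus>\<^bsub>H\<^esub>a\<in>Z. U \<sigma> n \<otimes>\<^bsub>H\<^esub> U_unit a) = U \<sigma> n \<otimes>\<^bsub>H\<^esub> U_unit n"
    by (rule H.M.finsum_single) (use assms in \<open>auto intro: U_unit_mult_distinct(2)\<close>)
  then show "U \<sigma> n \<otimes>\<^bsub>H\<^esub> \<one>\<^bsub>H\<^esub> = U \<sigma> n"
    unfolding H_field_eqs(2) using assms by (simp add: finsum_mult_right U_unit_mult)
qed

lemma one_closed: "\<one>\<^bsub>H\<^esub> \<in> carrier H"
  unfolding H_field_eqs(2) by (rule H.M.finsum_closed) auto

lemma U_assoc:
  assumes c: "\<rho> \<in> carrier G" "\<sigma> \<in> carrier G" "\<tau> \<in> carrier G" and n: "n \<in> Z" "n' \<in> Z" "n'' \<in> Z"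
  shows "(U \<rho> n \<otimes>\<^bsub>H\<^esub> U \<sigma> n') \<otimes>\<^bsub>H\<^esub> U \<tau> n'' = U \<rho> n \<otimes>\<^bsub>H\<^esub> (U \<sigma> n' \<otimes>\<^bsub>H\<^esub> U \<tau> n'')"
proof -
  note [simp] = c \<alpha>_unit smult_mult_left smult_mult_right U_mult
  consider "n = n'" "n' = n''" | "n \<noteq> n'" "n' = n''" | "n = n'" "n' \<noteq> n''" | "n \<noteq> n'" "n' \<noteq> n''" by blast
  then show ?thesis
  proof cases
    case 1
    have "up (\<alpha> (\<rho>, \<sigma>)) n \<otimes>\<^bsub>k\<^esub> up (\<alpha> (\<rho> \<otimes>\<^bsub>G\<^esub> \<sigma>, \<tau>)) n = up (\<alpha> (\<sigma>, \<tau>)) n \<otimes>\<^bsub>k\<^esub> up (\<alpha> (\<rho>, \<sigma> \<otimes>\<^bsub>G\<^esub> \<tau>)) n"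
      by (simp flip: K.unit_pow_mult_base add: cocycle)
    then show ?thesis using 1 by (simp add: H.smult_assoc1[symmetric] G.m_assoc)
  next
    case 2
    then have "n mod int m \<noteq> n' mod int m" using n Z_mod by blast
    then show ?thesis using 2 by (simp add: U_mult_distinct)
  next
    case 3
    then have "n' mod int m \<noteq> n'' mod int m" using n Z_mod by blast
    then show ?thesis using 3 by (simp add: U_mult_distinct)
  next
    case 4
    then have "n mod int m \<noteq> n' mod int m" "n' mod int m \<noteq> n'' mod int m" using n Z_mod by blast+
    then show ?thesis using 4 by (simp add: U_mult_distinct)
  qed
qed

lemma H_assoc:
  assumes "x \<in> carrier H" "y \<in> carrier H" "z \<in> carrier H"
  shows "(x \<otimes>\<^bsub>H\<^esub> y) \<otimes>\<^bsub>H\<^esub> z = x \<otimes>\<^bsub>H\<^esub> (y \<otimes>\<^bsub>H\<^esub> z)"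
proof -
  note left = bilinear_left[OF mult_bilinear] and right = bilinear_right[OF mult_bilinear]
  note eqI = hom_eqI[OF gens_generate H_module H_module]
  have gc: "x \<in> carrier H" if "x \<in> gens" for x using that gens_generate by (auto simp: generates_def)
  have 1: "(x \<otimes>\<^bsub>H\<^esub> y) \<otimes>\<^bsub>H\<^esub> z = x \<otimes>\<^bsub>H\<^esub> (y \<otimes>\<^bsub>H\<^esub> z)" if "x \<in> gens" "y \<in> gens" "z \<in> gens" for x y z
    using that by (auto elim!: gensE intro: U_assoc)
  have 2: "(x \<otimes>\<^bsub>H\<^esub> y) \<otimes>\<^bsub>H\<^esub> z = x \<otimes>\<^bsub>H\<^esub> (y \<otimes>\<^bsub>H\<^esub> z)" if "x \<in> gens" "y \<in> gens" "z \<in> carrier H" for x y z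
    by (rule eqI[OF right module_hom_compose[OF right right] 1 that(3)]) (use that gc in auto)
  have 3: "(x \<otimes>\<^bsub>H\<^esub> y) \<otimes>\<^bsub>H\<^esub> z = x \<otimes>\<^bsub>H\<^esub> (y \<otimes>\<^bsub>H\<^esub> z)" if "x \<in> gens" "y \<in> carrier H" "z \<in> carrier H" for x y z
    by (rule eqI[OF module_hom_compose[OF right left] module_hom_compose[OF left right] 2 that(2)])
      (use that gc in auto)
  show ?thesis
    by (rule eqI[OF module_hom_compose[OF left left] left 3 assms(1)]) (use assms in auto)
qed

lemma H_one:
  assumes "x \<in> carrier H"
  shows "\<one>\<^bsub>H\<^esub> \<otimes>\<^bsub>H\<^esub> x = x" "x \<otimes>\<^bsub>H\<^esub> \<one>\<^bsub>H\<^esub> = x"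
proof -
  note eqI = hom_eqI[OF gens_generate H_module H_module _ module_hom_id]
  show "\<one>\<^bsub>H\<^esub> \<otimes>\<^bsub>H\<^esub> x = x"
    by (rule eqI[OF bilinear_right[OF mult_bilinear one_closed] _ assms]) (auto elim!: gensE simp: one_mult_U)
  show "x \<otimes>\<^bsub>H\<^esub> \<one>\<^bsub>H\<^esub> = x"
    by (rule eqI[OF bilinear_left[OF mult_bilinear one_closed] _ assms]) (auto elim!: gensE simp: one_mult_U)
qed

lemma H_ring: "ring H"
proof (rule ringI)
  show "abelian_group H" by (rule H.M.abelian_group_axioms)
  show "Group.monoid H" by (rule Group.monoidI) (simp_all add: one_closed H_assoc H_one)
  show "(x \<oplus>\<^bsub>H\<^esub> y) \<otimes>\<^bsub>H\<^esub> z = x \<otimes>\<^bsub>H\<^esub> z \<oplus>\<^bsub>H\<^esub> y \<otimes>\<^bsub>H\<^esub> z" if "x \<in> carrier H" "y \<in> carrier H" "z \<in> carrier H" for x y z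
    using that by (intro module_hom_add[OF bilinear_left[OF mult_bilinear]])
  show "z \<otimes>\<^bsub>H\<^esub> (x \<oplus>\<^bsub>H\<^esub> y) = z \<otimes>\<^bsub>H\<^esub> x \<oplus>\<^bsub>H\<^esub> z \<otimes>\<^bsub>H\<^esub> y" if "x \<in> carrier H" "y \<in> carrier H" "z \<in> carrier H" for x y z
    using that by (intro module_hom_add[OF bilinear_right[OF mult_bilinear]])
qed

lemma H_vectorspace: "vectorspace k H"
  by (intro vectorspace.intro H_module K.field_axioms)

lemma H_assoc_algebra: "assoc_algebra k H"
  by (intro assoc_algebra.intro assoc_algebra_axioms.intro H_vectorspace H_ring)
    (simp_all add: smult_mult_left smult_mult_right)

end

lemma module_hom_id': "id \<in> module_hom R M M"
  by (rule module_homI) auto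

lemma (in cring) regular_algebra_module: "module R (regular_algebra R)"
proof (rule moduleI)
  show "abelian_group (regular_algebra R)"
  proof (rule abelian_groupI)
    fix x assume "x \<in> carrier (regular_algebra R)"
    then show "\<exists>y\<in>carrier (regular_algebra R). y \<oplus>\<^bsub>regular_algebra R\<^esub> x = \<zero>\<^bsub>regular_algebra R\<^esub>"
      by (intro bexI[of _ "\<ominus> x"]) (auto simp: regular_algebra_def l_neg)
  qed (auto simp: regular_algebra_def a_ac)
qed (auto simp: regular_algebra_def is_cring l_distr r_distr m_assoc)

context twisting
begin

subsection \<open>The coalgebra\<close>

lemma regular_module: "module k (regular_algebra k)" by (rule K.regular_algebra_module)

lemma regular_simps [simp]:
  "carrier (regular_algebra k) = carrier k" "zero (regular_algebra k) = zero k" "one (regular_algebra k) = one k"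
  "add (regular_algebra k) = add k" "smult (regular_algebra k) = monoid.mult k"
  "monoid.mult (regular_algebra k) = monoid.mult k"
  by (simp_all add: regular_algebra_def)

lemma comult_hom': "comult H \<in> module_hom k H T"
  unfolding H_field_eqs(3) by (rule H.lin_ext_hom[OF T_module]) (auto intro!: T.M.finsum_closed)

lemma counit_hom': "counit H \<in> module_hom k H (regular_algebra k)"
  unfolding H_field_eqs(4) by (rule H.lin_ext_hom[OF regular_module]) auto

lemma antipode_hom': "antipode H \<in> module_hom k H H"
  unfolding H_field_eqs(5) by (rule H.lin_ext_hom[OF H_module]) auto

lemma pt_smult:
  assumes "x \<in> carrier H" "y \<in> carrier H" "a \<in> carrier k"
  shows "pt (a \<odot>\<^bsub>H\<^esub> x) y = a \<odot>\<^bsub>T\<^esub> pt x y" "pt x (a \<odot>\<^bsub>H\<^esub> y) = a \<odot>\<^bsub>T\<^esub> pt x y"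
  using assms module_hom_smult[OF bilinear_left[OF pt_bilinear]]
    module_hom_smult[OF bilinear_right[OF pt_bilinear]] by auto

text \<open>The factors of \<open>f\<close> from the two legs cancel. Hence sums of such tensors may be
  reindexed along residues.\<close>

lemma pt_U_periodic:
  assumes "\<sigma> \<in> carrier G"
  shows "pt (U \<sigma> (a mod int m + c)) (U \<sigma> (n - a mod int m)) = pt (U \<sigma> (a + c)) (U \<sigma> (n - a))"
proof -
  let ?q = "a div int m" and ?r = "a mod int m"
  have "a + c = (?r + c) + int m * ?q" "n - a = (n - ?r) + int m * (- ?q)" by (simp_all add: algebra_simps)
  then have "U \<sigma> (a + c) = up (f \<sigma>) ?q \<odot>\<^bsub>H\<^esub> U \<sigma> (?r + c)" "U \<sigma> (n - a) = up (f \<sigma>) (- ?q) \<odot>\<^bsub>H\<^esub> U \<sigma> (n - ?r)"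
    using U_shift[OF assms] by metis+
  then show ?thesis
    using assms by (simp add: pt_smult f_unit T.smult_assoc1[symmetric])
qed

lemma comult_basis_vec: "\<lbrakk>\<sigma> \<in> carrier G; i < m\<rbrakk> \<Longrightarrow>
    comult H (basis_vec k (\<sigma>, i)) = (\<Oplus>\<^bsub>T\<^esub>a\<in>Z. pt (U \<sigma> a) (U \<sigma> (int i - a)))"
  unfolding H_field_eqs(3) by (subst H.lin_ext_basis_vec[OF T_module]) (auto intro!: T.M.finsum_closed)

text \<open>The defining formula of the comultiplication holds for all integers \<open>n\<close>: a shift of
  \<open>n\<close> by \<open>m\<close> is absorbed by the second leg.\<close>

lemma comult_U:
  assumes "\<sigma> \<in> carrier G"
  shows "comult H (U \<sigma> n) = (\<Oplus>\<^bsub>T\<^esub>a\<in>Z. pt (U \<sigma> a) (U \<sigma> (n - a)))"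
proof -
  let ?q = "n div int m" and ?r = "n mod int m"
  have s: "U \<sigma> (n - a) = up (f \<sigma>) ?q \<odot>\<^bsub>H\<^esub> U \<sigma> (?r - a)" for a
    using U_shift[OF assms, of "?r - a" ?q] by (simp add: algebra_simps)
  have "comult H (U \<sigma> n) = up (f \<sigma>) ?q \<odot>\<^bsub>T\<^esub> (\<Oplus>\<^bsub>T\<^esub>a\<in>Z. pt (U \<sigma> a) (U \<sigma> (?r - a)))"
    using assms m_pos
    by (simp add: U_eq[of \<sigma> n] module_hom_smult[OF comult_hom'] basis_closed f_unit comult_basis_vec)
  also have "\<dots> = (\<Oplus>\<^bsub>T\<^esub>a\<in>Z. up (f \<sigma>) ?q \<odot>\<^bsub>T\<^esub> pt (U \<sigma> a) (U \<sigma> (?r - a)))"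
    using assms by (intro T.finsum_smult_ldistr) (auto simp: f_unit)
  also have "\<dots> = (\<Oplus>\<^bsub>T\<^esub>a\<in>Z. pt (U \<sigma> a) (U \<sigma> (n - a)))"
    using assms by (intro T.M.finsum_cong') (auto simp: s pt_smult f_unit)
  finally show ?thesis .
qed

lemma hom_comult_U:
  assumes "module k N" "h \<in> module_hom k T N" "\<sigma> \<in> carrier G"
  shows "h (comult H (U \<sigma> n)) = (\<Oplus>\<^bsub>N\<^esub>a\<in>Z. h (pt (U \<sigma> a) (U \<sigma> (n - a))))"
  unfolding comult_U[OF assms(3)]
  by (rule module_hom_finsum[OF T_module assms(1,2)]) (simp add: assms(3))

lemma comult_closed [simp]: "x \<in> carrier H \<Longrightarrow> comult H x \<in> carrier T"
  by (rule module_hom_closedD[OF comult_hom'])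

lemma counit_basis_vec: "\<lbrakk>\<sigma> \<in> carrier G; i < m\<rbrakk> \<Longrightarrow>
    counit H (basis_vec k (\<sigma>, i)) = (if i = 0 then \<one>\<^bsub>k\<^esub> else \<zero>\<^bsub>k\<^esub>)"
  unfolding H_field_eqs(4) by (subst H.lin_ext_basis_vec[OF regular_module]) auto

lemma counit_U: "\<lbrakk>\<sigma> \<in> carrier G; n \<in> Z\<rbrakk> \<Longrightarrow> counit H (U \<sigma> n) = (if n = 0 then \<one>\<^bsub>k\<^esub> else \<zero>\<^bsub>k\<^esub>)"
  using basis_vec_eq_U[of \<sigma> "nat n"] counit_basis_vec[of \<sigma> "nat n"] by (auto simp: nat_less_iff)

lemma counit_U_mod:
  assumes "\<sigma> \<in> carrier G"
  shows "counit H (U \<sigma> n) = (if n mod int m = 0 then up (f \<sigma>) (n div int m) else \<zero>\<^bsub>k\<^esub>)"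
  using assms counit_U[OF assms, of "n mod int m"] mod_Z(1)[of n]
  by (subst U_div_mod[OF assms]) (simp add: module_hom_smult[OF counit_hom'] f_unit)

lemma counit_closed [simp]: "x \<in> carrier H \<Longrightarrow> counit H x \<in> carrier k"
  using module_hom_closedD[OF counit_hom'] by simp

lemma antipode_closed [simp]: "x \<in> carrier H \<Longrightarrow> antipode H x \<in> carrier H"
  by (rule module_hom_closedD[OF antipode_hom'])

lemma antipode_basis_vec: "\<lbrakk>\<sigma> \<in> carrier G; i < m\<rbrakk> \<Longrightarrow> antipode H (basis_vec k (\<sigma>, i)) = U_inv \<sigma> (- int i)"
  unfolding H_field_eqs(5) by (subst H.lin_ext_basis_vec[OF H_module]) auto

lemma f_mult_inv:
  assumes "\<sigma> \<in> carrier G"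
  shows "up (\<alpha> (\<one>\<^bsub>G\<^esub>, \<one>\<^bsub>G\<^esub>)) (int m * q) \<otimes>\<^bsub>k\<^esub> up (\<alpha> (\<sigma>, inv\<^bsub>G\<^esub> \<sigma>)) (int m * q)
    = up (f \<sigma>) q \<otimes>\<^bsub>k\<^esub> up (f (inv\<^bsub>G\<^esub> \<sigma>)) q"
  using \<alpha>_pow_unit[of \<sigma> "inv\<^bsub>G\<^esub> \<sigma>" q] assms unfolding \<alpha>_one_pow
  by (simp add: K.m_comm[of "up (f \<one>\<^bsub>G\<^esub>) q"] f_unit \<alpha>_unit)

lemma antipode_U:
  assumes \<sigma>: "\<sigma> \<in> carrier G"
  shows "antipode H (U \<sigma> n) = U_inv \<sigma> (- n)"
proof -
  let ?q = "n div int m" and ?r = "n mod int m" and ?a = "\<alpha> (\<one>\<^bsub>G\<^esub>, \<one>\<^bsub>G\<^esub>)" and ?b = "\<alpha> (\<sigma>, inv\<^bsub>G\<^esub> \<sigma>)"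
  note [simp] = \<sigma> \<alpha>_unit f_unit
  have n: "n = int m * ?q + ?r" "- n = - ?r + int m * (- ?q)" by (simp_all add: algebra_simps)
  have "U_inv \<sigma> (- n) = (up ?a n \<otimes>\<^bsub>k\<^esub> up ?b n) \<odot>\<^bsub>H\<^esub> U (inv\<^bsub>G\<^esub> \<sigma>) (- n)" by (simp add: U_inv_eq)
  also have "U (inv\<^bsub>G\<^esub> \<sigma>) (- n) = up (f (inv\<^bsub>G\<^esub> \<sigma>)) (- ?q) \<odot>\<^bsub>H\<^esub> U (inv\<^bsub>G\<^esub> \<sigma>) (- ?r)"
    by (subst n(2)) (rule U_shift, simp)
  also have "up ?a n = up ?a (int m * ?q) \<otimes>\<^bsub>k\<^esub> up ?a ?r" by (simp flip: K.unit_pow_add)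
  also have "up ?b n = up ?b (int m * ?q) \<otimes>\<^bsub>k\<^esub> up ?b ?r" by (simp flip: K.unit_pow_add)
  also have "up ?a (int m * ?q) \<otimes>\<^bsub>k\<^esub> up ?a ?r \<otimes>\<^bsub>k\<^esub> (up ?b (int m * ?q) \<otimes>\<^bsub>k\<^esub> up ?b ?r)
      = (up ?a (int m * ?q) \<otimes>\<^bsub>k\<^esub> up ?b (int m * ?q)) \<otimes>\<^bsub>k\<^esub> (up ?a ?r \<otimes>\<^bsub>k\<^esub> up ?b ?r)" by (simp add: K.m_ac)
  also have "\<dots> = up (f \<sigma>) ?q \<otimes>\<^bsub>k\<^esub> (up ?a ?r \<otimes>\<^bsub>k\<^esub> up ?b ?r) \<otimes>\<^bsub>k\<^esub> up (f (inv\<^bsub>G\<^esub> \<sigma>)) ?q"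
    unfolding f_mult_inv[OF \<sigma>] by (simp add: K.m_ac)
  also have "(up (f \<sigma>) ?q \<otimes>\<^bsub>k\<^esub> (up ?a ?r \<otimes>\<^bsub>k\<^esub> up ?b ?r) \<otimes>\<^bsub>k\<^esub> up (f (inv\<^bsub>G\<^esub> \<sigma>)) ?q) \<odot>\<^bsub>H\<^esub>
        (up (f (inv\<^bsub>G\<^esub> \<sigma>)) (- ?q) \<odot>\<^bsub>H\<^esub> U (inv\<^bsub>G\<^esub> \<sigma>) (- ?r))
      = (up (f \<sigma>) ?q \<otimes>\<^bsub>k\<^esub> (up ?a ?r \<otimes>\<^bsub>k\<^esub> up ?b ?r)) \<odot>\<^bsub>H\<^esub> U (inv\<^bsub>G\<^esub> \<sigma>) (- ?r)"
    by (simp add: H.smult_assoc1[symmetric] K.m_assoc)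
  also have "\<dots> = up (f \<sigma>) ?q \<odot>\<^bsub>H\<^esub> U_inv \<sigma> (- ?r)"
    by (simp add: H.smult_assoc1 U_inv_eq)
  also have "\<dots> = antipode H (U \<sigma> n)"
    using m_pos by (simp add: U_eq[of \<sigma> n] module_hom_smult[OF antipode_hom'] basis_closed antipode_basis_vec)
  finally show ?thesis ..
qed

lemma H_homI:
  assumes "module k N" "h \<in> module_hom k H N" "h' \<in> module_hom k H N"
    and "\<And>\<sigma> n. \<lbrakk>\<sigma> \<in> carrier G; n \<in> Z\<rbrakk> \<Longrightarrow> h (U \<sigma> n) = h' (U \<sigma> n)" "x \<in> carrier H"
  shows "h x = h' x"
  by (rule hom_eqI[OF gens_generate H_module assms(1-3) _ assms(5)]) (auto elim!: gensE intro: assms(4))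

text \<open>Both sides are \<open>\<Sum> U\<^sub>b \<otimes> U\<^sub>c \<otimes>
  U\<^sub>n\<^sub>-\<^sub>b\<^sub>-\<^sub>c\<close> over residues \<open>b\<close> and
  \<open>c\<close>. On the left the sum comes with \<open>a = b + c\<close> in place of
  \<open>c\<close>, so the sum over \<open>a\<close> is shifted by \<open>b\<close>.\<close>

lemma H_coassoc:
  assumes "x \<in> carrier H"
  shows "tensor_assoc k H H H (tensor_map k T H (comult H) id (comult H x)) = tensor_map k H T id (comult H) (comult H x)"
proof -
  let ?TH = "tensor_module k T H" and ?HT = "tensor_module k H T" and ?p = "pure_tensor k H T"
  have HT: "module k ?HT" by (rule K.tensor_is_module[OF H_module T_module])
  have TH: "module k ?TH" by (rule K.tensor_is_module[OF T_module H_module])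
  interpret HT: module k ?HT by (rule HT)
  note a_hom = K.tensor_assoc_hom[OF H_module H_module H_module]
  note l_hom = K.tensor_map_hom[OF H_module H_module T_module H_module comult_hom' module_hom_id']
  note r_hom = K.tensor_map_hom[OF H_module H_module H_module T_module module_hom_id' comult_hom']
  note lp = K.tensor_map_pure[OF H_module H_module T_module H_module comult_hom' module_hom_id']
  note rp = K.tensor_map_pure[OF H_module H_module H_module T_module module_hom_id' comult_hom']
  note ap = K.tensor_assoc_pure[OF H_module H_module H_module]
  note p_closed = K.pure_tensor_closed[OF H_module T_module]
  note p_right = bilinear_right[OF K.pure_tensor_bilinear[OF H_module T_module]]
  note pTH_left = bilinear_left[OF K.pure_tensor_bilinear[OF T_module H_module]]
  have l: "(\<lambda>t. tensor_assoc k H H H (tensor_map k T H (comult H) id t)) \<in> module_hom k T ?HT"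
    by (rule module_hom_compose[OF l_hom a_hom])
  show ?thesis
  proof (rule H_homI[OF HT module_hom_compose[OF comult_hom' l] module_hom_compose[OF comult_hom' r_hom] _ assms])
    fix \<sigma> n assume \<sigma> [simp]: "\<sigma> \<in> carrier G"
    have 1: "tensor_assoc k H H H (tensor_map k T H (comult H) id (pt (U \<sigma> a) (U \<sigma> (n - a))))
      = (\<Oplus>\<^bsub>?HT\<^esub>b\<in>Z. ?p (U \<sigma> b) (pt (U \<sigma> (a - b)) (U \<sigma> (n - a))))" for a
    proof -
      have "(\<lambda>t. tensor_assoc k H H H (pure_tensor k T H t (U \<sigma> (n - a)))) \<in> module_hom k T ?HT"
        by (rule module_hom_compose[OF pTH_left a_hom]) simp
      from hom_comult_U[OF HT this \<sigma>]
      show ?thesis by (simp add: lp ap)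
    qed
    have 2: "(\<Oplus>\<^bsub>?HT\<^esub>a\<in>Z. ?p (U \<sigma> b) (pt (U \<sigma> (a - b)) (U \<sigma> (n - a)))) = ?p (U \<sigma> b) (comult H (U \<sigma> (n - b)))" for b
    proof -
      have "(\<Oplus>\<^bsub>?HT\<^esub>a\<in>Z. ?p (U \<sigma> b) (pt (U \<sigma> (a - b)) (U \<sigma> (n - a))))
        = ?p (U \<sigma> b) (\<Oplus>\<^bsub>T\<^esub>a\<in>Z. pt (U \<sigma> (a - b)) (U \<sigma> (n - a)))"
        by (rule module_hom_finsum[OF T_module HT p_right, symmetric]) simp_all
      also have "(\<Oplus>\<^bsub>T\<^esub>a\<in>Z. pt (U \<sigma> (a - b)) (U \<sigma> (n - a))) = (\<Oplus>\<^bsub>T\<^esub>a\<in>Z. pt (U \<sigma> a) (U \<sigma> (n - b - a)))"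
        using T.M.finsum_residues_shift[of "\<lambda>a. pt (U \<sigma> a) (U \<sigma> (n - b - a))" "int m" b]
          pt_U_periodic[OF \<sigma>, of _ 0 "n - b"] m_pos by simp
      finally show ?thesis by (simp add: comult_U)
    qed
    have "tensor_assoc k H H H (tensor_map k T H (comult H) id (comult H (U \<sigma> n)))
      = (\<Oplus>\<^bsub>?HT\<^esub>a\<in>Z. \<Oplus>\<^bsub>?HT\<^esub>b\<in>Z. ?p (U \<sigma> b) (pt (U \<sigma> (a - b)) (U \<sigma> (n - a))))"
      unfolding hom_comult_U[OF HT l \<sigma>] 1 ..
    also have "\<dots> = (\<Oplus>\<^bsub>?HT\<^esub>b\<in>Z. \<Oplus>\<^bsub>?HT\<^esub>a\<in>Z. ?p (U \<sigma> b) (pt (U \<sigma> (a - b)) (U \<sigma> (n - a))))"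
      by (rule HT.M.finsum_swap) (auto intro!: p_closed)
    also have "\<dots> = tensor_map k H T id (comult H) (comult H (U \<sigma> n))"
      unfolding 2 hom_comult_U[OF HT r_hom \<sigma>] by (simp add: rp)
    finally show "tensor_assoc k H H H (tensor_map k T H (comult H) id (comult H (U \<sigma> n)))
      = tensor_map k H T id (comult H) (comult H (U \<sigma> n))" .
  qed
qed

lemma H_counit_bilinear:
  "bilinear k H H H (\<lambda>y z. counit H y \<odot>\<^bsub>H\<^esub> z)" "bilinear k H H H (\<lambda>y z. counit H z \<odot>\<^bsub>H\<^esub> y)"
proof -
  have r: "bilinear k (regular_algebra k) H H (smult H)"
    by (intro bilinearI module_homI) (auto simp: H.smult_l_distr H.smult_r_distr H.smult_assoc1[symmetric] K.m_comm)
  show 1: "bilinear k H H H (\<lambda>y z. counit H y \<odot>\<^bsub>H\<^esub> z)"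
    by (rule bilinear_precompose[OF r counit_hom' module_hom_id])
  show "bilinear k H H H (\<lambda>y z. counit H z \<odot>\<^bsub>H\<^esub> y)" by (rule bilinear_flip[OF 1])
qed

lemma H_counit_left:
  assumes "x \<in> carrier H"
  shows "tensor_lift k H (\<lambda>y z. counit H y \<odot>\<^bsub>H\<^esub> z) (comult H x) = x"
proof -
  note l = K.tensor_lift_hom[OF H_module H_module H_module H_counit_bilinear(1)]
  note p = K.tensor_lift_pure[OF H_module H_module H_module H_counit_bilinear(1)]
  show ?thesis
  proof (rule H_homI[OF H_module module_hom_compose[OF comult_hom' l] module_hom_id _ assms])
    fix \<sigma> n assume \<sigma> [simp]: "\<sigma> \<in> carrier G"
    have "(\<Oplus>\<^bsub>H\<^esub>a\<in>Z. counit H (U \<sigma> a) \<odot>\<^bsub>H\<^esub> U \<sigma> (n - a)) = counit H (U \<sigma> 0) \<odot>\<^bsub>H\<^esub> U \<sigma> (n - 0)"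
      using m_pos by (intro H.M.finsum_single) (auto simp: counit_U)
    also have "\<dots> = U \<sigma> n" using m_pos by (simp add: counit_U)
    finally show "tensor_lift k H (\<lambda>y z. counit H y \<odot>\<^bsub>H\<^esub> z) (comult H (U \<sigma> n)) = U \<sigma> n"
      unfolding hom_comult_U[OF H_module l \<sigma>] by (simp add: p)
  qed
qed

lemma mod_diff_Z: 
  assumes "a \<in> Z" "n \<in> Z" "(n - a) mod int m = 0"
  shows "a = n"
proof -
  have "int m dvd n - a" using assms(3) by (simp only: mod_eq_0_iff_dvd)
  then have "n mod int m = a mod int m" by (simp only: mod_eq_dvd_iff)
  then show ?thesis using assms(1,2) by simp
qed

lemma H_counit_right:
  assumes "x \<in> carrier H"
  shows "tensor_lift k H (\<lambda>y z. counit H z \<odot>\<^bsub>H\<^esub> y) (comult H x) = x"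
proof -
  note l = K.tensor_lift_hom[OF H_module H_module H_module H_counit_bilinear(2)]
  note p = K.tensor_lift_pure[OF H_module H_module H_module H_counit_bilinear(2)]
  show ?thesis
  proof (rule H_homI[OF H_module module_hom_compose[OF comult_hom' l] module_hom_id _ assms])
    fix \<sigma> n assume \<sigma> [simp]: "\<sigma> \<in> carrier G" and n: "n \<in> Z"
    have "(\<Oplus>\<^bsub>H\<^esub>a\<in>Z. counit H (U \<sigma> (n - a)) \<odot>\<^bsub>H\<^esub> U \<sigma> a) = counit H (U \<sigma> (n - n)) \<odot>\<^bsub>H\<^esub> U \<sigma> n"
    proof (rule H.M.finsum_single[where i = n and x = "\<lambda>a. counit H (U \<sigma> (n - a)) \<odot>\<^bsub>H\<^esub> U \<sigma> a"])
      fix a assume "a \<in> Z" "a \<noteq> n"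
      then have "(n - a) mod int m \<noteq> 0" using n mod_diff_Z[of a n] by metis
      then show "counit H (U \<sigma> (n - a)) \<odot>\<^bsub>H\<^esub> U \<sigma> a = \<zero>\<^bsub>H\<^esub>" by (simp add: counit_U_mod)
    qed (use n in simp_all)
    also have "\<dots> = U \<sigma> n" using m_pos by (simp add: counit_U)
    finally show "tensor_lift k H (\<lambda>y z. counit H z \<odot>\<^bsub>H\<^esub> y) (comult H (U \<sigma> n)) = U \<sigma> n"
      unfolding hom_comult_U[OF H_module l \<sigma>] by (simp add: p)
  qed
qed

lemma H_antipode_bilinear:
  "bilinear k H H H (\<lambda>y z. antipode H y \<otimes>\<^bsub>H\<^esub> z)" "bilinear k H H H (\<lambda>y z. y \<otimes>\<^bsub>H\<^esub> antipode H z)"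
  by (rule bilinear_precompose[OF mult_bilinear antipode_hom' module_hom_id]
      bilinear_precompose[OF mult_bilinear module_hom_id antipode_hom'])+

lemma counit_smult_one_hom: "(\<lambda>x. counit H x \<odot>\<^bsub>H\<^esub> \<one>\<^bsub>H\<^esub>) \<in> module_hom k H H"
  by (rule bilinear_left[OF H_counit_bilinear(1) one_closed])

text \<open>The summands vanish unless \<open>n = 0\<close>, and then they are the units of the components, in
  reflected order.\<close>

lemma H_antipode_left:
  assumes "x \<in> carrier H"
  shows "tensor_lift k H (\<lambda>y z. antipode H y \<otimes>\<^bsub>H\<^esub> z) (comult H x) = counit H x \<odot>\<^bsub>H\<^esub> \<one>\<^bsub>H\<^esub>"
proof -
  note l = K.tensor_lift_hom[OF H_module H_module H_module H_antipode_bilinear(1)]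
  note p = K.tensor_lift_pure[OF H_module H_module H_module H_antipode_bilinear(1)]
  show ?thesis
  proof (rule H_homI[OF H_module module_hom_compose[OF comult_hom' l] counit_smult_one_hom _ assms])
    fix \<sigma> n assume \<sigma> [simp]: "\<sigma> \<in> carrier G" and n: "n \<in> Z"
    have "(\<Oplus>\<^bsub>H\<^esub>a\<in>Z. U_inv \<sigma> (- a) \<otimes>\<^bsub>H\<^esub> U \<sigma> (n - a)) = counit H (U \<sigma> n) \<odot>\<^bsub>H\<^esub> \<one>\<^bsub>H\<^esub>"
    proof (cases "n = 0")
      case True
      have "(\<Oplus>\<^bsub>H\<^esub>a\<in>Z. U_unit (0 - a)) = (\<Oplus>\<^bsub>H\<^esub>a\<in>Z. U_unit a)"
        using m_pos by (intro H.M.finsum_residues_reflect) (auto simp: U_unit_periodic)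
      then show ?thesis using True n by (simp add: U_inv_mult counit_U H_field_eqs(2)[symmetric] one_closed)
    next
      case False
      have "(- a) mod int m \<noteq> (n - a) mod int m" for a
      proof
        assume "(- a) mod int m = (n - a) mod int m"
        then have "int m dvd - a - (n - a)" by (simp only: mod_eq_dvd_iff)
        then have "n mod int m = 0" by simp
        then show False using False n by simp
      qed
      then show ?thesis using False n by (simp add: U_inv_mult_distinct counit_U one_closed)
    qed
    then show "tensor_lift k H (\<lambda>y z. antipode H y \<otimes>\<^bsub>H\<^esub> z) (comult H (U \<sigma> n)) = counit H (U \<sigma> n) \<odot>\<^bsub>H\<^esub> \<one>\<^bsub>H\<^esub>"
      unfolding hom_comult_U[OF H_module l \<sigma>] by (simp add: p antipode_U)
  qed
qed

lemma H_antipode_right: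
  assumes "x \<in> carrier H"
  shows "tensor_lift k H (\<lambda>y z. y \<otimes>\<^bsub>H\<^esub> antipode H z) (comult H x) = counit H x \<odot>\<^bsub>H\<^esub> \<one>\<^bsub>H\<^esub>"
proof -
  note l = K.tensor_lift_hom[OF H_module H_module H_module H_antipode_bilinear(2)]
  note p = K.tensor_lift_pure[OF H_module H_module H_module H_antipode_bilinear(2)]
  show ?thesis
  proof (rule H_homI[OF H_module module_hom_compose[OF comult_hom' l] counit_smult_one_hom _ assms])
    fix \<sigma> n assume \<sigma> [simp]: "\<sigma> \<in> carrier G" and n: "n \<in> Z"
    have "(\<Oplus>\<^bsub>H\<^esub>a\<in>Z. U \<sigma> a \<otimes>\<^bsub>H\<^esub> U_inv \<sigma> (a - n)) = counit H (U \<sigma> n) \<odot>\<^bsub>H\<^esub> \<one>\<^bsub>H\<^esub>"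
    proof (cases "n = 0")
      case True
      then show ?thesis using n by (simp add: U_inv_mult counit_U H_field_eqs(2)[symmetric] one_closed)
    next
      case False
      have "(a - n) mod int m \<noteq> a mod int m" for a
      proof
        assume "(a - n) mod int m = a mod int m"
        then have "int m dvd (a - n) - a" by (simp only: mod_eq_dvd_iff)
        then have "n mod int m = 0" by simp
        then show False using False n by simp
      qed
      then show ?thesis using False n by (simp add: U_inv_mult_distinct counit_U one_closed)
    qed
    then show "tensor_lift k H (\<lambda>y z. y \<otimes>\<^bsub>H\<^esub> antipode H z) (comult H (U \<sigma> n)) = counit H (U \<sigma> n) \<odot>\<^bsub>H\<^esub> \<one>\<^bsub>H\<^esub>"
      unfolding hom_comult_U[OF H_module l \<sigma>] by (simp add: p antipode_U)
  qed
qed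

lemma H_cocommutative: "cocommutative k H"
  unfolding cocommutative_def
proof
  fix x assume x: "x \<in> carrier H"
  note s = K.tensor_swap_hom[OF H_module H_module]
  show "tensor_swap k H H (comult H x) = comult H x"
  proof (rule H_homI[OF T_module module_hom_compose[OF comult_hom' s] comult_hom' _ x])
    fix \<sigma> n assume \<sigma> [simp]: "\<sigma> \<in> carrier G"
    have "(\<Oplus>\<^bsub>T\<^esub>a\<in>Z. pt (U \<sigma> (n - a)) (U \<sigma> a)) = (\<Oplus>\<^bsub>T\<^esub>a\<in>Z. pt (U \<sigma> a) (U \<sigma> (n - a)))"
      using T.M.finsum_residues_reflect[of "\<lambda>a. pt (U \<sigma> a) (U \<sigma> (n - a))" "int m" n]
        pt_U_periodic[OF \<sigma>, of _ 0 n] m_pos by simp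
    then show "tensor_swap k H H (comult H (U \<sigma> n)) = comult H (U \<sigma> n)"
      unfolding hom_comult_U[OF T_module s \<sigma>]
      by (simp add: K.tensor_swap_pure[OF H_module H_module] comult_U)
  qed
qed

lemma one_eq_reflect: "\<one>\<^bsub>H\<^esub> = (\<Oplus>\<^bsub>H\<^esub>n\<in>Z. U_unit (n - a))"
  unfolding H_field_eqs(2)
  using m_pos by (intro H.M.finsum_residues_shift[symmetric]) (auto simp: U_unit_periodic)

text \<open>Each \<open>U_unit n\<close> is a scalar multiple of \<open>U 1 n\<close>, with factors
  multiplicative in \<open>n\<close>, so the units of the components have the same comultiplication
  formula; summing over \<open>n\<close> first turns the second leg into 1.\<close>

lemma comult_one: "comult H \<one>\<^bsub>H\<^esub> = pt \<one>\<^bsub>H\<^esub> \<one>\<^bsub>H\<^esub>"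
proof -
  have 1: "comult H (U_unit n) = (\<Oplus>\<^bsub>T\<^esub>a\<in>Z. pt (U_unit a) (U_unit (n - a)))" for n
  proof -
    let ?a = "\<alpha> (\<one>\<^bsub>G\<^esub>, \<one>\<^bsub>G\<^esub>)"
    have "comult H (U_unit n) = up ?a (- n) \<odot>\<^bsub>T\<^esub> (\<Oplus>\<^bsub>T\<^esub>a\<in>Z. pt (U \<one>\<^bsub>G\<^esub> a) (U \<one>\<^bsub>G\<^esub> (n - a)))"
      by (simp add: U_unit_eq module_hom_smult[OF comult_hom'] \<alpha>_unit comult_U)
    also have "\<dots> = (\<Oplus>\<^bsub>T\<^esub>a\<in>Z. up ?a (- n) \<odot>\<^bsub>T\<^esub> pt (U \<one>\<^bsub>G\<^esub> a) (U \<one>\<^bsub>G\<^esub> (n - a)))"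
      by (intro T.finsum_smult_ldistr) (auto simp: \<alpha>_unit)
    also have "\<dots> = (\<Oplus>\<^bsub>T\<^esub>a\<in>Z. pt (U_unit a) (U_unit (n - a)))"
      by (intro T.M.finsum_cong')
        (auto simp: U_unit_eq pt_smult \<alpha>_unit T.smult_assoc1[symmetric] K.unit_pow_add[symmetric])
    finally show ?thesis .
  qed
  have "comult H \<one>\<^bsub>H\<^esub> = (\<Oplus>\<^bsub>T\<^esub>n\<in>Z. comult H (U_unit n))"
    unfolding H_field_eqs(2) by (rule module_hom_finsum[OF H_module T_module comult_hom']) simp
  also have "\<dots> = (\<Oplus>\<^bsub>T\<^esub>n\<in>Z. \<Oplus>\<^bsub>T\<^esub>a\<in>Z. pt (U_unit a) (U_unit (n - a)))" by (simp add: 1)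
  also have "\<dots> = (\<Oplus>\<^bsub>T\<^esub>a\<in>Z. \<Oplus>\<^bsub>T\<^esub>n\<in>Z. pt (U_unit a) (U_unit (n - a)))"
    by (rule T.M.finsum_swap) auto
  also have "\<dots> = (\<Oplus>\<^bsub>T\<^esub>a\<in>Z. pt (U_unit a) \<one>\<^bsub>H\<^esub>)"
  proof (rule T.M.finsum_cong'[OF refl])
    show "(\<Oplus>\<^bsub>T\<^esub>n\<in>Z. pt (U_unit a) (U_unit (n - a))) = pt (U_unit a) \<one>\<^bsub>H\<^esub>" for a
      unfolding one_eq_reflect[of a]
      by (rule module_hom_finsum[OF H_module T_module bilinear_right[OF pt_bilinear], symmetric]) auto
  qed (simp add: one_closed)
  also have "\<dots> = pt \<one>\<^bsub>H\<^esub> \<one>\<^bsub>H\<^esub>"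
    by (subst (2) H_field_eqs(2),
      rule module_hom_finsum[OF H_module T_module bilinear_left[OF pt_bilinear], symmetric]) (auto simp: one_closed)
  finally show ?thesis .
qed

lemma T_mult_bilinear: "bilinear k T T T (monoid.mult (tensor_algebra k H H))"
  by (rule K.tensor_algebra_mult_bilinear[OF H_module H_module mult_bilinear mult_bilinear])

lemmas T_mult_pt = K.tensor_algebra_mult_pure[OF H_module H_module mult_bilinear mult_bilinear]

text \<open>In the product of the two sums the first legs force equal summation indices, and then the second
  legs force \<open>n\<close> and \<open>n'\<close> to be congruent.\<close>

lemma comult_mult_U:
  assumes \<sigma>: "\<sigma> \<in> carrier G" "\<tau> \<in> carrier G" and n: "n \<in> Z" "n' \<in> Z"
  shows "comult H (U \<sigma> n \<otimes>\<^bsub>H\<^esub> U \<tau> n') = comult H (U \<sigma> n) \<otimes>\<^bsub>tensor_algebra k H H\<^esub> comult H (U \<tau> n')"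
proof -
  note [simp] = \<sigma> \<alpha>_unit
  have "comult H (U \<sigma> n) \<otimes>\<^bsub>tensor_algebra k H H\<^esub> comult H (U \<tau> n')
    = (\<Oplus>\<^bsub>T\<^esub>a\<in>Z. pt (U \<sigma> a) (U \<sigma> (n - a)) \<otimes>\<^bsub>tensor_algebra k H H\<^esub> comult H (U \<tau> n'))"
    by (rule hom_comult_U[OF T_module bilinear_left[OF T_mult_bilinear]]) simp_all
  also have "\<dots> = (\<Oplus>\<^bsub>T\<^esub>a\<in>Z. pt (U \<sigma> a \<otimes>\<^bsub>H\<^esub> U \<tau> a) (U \<sigma> (n - a) \<otimes>\<^bsub>H\<^esub> U \<tau> (n' - a)))"
  proof (rule T.M.finsum_cong'[OF refl])
    fix a assume a: "a \<in> Z"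
    have "pt (U \<sigma> a) (U \<sigma> (n - a)) \<otimes>\<^bsub>tensor_algebra k H H\<^esub> comult H (U \<tau> n')
      = (\<Oplus>\<^bsub>T\<^esub>b\<in>Z. pt (U \<sigma> a) (U \<sigma> (n - a)) \<otimes>\<^bsub>tensor_algebra k H H\<^esub> pt (U \<tau> b) (U \<tau> (n' - b)))"
      by (rule hom_comult_U[OF T_module bilinear_right[OF T_mult_bilinear]]) simp_all
    also have "\<dots> = (\<Oplus>\<^bsub>T\<^esub>b\<in>Z. pt (U \<sigma> a \<otimes>\<^bsub>H\<^esub> U \<tau> b) (U \<sigma> (n - a) \<otimes>\<^bsub>H\<^esub> U \<tau> (n' - b)))"
      by (simp add: T_mult_pt)
    also have "\<dots> = pt (U \<sigma> a \<otimes>\<^bsub>H\<^esub> U \<tau> a) (U \<sigma> (n - a) \<otimes>\<^bsub>H\<^esub> U \<tau> (n' - a))"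
    proof (rule T.M.finsum_single[where i = a])
      fix b assume "b \<in> Z" "b \<noteq> a"
      then have "a mod int m \<noteq> b mod int m" using a Z_mod by blast
      then show "pt (U \<sigma> a \<otimes>\<^bsub>H\<^esub> U \<tau> b) (U \<sigma> (n - a) \<otimes>\<^bsub>H\<^esub> U \<tau> (n' - b)) = \<zero>\<^bsub>T\<^esub>"
        by (simp add: U_mult_distinct module_hom_zero[OF H_module T_module bilinear_left[OF pt_bilinear]])
    qed (use a in auto)
    finally show "pt (U \<sigma> a) (U \<sigma> (n - a)) \<otimes>\<^bsub>tensor_algebra k H H\<^esub> comult H (U \<tau> n') = \<dots>" .
  qed auto
  also have "\<dots> = comult H (U \<sigma> n \<otimes>\<^bsub>H\<^esub> U \<tau> n')"
  proof (cases "n = n'")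
    case True
    let ?c = "up (\<alpha> (\<sigma>, \<tau>))"
    have s: "?c (j - a) \<otimes>\<^bsub>k\<^esub> ?c a = ?c j" for j a by (simp flip: K.unit_pow_add)
    have "comult H (U \<sigma> n \<otimes>\<^bsub>H\<^esub> U \<tau> n')
      = ?c n \<odot>\<^bsub>T\<^esub> (\<Oplus>\<^bsub>T\<^esub>a\<in>Z. pt (U (\<sigma> \<otimes>\<^bsub>G\<^esub> \<tau>) a) (U (\<sigma> \<otimes>\<^bsub>G\<^esub> \<tau>) (n - a)))"
      using True by (simp add: U_mult module_hom_smult[OF comult_hom'] comult_U)
    also have "\<dots> = (\<Oplus>\<^bsub>T\<^esub>a\<in>Z. ?c n \<odot>\<^bsub>T\<^esub> pt (U (\<sigma> \<otimes>\<^bsub>G\<^esub> \<tau>) a) (U (\<sigma> \<otimes>\<^bsub>G\<^esub> \<tau>) (n - a)))"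
      by (intro T.finsum_smult_ldistr) auto
    also have "\<dots> = (\<Oplus>\<^bsub>T\<^esub>a\<in>Z. pt (U \<sigma> a \<otimes>\<^bsub>H\<^esub> U \<tau> a) (U \<sigma> (n - a) \<otimes>\<^bsub>H\<^esub> U \<tau> (n' - a)))"
      using True by (intro T.M.finsum_cong') (auto simp: U_mult pt_smult T.smult_assoc1[symmetric] s)
    finally show ?thesis ..
  next
    case False
    have "(n - a) mod int m \<noteq> (n' - a) mod int m" for a
    proof
      assume "(n - a) mod int m = (n' - a) mod int m"
      then have "int m dvd (n - a) - (n' - a)" by (simp only: mod_eq_dvd_iff)
      then have "n mod int m = n' mod int m" by (simp add: mod_eq_dvd_iff)
      then show False using False n Z_mod by blast
    qed
    moreover have "n mod int m \<noteq> n' mod int m" using False n Z_mod by blast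
    ultimately show ?thesis
      by (simp add: U_mult_distinct module_hom_zero[OF H_module T_module bilinear_right[OF pt_bilinear]]
          module_hom_zero[OF H_module T_module comult_hom'])
  qed
  finally show ?thesis ..
qed

lemma bilinear_on_U_eqI:
  assumes "module k N" "bilinear k H H N \<beta>" "bilinear k H H N \<beta>'"
    and "\<And>\<sigma> n \<tau> n'. \<lbrakk>\<sigma> \<in> carrier G; n \<in> Z; \<tau> \<in> carrier G; n' \<in> Z\<rbrakk> \<Longrightarrow> \<beta> (U \<sigma> n) (U \<tau> n') = \<beta>' (U \<sigma> n) (U \<tau> n')"
    and "x \<in> carrier H" "y \<in> carrier H"
  shows "\<beta> x y = \<beta>' x y"
  by (rule bilinear_eqI[OF gens_generate gens_generate H_module H_module assms(1-3) _ assms(5,6)])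
    (auto elim!: gensE intro: assms(4))

lemma H_comult_algebra_hom: "comult H \<in> algebra_hom k H (tensor_algebra k H H)"
proof -
  have "comult H (x \<otimes>\<^bsub>H\<^esub> y) = comult H x \<otimes>\<^bsub>tensor_algebra k H H\<^esub> comult H y"
    if "x \<in> carrier H" "y \<in> carrier H" for x y
    by (rule bilinear_on_U_eqI[OF T_module bilinear_compose_hom[OF mult_bilinear comult_hom']
          bilinear_precompose[OF T_mult_bilinear comult_hom' comult_hom'] comult_mult_U that])
  then have "comult H \<in> ring_hom H (tensor_algebra k H H)"
    by (intro ring_hom_memI) (auto simp: K.tensor_algebra_simps comult_one module_hom_add[OF comult_hom'])
  moreover have "comult H \<in> module_hom k H (tensor_algebra k H H)"
    using comult_hom' by (simp add: module_hom_def K.tensor_algebra_simps)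
  ultimately show ?thesis by (simp add: algebra_hom_def)
qed

lemma H_counit_algebra_hom: "counit H \<in> algebra_hom k H (regular_algebra k)"
proof -
  have r: "bilinear k (regular_algebra k) (regular_algebra k) (regular_algebra k) (monoid.mult k)"
    by (intro bilinearI module_homI) (auto simp: K.l_distr K.r_distr K.m_ac)
  have 1: "counit H (x \<otimes>\<^bsub>H\<^esub> y) = counit H x \<otimes>\<^bsub>k\<^esub> counit H y"
    if "x \<in> carrier H" "y \<in> carrier H" for x y
  proof (rule bilinear_on_U_eqI[OF regular_module bilinear_compose_hom[OF mult_bilinear counit_hom']
          bilinear_precompose[OF r counit_hom' counit_hom'] _ that])
    fix \<sigma> n \<tau> n' assume c: "\<sigma> \<in> carrier G" "n \<in> Z" "\<tau> \<in> carrier G" "n' \<in> Z"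
    show "counit H (U \<sigma> n \<otimes>\<^bsub>H\<^esub> U \<tau> n') = counit H (U \<sigma> n) \<otimes>\<^bsub>k\<^esub> counit H (U \<tau> n')"
    proof (cases "n = n'")
      case True
      then show ?thesis using c by (simp add: U_mult module_hom_smult[OF counit_hom'] counit_U \<alpha>_unit)
    next
      case False
      then have "n mod int m \<noteq> n' mod int m" using c Z_mod by blast
      then show ?thesis using c False
        by (auto simp: U_mult_distinct module_hom_zero[OF H_module regular_module counit_hom', simplified] counit_U)
    qed
  qed
  have "counit H \<one>\<^bsub>H\<^esub> = (\<Oplus>\<^bsub>regular_algebra k\<^esub>n\<in>Z. counit H (U_unit n))"
    unfolding H_field_eqs(2) by (rule module_hom_finsum[OF H_module regular_module counit_hom']) simp
  also have "\<dots> = counit H (U_unit 0)"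
  proof -
    interpret r: module k "regular_algebra k" by (rule regular_module)
    show ?thesis
      using m_pos by (intro r.M.finsum_single) (auto simp: U_unit_eq module_hom_smult[OF counit_hom'] counit_U \<alpha>_unit)
  qed
  also have "\<dots> = \<one>\<^bsub>k\<^esub>"
    using m_pos by (simp add: U_unit_eq counit_U)
  finally have "counit H \<in> ring_hom H (regular_algebra k)"
    using 1 by (intro ring_hom_memI) (auto simp: module_hom_add[OF counit_hom'])
  then show ?thesis using counit_hom' by (simp add: algebra_hom_def)
qed

theorem H_hopf_algebra: "hopf_algebra k H"
  by (intro hopf_algebra.intro hopf_algebra_axioms.intro H_assoc_algebra H_comult_algebra_hom
      H_counit_algebra_hom H_coassoc H_counit_left H_counit_right antipode_hom' H_antipode_left H_antipode_right)

end

section \<open>Dimension and complements\<close>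

lemma (in based_module) basis_vec_dim:
  assumes "field R" and S: "finite S"
  shows "vectorspace.fin_dim R M" and "vectorspace.dim R M = card S"
proof -
  interpret K: field R by fact
  interpret V: vectorspace R M by unfold_locales
  let ?B = "basis_vec R ` S"
  have B: "?B \<subseteq> carrier M" by (auto intro: basis_vec_closed)
  have inj: "inj_on (basis_vec R) S"
    by (rule inj_onI) (metis basis_vec_def K.one_not_zero)
  have gen: "gen_set ?B"
  proof -
    have s: "LinearCombinations.submodule R (span ?B) M" by (rule span_is_submodule[OF B])
    have "p \<in> span ?B" if "p \<in> carrier M" for p
    proof -
      have "p \<in> lspan R M ?B" using generates_basis that by (auto simp: generates_def)
      then show ?thesis
      proof induction
        case zero
        show ?case by (rule LinearCombinations.submodule.zero_closed[OF s])
      next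
        case (base x)
        then show ?case using in_own_span[OF B] by auto
      next
        case (add x y)
        then show ?case using LinearCombinations.submodule.m_closed[OF s] by auto
      next
        case (smult a x)
        then show ?case using LinearCombinations.submodule.smult_closed[OF s] by auto
      qed
    qed
    then show ?thesis using LinearCombinations.submodule.subset[OF s] by auto
  qed
  have "lin_indpt ?B"
  proof (rule finite_lin_indpt2)
    have app: "basis_vec R x y = (if y = x then \<one> else \<zero>)" for x y by (simp add: basis_vec_def)
    fix a assume a: "a \<in> ?B \<rightarrow> carrier R" and z: "lincomb a ?B = \<zero>\<^bsub>M\<^esub>"
    have "lincomb a ?B = (\<Oplus>\<^bsub>M\<^esub>x\<in>S. a (basis_vec R x) \<odot>\<^bsub>M\<^esub> basis_vec R x)"
      unfolding lincomb_def using a inj B by (subst M.finsum_reindex) (auto simp: Pi_iff intro!: basis_vec_closed)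
    then have "(\<Oplus>\<^bsub>M\<^esub>x\<in>S. a (basis_vec R x) \<odot>\<^bsub>M\<^esub> basis_vec R x) = \<zero>\<^bsub>M\<^esub>" using z by simp
    then have "(\<Oplus>\<^bsub>M\<^esub>x\<in>S. a (basis_vec R x) \<odot>\<^bsub>M\<^esub> basis_vec R x) y = \<zero>" for y
      by (simp only: zero_fun)
    moreover have "(\<Oplus>\<^bsub>M\<^esub>x\<in>S. a (basis_vec R x) \<odot>\<^bsub>M\<^esub> basis_vec R x) y = a (basis_vec R y)" if y: "y \<in> S" for y
    proof -
      have "(\<Oplus>\<^bsub>M\<^esub>x\<in>S. a (basis_vec R x) \<odot>\<^bsub>M\<^esub> basis_vec R x) y
        = (\<Oplus>x\<in>S. (a (basis_vec R x) \<odot>\<^bsub>M\<^esub> basis_vec R x) y)"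
        using S a by (intro finsum_fun) (auto intro!: basis_vec_closed)
      also have "\<dots> = (\<Oplus>x\<in>S. if y = x then a (basis_vec R x) else \<zero>)"
        using a by (intro R.finsum_cong') (auto simp: smult_fun app Pi_iff)
      also have "\<dots> = a (basis_vec R y)"
        using S a y by (intro R.finsum_singleton) auto
      finally show ?thesis .
    qed
    ultimately show "\<forall>v\<in>?B. a v = \<zero>" by auto
  qed (use S B in auto)
  then have "V.basis ?B" using gen B by (simp add: V.basis_def)
  then show "V.dim = card S" using V.dim_basis[of ?B] S inj by (simp add: card_image)
  show "V.fin_dim" unfolding V.fin_dim_def using gen B S by blast
qed

definition is_subspace :: "('k, 'r) ring_scheme \<Rightarrow> ('k, 'v, 'm) module_scheme \<Rightarrow> 'v set \<Rightarrow> bool"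
  where "is_subspace R V I \<longleftrightarrow> I \<subseteq> carrier V \<and> \<zero>\<^bsub>V\<^esub> \<in> I \<and> (\<forall>x\<in>I. \<forall>y\<in>I. x \<oplus>\<^bsub>V\<^esub> y \<in> I) \<and>
    (\<forall>a\<in>carrier R. \<forall>x\<in>I. a \<odot>\<^bsub>V\<^esub> x \<in> I)"

context field
begin

context
  fixes V :: "('a, 'v, 'm) module_scheme" and I :: "'v set"
  assumes V: "module R V" and I: "is_subspace R V I"
begin

interpretation V: module R V by (rule V)

text \<open>The complement is enlarged by one generator at a time, whenever the generator is not yet reached.\<close>

lemma complement_of_generators:
  assumes "finite E" "E \<subseteq> carrier V"
  shows "\<exists>J. is_subspace R V J \<and> I \<inter> J = {\<zero>\<^bsub>V\<^esub>} \<and> (\<forall>x\<in>E. \<exists>i\<in>I. \<exists>j\<in>J. x = i \<oplus>\<^bsub>V\<^esub> j)"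
  using assms
proof (induction E rule: finite_induct)
  case empty
  then show ?case using I by (intro exI[of _ "{\<zero>\<^bsub>V\<^esub>}"]) (auto simp: is_subspace_def)
next
  case (insert x E)
  then obtain J where J: "is_subspace R V J" "I \<inter> J = {\<zero>\<^bsub>V\<^esub>}" "\<forall>x\<in>E. \<exists>i\<in>I. \<exists>j\<in>J. x = i \<oplus>\<^bsub>V\<^esub> j"
    by auto
  have x: "x \<in> carrier V" using insert.prems by auto
  show ?case
  proof (cases "\<exists>i\<in>I. \<exists>j\<in>J. x = i \<oplus>\<^bsub>V\<^esub> j")
    case True
    then show ?thesis using J by blast
  next
    case False
    have Ic: "\<And>i. i \<in> I \<Longrightarrow> i \<in> carrier V" and Jc: "\<And>j. j \<in> J \<Longrightarrow> j \<in> carrier V"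
      and I0: "\<zero>\<^bsub>V\<^esub> \<in> I" and J0: "\<zero>\<^bsub>V\<^esub> \<in> J"
      and Ia: "\<And>i j. \<lbrakk>i \<in> I; j \<in> I\<rbrakk> \<Longrightarrow> i \<oplus>\<^bsub>V\<^esub> j \<in> I" and Ja: "\<And>i j. \<lbrakk>i \<in> J; j \<in> J\<rbrakk> \<Longrightarrow> i \<oplus>\<^bsub>V\<^esub> j \<in> J"
      and Is: "\<And>a i. \<lbrakk>a \<in> carrier R; i \<in> I\<rbrakk> \<Longrightarrow> a \<odot>\<^bsub>V\<^esub> i \<in> I"
      and Js: "\<And>a i. \<lbrakk>a \<in> carrier R; i \<in> J\<rbrakk> \<Longrightarrow> a \<odot>\<^bsub>V\<^esub> i \<in> J"
      using I J(1) by (auto simp: is_subspace_def)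
    define J' where "J' = {j \<oplus>\<^bsub>V\<^esub> c \<odot>\<^bsub>V\<^esub> x | j c. j \<in> J \<and> c \<in> carrier R}"
    have J'I: "j \<oplus>\<^bsub>V\<^esub> c \<odot>\<^bsub>V\<^esub> x \<in> J'" if "j \<in> J" "c \<in> carrier R" for j c
      using that by (auto simp: J'_def)
    have sub: "is_subspace R V J'"
      unfolding is_subspace_def
    proof (intro conjI ballI)
      show "J' \<subseteq> carrier V" using Jc x by (auto simp: J'_def)
      show "\<zero>\<^bsub>V\<^esub> \<in> J'" using J'I[OF J0, of \<zero>] x by simp
    next
      fix y z assume "y \<in> J'" "z \<in> J'"
      then obtain j c j' c' where e: "j \<in> J" "c \<in> carrier R" "j' \<in> J" "c' \<in> carrier R"
        "y = j \<oplus>\<^bsub>V\<^esub> c \<odot>\<^bsub>V\<^esub> x" "z = j' \<oplus>\<^bsub>V\<^esub> c' \<odot>\<^bsub>V\<^esub> x" by (auto simp: J'_def)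
      then have "y \<oplus>\<^bsub>V\<^esub> z = (j \<oplus>\<^bsub>V\<^esub> j') \<oplus>\<^bsub>V\<^esub> (c \<oplus> c') \<odot>\<^bsub>V\<^esub> x"
        using Jc x by (simp add: V.smult_l_distr V.M.a_ac)
      then show "y \<oplus>\<^bsub>V\<^esub> z \<in> J'" using e by (simp add: J'I Ja)
    next
      fix a y assume "a \<in> carrier R" "y \<in> J'"
      then obtain j c where e: "a \<in> carrier R" "j \<in> J" "c \<in> carrier R" "y = j \<oplus>\<^bsub>V\<^esub> c \<odot>\<^bsub>V\<^esub> x"
        by (auto simp: J'_def)
      then have "a \<odot>\<^bsub>V\<^esub> y = a \<odot>\<^bsub>V\<^esub> j \<oplus>\<^bsub>V\<^esub> (a \<otimes> c) \<odot>\<^bsub>V\<^esub> x"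
        using Jc x by (simp add: V.smult_r_distr V.smult_assoc1)
      then show "a \<odot>\<^bsub>V\<^esub> y \<in> J'" using e by (simp add: J'I Js)
    qed
    have int: "I \<inter> J' = {\<zero>\<^bsub>V\<^esub>}"
    proof
      show "I \<inter> J' \<subseteq> {\<zero>\<^bsub>V\<^esub>}"
      proof
        fix y assume "y \<in> I \<inter> J'"
        then obtain j c where e: "y \<in> I" "j \<in> J" "c \<in> carrier R" "y = j \<oplus>\<^bsub>V\<^esub> c \<odot>\<^bsub>V\<^esub> x"
          by (auto simp: J'_def)
        show "y \<in> {\<zero>\<^bsub>V\<^esub>}"
        proof (cases "c = \<zero>")
          case True
          then have "y \<in> I \<inter> J" using e Jc x by auto
          then show ?thesis using J by blast
        next
          case False
          \<comment> \<open>otherwise the relation could be solved for \<open>x\<close>, which lies outside \<open>I + J\<close>\<close>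
          then have c: "inv c \<in> carrier R" "inv c \<otimes> c = \<one>" "\<ominus> (inv c) \<in> carrier R"
            using e(3) by (auto simp: field_Units)
          have "inv c \<odot>\<^bsub>V\<^esub> y \<oplus>\<^bsub>V\<^esub> (\<ominus> (inv c)) \<odot>\<^bsub>V\<^esub> j = x"
            using e c Jc x
            by (simp add: V.smult_r_distr V.smult_assoc1[symmetric] V.smult_l_minus V.M.a_ac V.M.r_neg2 V.M.r_neg1 V.M.r_neg)
          then show ?thesis using False e c Is Js \<open>\<not> (\<exists>i\<in>I. \<exists>j\<in>J. x = i \<oplus>\<^bsub>V\<^esub> j)\<close> by metis
        qed
      qed
      show "{\<zero>\<^bsub>V\<^esub>} \<subseteq> I \<inter> J'" using I0 sub by (auto simp: is_subspace_def)
    qed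
    have "\<exists>i\<in>I. \<exists>j\<in>J'. y = i \<oplus>\<^bsub>V\<^esub> j" if "y \<in> insert x E" for y
    proof (cases "y = x")
      case True
      then have "y = \<zero>\<^bsub>V\<^esub> \<oplus>\<^bsub>V\<^esub> (\<zero>\<^bsub>V\<^esub> \<oplus>\<^bsub>V\<^esub> \<one> \<odot>\<^bsub>V\<^esub> x)" using x by simp
      then show ?thesis using I0 J'I[OF J0 one_closed] by blast
    next
      case False
      then obtain i j where e: "i \<in> I" "j \<in> J" "y = i \<oplus>\<^bsub>V\<^esub> j" using J(3) \<open>y \<in> insert x E\<close> by blast
      then have "y = i \<oplus>\<^bsub>V\<^esub> (j \<oplus>\<^bsub>V\<^esub> \<zero> \<odot>\<^bsub>V\<^esub> x)" using Jc x by simp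
      then show ?thesis using e J'I[OF _ zero_closed] by blast
    qed
    then show ?thesis using sub int by blast
  qed
qed

lemma linear_projection:
  assumes "finite E" "generates R V E"
  shows "\<exists>p\<in>module_hom R V V. (\<forall>v\<in>carrier V. p v \<in> I) \<and> (\<forall>v\<in>I. p v = v)"
proof -
  have E: "E \<subseteq> carrier V" "carrier V \<subseteq> lspan R V E" using assms(2) by (auto simp: generates_def)
  obtain J where J: "is_subspace R V J" "I \<inter> J = {\<zero>\<^bsub>V\<^esub>}" "\<forall>x\<in>E. \<exists>i\<in>I. \<exists>j\<in>J. x = i \<oplus>\<^bsub>V\<^esub> j"
    using complement_of_generators[OF assms(1) E(1)] by auto
  have Ic: "\<And>i. i \<in> I \<Longrightarrow> i \<in> carrier V" and Jc: "\<And>j. j \<in> J \<Longrightarrow> j \<in> carrier V"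
    and I0: "\<zero>\<^bsub>V\<^esub> \<in> I" and J0: "\<zero>\<^bsub>V\<^esub> \<in> J"
    and Ia: "\<And>i j. \<lbrakk>i \<in> I; j \<in> I\<rbrakk> \<Longrightarrow> i \<oplus>\<^bsub>V\<^esub> j \<in> I" and Ja: "\<And>i j. \<lbrakk>i \<in> J; j \<in> J\<rbrakk> \<Longrightarrow> i \<oplus>\<^bsub>V\<^esub> j \<in> J"
    and Is: "\<And>a i. \<lbrakk>a \<in> carrier R; i \<in> I\<rbrakk> \<Longrightarrow> a \<odot>\<^bsub>V\<^esub> i \<in> I"
    and Js: "\<And>a i. \<lbrakk>a \<in> carrier R; i \<in> J\<rbrakk> \<Longrightarrow> a \<odot>\<^bsub>V\<^esub> i \<in> J"
    using I J(1) by (auto simp: is_subspace_def)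
  have In: "\<ominus>\<^bsub>V\<^esub> i \<in> I" if "i \<in> I" for i using Is[of "\<ominus> \<one>" i] that Ic by (simp add: V.smult_l_minus)
  have Jn: "\<ominus>\<^bsub>V\<^esub> i \<in> J" if "i \<in> J" for i using Js[of "\<ominus> \<one>" i] that Jc by (simp add: V.smult_l_minus)
  have ex: "\<exists>i\<in>I. \<exists>j\<in>J. v = i \<oplus>\<^bsub>V\<^esub> j" if "v \<in> carrier V" for v
  proof -
    have "v \<in> lspan R V E" using E(2) that by auto
    then show ?thesis
    proof induction
      case zero
      then show ?case by (intro bexI[OF _ I0] bexI[OF _ J0]) simp
    next
      case (base x)
      then show ?case using J(3) by auto
    next
      case (add x y)
      then obtain i j i' j' where e: "i \<in> I" "j \<in> J" "x = i \<oplus>\<^bsub>V\<^esub> j" "i' \<in> I" "j' \<in> J" "y = i' \<oplus>\<^bsub>V\<^esub> j'" by blast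
      then have "x \<oplus>\<^bsub>V\<^esub> y = (i \<oplus>\<^bsub>V\<^esub> i') \<oplus>\<^bsub>V\<^esub> (j \<oplus>\<^bsub>V\<^esub> j')" using Ic Jc by (simp add: V.M.a_ac)
      then show ?case using e Ia Ja by blast
    next
      case (smult a x)
      then obtain i j where e: "i \<in> I" "j \<in> J" "x = i \<oplus>\<^bsub>V\<^esub> j" by blast
      then have "a \<odot>\<^bsub>V\<^esub> x = a \<odot>\<^bsub>V\<^esub> i \<oplus>\<^bsub>V\<^esub> a \<odot>\<^bsub>V\<^esub> j" using smult Ic Jc by (simp add: V.smult_r_distr)
      then show ?case using e Is Js smult(1) by blast
    qed
  qed
  have unique: "i = i'" if e: "i \<in> I" "j \<in> J" "i' \<in> I" "j' \<in> J" "i \<oplus>\<^bsub>V\<^esub> j = i' \<oplus>\<^bsub>V\<^esub> j'" for i j i' j'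
  proof -
    have c: "i \<in> carrier V" "j \<in> carrier V" "i' \<in> carrier V" "j' \<in> carrier V" using e Ic Jc by auto
    have "i \<oplus>\<^bsub>V\<^esub> \<ominus>\<^bsub>V\<^esub> i' = (i \<oplus>\<^bsub>V\<^esub> j) \<oplus>\<^bsub>V\<^esub> \<ominus>\<^bsub>V\<^esub> j \<oplus>\<^bsub>V\<^esub> \<ominus>\<^bsub>V\<^esub> i'"
      using c by (simp add: V.M.a_assoc V.M.r_neg)
    also have "\<dots> = (j' \<oplus>\<^bsub>V\<^esub> \<ominus>\<^bsub>V\<^esub> j) \<oplus>\<^bsub>V\<^esub> (i' \<oplus>\<^bsub>V\<^esub> \<ominus>\<^bsub>V\<^esub> i')"
      unfolding e(5) using c by (simp add: V.M.a_ac)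
    also have "\<dots> = j' \<oplus>\<^bsub>V\<^esub> \<ominus>\<^bsub>V\<^esub> j" using c by (simp add: V.M.r_neg)
    finally have "i \<oplus>\<^bsub>V\<^esub> \<ominus>\<^bsub>V\<^esub> i' = j' \<oplus>\<^bsub>V\<^esub> \<ominus>\<^bsub>V\<^esub> j" .
    moreover have "i \<oplus>\<^bsub>V\<^esub> \<ominus>\<^bsub>V\<^esub> i' \<in> I" "j' \<oplus>\<^bsub>V\<^esub> \<ominus>\<^bsub>V\<^esub> j \<in> J" using e by (simp_all add: Ia Ja In Jn)
    ultimately have "i \<oplus>\<^bsub>V\<^esub> \<ominus>\<^bsub>V\<^esub> i' \<in> I \<inter> J" by simp
    then have "i \<ominus>\<^bsub>V\<^esub> i' = \<zero>\<^bsub>V\<^esub>" using J(2) by (auto simp: a_minus_def)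
    then show ?thesis using c by (simp add: V.M.minus_eq_zero_iff)
  qed
  define p where "p v = (THE i. i \<in> I \<and> (\<exists>j\<in>J. v = i \<oplus>\<^bsub>V\<^esub> j))" for v
  have p_eq: "p (i \<oplus>\<^bsub>V\<^esub> j) = i" if "i \<in> I" "j \<in> J" for i j
    unfolding p_def using that unique by (intro the_equality) blast+
  have "p \<in> module_hom R V V"
  proof (rule module_homI)
    fix x assume "x \<in> carrier V"
    then obtain i j where e: "i \<in> I" "j \<in> J" "x = i \<oplus>\<^bsub>V\<^esub> j" using ex by blast
    then show "p x \<in> carrier V" using p_eq Ic by simp
  next
    fix x y assume "x \<in> carrier V" "y \<in> carrier V"
    then obtain i j i' j' where e: "i \<in> I" "j \<in> J" "x = i \<oplus>\<^bsub>V\<^esub> j" "i' \<in> I" "j' \<in> J" "y = i' \<oplus>\<^bsub>V\<^esub> j'" using ex by meson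
    then have "x \<oplus>\<^bsub>V\<^esub> y = (i \<oplus>\<^bsub>V\<^esub> i') \<oplus>\<^bsub>V\<^esub> (j \<oplus>\<^bsub>V\<^esub> j')" using Ic Jc by (simp add: V.M.a_ac)
    then show "p (x \<oplus>\<^bsub>V\<^esub> y) = p x \<oplus>\<^bsub>V\<^esub> p y" using e p_eq Ia Ja by simp
  next
    fix a x assume a: "a \<in> carrier R" "x \<in> carrier V"
    then obtain i j where e: "i \<in> I" "j \<in> J" "x = i \<oplus>\<^bsub>V\<^esub> j" using ex by blast
    then have "a \<odot>\<^bsub>V\<^esub> x = a \<odot>\<^bsub>V\<^esub> i \<oplus>\<^bsub>V\<^esub> a \<odot>\<^bsub>V\<^esub> j" using a Ic Jc by (simp add: V.smult_r_distr)
    then show "p (a \<odot>\<^bsub>V\<^esub> x) = a \<odot>\<^bsub>V\<^esub> p x" using e a p_eq Is Js by simp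
  qed
  moreover have "p v \<in> I" if "v \<in> carrier V" for v using ex[OF that] p_eq by auto
  moreover have "p v = v" if "v \<in> I" for v using p_eq[OF that J0] Ic[OF that] by simp
  ultimately show ?thesis by blast
qed

end

end

context twisting
begin

lemma H_dim: "vectorspace.fin_dim k H" "vectorspace.dim k H = m * order G"
  using H.basis_vec_dim[OF K.field_axioms] finite_G
  by (simp_all add: card_cartesian_product order_def mult.commute)

section \<open>Semisimplicity\<close>

text \<open>Multiply \<open>U\<^sub>\<sigma> U\<^sub>\<tau> = \<alpha>(\<sigma>,\<tau>)\<^sup>n
  U\<^sub>\<sigma>\<^sub>\<tau>\<close> by the inverse of \<open>U\<^sub>\<sigma>\<close> on the
  left and that of \<open>U\<^sub>\<sigma>\<^sub>\<tau>\<close> on the right. This is the relation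
  that makes averages linear over the algebra.\<close>

lemma U_mult_U_inv:
  assumes \<sigma>: "\<sigma> \<in> carrier G" "\<tau> \<in> carrier G"
  shows "U \<tau> n \<otimes>\<^bsub>H\<^esub> U_inv (\<sigma> \<otimes>\<^bsub>G\<^esub> \<tau>) n = up (\<alpha> (\<sigma>, \<tau>)) n \<odot>\<^bsub>H\<^esub> U_inv \<sigma> n"
proof -
  note [simp] = \<sigma> \<alpha>_unit smult_mult_left smult_mult_right
  have e: "U_unit n \<otimes>\<^bsub>H\<^esub> (U \<tau> n \<otimes>\<^bsub>H\<^esub> y) = U \<tau> n \<otimes>\<^bsub>H\<^esub> y" if "y \<in> carrier H" for y
    using that by (simp add: H_assoc[symmetric] U_unit_mult)
  have e': "U_inv \<sigma> n \<otimes>\<^bsub>H\<^esub> U_unit n = U_inv \<sigma> n"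
    by (simp add: U_inv_eq U_unit_mult)
  have "U \<tau> n \<otimes>\<^bsub>H\<^esub> U_inv (\<sigma> \<otimes>\<^bsub>G\<^esub> \<tau>) n
      = (U_inv \<sigma> n \<otimes>\<^bsub>H\<^esub> U \<sigma> n) \<otimes>\<^bsub>H\<^esub> (U \<tau> n \<otimes>\<^bsub>H\<^esub> U_inv (\<sigma> \<otimes>\<^bsub>G\<^esub> \<tau>) n)"
    by (simp add: U_inv_mult e)
  also have "\<dots> = U_inv \<sigma> n \<otimes>\<^bsub>H\<^esub> ((U \<sigma> n \<otimes>\<^bsub>H\<^esub> U \<tau> n) \<otimes>\<^bsub>H\<^esub> U_inv (\<sigma> \<otimes>\<^bsub>G\<^esub> \<tau>) n)"
    by (simp add: H_assoc)
  also have "\<dots> = up (\<alpha> (\<sigma>, \<tau>)) n \<odot>\<^bsub>H\<^esub> U_inv \<sigma> n"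
    by (simp add: U_mult U_inv_mult e')
  finally show ?thesis .
qed

lemma sum_U_unit_mult: "x \<in> carrier H \<Longrightarrow> (\<Oplus>\<^bsub>H\<^esub>n\<in>Z. U_unit n \<otimes>\<^bsub>H\<^esub> x) = x"
  using H_one(1)[of x] finsum_mult_left[of Z U_unit x] by (simp add: H_field_eqs(2))

text \<open>Scalars act through multiples of the unit, so a left ideal is closed under them.\<close>

lemma left_ideal_subspace:
  assumes "left_ideal I H"
  shows "is_subspace k H I"
proof -
  have s: "subgroup I (add_monoid H)" and m: "\<And>a x. \<lbrakk>a \<in> carrier H; x \<in> I\<rbrakk> \<Longrightarrow> a \<otimes>\<^bsub>H\<^esub> x \<in> I"
    using assms by (auto simp: left_ideal_def)
  have c: "I \<subseteq> carrier H" using subgroup.subset[OF s] by simp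
  have "a \<odot>\<^bsub>H\<^esub> x \<in> I" if "a \<in> carrier k" "x \<in> I" for a x
    using m[of "a \<odot>\<^bsub>H\<^esub> \<one>\<^bsub>H\<^esub>" x] that c by (auto simp: one_closed smult_mult_left H_one subset_iff)
  then show ?thesis
    using c subgroup.one_closed[OF s] subgroup.m_closed[OF s] by (auto simp: is_subspace_def)
qed

text \<open>Maschke averaging, carried out in every component of the product at once.\<close>

definition average :: "(('g \<times> nat \<Rightarrow> 'k) \<Rightarrow> 'g \<times> nat \<Rightarrow> 'k) \<Rightarrow> ('g \<times> nat \<Rightarrow> 'k) \<Rightarrow> 'g \<times> nat \<Rightarrow> 'k"
  where "average p x = (\<Oplus>\<^bsub>H\<^esub>\<sigma>\<in>carrier G. \<Oplus>\<^bsub>H\<^esub>n\<in>Z. U_inv \<sigma> n \<otimes>\<^bsub>H\<^esub> p (U \<sigma> n \<otimes>\<^bsub>H\<^esub> x))"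

context
  fixes p assumes p: "p \<in> module_hom k H H"
begin

lemma p_closed: "x \<in> carrier H \<Longrightarrow> p x \<in> carrier H"
  by (rule module_hom_closedD[OF p])

lemma average_hom: "average p \<in> module_hom k H H"
  unfolding average_def
  by (intro module_hom_sum_of_maps[OF H_module H_module]
      module_hom_compose[OF module_hom_compose[OF bilinear_right[OF mult_bilinear] p] bilinear_right[OF mult_bilinear]]) auto

lemma average_mult_U:
  assumes \<tau> [simp]: "\<tau> \<in> carrier G" and j: "j \<in> Z" and x [simp]: "x \<in> carrier H"
  shows "average p (U \<tau> j \<otimes>\<^bsub>H\<^esub> x) = U \<tau> j \<otimes>\<^bsub>H\<^esub> average p x"
proof -
  note [simp] = p_closed \<alpha>_unit smult_mult_left smult_mult_right
  have p_zero: "p \<zero>\<^bsub>H\<^esub> = \<zero>\<^bsub>H\<^esub>" by (rule module_hom_zero[OF H_module H_module p])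
  \<comment> \<open>both sides are sums of the values of \<open>t\<close>, on the left with the argument translated by \<open>\<tau>\<close>\<close>
  define t where "t \<sigma> = (U \<tau> j \<otimes>\<^bsub>H\<^esub> U_inv \<sigma> j) \<otimes>\<^bsub>H\<^esub> p (U \<sigma> j \<otimes>\<^bsub>H\<^esub> x)" for \<sigma>
  have ne: "n mod int m \<noteq> j mod int m" if "n \<in> Z" "n \<noteq> j" for n using that j Z_mod by blast
  have 1: "(\<Oplus>\<^bsub>H\<^esub>n\<in>Z. U_inv \<sigma> n \<otimes>\<^bsub>H\<^esub> p (U \<sigma> n \<otimes>\<^bsub>H\<^esub> (U \<tau> j \<otimes>\<^bsub>H\<^esub> x))) = t (\<sigma> \<otimes>\<^bsub>G\<^esub> \<tau>)" if \<sigma> [simp]: "\<sigma> \<in> carrier G" for \<sigma>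
  proof -
    have "(\<Oplus>\<^bsub>H\<^esub>n\<in>Z. U_inv \<sigma> n \<otimes>\<^bsub>H\<^esub> p (U \<sigma> n \<otimes>\<^bsub>H\<^esub> (U \<tau> j \<otimes>\<^bsub>H\<^esub> x)))
      = U_inv \<sigma> j \<otimes>\<^bsub>H\<^esub> p (U \<sigma> j \<otimes>\<^bsub>H\<^esub> (U \<tau> j \<otimes>\<^bsub>H\<^esub> x))"
      by (rule H.M.finsum_single[where i = j])
        (use j ne in \<open>auto simp: H_assoc[symmetric] U_mult_distinct p_zero\<close>)
    also have "\<dots> = t (\<sigma> \<otimes>\<^bsub>G\<^esub> \<tau>)"
      by (simp add: t_def H_assoc[symmetric] U_mult module_hom_smult[OF p] U_mult_U_inv)
    finally show ?thesis .
  qed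
  have 2: "U \<tau> j \<otimes>\<^bsub>H\<^esub> (\<Oplus>\<^bsub>H\<^esub>n\<in>Z. U_inv \<sigma> n \<otimes>\<^bsub>H\<^esub> p (U \<sigma> n \<otimes>\<^bsub>H\<^esub> x)) = t \<sigma>" if \<sigma> [simp]: "\<sigma> \<in> carrier G" for \<sigma>
  proof -
    have "U \<tau> j \<otimes>\<^bsub>H\<^esub> (\<Oplus>\<^bsub>H\<^esub>n\<in>Z. U_inv \<sigma> n \<otimes>\<^bsub>H\<^esub> p (U \<sigma> n \<otimes>\<^bsub>H\<^esub> x))
      = (\<Oplus>\<^bsub>H\<^esub>n\<in>Z. U \<tau> j \<otimes>\<^bsub>H\<^esub> (U_inv \<sigma> n \<otimes>\<^bsub>H\<^esub> p (U \<sigma> n \<otimes>\<^bsub>H\<^esub> x)))"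
      by (rule finsum_mult_right) auto
    also have "\<dots> = U \<tau> j \<otimes>\<^bsub>H\<^esub> (U_inv \<sigma> j \<otimes>\<^bsub>H\<^esub> p (U \<sigma> j \<otimes>\<^bsub>H\<^esub> x))"
      by (rule H.M.finsum_single[where i = j])
        (use j ne in \<open>auto simp: H_assoc[symmetric] U_inv_mult_distinct\<close>)
    finally show ?thesis by (simp add: t_def H_assoc)
  qed
  have t_closed: "t \<sigma> \<in> carrier H" if "\<sigma> \<in> carrier G" for \<sigma> using that by (simp add: t_def)
  have "average p (U \<tau> j \<otimes>\<^bsub>H\<^esub> x) = (\<Oplus>\<^bsub>H\<^esub>\<sigma>\<in>carrier G. t (\<sigma> \<otimes>\<^bsub>G\<^esub> \<tau>))"
    unfolding average_def by (rule H.M.finsum_cong') (auto simp: 1 t_closed)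
  also have "\<dots> = (\<Oplus>\<^bsub>H\<^esub>\<sigma>\<in>(\<lambda>\<sigma>. \<sigma> \<otimes>\<^bsub>G\<^esub> \<tau>) ` carrier G. t \<sigma>)"
    by (rule H.M.finsum_reindex[symmetric]) (auto simp: t_closed inj_on_def)
  also have "(\<lambda>\<sigma>. \<sigma> \<otimes>\<^bsub>G\<^esub> \<tau>) ` carrier G = carrier G"
    by (rule card_subset_eq[OF finite_G]) (auto simp: card_image inj_on_def)
  also have "(\<Oplus>\<^bsub>H\<^esub>\<sigma>\<in>carrier G. t \<sigma>) = (\<Oplus>\<^bsub>H\<^esub>\<sigma>\<in>carrier G. U \<tau> j \<otimes>\<^bsub>H\<^esub> (\<Oplus>\<^bsub>H\<^esub>n\<in>Z. U_inv \<sigma> n \<otimes>\<^bsub>H\<^esub> p (U \<sigma> n \<otimes>\<^bsub>H\<^esub> x)))"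
    by (rule H.M.finsum_cong') (auto simp: 2 t_closed)
  also have "\<dots> = U \<tau> j \<otimes>\<^bsub>H\<^esub> average p x"
    unfolding average_def by (rule finsum_mult_right[symmetric]) (auto intro!: H.M.finsum_closed)
  finally show ?thesis .
qed

lemma average_mult:
  assumes "a \<in> carrier H" "x \<in> carrier H"
  shows "average p (a \<otimes>\<^bsub>H\<^esub> x) = a \<otimes>\<^bsub>H\<^esub> average p x"
  by (rule H_homI[OF H_module module_hom_compose[OF bilinear_left[OF mult_bilinear assms(2)] average_hom]
        bilinear_left[OF mult_bilinear module_hom_closedD[OF average_hom assms(2)]] average_mult_U assms(1)])
    (use assms in auto)

end

text \<open>The average of a linear projection onto a left ideal, divided by the order of the group, is a
  projection which commutes with left multiplication; its kernel is the complementary left ideal.\<close>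

theorem H_semisimple:
  assumes "\<not> characteristic k dvd order G"
  shows "semisimple_ring H"
  unfolding semisimple_ring_def
proof (intro allI impI)
  fix I assume I: "left_ideal I H"
  have sub: "is_subspace k H I" by (rule left_ideal_subspace[OF I])
  then have Ic: "\<And>x. x \<in> I \<Longrightarrow> x \<in> carrier H" by (auto simp: is_subspace_def)
  have Im: "\<And>a x. \<lbrakk>a \<in> carrier H; x \<in> I\<rbrakk> \<Longrightarrow> a \<otimes>\<^bsub>H\<^esub> x \<in> I" using I by (auto simp: left_ideal_def)
  have Isum: "(\<Oplus>\<^bsub>H\<^esub>i\<in>D. v i) \<in> I" if "finite D" "\<And>i. i \<in> D \<Longrightarrow> v i \<in> I" for D :: "'d set" and v
    using that
  proof (induction D rule: finite_induct)
    case empty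
    then show ?case using sub by (auto simp: is_subspace_def)
  next
    case (insert d D)
    then have "v \<in> D \<rightarrow> carrier H" "v d \<in> carrier H" using Ic by auto
    then show ?case using insert sub by (auto simp: is_subspace_def)
  qed
  have "finite gens" using finite_G by (simp add: gens_def)
  then obtain p where p: "p \<in> module_hom k H H" "\<And>v. v \<in> carrier H \<Longrightarrow> p v \<in> I" "\<And>v. v \<in> I \<Longrightarrow> p v = v"
    using K.linear_projection[OF H_module sub _ gens_generate] by blast
  define c where "c = (\<Oplus>\<^bsub>k\<^esub>\<sigma>\<in>carrier G. \<one>\<^bsub>k\<^esub>)"
  have "c = [order G] \<cdot>\<^bsub>k\<^esub> \<one>\<^bsub>k\<^esub>"
    unfolding c_def order_def by (rule K.add.finprod_const) simp
  moreover have "[order G] \<cdot>\<^bsub>k\<^esub> \<one>\<^bsub>k\<^esub> \<noteq> \<zero>\<^bsub>k\<^esub>"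
    using assms K.add.pow_eq_id[of "\<one>\<^bsub>k\<^esub>" "order G"] by (simp add: characteristic_def)
  ultimately have c: "c \<in> Units k" by (simp add: K.field_Units)
  define q where "q x = inv\<^bsub>k\<^esub> c \<odot>\<^bsub>H\<^esub> average p x" for x
  have q_hom: "q \<in> module_hom k H H"
    unfolding q_def using c by (intro module_hom_smult_map[OF H_module average_hom[OF p(1)]]) auto
  have q_closed: "x \<in> carrier H \<Longrightarrow> q x \<in> carrier H" for x by (rule module_hom_closedD[OF q_hom])
  have q_mult: "q (a \<otimes>\<^bsub>H\<^esub> x) = a \<otimes>\<^bsub>H\<^esub> q x" if "a \<in> carrier H" "x \<in> carrier H" for a x
    using that c module_hom_closedD[OF average_hom[OF p(1)]]
    by (simp add: q_def average_mult[OF p(1)] smult_mult_right)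
  have q_I: "q x \<in> I" if "x \<in> carrier H" for x
  proof -
    have "average p x \<in> I" unfolding average_def
      using that finite_G p(2) by (intro Isum Im) auto
    then show ?thesis using sub c by (auto simp: is_subspace_def q_def)
  qed
  have q_id: "q x = x" if x: "x \<in> I" for x
  proof -
    have xc: "x \<in> carrier H" using Ic x by auto
    have "average p x = (\<Oplus>\<^bsub>H\<^esub>\<sigma>\<in>carrier G. \<Oplus>\<^bsub>H\<^esub>n\<in>Z. U_unit n \<otimes>\<^bsub>H\<^esub> x)"
      unfolding average_def
      using x xc by (intro H.M.finsum_cong') (auto simp: p(3) Im H_assoc[symmetric] U_inv_mult intro!: H.M.finsum_closed)
    also have "\<dots> = (\<Oplus>\<^bsub>H\<^esub>\<sigma>\<in>carrier G. \<one>\<^bsub>k\<^esub> \<odot>\<^bsub>H\<^esub> x)" using xc by (simp add: sum_U_unit_mult)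
    also have "\<dots> = c \<odot>\<^bsub>H\<^esub> x"
    proof -
      have l: "(\<lambda>a. a \<odot>\<^bsub>H\<^esub> x) \<in> module_hom k (regular_algebra k) H"
        by (rule module_homI) (use xc in \<open>auto simp: H.smult_l_distr H.smult_assoc1\<close>)
      have "(\<Oplus>\<^bsub>regular_algebra k\<^esub>\<sigma>\<in>carrier G. \<one>\<^bsub>k\<^esub>) = (\<Oplus>\<^bsub>k\<^esub>\<sigma>\<in>carrier G. \<one>\<^bsub>k\<^esub>)"
        by (simp add: finsum_def finprod_def)
      then show ?thesis
        using module_hom_finsum[OF regular_module H_module l, of "carrier G" "\<lambda>_. \<one>\<^bsub>k\<^esub>"] by (simp add: c_def)
    qed
    finally show ?thesis using c xc by (simp add: q_def H.smult_assoc1[symmetric] K.Units_closed)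
  qed
  define J where "J = {x \<in> carrier H. q x = \<zero>\<^bsub>H\<^esub>}"
  have q_minus: "q (x \<ominus>\<^bsub>H\<^esub> y) = q x \<ominus>\<^bsub>H\<^esub> q y" if "x \<in> carrier H" "y \<in> carrier H" for x y
    using module_hom_minus[OF H_module H_module q_hom that] .
  have q_zero: "q \<zero>\<^bsub>H\<^esub> = \<zero>\<^bsub>H\<^esub>" by (rule module_hom_zero[OF H_module H_module q_hom])
  have "subgroup J (add_monoid H)"
  proof (rule H.M.add.subgroupI)
    show "J \<subseteq> carrier H" "J \<noteq> {}" using q_zero by (auto simp: J_def)
    show "x \<oplus>\<^bsub>H\<^esub> y \<in> J" if "x \<in> J" "y \<in> J" for x y using that by (auto simp: J_def module_hom_add[OF q_hom])
    show "\<ominus>\<^bsub>H\<^esub> x \<in> J" if "x \<in> J" for x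
      using that q_minus[of "\<zero>\<^bsub>H\<^esub>" x] q_zero by (auto simp: J_def a_minus_def)
  qed
  then have J: "left_ideal J H" by (auto simp: left_ideal_def J_def q_mult)
  moreover have "I \<inter> J = {\<zero>\<^bsub>H\<^esub>}"
    using sub q_id q_zero by (auto simp: J_def is_subspace_def)
  moreover have "I <+>\<^bsub>H\<^esub> J = carrier H"
  proof
    show "I <+>\<^bsub>H\<^esub> J \<subseteq> carrier H" using Ic by (auto simp: set_add_def' J_def)
    show "carrier H \<subseteq> I <+>\<^bsub>H\<^esub> J"
    proof
      fix x assume x: "x \<in> carrier H"
      have "q x \<ominus>\<^bsub>H\<^esub> q (q x) = \<zero>\<^bsub>H\<^esub>"
        using x q_I q_id q_closed by (simp add: H.M.minus_eq_zero_iff)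
      then have "x \<ominus>\<^bsub>H\<^esub> q x \<in> J" using x q_closed by (simp add: J_def q_minus)
      moreover have "x = q x \<oplus>\<^bsub>H\<^esub> (x \<ominus>\<^bsub>H\<^esub> q x)"
        using x q_closed by (simp add: a_minus_def H.M.a_ac H.M.r_neg H.M.r_neg1 H.M.r_neg2)
      ultimately show "x \<in> I <+>\<^bsub>H\<^esub> J" using q_I[OF x] unfolding set_add_def' by blast
    qed
  qed
  ultimately show "\<exists>J. left_ideal J H \<and> I \<inter> J = {\<zero>\<^bsub>H\<^esub>} \<and> I <+>\<^bsub>H\<^esub> J = carrier H" by blast
qed

section \<open>The projection onto the twisted group algebra\<close>

abbreviation A :: "('k, 'g \<Rightarrow> 'k) module" where "A \<equiv> twisted_group_algebra k G \<alpha>"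

sublocale A: based_module k "carrier G" A
  by (rule K.based_moduleI[OF free_on_twisted_group_algebra])

text \<open>The component whose index is congruent to 1. The power of \<open>f\<close> is 1 for \<open>m >
  1\<close>. For \<open>m = 1\<close> the only component has index 0 and carries the trivial
  cocycle; the exponent \<open>(0 - 1) div 1 = - 1\<close> then rescales
  \<open>U\<^sub>\<sigma>\<close> by \<open>f(\<sigma>)\<^sup>-\<^sup>1\<close>, and
  \<open>\<alpha>\<close> is the coboundary of \<open>f\<close>.\<close>

definition proj :: "('g \<times> nat \<Rightarrow> 'k) \<Rightarrow> 'g \<Rightarrow> 'k"
  where "proj = lin_ext k A (\<lambda>(\<sigma>, i). if int i mod int m = 1 mod int m
    then up (f \<sigma>) ((int i - 1) div int m) \<odot>\<^bsub>A\<^esub> basis_vec k \<sigma> else \<zero>\<^bsub>A\<^esub>)"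

lemma A_module: "module k A" by (rule A.module_axioms)

lemma proj_hom: "proj \<in> module_hom k H A"
  unfolding proj_def by (rule H.lin_ext_hom[OF A_module]) (auto simp: f_unit A.basis_vec_closed)

lemma proj_U:
  assumes \<sigma>: "\<sigma> \<in> carrier G"
  shows "proj (U \<sigma> n) = (if n mod int m = 1 mod int m
    then up (f \<sigma>) ((n - 1) div int m) \<odot>\<^bsub>A\<^esub> basis_vec k \<sigma> else \<zero>\<^bsub>A\<^esub>)"
proof -
  let ?q = "n div int m" and ?r = "n mod int m"
  have b: "basis_vec k \<sigma> \<in> carrier A" using \<sigma> by (rule A.basis_vec_closed)
  have "proj (basis_vec k (\<sigma>, nat ?r)) = (if ?r = 1 mod int m
    then up (f \<sigma>) ((?r - 1) div int m) \<odot>\<^bsub>A\<^esub> basis_vec k \<sigma> else \<zero>\<^bsub>A\<^esub>)"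
    unfolding proj_def using \<sigma> m_pos b by (subst H.lin_ext_basis_vec[OF A_module]) (auto simp: f_unit)
  moreover have "(n - 1) div int m = ?q + (?r - 1) div int m"
  proof -
    have "n - 1 = (?r - 1) + ?q * int m" by (simp add: algebra_simps)
    then show ?thesis using m_pos by (metis add.commute div_mult_self1 of_nat_0_less_iff less_irrefl)
  qed
  ultimately show ?thesis
    using \<sigma> b by (simp add: U_eq module_hom_smult[OF proj_hom] basis_closed f_unit A.smult_assoc1[symmetric] K.unit_pow_add)
qed

lemma proj_U_1: "\<sigma> \<in> carrier G \<Longrightarrow> proj (U \<sigma> 1) = basis_vec k \<sigma>"
  by (simp add: proj_U A.basis_vec_closed)

lemmas A_mult = K.twisted_group_algebra_bilinear[where G = G and \<alpha> = \<alpha>, OF G.group_axioms K.Units_closed[OF \<alpha>_unit]]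

lemma proj_algebra_hom: "proj \<in> algebra_hom k H A"
proof -
  have zero: "\<zero>\<^bsub>A\<^esub> \<otimes>\<^bsub>A\<^esub> x = \<zero>\<^bsub>A\<^esub>" "x \<otimes>\<^bsub>A\<^esub> \<zero>\<^bsub>A\<^esub> = \<zero>\<^bsub>A\<^esub>" if "x \<in> carrier A" for x
    using module_hom_zero[OF A_module A_module bilinear_left[OF A_mult(1) that]]
      module_hom_zero[OF A_module A_module bilinear_right[OF A_mult(1) that]] by auto
  have 1: "proj (x \<otimes>\<^bsub>H\<^esub> y) = proj x \<otimes>\<^bsub>A\<^esub> proj y" if "x \<in> carrier H" "y \<in> carrier H" for x y
  proof (rule bilinear_on_U_eqI[OF A_module bilinear_compose_hom[OF mult_bilinear proj_hom]
        bilinear_precompose[OF A_mult(1) proj_hom proj_hom] _ that])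
    fix \<sigma> n \<tau> n' assume c [simp]: "\<sigma> \<in> carrier G" "\<tau> \<in> carrier G" and n: "n \<in> Z" "n' \<in> Z"
    note [simp] = A.basis_vec_closed \<alpha>_unit f_unit
    have s: "(a \<odot>\<^bsub>A\<^esub> x) \<otimes>\<^bsub>A\<^esub> (b \<odot>\<^bsub>A\<^esub> y) = (a \<otimes>\<^bsub>k\<^esub> b) \<odot>\<^bsub>A\<^esub> (x \<otimes>\<^bsub>A\<^esub> y)"
      if "a \<in> carrier k" "b \<in> carrier k" "x \<in> carrier A" "y \<in> carrier A" for a b x y
      using that bilinear_closed[OF A_mult(1)]
      by (simp add: module_hom_smult[OF bilinear_left[OF A_mult(1)]]
          module_hom_smult[OF bilinear_right[OF A_mult(1)]] A.smult_assoc1[symmetric] K.m_comm)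
    consider "n \<noteq> n'" | "n = n'" "n mod int m \<noteq> 1 mod int m" | "n = n'" "n mod int m = 1 mod int m" by blast
    then show "proj (U \<sigma> n \<otimes>\<^bsub>H\<^esub> U \<tau> n') = proj (U \<sigma> n) \<otimes>\<^bsub>A\<^esub> proj (U \<tau> n')"
    proof cases
      case 1
      then have ne: "n mod int m \<noteq> n' mod int m" using n Z_mod by blast
      then have "n mod int m \<noteq> 1 mod int m \<or> n' mod int m \<noteq> 1 mod int m" by auto
      then have "proj (U \<sigma> n) \<otimes>\<^bsub>A\<^esub> proj (U \<tau> n') = \<zero>\<^bsub>A\<^esub>"
        using module_hom_closedD[OF proj_hom U_closed, of \<sigma> n] module_hom_closedD[OF proj_hom U_closed, of \<tau> n']
        by (auto simp: proj_U zero simp del: U_closed)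
      then show ?thesis using ne by (simp add: U_mult_distinct module_hom_zero[OF H_module A_module proj_hom])
    next
      case 2
      then show ?thesis by (simp add: U_mult module_hom_smult[OF proj_hom] proj_U zero)
    next
      case 3
      let ?q = "(n - 1) div int m"
      have "int m dvd n - 1" using 3(2) by (simp only: mod_eq_dvd_iff)
      then have nq: "n = int m * ?q + 1" by simp
      have "up (\<alpha> (\<sigma>, \<tau>)) n \<otimes>\<^bsub>k\<^esub> up (f (\<sigma> \<otimes>\<^bsub>G\<^esub> \<tau>)) ?q
          = (up (\<alpha> (\<sigma>, \<tau>)) (int m * ?q) \<otimes>\<^bsub>k\<^esub> up (f (\<sigma> \<otimes>\<^bsub>G\<^esub> \<tau>)) ?q) \<otimes>\<^bsub>k\<^esub> \<alpha> (\<sigma>, \<tau>)"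
        by (subst (1) nq) (simp add: K.unit_pow_add K.m_ac K.Units_closed[OF \<alpha>_unit])
      also have "\<dots> = up (f \<sigma>) ?q \<otimes>\<^bsub>k\<^esub> up (f \<tau>) ?q \<otimes>\<^bsub>k\<^esub> \<alpha> (\<sigma>, \<tau>)" by (simp add: \<alpha>_pow_unit)
      finally show ?thesis
        using 3 by (simp add: U_mult module_hom_smult[OF proj_hom] proj_U s A_mult(2) A.smult_assoc1[symmetric] K.Units_closed[OF \<alpha>_unit])
    qed
  qed
  have "proj \<one>\<^bsub>H\<^esub> = (\<Oplus>\<^bsub>A\<^esub>n\<in>Z. proj (U_unit n))"
    unfolding H_field_eqs(2) by (rule module_hom_finsum[OF H_module A_module proj_hom]) simp
  also have "\<dots> = proj (U_unit (1 mod int m))"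
  proof (rule A.M.finsum_single)
    fix n assume n: "n \<in> Z" "n \<noteq> 1 mod int m"
    then have "n mod int m \<noteq> 1 mod int m" by simp
    then show "proj (U_unit n) = \<zero>\<^bsub>A\<^esub>" by (simp add: U_unit_eq module_hom_smult[OF proj_hom] proj_U \<alpha>_unit)
  qed (use m_pos in \<open>simp_all add: module_hom_closedD[OF proj_hom]\<close>)
  also have "\<dots> = up (\<alpha> (\<one>\<^bsub>G\<^esub>, \<one>\<^bsub>G\<^esub>)) (- 1) \<odot>\<^bsub>A\<^esub> basis_vec k \<one>\<^bsub>G\<^esub>"
    by (simp add: U_unit_periodic) (simp add: U_unit_eq module_hom_smult[OF proj_hom] proj_U_1 \<alpha>_unit)
  also have "\<dots> = \<one>\<^bsub>A\<^esub>"
    using \<alpha>_unit[of "\<one>\<^bsub>G\<^esub>" "\<one>\<^bsub>G\<^esub>"] by (simp add: twisted_group_algebra_simps K.unit_pow_inv[symmetric, of _ 1])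
  finally have "proj \<in> ring_hom H A"
    using 1 by (intro ring_hom_memI) (auto simp: module_hom_add[OF proj_hom] module_hom_closedD[OF proj_hom])
  then show ?thesis using proj_hom by (simp add: algebra_hom_def)
qed

lemma proj_surj: "proj ` carrier H = carrier A"
proof
  show "proj ` carrier H \<subseteq> carrier A" using module_hom_closedD[OF proj_hom] by auto
  show "carrier A \<subseteq> proj ` carrier H"
  proof
    fix p assume p: "p \<in> carrier A"
    let ?s = "{\<sigma>. p \<sigma> \<noteq> \<zero>\<^bsub>k\<^esub>}"
    have s: "\<And>\<sigma>. p \<sigma> \<in> carrier k" "?s \<subseteq> carrier G" using p by (auto simp: A.carrier_iff)
    have "proj (\<Oplus>\<^bsub>H\<^esub>\<sigma>\<in>?s. p \<sigma> \<odot>\<^bsub>H\<^esub> U \<sigma> 1) = (\<Oplus>\<^bsub>A\<^esub>\<sigma>\<in>?s. proj (p \<sigma> \<odot>\<^bsub>H\<^esub> U \<sigma> 1))"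
      using s by (intro module_hom_finsum[OF H_module A_module proj_hom]) auto
    also have "\<dots> = (\<Oplus>\<^bsub>A\<^esub>\<sigma>\<in>?s. p \<sigma> \<odot>\<^bsub>A\<^esub> basis_vec k \<sigma>)"
      using s by (intro A.M.finsum_cong') (auto simp: module_hom_smult[OF proj_hom] proj_U_1 intro!: A.basis_vec_closed)
    also have "\<dots> = p" by (rule A.basis_expansion[OF p, symmetric])
    finally show "p \<in> proj ` carrier H"
      using s by (intro image_eqI[of _ _ "\<Oplus>\<^bsub>H\<^esub>\<sigma>\<in>?s. p \<sigma> \<odot>\<^bsub>H\<^esub> U \<sigma> 1"]) (auto intro!: H.M.finsum_closed)
  qed
qed

end

section \<open>Roots of unity\<close>

text \<open>The cofactor of \<open>x - y\<close> in \<open>x\<^sup>n - y\<^sup>n\<close> specializes to the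
  derivative \<open>n a\<^sup>n\<^sup>-\<^sup>1\<close> at \<open>x = y = a\<close>; multiplying by
  \<open>a\<close> avoids the exponent \<open>n - 1\<close>. It replaces formal derivatives in the
  proof that roots are simple.\<close>

lemma (in cring) pow_diff_factor:
  assumes P: "cring P" and h: "h \<in> ring_hom P R" and x: "x \<in> carrier P" and y: "y \<in> carrier P"
    and a: "h x = a" "h y = a"
  shows "\<exists>s\<in>carrier P. x [^]\<^bsub>P\<^esub> n \<ominus>\<^bsub>P\<^esub> y [^]\<^bsub>P\<^esub> n = (x \<ominus>\<^bsub>P\<^esub> y) \<otimes>\<^bsub>P\<^esub> s
    \<and> a \<otimes> h s = [n] \<cdot> (a [^] (n::nat))"
proof -
  interpret P: cring P by fact
  have ac: "a \<in> carrier R" using ring_hom_closed[OF h x] a by simp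
  have hpow: "h (y [^]\<^bsub>P\<^esub> n) = a [^] n" for n :: nat
  proof (induction n)
    case 0
    then show ?case using ring_hom_one[OF h] by simp
  next
    case (Suc n)
    then show ?case using ring_hom_mult[OF h _ y, of "y [^]\<^bsub>P\<^esub> n"] y a by simp
  qed
  show ?thesis
  proof (induction n)
    case 0
    have "a \<otimes> h \<zero>\<^bsub>P\<^esub> = \<zero>"
      using ring_hom_zero[OF h P.ring_axioms ring_axioms] ac by simp
    then show ?case using x y by (intro bexI[of _ "\<zero>\<^bsub>P\<^esub>"]) (simp_all add: a_minus_def P.r_neg)
  next
    case (Suc n)
    then obtain s where s: "s \<in> carrier P" "x [^]\<^bsub>P\<^esub> n \<ominus>\<^bsub>P\<^esub> y [^]\<^bsub>P\<^esub> n = (x \<ominus>\<^bsub>P\<^esub> y) \<otimes>\<^bsub>P\<^esub> s"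
      "a \<otimes> h s = [n] \<cdot> (a [^] n)" by blast
    let ?s = "x \<otimes>\<^bsub>P\<^esub> s \<oplus>\<^bsub>P\<^esub> y [^]\<^bsub>P\<^esub> n"
    have hs: "h s \<in> carrier R" using ring_hom_closed[OF h s(1)] .
    have c: "x [^]\<^bsub>P\<^esub> n \<in> carrier P" "y [^]\<^bsub>P\<^esub> n \<in> carrier P" using x y by auto
    have "x [^]\<^bsub>P\<^esub> Suc n \<ominus>\<^bsub>P\<^esub> y [^]\<^bsub>P\<^esub> Suc n
      = x \<otimes>\<^bsub>P\<^esub> (x [^]\<^bsub>P\<^esub> n \<ominus>\<^bsub>P\<^esub> y [^]\<^bsub>P\<^esub> n) \<oplus>\<^bsub>P\<^esub> (x \<ominus>\<^bsub>P\<^esub> y) \<otimes>\<^bsub>P\<^esub> y [^]\<^bsub>P\<^esub> n"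
      using x y c unfolding P.nat_pow_Suc by algebra
    also have "\<dots> = (x \<ominus>\<^bsub>P\<^esub> y) \<otimes>\<^bsub>P\<^esub> ?s"
      unfolding s(2) using x y c s(1) by algebra
    finally have 1: "x [^]\<^bsub>P\<^esub> Suc n \<ominus>\<^bsub>P\<^esub> y [^]\<^bsub>P\<^esub> Suc n = (x \<ominus>\<^bsub>P\<^esub> y) \<otimes>\<^bsub>P\<^esub> ?s" .
    have "a \<otimes> h ?s = a \<otimes> (a \<otimes> h s) \<oplus> a [^] Suc n"
      using x s(1) c ac hs by (simp add: ring_hom_add[OF h] ring_hom_mult[OF h] a hpow r_distr m_comm)
    also have "\<dots> = [Suc n] \<cdot> (a [^] Suc n)"
      using ac by (simp add: s(3) add_pow_rdistr m_comm add.nat_pow_Suc)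
    finally show ?case using 1 x y s(1) by (intro bexI[of _ ?s]) auto
  qed
qed

context field
begin

definition unity_poly :: "nat \<Rightarrow> 'a list"
  where "unity_poly n = X [^]\<^bsub>poly_ring R\<^esub> n \<ominus>\<^bsub>poly_ring R\<^esub> \<one>\<^bsub>poly_ring R\<^esub>"

lemma unity_poly:
  assumes "n > 0"
  shows "unity_poly n \<in> carrier (poly_ring R)" and "degree (unity_poly n) = n" and "unity_poly n \<noteq> []"
    and "set_mset (roots (unity_poly n)) = {z \<in> carrier R. z [^] n = \<one>}"
proof -
  interpret P: domain "poly_ring R" by (rule univ_poly_is_domain[OF carrier_is_subring])
  have v: "X \<in> carrier (poly_ring R)" by (rule var_closed(1)[OF carrier_is_subring])
  show c: "unity_poly n \<in> carrier (poly_ring R)" unfolding unity_poly_def using v by simp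
  have "unity_poly n = poly_add (monom \<one> n) [\<ominus> \<one>]"
    using univ_poly_a_inv_def'[OF carrier_is_subring P.one_closed]
    by (simp add: unity_poly_def a_minus_def unitary_monom_eq_var_pow[OF carrier_is_subring]
        univ_poly_add univ_poly_one)
  moreover have "polynomial (carrier R) (monom \<one> n)" "polynomial (carrier R) [\<ominus> \<one>]"
    using v by (auto simp: univ_poly_carrier unitary_monom_eq_var_pow[OF carrier_is_subring] polynomial_def)
       (auto simp: polynomial_def univ_poly_carrier[symmetric])
  ultimately show d: "degree (unity_poly n) = n"
    using poly_add_degree_eq[OF carrier_is_subring, of "monom \<one> n" "[\<ominus> \<one>]"] assms
    by (simp add: monom_def)
  then show ne: "unity_poly n \<noteq> []" using assms by auto
  have ev: "eval (unity_poly n) z = z [^] n \<ominus> \<one>" if z: "z \<in> carrier R" for z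
  proof -
    interpret h: ring_hom_ring "poly_ring R" R "\<lambda>p. eval p z"
      by (rule eval_ring_hom[OF carrier_is_subring z])
    show ?thesis unfolding unity_poly_def using v z
      by (simp add: a_minus_def h.hom_nat_pow eval_var)
  qed
  show "set_mset (roots (unity_poly n)) = {z \<in> carrier R. z [^] n = \<one>}"
    using roots_mem_iff_is_root[OF c] ne ev by (auto simp: is_root_def minus_eq_zero_iff)
qed

lemma card_roots_of_unity_le:
  assumes "n > 0"
  shows "finite {z \<in> carrier R. z [^] n = \<one>}" "card {z \<in> carrier R. z [^] n = \<one>} \<le> n"
proof -
  show "finite {z \<in> carrier R. z [^] n = \<one>}"
    using unity_poly(4)[OF assms] by (metis finite_set_mset)
  have "card {z \<in> carrier R. z [^] n = \<one>} \<le> size (roots (unity_poly n))"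
    unfolding unity_poly(4)[OF assms, symmetric] size_multiset_overloaded_eq card_eq_sum
    by (rule sum_mono) (simp add: Suc_leI)
  also have "\<dots> \<le> n" using size_roots_le_degree[OF unity_poly(1)[OF assms]] unity_poly(2)[OF assms] by simp
  finally show "card {z \<in> carrier R. z [^] n = \<one>} \<le> n" .
qed

text \<open>At a multiple root \<open>a\<close> the cofactor of \<open>T - a\<close> would vanish, but
  \<open>a\<close> times its value is \<open>n a\<^sup>n = n\<close>.\<close>

lemma unity_poly_simple_roots:
  assumes n: "n > 0" and char: "[n] \<cdot> \<one> \<noteq> \<zero>" and a: "a \<in> carrier R" "a [^] n = \<one>"
  shows "count (roots (unity_poly n)) a \<le> 1"
proof (rule ccontr)
  assume "\<not> ?thesis"
  then have "2 \<le> alg_mult (unity_poly n) a"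
    by (simp add: alg_mult_eq_count_roots[OF unity_poly(1)[OF n]])
  interpret P: domain "poly_ring R" by (rule univ_poly_is_domain[OF carrier_is_subring])
  let ?l = "[\<one>, \<ominus> a]" and ?y = "poly_of_const a" and ?h = "\<lambda>p. eval p a"
  have v: "X \<in> carrier (poly_ring R)" by (rule var_closed(1)[OF carrier_is_subring])
  have l: "?l \<in> carrier (poly_ring R)" using a by (auto simp: univ_poly_carrier[symmetric] polynomial_def)
  have a0: "a \<noteq> \<zero>" using a n by (auto simp: nat_pow_zero)
  have y_eq: "?y = [a]" using a0 by (simp add: poly_of_const_def)
  have y: "?y \<in> carrier (poly_ring R)" using a a0 by (auto simp: y_eq univ_poly_carrier[symmetric] polynomial_def)
  have h: "?h \<in> ring_hom (poly_ring R) R" by (rule eval_is_hom[OF carrier_is_subring a(1)])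
  obtain q where q: "q \<in> carrier (poly_ring R)" "unity_poly n = (?l \<otimes>\<^bsub>poly_ring R\<^esub> ?l) \<otimes>\<^bsub>poly_ring R\<^esub> q"
    using le_alg_mult_imp_pdivides[OF a(1) unity_poly(1)[OF n] \<open>2 \<le> _\<close>] l
    unfolding pdivides_def factor_def by (auto simp: numeral_2_eq_2)
  obtain s where s: "s \<in> carrier (poly_ring R)"
    "X [^]\<^bsub>poly_ring R\<^esub> n \<ominus>\<^bsub>poly_ring R\<^esub> ?y [^]\<^bsub>poly_ring R\<^esub> n = (X \<ominus>\<^bsub>poly_ring R\<^esub> ?y) \<otimes>\<^bsub>poly_ring R\<^esub> s"
    "a \<otimes> ?h s = [n] \<cdot> (a [^] n)"
    using pow_diff_factor[OF P.is_cring h v y, of a n] a by (auto simp: eval_var y_eq)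
  have ypow: "?y [^]\<^bsub>poly_ring R\<^esub> n = \<one>\<^bsub>poly_ring R\<^esub>"
  proof -
    interpret c: ring_hom_ring R "poly_ring R" poly_of_const
      using canonical_embedding_ring_hom[OF carrier_is_subring] by simp
    show ?thesis using c.hom_nat_pow[OF a(1), of n] a(2) by simp
  qed
  have xl: "X \<ominus>\<^bsub>poly_ring R\<^esub> ?y = ?l"
    using univ_poly_a_inv_def'[OF carrier_is_subring y] a a0
    by (simp add: a_minus_def y_eq univ_poly_add var_def)
  have l0: "?l \<noteq> \<zero>\<^bsub>poly_ring R\<^esub>" by (simp add: univ_poly_zero)
  have "?l \<otimes>\<^bsub>poly_ring R\<^esub> s = ?l \<otimes>\<^bsub>poly_ring R\<^esub> (?l \<otimes>\<^bsub>poly_ring R\<^esub> q)"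
    using s(2) q l by (simp add: ypow xl unity_poly_def P.m_assoc)
  then have "s = ?l \<otimes>\<^bsub>poly_ring R\<^esub> q"
    using P.m_lcancel[OF l0 l, of s] s(1) q(1) l by simp
  then have "?h s = \<zero>"
    using ring_hom_mult[OF h l q(1)] ring_hom_closed[OF h q(1)] a by (simp add: r_neg)
  then show False using s(3) char a by simp
qed

end

lemma (in algebraically_closed) card_roots_of_unity:
  assumes n: "n > 0" and char: "[n] \<cdot> \<one> \<noteq> \<zero>"
  shows "card {z \<in> carrier L. z [^] n = \<one>} = n"
proof -
  let ?p = "unity_poly n"
  have "n = size (roots ?p)"
    using roots_over_carrier[OF unity_poly(1)[OF n]] unity_poly(2)[OF n] by (simp add: splitted_def)
  also have "\<dots> = (\<Sum>a\<in>set_mset (roots ?p). count (roots ?p) a)" by (simp add: size_multiset_overloaded_eq)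
  also have "\<dots> = (\<Sum>a\<in>set_mset (roots ?p). 1)"
  proof (rule sum.cong[OF refl])
    fix a assume a: "a \<in># roots ?p"
    then have "count (roots ?p) a \<le> 1"
      using unity_poly_simple_roots[OF n char] unity_poly(4)[OF n] by auto
    then show "count (roots ?p) a = 1" using a by (metis count_greater_zero_iff le_antisym less_eq_Suc_le One_nat_def)
  qed
  also have "\<dots> = card {z \<in> carrier L. z [^] n = \<one>}" by (simp add: unity_poly(4)[OF n])
  finally show ?thesis ..
qed

context field
begin

context
  fixes m :: nat and roots_m :: "'a set"
  assumes m: "m > 0" and roots_m: "roots_m = {z \<in> carrier R. z [^] m = \<one>}" and card: "card roots_m = m"
begin

lemma root_of_unity_unit: "z \<in> roots_m \<Longrightarrow> z \<in> Units R"
  using m by (auto simp: roots_m field_Units nat_pow_zero)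

lemma root_of_unity_unit_pow:
  assumes z: "z \<in> roots_m" shows "unit_pow R z (int m * q) = \<one>"
  using root_of_unity_unit[OF z] z by (simp add: unit_pow_mult unit_pow_int) (simp add: roots_m)

lemma root_of_unity_pow_mod:
  assumes z: "z \<in> roots_m" shows "unit_pow R z (n mod int m) = unit_pow R z n"
proof -
  have "unit_pow R z n = unit_pow R z (int m * (n div int m) + n mod int m)" by simp
  also have "\<dots> = unit_pow R z (n mod int m)"
    using z root_of_unity_unit[OF z] by (subst unit_pow_add) (simp_all add: root_of_unity_unit_pow)
  finally show ?thesis ..
qed

text \<open>The sum is invariant under multiplication by \<open>z\<close>, which only shifts the index.\<close>

lemma sum_powers_of_root:
  assumes z: "z \<in> roots_m"
  shows "(\<Oplus>n\<in>{0..<int m}. unit_pow R z n) = (if z = \<one> then [m] \<cdot> \<one> else \<zero>)"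
proof (cases "z = \<one>")
  case True
  have "(\<Oplus>n\<in>{0..<int m}. \<one>) = [m] \<cdot> \<one>" using add.finprod_const[of \<one> "{0..<int m}"] by simp
  then show ?thesis using True by simp
next
  case False
  note u = root_of_unity_unit[OF z]
  let ?s = "\<Oplus>n\<in>{0..<int m}. unit_pow R z n"
  have c: "z \<in> carrier R" "?s \<in> carrier R" using u by (auto intro!: finsum_closed)
  have "?s = (\<Oplus>n\<in>{0..<int m}. unit_pow R z (n - (- 1)))"
    using u m root_of_unity_pow_mod[OF z] by (intro finsum_residues_shift[symmetric]) auto
  also have "\<dots> = (\<Oplus>n\<in>{0..<int m}. z \<otimes> unit_pow R z n)"
    using u c by (intro finsum_cong') (auto simp: unit_pow_add m_comm)
  also have "\<dots> = z \<otimes> ?s" using u c by (intro finsum_rdistr[symmetric]) auto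
  finally have "?s = z \<otimes> ?s" .
  then have "(z \<ominus> \<one>) \<otimes> ?s = \<zero>" using c by (simp add: a_minus_def l_distr l_minus r_neg)
  moreover have "z \<ominus> \<one> \<noteq> \<zero>" using False c by (simp add: minus_eq_zero_iff)
  ultimately show ?thesis using c False integral_iff[of "z \<ominus> \<one>" ?s] by simp
qed

text \<open>For \<open>n\<close> not divisible by \<open>m\<close> some root \<open>w\<close> has
  \<open>w\<^sup>n \<noteq> 1\<close>, as \<open>T\<^sup>d - 1\<close> with \<open>0 < d < m\<close>
  has fewer than \<open>m\<close> roots; multiplication by \<open>w\<close> permutes the roots and
  multiplies the sum by \<open>w\<^sup>n\<close>.\<close>

lemma sum_over_roots:
  "(\<Oplus>z\<in>roots_m. unit_pow R z n) = (if n mod int m = 0 then [m] \<cdot> \<one> else \<zero>)"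
proof (cases "n mod int m = 0")
  case True
  have "unit_pow R z n = \<one>" if "z \<in> roots_m" for z
    using root_of_unity_pow_mod[OF that, of n] True by simp
  then have "(\<Oplus>z\<in>roots_m. unit_pow R z n) = (\<Oplus>z\<in>roots_m. \<one>)" by (intro finsum_cong') auto
  also have "\<dots> = [m] \<cdot> \<one>" using add.finprod_const[of \<one> roots_m] card by simp
  finally show ?thesis using True by simp
next
  case False
  let ?d = "nat (n mod int m)"
  have "0 \<le> n mod int m" "n mod int m < int m" using m by simp_all
  then have d: "?d > 0" "?d < m" and d_int: "int ?d = n mod int m" using False by linarith+
  have pw: "unit_pow R z n = z [^] ?d" if "z \<in> roots_m" for z
    using root_of_unity_pow_mod[OF that, of n] unit_pow_int[OF root_of_unity_unit[OF that], of ?d] by (simp only: d_int)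
  have "\<exists>w\<in>roots_m. w [^] ?d \<noteq> \<one>"
  proof (rule ccontr)
    assume "\<not> ?thesis"
    then have "roots_m \<subseteq> {z \<in> carrier R. z [^] ?d = \<one>}" by (auto simp: roots_m)
    from card_mono[OF card_roots_of_unity_le(1)[OF d(1)] this] show False
      using card_roots_of_unity_le(2)[OF d(1)] card d(2) by simp
  qed
  then obtain w where w: "w \<in> roots_m" "unit_pow R w n \<noteq> \<one>" using pw by auto
  note u = root_of_unity_unit
  let ?s = "\<Oplus>z\<in>roots_m. unit_pow R z n" and ?w = "unit_pow R w n"
  have c: "?w \<in> carrier R" "?s \<in> carrier R" using u w by (auto intro!: finsum_closed)
  have inj: "inj_on (\<lambda>z. w \<otimes> z) roots_m"
    using u[OF w(1)] by (intro inj_onI) (auto simp: roots_m Units_l_cancel)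
  have fin: "finite roots_m" using card_roots_of_unity_le(1)[OF m] by (simp add: roots_m)
  have "(\<lambda>z. w \<otimes> z) ` roots_m \<subseteq> roots_m"
    using w(1) by (auto simp: roots_m nat_pow_distrib)
  then have img: "(\<lambda>z. w \<otimes> z) ` roots_m = roots_m"
    using inj fin by (intro card_subset_eq) (auto simp: card_image)
  have "?s = (\<Oplus>z\<in>(\<lambda>z. w \<otimes> z) ` roots_m. unit_pow R z n)" by (simp add: img)
  also have "\<dots> = (\<Oplus>z\<in>roots_m. unit_pow R (w \<otimes> z) n)"
    using u w(1) by (intro finsum_reindex inj) auto
  also have "\<dots> = (\<Oplus>z\<in>roots_m. ?w \<otimes> unit_pow R z n)"
    using u w(1) by (intro finsum_cong') (auto simp: unit_pow_mult_base)
  also have "\<dots> = ?w \<otimes> ?s" using u w(1) fin by (intro finsum_rdistr[symmetric]) auto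
  finally have "?s = ?w \<otimes> ?s" .
  then have "(?w \<ominus> \<one>) \<otimes> ?s = \<zero>" using c by (simp add: a_minus_def l_distr l_minus r_neg)
  moreover have "?w \<ominus> \<one> \<noteq> \<zero>" using w(2) c by (simp add: minus_eq_zero_iff)
  ultimately show ?thesis using c False integral_iff[of "?w \<ominus> \<one>" ?s] by simp
qed

end

end

section \<open>Extension of scalars\<close>

lemma abelian_group_cong:
  assumes "abelian_group M" "carrier N = carrier M" "\<zero>\<^bsub>N\<^esub> = \<zero>\<^bsub>M\<^esub>" "add N = add M"
  shows "abelian_group N"
proof -
  interpret M: abelian_group M by fact
  show ?thesis
  proof (rule abelian_groupI)
    fix x assume "x \<in> carrier N"
    then show "\<exists>y\<in>carrier N. y \<oplus>\<^bsub>N\<^esub> x = \<zero>\<^bsub>N\<^esub>"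
      using assms(2-4) by (intro bexI[of _ "\<ominus>\<^bsub>M\<^esub> x"]) (simp_all add: M.l_neg)
  qed (simp_all add: assms(2-4) M.a_ac)
qed

lemma (in module) finsum_smult_left:
  assumes "finite I" "\<And>i. i \<in> I \<Longrightarrow> c i \<in> carrier R" "v \<in> carrier M"
  shows "(\<Oplus>\<^bsub>R\<^esub>i\<in>I. c i) \<odot>\<^bsub>M\<^esub> v = (\<Oplus>\<^bsub>M\<^esub>i\<in>I. c i \<odot>\<^bsub>M\<^esub> v)"
  using assms(1,2)
proof (induction I rule: finite_induct)
  case empty
  then show ?case using assms(3) by simp
next
  case (insert i I)
  then have "c \<in> I \<rightarrow> carrier R" "c i \<in> carrier R" "(\<lambda>i. c i \<odot>\<^bsub>M\<^esub> v) \<in> I \<rightarrow> carrier M" using assms(3) by auto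
  then show ?case using insert assms(3) by (simp add: smult_l_distr R.finsum_closed)
qed

text \<open>The field \<open>k\<close> is a subfield of \<open>L\<close>. Its record shares the operations of
  \<open>L\<close>, but inverses and powers in the two unit groups have to be compared.\<close>

locale twisting_extension = twisting k G \<alpha> f m + L: field L
  for k :: "('k, 'r) ring_scheme" and L :: "('k, 't) ring_scheme" and G :: "('g, 's) monoid_scheme"
    and \<alpha> :: "'g \<times> 'g \<Rightarrow> 'k" and f :: "'g \<Rightarrow> 'k" and m :: nat +
  fixes g :: "'g \<Rightarrow> 'k"
  assumes carrier_sub: "carrier k \<subseteq> carrier L"
    and k_ops: "monoid.mult k = monoid.mult L" "add k = add L" "one k = one L" "zero k = zero L"
    and g_unit: "\<sigma> \<in> carrier G \<Longrightarrow> g \<sigma> \<in> Units L"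
    and g_pow: "\<sigma> \<in> carrier G \<Longrightarrow> g \<sigma> [^]\<^bsub>L\<^esub> m = f \<sigma>"
    and card_roots: "card {z \<in> carrier L. z [^]\<^bsub>L\<^esub> m = \<one>\<^bsub>L\<^esub>} = m"
    and m_nonzero: "[m] \<cdot>\<^bsub>L\<^esub> \<one>\<^bsub>L\<^esub> \<noteq> \<zero>\<^bsub>L\<^esub>"
begin

abbreviation upL :: "'k \<Rightarrow> int \<Rightarrow> 'k" where "upL \<equiv> unit_pow L"

lemma k_L: "a \<in> carrier k \<Longrightarrow> a \<in> carrier L"
  using carrier_sub by auto

lemma Units_k_L: "x \<in> Units k \<Longrightarrow> x \<in> Units L"
  using carrier_sub by (auto simp: K.field_Units L.field_Units k_ops)

lemma inv_k_L: "x \<in> Units k \<Longrightarrow> inv\<^bsub>k\<^esub> x = inv\<^bsub>L\<^esub> x"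
  using L.comm_inv_char[of x "inv\<^bsub>k\<^esub> x"] K.Units_r_inv[of x]
  by (simp add: k_ops k_L K.Units_closed K.Units_inv_closed)

lemma unit_pow_k_L:
  assumes "x \<in> Units k"
  shows "up x n = upL x n"
proof -
  have p: "a [^]\<^bsub>k\<^esub> (j::nat) = a [^]\<^bsub>L\<^esub> j" for a j by (simp add: nat_pow_def k_ops)
  show ?thesis
  proof (cases "n \<ge> 0")
    case True
    then obtain j where "n = int j" using nonneg_int_cases by blast
    then show ?thesis using assms Units_k_L by (simp add: K.unit_pow_int L.unit_pow_int p)
  next
    case False
    then obtain j where j: "n = - int j" by (metis int_cases2 le_minus_iff neg_0_le_iff_le of_nat_0_le_iff)
    have "up x n = up (inv\<^bsub>k\<^esub> x) (int j)" using assms j by (simp add: K.unit_pow_inv)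
    also have "\<dots> = upL (inv\<^bsub>L\<^esub> x) (int j)"
      using assms Units_k_L K.unit_pow_int[OF K.Units_inv_Units[OF assms], of j]
      by (simp add: L.unit_pow_int p inv_k_L)
    also have "\<dots> = upL x n" using assms j Units_k_L by (simp add: L.unit_pow_inv)
    finally show ?thesis .
  qed
qed

lemma module_restrict:
  assumes "module L N"
  shows "module k N"
proof -
  interpret N: module L N by fact
  show ?thesis
    by (rule moduleI)
      (auto simp: K.is_cring N.M.abelian_group_axioms k_L k_ops N.smult_l_distr N.smult_r_distr N.smult_assoc1)
qed

lemma module_hom_restrict: "h \<in> module_hom L M N \<Longrightarrow> h \<in> module_hom k M N"
  unfolding module_hom_def by (auto simp: k_L)

lemma bilinear_restrict: "bilinear L V W N \<beta> \<Longrightarrow> bilinear k V W N \<beta>"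
  unfolding bilinear_def by (auto intro: module_hom_restrict)

abbreviation RL :: "('k, 'k) module" where "RL \<equiv> regular_algebra L"
abbreviation T0 :: "('k, (('g \<times> nat \<Rightarrow> 'k) \<times> 'k \<Rightarrow> 'k) set) module" where "T0 \<equiv> tensor_module k H RL"
abbreviation p0 :: "('g \<times> nat \<Rightarrow> 'k) \<Rightarrow> 'k \<Rightarrow> (('g \<times> nat \<Rightarrow> 'k) \<times> 'k \<Rightarrow> 'k) set" where "p0 \<equiv> pure_tensor k H RL"
abbreviation B :: "('k, (('g \<times> nat \<Rightarrow> 'k) \<times> 'k \<Rightarrow> 'k) set) hopf_algebra" where "B \<equiv> base_change k L H"

lemma RL_simps [simp]:
  "carrier RL = carrier L" "zero RL = zero L" "one RL = one L"
  "add RL = add L" "smult RL = monoid.mult L" "monoid.mult RL = monoid.mult L"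
  by (simp_all add: regular_algebra_def)

lemma RL_module_L: "module L RL" by (rule L.regular_algebra_module)
lemma RL_module: "module k RL" by (rule module_restrict[OF RL_module_L])
lemma T0_module: "module k T0" by (rule K.tensor_is_module[OF H_module RL_module])

lemma smult_bilinear:
  assumes "module L N"
  shows "bilinear k RL N N (smult N)"
proof -
  interpret N: module L N by fact
  show ?thesis
    by (intro bilinearI module_homI)
      (auto simp: k_L N.smult_l_distr N.smult_r_distr N.smult_assoc1[symmetric] L.m_comm)
qed

lemmas p0_bilinear = K.pure_tensor_bilinear[OF H_module RL_module]
lemma p0_closed [simp]: "\<lbrakk>x \<in> carrier H; c \<in> carrier L\<rbrakk> \<Longrightarrow> p0 x c \<in> carrier T0"
  using K.pure_tensor_closed[OF H_module RL_module] by simp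

lemma T0_homI:
  assumes "module k N" "h \<in> module_hom k T0 N" "h' \<in> module_hom k T0 N"
    and "\<And>x c. \<lbrakk>x \<in> carrier H; c \<in> carrier L\<rbrakk> \<Longrightarrow> h (p0 x c) = h' (p0 x c)" "t \<in> carrier T0"
  shows "h t = h' t"
  by (rule K.tensor_hom_eqI[OF H_module RL_module generates_carrier generates_carrier assms(1-3) _ assms(5)])
    (simp add: assms(4))

lemma B_simps:
  "carrier B = carrier T0" "zero B = zero T0" "add B = add T0"
  "\<one>\<^bsub>B\<^esub> = p0 \<one>\<^bsub>H\<^esub> \<one>\<^bsub>L\<^esub>" "monoid.mult B = monoid.mult (tensor_algebra k H RL)"
  "smult B = (\<lambda>c. tensor_map k H RL id (\<lambda>x. c \<otimes>\<^bsub>L\<^esub> x))"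
  by (simp_all add: base_change_def base_change_algebra_def Let_def K.tensor_algebra_simps)

lemma mult_L_hom: "c \<in> carrier L \<Longrightarrow> (\<lambda>x. c \<otimes>\<^bsub>L\<^esub> x) \<in> module_hom k RL RL"
  by (rule module_homI) (auto simp: k_L L.r_distr L.m_lcomm)

lemma smultB_hom: "c \<in> carrier L \<Longrightarrow> (\<lambda>s. c \<odot>\<^bsub>B\<^esub> s) \<in> module_hom k T0 T0"
  unfolding B_simps
  by (rule K.tensor_map_hom[OF H_module RL_module H_module RL_module module_hom_id' mult_L_hom])

lemma smultB_p0: "\<lbrakk>c \<in> carrier L; x \<in> carrier H; d \<in> carrier L\<rbrakk> \<Longrightarrow> c \<odot>\<^bsub>B\<^esub> p0 x d = p0 x (c \<otimes>\<^bsub>L\<^esub> d)"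
  unfolding B_simps
  by (subst K.tensor_map_pure[OF H_module RL_module H_module RL_module module_hom_id' mult_L_hom]) auto

lemma B_module: "module L B"
proof (rule moduleI)
  interpret T0: module k T0 by (rule T0_module)
  show "cring L" ..
  show "abelian_group B"
    by (rule abelian_group_cong[OF T0.M.abelian_group_axioms]) (simp_all add: B_simps)
  note cl = module_hom_closedD[OF smultB_hom]
  show "c \<odot>\<^bsub>B\<^esub> s \<in> carrier B" if "c \<in> carrier L" "s \<in> carrier B" for c s
    using cl that by (simp add: B_simps(1))
  show "c \<odot>\<^bsub>B\<^esub> (s \<oplus>\<^bsub>B\<^esub> t) = c \<odot>\<^bsub>B\<^esub> s \<oplus>\<^bsub>B\<^esub> c \<odot>\<^bsub>B\<^esub> t"
    if "c \<in> carrier L" "s \<in> carrier B" "t \<in> carrier B" for c s t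
    using module_hom_add[OF smultB_hom, of c s t] that by (simp add: B_simps(1,3))
  show "(c \<oplus>\<^bsub>L\<^esub> d) \<odot>\<^bsub>B\<^esub> s = c \<odot>\<^bsub>B\<^esub> s \<oplus>\<^bsub>B\<^esub> d \<odot>\<^bsub>B\<^esub> s"
    if c: "c \<in> carrier L" "d \<in> carrier L" and s: "s \<in> carrier B" for c d s
  proof -
    have "(c \<oplus>\<^bsub>L\<^esub> d) \<odot>\<^bsub>B\<^esub> s = c \<odot>\<^bsub>B\<^esub> s \<oplus>\<^bsub>T0\<^esub> d \<odot>\<^bsub>B\<^esub> s"
      by (rule T0_homI[OF T0_module smultB_hom module_hom_add_maps[OF T0_module smultB_hom smultB_hom]])
        (use c s in \<open>auto simp: smultB_p0 L.l_distr B_simps(1)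
          module_hom_add[OF bilinear_right[OF p0_bilinear], simplified]\<close>)
    then show ?thesis by (simp add: B_simps(3))
  qed
  show "(c \<otimes>\<^bsub>L\<^esub> d) \<odot>\<^bsub>B\<^esub> s = c \<odot>\<^bsub>B\<^esub> (d \<odot>\<^bsub>B\<^esub> s)"
    if c: "c \<in> carrier L" "d \<in> carrier L" and s: "s \<in> carrier B" for c d s
    by (rule T0_homI[OF T0_module smultB_hom module_hom_compose[OF smultB_hom smultB_hom]])
      (use c s in \<open>auto simp: smultB_p0 L.m_assoc B_simps(1)\<close>)
  show "\<one>\<^bsub>L\<^esub> \<odot>\<^bsub>B\<^esub> s = s" if "s \<in> carrier B" for s
    by (rule T0_homI[OF T0_module smultB_hom module_hom_id])
      (use that in \<open>auto simp: smultB_p0 B_simps(1)\<close>)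
qed

sublocale B: module L B by (rule B_module)

lemma B_module_k: "module k B" by (rule module_restrict[OF B_module])

lemma B_smult_k:
  assumes "a \<in> carrier k" "s \<in> carrier T0"
  shows "a \<odot>\<^bsub>B\<^esub> s = a \<odot>\<^bsub>T0\<^esub> s"
proof (rule T0_homI[OF T0_module smultB_hom module_hom_smult_map[OF T0_module module_hom_id]])
  show "a \<odot>\<^bsub>B\<^esub> p0 x c = a \<odot>\<^bsub>T0\<^esub> p0 x c" if "x \<in> carrier H" "c \<in> carrier L" for x c
    using that assms(1) module_hom_smult[OF bilinear_right[OF p0_bilinear], of x a c] by (simp add: smultB_p0 k_L)
qed (use assms k_L in auto)

lemma hom_to_B: "h \<in> module_hom k M T0 \<Longrightarrow> h \<in> module_hom k M B"
  by (rule module_homI)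
    (auto simp: B_simps(1,3) B_smult_k module_hom_closedD module_hom_add module_hom_smult)

lemma L_linearI:
  assumes N: "module L N" and h: "h \<in> module_hom k T0 N"
    and lin: "\<And>x c d. \<lbrakk>x \<in> carrier H; c \<in> carrier L; d \<in> carrier L\<rbrakk> \<Longrightarrow> h (p0 x (c \<otimes>\<^bsub>L\<^esub> d)) = c \<odot>\<^bsub>N\<^esub> h (p0 x d)"
  shows "h \<in> module_hom L B N"
proof (rule module_homI)
  show "h s \<in> carrier N" if "s \<in> carrier B" for s
    using that module_hom_closedD[OF h] by (simp add: B_simps)
  show "h (s \<oplus>\<^bsub>B\<^esub> t) = h s \<oplus>\<^bsub>N\<^esub> h t" if "s \<in> carrier B" "t \<in> carrier B" for s t
    using that module_hom_add[OF h] by (simp add: B_simps)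
  show "h (c \<odot>\<^bsub>B\<^esub> s) = c \<odot>\<^bsub>N\<^esub> h s" if c: "c \<in> carrier L" and s: "s \<in> carrier B" for c s
    by (rule T0_homI[OF module_restrict[OF N] module_hom_compose[OF smultB_hom h]
          module_hom_compose[OF h bilinear_right[OF smult_bilinear[OF N]]]])
      (use c s in \<open>auto simp: smultB_p0 lin B_simps(1)\<close>)
qed

subsection \<open>The algebra over the extension field\<close>

definition \<iota> :: "('g \<times> nat \<Rightarrow> 'k) \<Rightarrow> (('g \<times> nat \<Rightarrow> 'k) \<times> 'k \<Rightarrow> 'k) set"
  where "\<iota> x = p0 x \<one>\<^bsub>L\<^esub>"

lemma \<iota>_hom: "\<iota> \<in> module_hom k H B"
  unfolding \<iota>_def[abs_def] by (rule hom_to_B, rule bilinear_left[OF p0_bilinear]) simp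

lemma \<iota>_closed [simp]: "x \<in> carrier H \<Longrightarrow> \<iota> x \<in> carrier B"
  by (rule module_hom_closedD[OF \<iota>_hom])

lemma p0_eq: "\<lbrakk>x \<in> carrier H; c \<in> carrier L\<rbrakk> \<Longrightarrow> p0 x c = c \<odot>\<^bsub>B\<^esub> \<iota> x"
  by (simp add: \<iota>_def smultB_p0)

lemma B_generates: "generates L B (\<iota> ` gens)"
proof (rule generatesI)
  have gens: "gens \<subseteq> carrier H" using gens_generate by (auto simp: generates_def)
  then show "\<iota> ` gens \<subseteq> carrier B" by auto
  let ?P = "(\<lambda>(x, c). p0 x c) ` (gens \<times> carrier RL)"
  have P: "?P \<subseteq> carrier T0" using gens by auto
  fix s assume "s \<in> carrier B"
  then have "s \<in> lspan k T0 ?P"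
    using K.tensor_generates[OF H_module RL_module gens_generate generates_carrier] by (auto simp: B_simps generates_def)
  then show "s \<in> lspan L B (\<iota> ` gens)"
  proof induction
    case zero
    show ?case using lspan_zero[of B] by (simp add: B_simps)
  next
    case (base s)
    then obtain x c where "x \<in> gens" "c \<in> carrier L" "s = p0 x c" by auto
    then show ?case using gens by (auto simp: p0_eq subset_iff intro!: lspan_smult[OF _ lspan_base])
  next
    case (add s t)
    then show ?case using lspan_add[of s L B _ t] by (simp add: B_simps)
  next
    case (smult a s)
    then have "a \<odot>\<^bsub>T0\<^esub> s = a \<odot>\<^bsub>B\<^esub> s" using lspan_closed[OF T0_module P] by (simp add: B_smult_k)
    then show ?case using smult by (simp add: lspan_smult k_L)
  qed
qed

lemma RL_mult_bilinear: "bilinear k RL RL RL (monoid.mult RL)"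
  using smult_bilinear[OF RL_module_L] by simp

lemmas T0_mult_bilinear = K.tensor_algebra_mult_bilinear[OF H_module RL_module mult_bilinear RL_mult_bilinear]

lemma B_mult_p0:
  "\<lbrakk>x \<in> carrier H; c \<in> carrier L; y \<in> carrier H; d \<in> carrier L\<rbrakk> \<Longrightarrow> p0 x c \<otimes>\<^bsub>B\<^esub> p0 y d = p0 (x \<otimes>\<^bsub>H\<^esub> y) (c \<otimes>\<^bsub>L\<^esub> d)"
  unfolding B_simps
  using K.tensor_algebra_mult_pure[OF H_module RL_module mult_bilinear RL_mult_bilinear, of x c y d] by simp

lemma B_mult_smult:
  assumes c: "c \<in> carrier L" and st: "s \<in> carrier T0" "t \<in> carrier T0"
  shows "(c \<odot>\<^bsub>B\<^esub> s) \<otimes>\<^bsub>B\<^esub> t = c \<odot>\<^bsub>B\<^esub> (s \<otimes>\<^bsub>B\<^esub> t)" "s \<otimes>\<^bsub>B\<^esub> (c \<odot>\<^bsub>B\<^esub> t) = c \<odot>\<^bsub>B\<^esub> (s \<otimes>\<^bsub>B\<^esub> t)"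
proof -
  note mb = T0_mult_bilinear[folded B_simps(5)]
  note gen = K.tensor_generates[OF H_module RL_module generates_carrier generates_carrier]
  note r = bilinear_compose_hom[OF mb smultB_hom[OF c]]
  show "(c \<odot>\<^bsub>B\<^esub> s) \<otimes>\<^bsub>B\<^esub> t = c \<odot>\<^bsub>B\<^esub> (s \<otimes>\<^bsub>B\<^esub> t)"
    by (rule bilinear_eqI[OF gen gen T0_module T0_module T0_module
          bilinear_precompose[OF mb smultB_hom[OF c] module_hom_id] r _ st])
      (use c in \<open>auto simp: smultB_p0 B_mult_p0 L.m_assoc\<close>)
  show "s \<otimes>\<^bsub>B\<^esub> (c \<odot>\<^bsub>B\<^esub> t) = c \<odot>\<^bsub>B\<^esub> (s \<otimes>\<^bsub>B\<^esub> t)"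
    by (rule bilinear_eqI[OF gen gen T0_module T0_module T0_module
          bilinear_precompose[OF mb module_hom_id smultB_hom[OF c]] r _ st])
      (use c in \<open>auto simp: smultB_p0 B_mult_p0 L.m_lcomm\<close>)
qed

lemma B_mult_bilinear: "bilinear L B B B (monoid.mult B)"
proof -
  note mb = T0_mult_bilinear[folded B_simps(5)]
  note mc = bilinear_closed[OF mb]
  show ?thesis
  proof (rule bilinearI; rule module_homI)
    show "s \<otimes>\<^bsub>B\<^esub> t \<in> carrier B" if "s \<in> carrier B" "t \<in> carrier B" for s t
      using mc that by (simp add: B_simps(1))
    then show "s \<otimes>\<^bsub>B\<^esub> t \<in> carrier B" if "t \<in> carrier B" "s \<in> carrier B" for s t using that by simp
    show "(s \<oplus>\<^bsub>B\<^esub> s') \<otimes>\<^bsub>B\<^esub> t = s \<otimes>\<^bsub>B\<^esub> t \<oplus>\<^bsub>B\<^esub> s' \<otimes>\<^bsub>B\<^esub> t"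
      if "t \<in> carrier B" "s \<in> carrier B" "s' \<in> carrier B" for s s' t
      using module_hom_add[OF bilinear_left[OF mb], of t s s'] that by (simp add: B_simps(1,3))
    show "t \<otimes>\<^bsub>B\<^esub> (s \<oplus>\<^bsub>B\<^esub> s') = t \<otimes>\<^bsub>B\<^esub> s \<oplus>\<^bsub>B\<^esub> t \<otimes>\<^bsub>B\<^esub> s'"
      if "t \<in> carrier B" "s \<in> carrier B" "s' \<in> carrier B" for s s' t
      using module_hom_add[OF bilinear_right[OF mb], of t s s'] that by (simp add: B_simps(1,3))
    show "(c \<odot>\<^bsub>B\<^esub> s) \<otimes>\<^bsub>B\<^esub> t = c \<odot>\<^bsub>B\<^esub> (s \<otimes>\<^bsub>B\<^esub> t)"
      if "t \<in> carrier B" "c \<in> carrier L" "s \<in> carrier B" for c s t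
      using that by (simp add: B_mult_smult B_simps(1))
    show "t \<otimes>\<^bsub>B\<^esub> (c \<odot>\<^bsub>B\<^esub> s) = c \<odot>\<^bsub>B\<^esub> (t \<otimes>\<^bsub>B\<^esub> s)"
      if "t \<in> carrier B" "c \<in> carrier L" "s \<in> carrier B" for c s t
      using that by (simp add: B_mult_smult B_simps(1))
  qed
qed

lemma \<iota>_mult: "\<lbrakk>x \<in> carrier H; y \<in> carrier H\<rbrakk> \<Longrightarrow> \<iota> x \<otimes>\<^bsub>B\<^esub> \<iota> y = \<iota> (x \<otimes>\<^bsub>H\<^esub> y)"
  by (simp add: \<iota>_def B_mult_p0)

lemma \<iota>_smult: "\<lbrakk>a \<in> carrier k; x \<in> carrier H\<rbrakk> \<Longrightarrow> \<iota> (a \<odot>\<^bsub>H\<^esub> x) = a \<odot>\<^bsub>B\<^esub> \<iota> x"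
  by (rule module_hom_smult[OF \<iota>_hom])

lemma B_one: "\<one>\<^bsub>B\<^esub> = \<iota> \<one>\<^bsub>H\<^esub>"
  by (simp add: B_simps \<iota>_def)

definition u :: "'g \<Rightarrow> int \<Rightarrow> (('g \<times> nat \<Rightarrow> 'k) \<times> 'k \<Rightarrow> 'k) set"
  where "u \<sigma> n = \<iota> (U \<sigma> n)"

lemma u_closed [simp]: "\<sigma> \<in> carrier G \<Longrightarrow> u \<sigma> n \<in> carrier B"
  by (simp add: u_def)

lemma B_generates_u: "generates L B ((\<lambda>(\<sigma>, n). u \<sigma> n) ` (carrier G \<times> Z))"
proof -
  have "\<iota> ` gens = (\<lambda>(\<sigma>, n). u \<sigma> n) ` (carrier G \<times> Z)"
    unfolding gens_def image_image by (rule image_cong) (auto simp: u_def)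
  then show ?thesis using B_generates by simp
qed

lemma u_mult:
  "\<lbrakk>\<sigma> \<in> carrier G; \<tau> \<in> carrier G\<rbrakk> \<Longrightarrow> u \<sigma> n \<otimes>\<^bsub>B\<^esub> u \<tau> n = upL (\<alpha> (\<sigma>, \<tau>)) n \<odot>\<^bsub>B\<^esub> u (\<sigma> \<otimes>\<^bsub>G\<^esub> \<tau>) n"
  by (simp add: u_def \<iota>_mult U_mult \<iota>_smult \<alpha>_unit unit_pow_k_L[symmetric])

lemma u_mult_distinct:
  "\<lbrakk>\<sigma> \<in> carrier G; \<tau> \<in> carrier G; n mod int m \<noteq> n' mod int m\<rbrakk> \<Longrightarrow> u \<sigma> n \<otimes>\<^bsub>B\<^esub> u \<tau> n' = \<zero>\<^bsub>B\<^esub>"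
  by (simp add: u_def \<iota>_mult U_mult_distinct module_hom_zero[OF H_module B_module_k \<iota>_hom])

lemma u_shift: "\<sigma> \<in> carrier G \<Longrightarrow> u \<sigma> (n + int m * q) = upL (f \<sigma>) q \<odot>\<^bsub>B\<^esub> u \<sigma> n"
  by (simp add: u_def U_shift \<iota>_smult f_unit unit_pow_k_L[symmetric])

lemma B_one_sum: "\<one>\<^bsub>B\<^esub> = (\<Oplus>\<^bsub>B\<^esub>n\<in>Z. upL (\<alpha> (\<one>\<^bsub>G\<^esub>, \<one>\<^bsub>G\<^esub>)) (- n) \<odot>\<^bsub>B\<^esub> u \<one>\<^bsub>G\<^esub> n)"
proof -
  have "\<one>\<^bsub>B\<^esub> = (\<Oplus>\<^bsub>B\<^esub>n\<in>Z. \<iota> (U_unit n))"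
    unfolding B_one H_field_eqs(2) by (rule module_hom_finsum[OF H_module B_module_k \<iota>_hom]) simp
  then show ?thesis by (simp add: U_unit_eq \<iota>_smult \<alpha>_unit u_def) (simp add: unit_pow_k_L \<alpha>_unit)
qed

lemma B_homI:
  assumes "module L N" "h \<in> module_hom L B N" "h' \<in> module_hom L B N"
    and "\<And>\<sigma> n. \<lbrakk>\<sigma> \<in> carrier G; n \<in> Z\<rbrakk> \<Longrightarrow> h (u \<sigma> n) = h' (u \<sigma> n)" "s \<in> carrier B"
  shows "h s = h' s"
  by (rule hom_eqI[OF B_generates_u B_module assms(1-3) _ assms(5)]) (auto intro: assms(4))

text \<open>Linear maps over \<open>L\<close> out of the extended algebra come from linear maps over \<open>k\<close> out of \<open>H\<close>. The
  comultiplication is of this form, and the isomorphism onto the group algebra is defined in this way.\<close>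

lemma scalar_extension:
  assumes N: "module L N" and h: "h \<in> module_hom k H N"
  shows "tensor_lift k N (\<lambda>x c. c \<odot>\<^bsub>N\<^esub> h x) \<in> module_hom L B N"
    and "x \<in> carrier H \<Longrightarrow> tensor_lift k N (\<lambda>x c. c \<odot>\<^bsub>N\<^esub> h x) (\<iota> x) = h x"
proof -
  interpret N: module L N by (rule N)
  have b: "bilinear k H RL N (\<lambda>x c. c \<odot>\<^bsub>N\<^esub> h x)"
    by (rule bilinear_flip, rule bilinear_precompose[OF smult_bilinear[OF N] module_hom_id h])
  note p = K.tensor_lift_pure[OF H_module RL_module module_restrict[OF N] b]
  show "tensor_lift k N (\<lambda>x c. c \<odot>\<^bsub>N\<^esub> h x) \<in> module_hom L B N"
    by (rule L_linearI[OF N K.tensor_lift_hom[OF H_module RL_module module_restrict[OF N] b]])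
      (simp add: p module_hom_closedD[OF h] N.smult_assoc1)
  show "x \<in> carrier H \<Longrightarrow> tensor_lift k N (\<lambda>x c. c \<odot>\<^bsub>N\<^esub> h x) (\<iota> x) = h x"
    by (simp add: \<iota>_def p module_hom_closedD[OF h])
qed

subsection \<open>The coalgebra over the extension field\<close>

abbreviation TB where "TB \<equiv> tensor_module L B B"
abbreviation ptB where "ptB \<equiv> pure_tensor L B B"

lemma TB_module: "module L TB" by (rule L.tensor_is_module[OF B_module B_module])
lemmas ptB_bilinear = L.pure_tensor_bilinear[OF B_module B_module]
lemmas ptB_closed [simp] = L.pure_tensor_closed[OF B_module B_module]

sublocale TB: module L TB by (rule TB_module)

lemma B_coalgebra_simps:
  "comult B = tensor_lift k TB (\<lambda>x c. c \<odot>\<^bsub>TB\<^esub> tensor_lift k TB (\<lambda>x y. ptB (\<iota> x) (\<iota> y)) (comult H x))"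
  "counit B = tensor_lift k RL (\<lambda>x c. counit H x \<otimes>\<^bsub>L\<^esub> c)"
  "antipode B = tensor_map k H RL (antipode H) id"
proof -
  let ?BA = "base_change_algebra k L H"
  have c: "tensor_module L ?BA ?BA = TB" "pure_tensor L ?BA ?BA = ptB"
    by (rule tensor_cong; simp add: base_change_def Let_def)+
  show "comult B = tensor_lift k TB (\<lambda>x c. c \<odot>\<^bsub>TB\<^esub> tensor_lift k TB (\<lambda>x y. ptB (\<iota> x) (\<iota> y)) (comult H x))"
    unfolding c[symmetric] \<iota>_def by (simp add: base_change_def Let_def)
qed (simp_all add: base_change_def Let_def)

lemma \<iota>\<iota>_bilinear: "bilinear k H H TB (\<lambda>x y. ptB (\<iota> x) (\<iota> y))"
  by (rule bilinear_precompose[OF bilinear_restrict[OF ptB_bilinear] \<iota>_hom \<iota>_hom])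

lemma comultB_hom: "comult B \<in> module_hom L B TB"
  and comultB_u: "\<sigma> \<in> carrier G \<Longrightarrow> comult B (u \<sigma> n) = (\<Oplus>\<^bsub>TB\<^esub>a\<in>Z. ptB (u \<sigma> a) (u \<sigma> (n - a)))"
proof -
  note TBk = module_restrict[OF TB_module]
  note J = K.tensor_lift_hom[OF H_module H_module TBk \<iota>\<iota>_bilinear]
  note Jc = module_hom_compose[OF comult_hom' J]
  show "comult B \<in> module_hom L B TB"
    unfolding B_coalgebra_simps by (rule scalar_extension(1)[OF TB_module Jc])
  assume \<sigma>: "\<sigma> \<in> carrier G"
  then have "comult B (u \<sigma> n) = tensor_lift k TB (\<lambda>x y. ptB (\<iota> x) (\<iota> y)) (comult H (U \<sigma> n))"
    unfolding B_coalgebra_simps u_def by (intro scalar_extension(2)[OF TB_module Jc]) simp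
  also have "\<dots> = (\<Oplus>\<^bsub>TB\<^esub>a\<in>Z. ptB (u \<sigma> a) (u \<sigma> (n - a)))"
    unfolding hom_comult_U[OF TBk J \<sigma>]
    using \<sigma> by (simp add: K.tensor_lift_pure[OF H_module H_module TBk \<iota>\<iota>_bilinear] u_def)
  finally show "comult B (u \<sigma> n) = \<dots>" .
qed

lemma counitB_hom: "counit B \<in> module_hom L B RL"
  and counitB_\<iota>: "x \<in> carrier H \<Longrightarrow> counit B (\<iota> x) = counit H x"
proof -
  have "counit H \<in> module_hom k H RL"
    using counit_hom' by (auto simp: module_hom_def k_ops k_L Pi_iff)
  then have b: "bilinear k H RL RL (\<lambda>x c. counit H x \<otimes>\<^bsub>L\<^esub> c)"
    using bilinear_precompose[OF RL_mult_bilinear _ module_hom_id] by simp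
  note p = K.tensor_lift_pure[OF H_module RL_module RL_module b]
  have cl: "x \<in> carrier H \<Longrightarrow> counit H x \<in> carrier L" for x by (simp add: k_L)
  show "counit B \<in> module_hom L B RL"
    unfolding B_coalgebra_simps
    by (rule L_linearI[OF RL_module_L K.tensor_lift_hom[OF H_module RL_module RL_module b]])
      (simp add: p cl L.m_lcomm)
  show "x \<in> carrier H \<Longrightarrow> counit B (\<iota> x) = counit H x"
    unfolding B_coalgebra_simps by (simp add: \<iota>_def p cl)
qed

lemma antipodeB_hom: "antipode B \<in> module_hom L B B"
  and antipodeB_\<iota>: "x \<in> carrier H \<Longrightarrow> antipode B (\<iota> x) = \<iota> (antipode H x)"
proof -
  note h = K.tensor_map_hom[OF H_module RL_module H_module RL_module antipode_hom' module_hom_id']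
  note p = K.tensor_map_pure[OF H_module RL_module H_module RL_module antipode_hom' module_hom_id']
  show "antipode B \<in> module_hom L B B"
    unfolding B_coalgebra_simps
    by (rule L_linearI[OF B_module hom_to_B[OF h]]) (simp add: p smultB_p0)
  show "x \<in> carrier H \<Longrightarrow> antipode B (\<iota> x) = \<iota> (antipode H x)"
    unfolding B_coalgebra_simps by (simp add: \<iota>_def p)
qed

end

context twisting_extension
begin

section \<open>The central extension\<close>

definition roots :: "'k set" where "roots = {z \<in> carrier L. z [^]\<^bsub>L\<^esub> m = \<one>\<^bsub>L\<^esub>}"

abbreviation Ghat :: "('k \<times> 'g) monoid" where "Ghat \<equiv> hat_group L G m \<alpha> g"

lemmas roots_unit = L.root_of_unity_unit[OF m_pos roots_def card_roots[folded roots_def]]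
lemmas roots_unit_pow = L.root_of_unity_unit_pow[OF m_pos roots_def card_roots[folded roots_def]]
lemmas roots_sum_powers = L.sum_powers_of_root[OF m_pos roots_def card_roots[folded roots_def]]
lemmas roots_sum = L.sum_over_roots[OF m_pos roots_def card_roots[folded roots_def]]

lemma finite_roots: "finite roots"
  unfolding roots_def by (rule L.card_roots_of_unity_le(1)[OF m_pos])

lemma roots_iff: "z \<in> roots \<longleftrightarrow> z \<in> Units L \<and> upL z (int m) = \<one>\<^bsub>L\<^esub>"
proof
  show "z \<in> roots \<Longrightarrow> z \<in> Units L \<and> upL z (int m) = \<one>\<^bsub>L\<^esub>"
    using roots_unit roots_unit_pow[of z 1] by simp
  show "z \<in> Units L \<and> upL z (int m) = \<one>\<^bsub>L\<^esub> \<Longrightarrow> z \<in> roots"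
    by (auto simp: roots_def L.unit_pow_int L.Units_closed)
qed

lemma \<alpha>_unit_L: "\<lbrakk>\<sigma> \<in> carrier G; \<tau> \<in> carrier G\<rbrakk> \<Longrightarrow> \<alpha> (\<sigma>, \<tau>) \<in> Units L"
  by (rule Units_k_L[OF \<alpha>_unit])

lemma f_unit_L: "\<sigma> \<in> carrier G \<Longrightarrow> f \<sigma> \<in> Units L"
  by (rule Units_k_L[OF f_unit])

lemma \<alpha>_pow_unit_L:
  assumes "\<sigma> \<in> carrier G" "\<tau> \<in> carrier G"
  shows "upL (f \<sigma>) (- q) \<otimes>\<^bsub>L\<^esub> upL (f \<tau>) (- q) \<otimes>\<^bsub>L\<^esub> upL (\<alpha> (\<sigma>, \<tau>)) (int m * q) = upL (f (\<sigma> \<otimes>\<^bsub>G\<^esub> \<tau>)) (- q)"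
proof -
  note [simp] = assms \<alpha>_unit_L f_unit_L
  let ?A = "upL (\<alpha> (\<sigma>, \<tau>)) (int m * q)" and ?s = "upL (f \<sigma>)" and ?t = "upL (f \<tau>)"
    and ?p = "upL (f (\<sigma> \<otimes>\<^bsub>G\<^esub> \<tau>))"
  have 1: "?A \<otimes>\<^bsub>L\<^esub> ?p q = ?s q \<otimes>\<^bsub>L\<^esub> ?t q"
    using \<alpha>_pow_unit[of \<sigma> \<tau> q] by (simp add: unit_pow_k_L \<alpha>_unit f_unit k_ops)
  have "?A = (?A \<otimes>\<^bsub>L\<^esub> ?p q) \<otimes>\<^bsub>L\<^esub> ?p (- q)" by (simp add: L.m_assoc)
  then have A: "?A = ?s q \<otimes>\<^bsub>L\<^esub> ?t q \<otimes>\<^bsub>L\<^esub> ?p (- q)" unfolding 1 .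
  have "?s (- q) \<otimes>\<^bsub>L\<^esub> ?t (- q) \<otimes>\<^bsub>L\<^esub> ?A
      = (?s (- q) \<otimes>\<^bsub>L\<^esub> ?s q) \<otimes>\<^bsub>L\<^esub> (?t (- q) \<otimes>\<^bsub>L\<^esub> ?t q) \<otimes>\<^bsub>L\<^esub> ?p (- q)"
    unfolding A by (simp add: L.m_ac del: L.unit_pow_neg_cancel)
  then show ?thesis by simp
qed

text \<open>Under \<open>(z, \<sigma>) \<mapsto> \<kappa>(z, \<sigma>) U\<^sub>\<sigma>\<close> the group embeds into the units of the twisted group
  algebra over the extension field; this is how all computations in it are made.\<close>

definition \<kappa> :: "'k \<times> 'g \<Rightarrow> 'k" where "\<kappa> h = fst h \<otimes>\<^bsub>L\<^esub> inv\<^bsub>L\<^esub> (g (snd h))"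

lemma hat_carrier: "carrier Ghat = roots \<times> carrier G"
proof -
  have "carrier (roots_of_unity_group L m) = roots"
    using roots_unit by (auto simp: roots_of_unity_group_def roots_def units_of_carrier L.Units_closed)
  then show ?thesis by (simp add: hat_group_def central_extension_def)
qed

definition \<beta> :: "'g \<Rightarrow> 'g \<Rightarrow> 'k"
  where "\<beta> \<sigma> \<tau> = \<alpha> (\<sigma>, \<tau>) \<otimes>\<^bsub>L\<^esub> (g (\<sigma> \<otimes>\<^bsub>G\<^esub> \<tau>) \<otimes>\<^bsub>L\<^esub> (inv\<^bsub>L\<^esub> (g \<sigma>) \<otimes>\<^bsub>L\<^esub> inv\<^bsub>L\<^esub> (g \<tau>)))"

lemma hat_cocycle:
  assumes "\<sigma> \<in> carrier G" "\<tau> \<in> carrier G"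
  shows "\<alpha> (\<sigma>, \<tau>) \<otimes>\<^bsub>L\<^esub> inv\<^bsub>units_of L\<^esub> (coboundary G (units_of L) g (\<sigma>, \<tau>)) = \<beta> \<sigma> \<tau>"
proof -
  note [simp] = assms g_unit L.Units_closed[OF g_unit] L.Units_inv_closed[OF g_unit]
  let ?s = "g \<sigma>" and ?t = "g \<tau>" and ?p = "g (\<sigma> \<otimes>\<^bsub>G\<^esub> \<tau>)"
  have c: "coboundary G (units_of L) g (\<sigma>, \<tau>) = ?s \<otimes>\<^bsub>L\<^esub> ?t \<otimes>\<^bsub>L\<^esub> inv\<^bsub>L\<^esub> ?p"
    by (simp add: coboundary_def units_of_mult L.units_of_inv)
  have "(?s \<otimes>\<^bsub>L\<^esub> ?t \<otimes>\<^bsub>L\<^esub> inv\<^bsub>L\<^esub> ?p) \<otimes>\<^bsub>L\<^esub> (?p \<otimes>\<^bsub>L\<^esub> (inv\<^bsub>L\<^esub> ?s \<otimes>\<^bsub>L\<^esub> inv\<^bsub>L\<^esub> ?t))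
    = (?s \<otimes>\<^bsub>L\<^esub> inv\<^bsub>L\<^esub> ?s) \<otimes>\<^bsub>L\<^esub> (?t \<otimes>\<^bsub>L\<^esub> inv\<^bsub>L\<^esub> ?t) \<otimes>\<^bsub>L\<^esub> (?p \<otimes>\<^bsub>L\<^esub> inv\<^bsub>L\<^esub> ?p)"
    by (simp add: L.m_ac del: L.Units_r_inv L.Units_l_inv)
  also have "\<dots> = \<one>\<^bsub>L\<^esub>" by simp
  finally have "inv\<^bsub>L\<^esub> (?s \<otimes>\<^bsub>L\<^esub> ?t \<otimes>\<^bsub>L\<^esub> inv\<^bsub>L\<^esub> ?p) = ?p \<otimes>\<^bsub>L\<^esub> (inv\<^bsub>L\<^esub> ?s \<otimes>\<^bsub>L\<^esub> inv\<^bsub>L\<^esub> ?t)"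
    by (intro L.comm_inv_char) simp_all
  then show ?thesis by (simp add: c L.units_of_inv \<beta>_def)
qed

lemma \<beta>_unit: "\<lbrakk>\<sigma> \<in> carrier G; \<tau> \<in> carrier G\<rbrakk> \<Longrightarrow> \<beta> \<sigma> \<tau> \<in> Units L"
  by (simp add: \<beta>_def \<alpha>_unit_L g_unit)

lemma hat_mult:
  assumes "h \<in> carrier Ghat" "h' \<in> carrier Ghat"
  shows "h \<otimes>\<^bsub>Ghat\<^esub> h' = (fst h \<otimes>\<^bsub>L\<^esub> fst h' \<otimes>\<^bsub>L\<^esub> \<beta> (snd h) (snd h'), snd h \<otimes>\<^bsub>G\<^esub> snd h')"
  using assms hat_cocycle
  by (auto simp: hat_carrier) 
    (simp add: hat_group_def central_extension_def roots_of_unity_group_def units_of_mult)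

lemma \<kappa>_unit [simp]: "h \<in> carrier Ghat \<Longrightarrow> \<kappa> h \<in> Units L"
  by (auto simp: \<kappa>_def hat_carrier roots_unit g_unit)

lemma \<kappa>_mult':
  assumes c: "z \<in> Units L" "w \<in> Units L" "\<sigma> \<in> carrier G" "\<tau> \<in> carrier G"
  shows "\<kappa> (z \<otimes>\<^bsub>L\<^esub> w \<otimes>\<^bsub>L\<^esub> \<beta> \<sigma> \<tau>, \<sigma> \<otimes>\<^bsub>G\<^esub> \<tau>) = \<kappa> (z, \<sigma>) \<otimes>\<^bsub>L\<^esub> \<kappa> (w, \<tau>) \<otimes>\<^bsub>L\<^esub> \<alpha> (\<sigma>, \<tau>)"
proof -
  note [simp] = c g_unit L.Units_closed[OF g_unit] L.Units_inv_closed[OF g_unit]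
    L.Units_closed[OF \<alpha>_unit_L] L.Units_closed[OF c(1)] L.Units_closed[OF c(2)]
  let ?p = "g (\<sigma> \<otimes>\<^bsub>G\<^esub> \<tau>)"
  have "\<kappa> (z \<otimes>\<^bsub>L\<^esub> w \<otimes>\<^bsub>L\<^esub> \<beta> \<sigma> \<tau>, \<sigma> \<otimes>\<^bsub>G\<^esub> \<tau>)
    = (\<kappa> (z, \<sigma>) \<otimes>\<^bsub>L\<^esub> \<kappa> (w, \<tau>) \<otimes>\<^bsub>L\<^esub> \<alpha> (\<sigma>, \<tau>)) \<otimes>\<^bsub>L\<^esub> (?p \<otimes>\<^bsub>L\<^esub> inv\<^bsub>L\<^esub> ?p)"
    unfolding \<kappa>_def \<beta>_def fst_conv snd_conv by (simp add: L.m_ac del: L.Units_r_inv L.Units_l_inv)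
  then show ?thesis by (simp add: \<kappa>_def)
qed

lemma \<kappa>_pow:
  assumes "z \<in> Units L" "\<sigma> \<in> carrier G"
  shows "upL (\<kappa> (z, \<sigma>)) (int m * q) = upL z (int m * q) \<otimes>\<^bsub>L\<^esub> upL (f \<sigma>) (- q)"
proof -
  have "upL (inv\<^bsub>L\<^esub> (g \<sigma>)) (int m * q) = upL (g \<sigma>) (int m * (- q))"
    using assms g_unit by (simp add: L.unit_pow_inv)
  also have "\<dots> = upL (f \<sigma>) (- q)"
    using assms g_unit g_pow by (subst L.unit_pow_mult) (simp_all add: L.unit_pow_int)
  finally show ?thesis using assms g_unit by (simp add: \<kappa>_def L.unit_pow_mult_base)
qed

lemma \<kappa>_hat_pow: "h \<in> carrier Ghat \<Longrightarrow> upL (\<kappa> h) (int m * q) = upL (f (snd h)) (- q)"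
  using \<kappa>_pow[of "fst h" "snd h" q] roots_unit_pow[of "fst h" q]
  by (auto simp: hat_carrier roots_unit f_unit_L)

text \<open>A unit \<open>z\<close> is an \<open>m\<close>-th root of unity iff \<open>\<kappa>(z,
  \<sigma>)\<^sup>m = f(\<sigma>)\<^sup>-\<^sup>1\<close>, because \<open>g(\<sigma>)\<^sup>m =
  f(\<sigma>)\<close>.\<close>

lemma hat_iff:
  assumes z: "z \<in> Units L" and \<sigma>: "\<sigma> \<in> carrier G"
  shows "(z, \<sigma>) \<in> carrier Ghat \<longleftrightarrow> upL (\<kappa> (z, \<sigma>)) (int m) = upL (f \<sigma>) (- 1)"
proof -
  have u: "upL (f \<sigma>) (- 1) \<in> Units L" using \<sigma> f_unit_L by simp
  have "upL (\<kappa> (z, \<sigma>)) (int m) = upL (f \<sigma>) (- 1) \<otimes>\<^bsub>L\<^esub> upL z (int m)"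
    using \<kappa>_pow[OF z \<sigma>, of 1] z u by (simp add: L.m_comm L.Units_closed)
  moreover have "upL (f \<sigma>) (- 1) = upL (f \<sigma>) (- 1) \<otimes>\<^bsub>L\<^esub> \<one>\<^bsub>L\<^esub>" using u by (simp add: L.Units_closed)
  ultimately have "upL (\<kappa> (z, \<sigma>)) (int m) = upL (f \<sigma>) (- 1) \<longleftrightarrow> upL z (int m) = \<one>\<^bsub>L\<^esub>"
    using L.Units_l_cancel[OF u, of "upL z (int m)" "\<one>\<^bsub>L\<^esub>"] z by simp
  then show ?thesis using z \<sigma> by (simp add: hat_carrier roots_iff)
qed

text \<open>Since \<open>\<kappa>\<close> and the second entry determine an element, the group laws follow
  from the cocycle identity of \<open>\<alpha>\<close>, without computing with the quotient cocycle.\<close>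

lemma hat_eqI:
  assumes "h \<in> carrier Ghat" "h' \<in> carrier Ghat" "snd h = snd h'" "\<kappa> h = \<kappa> h'"
  shows "h = h'"
proof -
  have "inv\<^bsub>L\<^esub> (g (snd h)) \<otimes>\<^bsub>L\<^esub> fst h = inv\<^bsub>L\<^esub> (g (snd h)) \<otimes>\<^bsub>L\<^esub> fst h'"
    using assms L.Units_closed[OF roots_unit] L.Units_inv_closed[OF g_unit]
    by (auto simp: \<kappa>_def hat_carrier L.m_comm)
  then have "fst h = fst h'"
    using assms L.Units_closed[OF roots_unit] g_unit by (auto simp: hat_carrier L.Units_l_cancel)
  then show ?thesis using assms(3) by (simp add: prod_eq_iff)
qed

lemma hat_closed:
  assumes "h \<in> carrier Ghat" "h' \<in> carrier Ghat"
  shows "h \<otimes>\<^bsub>Ghat\<^esub> h' \<in> carrier Ghat"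
proof -
  obtain z \<sigma> w \<tau> where h: "h = (z, \<sigma>)" "h' = (w, \<tau>)" by (cases h, cases h')
  have c: "z \<in> Units L" "w \<in> Units L" "\<sigma> \<in> carrier G" "\<tau> \<in> carrier G"
    using assms h roots_unit by (auto simp: hat_carrier)
  have k: "\<kappa> (z, \<sigma>) \<in> Units L" "\<kappa> (w, \<tau>) \<in> Units L" using assms h by simp_all
  have p: "upL (\<kappa> (z, \<sigma>)) (int m) = upL (f \<sigma>) (- 1)" "upL (\<kappa> (w, \<tau>)) (int m) = upL (f \<tau>) (- 1)"
    using assms h hat_iff c by auto
  have "upL (\<kappa> (z \<otimes>\<^bsub>L\<^esub> w \<otimes>\<^bsub>L\<^esub> \<beta> \<sigma> \<tau>, \<sigma> \<otimes>\<^bsub>G\<^esub> \<tau>)) (int m) = upL (f (\<sigma> \<otimes>\<^bsub>G\<^esub> \<tau>)) (- 1)"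
    using k c \<alpha>_pow_unit_L[OF c(3,4), of 1] by (simp add: \<kappa>_mult' L.unit_pow_mult_base \<alpha>_unit_L p)
  then show ?thesis
    using assms h c by (simp add: hat_mult hat_iff \<beta>_unit)
qed

lemma \<kappa>_mult:
  assumes "h \<in> carrier Ghat" "h' \<in> carrier Ghat"
  shows "\<kappa> (h \<otimes>\<^bsub>Ghat\<^esub> h') = \<kappa> h \<otimes>\<^bsub>L\<^esub> \<kappa> h' \<otimes>\<^bsub>L\<^esub> \<alpha> (snd h, snd h')"
  using assms \<kappa>_mult'[of "fst h" "fst h'" "snd h" "snd h'"] roots_unit
  by (auto simp: hat_mult) (auto simp: hat_carrier)

lemma snd_mult: "\<lbrakk>h \<in> carrier Ghat; h' \<in> carrier Ghat\<rbrakk> \<Longrightarrow> snd (h \<otimes>\<^bsub>Ghat\<^esub> h') = snd h \<otimes>\<^bsub>G\<^esub> snd h'"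
  by (simp add: hat_mult)

lemma snd_closed [simp]: "h \<in> carrier Ghat \<Longrightarrow> snd h \<in> carrier G"
  by (auto simp: hat_carrier)

lemma hat_one: "\<one>\<^bsub>Ghat\<^esub> \<in> carrier Ghat" "snd \<one>\<^bsub>Ghat\<^esub> = \<one>\<^bsub>G\<^esub>" "\<kappa> \<one>\<^bsub>Ghat\<^esub> = inv\<^bsub>L\<^esub> (\<alpha> (\<one>\<^bsub>G\<^esub>, \<one>\<^bsub>G\<^esub>))"
proof -
  let ?C = "roots_of_unity_group L m" and ?b = "\<beta> \<one>\<^bsub>G\<^esub> \<one>\<^bsub>G\<^esub>" and ?a = "\<alpha> (\<one>\<^bsub>G\<^esub>, \<one>\<^bsub>G\<^esub>)" and ?g = "g \<one>\<^bsub>G\<^esub>"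
  note [simp] = g_unit L.Units_closed[OF g_unit] L.Units_inv_closed[OF g_unit]
    L.Units_closed[OF \<alpha>_unit_L] \<alpha>_unit_L \<beta>_unit L.Units_closed[OF \<beta>_unit] L.Units_inv_closed[OF \<beta>_unit] f_unit_L
  have bg: "?b \<otimes>\<^bsub>L\<^esub> ?g = ?a"
  proof -
    have "?b \<otimes>\<^bsub>L\<^esub> ?g = ?a \<otimes>\<^bsub>L\<^esub> ((?g \<otimes>\<^bsub>L\<^esub> inv\<^bsub>L\<^esub> ?g) \<otimes>\<^bsub>L\<^esub> (?g \<otimes>\<^bsub>L\<^esub> inv\<^bsub>L\<^esub> ?g))"
      by (simp add: \<beta>_def L.m_ac del: L.Units_r_inv L.Units_l_inv)
    then show ?thesis by simp
  qed
  have bm: "?b \<in> roots"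
  proof -
    have 1: "(\<one>\<^bsub>L\<^esub>, \<one>\<^bsub>G\<^esub>) \<in> carrier Ghat" by (simp add: hat_carrier roots_def)
    have "(\<one>\<^bsub>L\<^esub>, \<one>\<^bsub>G\<^esub>) \<otimes>\<^bsub>Ghat\<^esub> (\<one>\<^bsub>L\<^esub>, \<one>\<^bsub>G\<^esub>) \<in> carrier Ghat" by (rule hat_closed[OF 1 1])
    then show ?thesis by (simp add: hat_mult 1) (simp add: hat_carrier)
  qed
  have im: "inv\<^bsub>L\<^esub> ?b \<in> roots"
    using roots_unit_pow[OF bm, of "- 1"] by (simp add: roots_iff L.unit_pow_inv)
  have "inv\<^bsub>?C\<^esub> ?b = inv\<^bsub>L\<^esub> ?b"
    unfolding m_inv_def[of ?C]
  proof (rule the_equality)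
    show "inv\<^bsub>L\<^esub> ?b \<in> carrier ?C \<and> ?b \<otimes>\<^bsub>?C\<^esub> inv\<^bsub>L\<^esub> ?b = \<one>\<^bsub>?C\<^esub> \<and> inv\<^bsub>L\<^esub> ?b \<otimes>\<^bsub>?C\<^esub> ?b = \<one>\<^bsub>?C\<^esub>"
      using im roots_unit[OF im]
      by (auto simp: roots_of_unity_group_def units_of_carrier units_of_mult units_of_one roots_def)
    fix y assume "y \<in> carrier ?C \<and> ?b \<otimes>\<^bsub>?C\<^esub> y = \<one>\<^bsub>?C\<^esub> \<and> y \<otimes>\<^bsub>?C\<^esub> ?b = \<one>\<^bsub>?C\<^esub>"
    then show "y = inv\<^bsub>L\<^esub> ?b"
      using L.comm_inv_char[of ?b y]
      by (auto simp: roots_of_unity_group_def units_of_carrier units_of_mult units_of_one L.Units_closed)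
  qed
  then have one: "\<one>\<^bsub>Ghat\<^esub> = (inv\<^bsub>L\<^esub> ?b, \<one>\<^bsub>G\<^esub>)"
    using hat_cocycle[of "\<one>\<^bsub>G\<^esub>" "\<one>\<^bsub>G\<^esub>"] by (simp add: hat_group_def central_extension_def)
  show "\<one>\<^bsub>Ghat\<^esub> \<in> carrier Ghat" "snd \<one>\<^bsub>Ghat\<^esub> = \<one>\<^bsub>G\<^esub>" using im by (simp_all add: one hat_carrier)
  have "?a \<otimes>\<^bsub>L\<^esub> \<kappa> \<one>\<^bsub>Ghat\<^esub> = (?b \<otimes>\<^bsub>L\<^esub> inv\<^bsub>L\<^esub> ?b) \<otimes>\<^bsub>L\<^esub> (?g \<otimes>\<^bsub>L\<^esub> inv\<^bsub>L\<^esub> ?g)"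
    unfolding bg[symmetric] one \<kappa>_def fst_conv snd_conv
    by (simp add: L.m_ac del: L.Units_r_inv L.Units_l_inv)
  then have "?a \<otimes>\<^bsub>L\<^esub> \<kappa> \<one>\<^bsub>Ghat\<^esub> = \<one>\<^bsub>L\<^esub>" by simp
  then show "\<kappa> \<one>\<^bsub>Ghat\<^esub> = inv\<^bsub>L\<^esub> ?a"
    using L.comm_inv_char[of ?a "\<kappa> \<one>\<^bsub>Ghat\<^esub>"] \<kappa>_unit[OF \<open>\<one>\<^bsub>Ghat\<^esub> \<in> carrier Ghat\<close>] by (simp add: L.Units_closed)
qed

lemma cocycle_L:
  "\<lbrakk>\<rho> \<in> carrier G; \<sigma> \<in> carrier G; \<tau> \<in> carrier G\<rbrakk> \<Longrightarrow>
    \<alpha> (\<rho>, \<sigma>) \<otimes>\<^bsub>L\<^esub> \<alpha> (\<rho> \<otimes>\<^bsub>G\<^esub> \<sigma>, \<tau>) = \<alpha> (\<sigma>, \<tau>) \<otimes>\<^bsub>L\<^esub> \<alpha> (\<rho>, \<sigma> \<otimes>\<^bsub>G\<^esub> \<tau>)"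
  using cocycle by (simp add: k_ops)

lemma hat_group: "group Ghat"
proof (rule groupI)
  note [simp] = hat_closed \<kappa>_mult snd_mult L.Units_closed[OF \<alpha>_unit_L] L.Units_closed[OF \<kappa>_unit] \<alpha>_unit_L
  show "h \<otimes>\<^bsub>Ghat\<^esub> h' \<in> carrier Ghat" if "h \<in> carrier Ghat" "h' \<in> carrier Ghat" for h h'
    using that by (rule hat_closed)
  show "\<one>\<^bsub>Ghat\<^esub> \<in> carrier Ghat" by (rule hat_one)
  show "(h \<otimes>\<^bsub>Ghat\<^esub> h') \<otimes>\<^bsub>Ghat\<^esub> h'' = h \<otimes>\<^bsub>Ghat\<^esub> (h' \<otimes>\<^bsub>Ghat\<^esub> h'')"
    if [simp]: "h \<in> carrier Ghat" "h' \<in> carrier Ghat" "h'' \<in> carrier Ghat" for h h' h''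
  proof (rule hat_eqI)
    have "\<kappa> ((h \<otimes>\<^bsub>Ghat\<^esub> h') \<otimes>\<^bsub>Ghat\<^esub> h'')
      = (\<kappa> h \<otimes>\<^bsub>L\<^esub> \<kappa> h' \<otimes>\<^bsub>L\<^esub> \<kappa> h'') \<otimes>\<^bsub>L\<^esub> (\<alpha> (snd h, snd h') \<otimes>\<^bsub>L\<^esub> \<alpha> (snd h \<otimes>\<^bsub>G\<^esub> snd h', snd h''))"
      by (simp add: L.m_ac)
    also have "\<dots> = (\<kappa> h \<otimes>\<^bsub>L\<^esub> \<kappa> h' \<otimes>\<^bsub>L\<^esub> \<kappa> h'') \<otimes>\<^bsub>L\<^esub> (\<alpha> (snd h', snd h'') \<otimes>\<^bsub>L\<^esub> \<alpha> (snd h, snd h' \<otimes>\<^bsub>G\<^esub> snd h''))"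
      by (simp add: cocycle_L)
    also have "\<dots> = \<kappa> (h \<otimes>\<^bsub>Ghat\<^esub> (h' \<otimes>\<^bsub>Ghat\<^esub> h''))" by (simp add: L.m_ac)
    finally show "\<kappa> ((h \<otimes>\<^bsub>Ghat\<^esub> h') \<otimes>\<^bsub>Ghat\<^esub> h'') = \<kappa> (h \<otimes>\<^bsub>Ghat\<^esub> (h' \<otimes>\<^bsub>Ghat\<^esub> h''))" .
  qed (simp_all add: G.m_assoc)
  fix h assume h [simp]: "h \<in> carrier Ghat"
  let ?a = "\<alpha> (\<one>\<^bsub>G\<^esub>, \<one>\<^bsub>G\<^esub>)"
  have au: "?a \<in> Units L" by simp
  show "\<one>\<^bsub>Ghat\<^esub> \<otimes>\<^bsub>Ghat\<^esub> h = h"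
  proof (rule hat_eqI)
    have "\<kappa> (\<one>\<^bsub>Ghat\<^esub> \<otimes>\<^bsub>Ghat\<^esub> h) = \<kappa> h \<otimes>\<^bsub>L\<^esub> (inv\<^bsub>L\<^esub> ?a \<otimes>\<^bsub>L\<^esub> ?a)"
      using L.Units_inv_closed[OF au] by (simp add: hat_one \<alpha>_one[OF snd_closed[OF h]] L.m_ac del: L.Units_l_inv L.Units_r_inv)
    then show "\<kappa> (\<one>\<^bsub>Ghat\<^esub> \<otimes>\<^bsub>Ghat\<^esub> h) = \<kappa> h" using au by simp
  qed (simp_all add: hat_one)
  define \<sigma> where "\<sigma> = snd h"
  define \<tau> where "\<tau> = inv\<^bsub>G\<^esub> \<sigma>"
  have \<sigma> [simp]: "\<sigma> \<in> carrier G" "\<tau> \<in> carrier G" "\<tau> \<otimes>\<^bsub>G\<^esub> \<sigma> = \<one>\<^bsub>G\<^esub>" by (simp_all add: \<sigma>_def \<tau>_def)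
  let ?b = "\<alpha> (\<tau>, \<sigma>)"
  \<comment> \<open>the value of \<open>\<kappa>\<close> at the inverse, forced by multiplicativity of \<open>\<kappa>\<close> up to \<open>\<alpha>\<close>\<close>
  define c where "c = upL ?b (- 1) \<otimes>\<^bsub>L\<^esub> upL ?a (- 1) \<otimes>\<^bsub>L\<^esub> upL (\<kappa> h) (- 1)"
  note [simp] = g_unit L.Units_closed[OF g_unit] L.Units_inv_closed[OF g_unit] f_unit_L
  have cu: "c \<in> Units L" "c \<in> carrier L" by (simp_all add: c_def L.Units_closed)
  let ?y = "c \<otimes>\<^bsub>L\<^esub> g \<tau>"
  have y: "\<kappa> (?y, \<tau>) = c" using cu by (simp add: \<kappa>_def L.m_assoc)
  have "upL c (int m) = upL (f \<tau>) (- 1)"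
  proof -
    have pw: "upL (upL x (- 1)) (int m) = upL x (int m * (- 1))" if "x \<in> Units L" for x
      using that by (simp add: L.unit_pow_mult[symmetric])
    have "upL ?a (int m * (- 1)) \<otimes>\<^bsub>L\<^esub> upL ?b (int m * (- 1)) = upL (f \<sigma>) (- 1) \<otimes>\<^bsub>L\<^esub> upL (f \<tau>) (- 1)"
      using f_mult_inv[of \<sigma> "- 1"] \<alpha>_inv[of \<sigma>] unfolding \<tau>_def[symmetric]
      by (simp add: unit_pow_k_L \<alpha>_unit f_unit k_ops)
    moreover have "upL (\<kappa> h) (int m * (- 1)) = upL (f \<sigma>) 1" using \<kappa>_hat_pow[OF h, of "- 1"] by (simp add: \<sigma>_def)
    ultimately have "upL c (int m) = (upL (f \<sigma>) (- 1) \<otimes>\<^bsub>L\<^esub> upL (f \<tau>) (- 1)) \<otimes>\<^bsub>L\<^esub> upL (f \<sigma>) 1"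
      unfolding c_def by (simp add: L.unit_pow_mult_base pw L.m_ac del: L.unit_pow_1)
    also have "\<dots> = upL (f \<tau>) (- 1) \<otimes>\<^bsub>L\<^esub> (upL (f \<sigma>) (- 1) \<otimes>\<^bsub>L\<^esub> upL (f \<sigma>) 1)"
      by (simp add: L.m_ac del: L.unit_pow_1 L.unit_pow_neg_cancel)
    also have "\<dots> = upL (f \<tau>) (- 1)" by (simp add: L.unit_pow_add[symmetric] del: L.unit_pow_1)
    finally show ?thesis .
  qed
  then have yc: "(?y, \<tau>) \<in> carrier Ghat" using cu by (simp add: hat_iff y)
  have "(?y, \<tau>) \<otimes>\<^bsub>Ghat\<^esub> h = \<one>\<^bsub>Ghat\<^esub>"
  proof (rule hat_eqI)
    have "\<kappa> ((?y, \<tau>) \<otimes>\<^bsub>Ghat\<^esub> h) = c \<otimes>\<^bsub>L\<^esub> \<kappa> h \<otimes>\<^bsub>L\<^esub> ?b"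
      using \<kappa>_mult[OF yc h] unfolding y \<sigma>_def[symmetric] snd_conv .
    also have "\<dots> = upL ?a (- 1) \<otimes>\<^bsub>L\<^esub> (upL ?b (- 1) \<otimes>\<^bsub>L\<^esub> upL ?b 1) \<otimes>\<^bsub>L\<^esub> (upL (\<kappa> h) (- 1) \<otimes>\<^bsub>L\<^esub> upL (\<kappa> h) 1)"
      unfolding c_def by (simp add: L.m_ac del: L.unit_pow_neg_cancel)
    also have "\<dots> = upL ?a (- 1)" by (simp add: L.unit_pow_add[symmetric] del: L.unit_pow_1)
    also have "\<dots> = inv\<^bsub>L\<^esub> ?a" using L.unit_pow_inv[OF au, of 1] L.unit_pow_1[OF L.Units_inv_Units[OF au]] by simp
    finally show "\<kappa> ((?y, \<tau>) \<otimes>\<^bsub>Ghat\<^esub> h) = \<kappa> \<one>\<^bsub>Ghat\<^esub>" by (simp add: hat_one)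
  qed (use yc in \<open>simp_all add: hat_one \<sigma>_def[symmetric]\<close>)
  then show "\<exists>h'\<in>carrier Ghat. h' \<otimes>\<^bsub>Ghat\<^esub> h = \<one>\<^bsub>Ghat\<^esub>" using yc by blast
qed

sublocale Ghat: group Ghat by (rule hat_group)

text \<open>Applying \<open>\<kappa>\<close> to \<open>h h\<^sup>-\<^sup>1 = 1\<close> gives the inverse
  without a formula for its first entry.\<close>

lemma hat_inv:
  assumes h: "h \<in> carrier Ghat"
  shows "snd (inv\<^bsub>Ghat\<^esub> h) = inv\<^bsub>G\<^esub> (snd h)"
    and "upL (\<kappa> (inv\<^bsub>Ghat\<^esub> h)) n = upL (\<kappa> h) (- n) \<otimes>\<^bsub>L\<^esub>
      (upL (\<alpha> (\<one>\<^bsub>G\<^esub>, \<one>\<^bsub>G\<^esub>)) (- n) \<otimes>\<^bsub>L\<^esub> upL (\<alpha> (snd h, inv\<^bsub>G\<^esub> (snd h))) (- n))"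
proof -
  have e: "h \<otimes>\<^bsub>Ghat\<^esub> inv\<^bsub>Ghat\<^esub> h = \<one>\<^bsub>Ghat\<^esub>" using h by simp
  have ih: "inv\<^bsub>Ghat\<^esub> h \<in> carrier Ghat" using h by simp
  have "snd h \<otimes>\<^bsub>G\<^esub> snd (inv\<^bsub>Ghat\<^esub> h) = \<one>\<^bsub>G\<^esub>" unfolding snd_mult[OF h ih, symmetric] e by (rule hat_one)
  then show s: "snd (inv\<^bsub>Ghat\<^esub> h) = inv\<^bsub>G\<^esub> (snd h)"
    using h ih by (metis G.inv_equality G.inv_inv snd_closed G.inv_closed)
  let ?a = "\<alpha> (\<one>\<^bsub>G\<^esub>, \<one>\<^bsub>G\<^esub>)" and ?b = "\<alpha> (snd h, inv\<^bsub>G\<^esub> (snd h))" and ?i = "\<kappa> (inv\<^bsub>Ghat\<^esub> h)"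
  have u [simp]: "?a \<in> Units L" "?b \<in> Units L" "\<kappa> h \<in> Units L" "?i \<in> Units L" using h ih by (auto simp: \<alpha>_unit_L simp del: Ghat.inv_closed)
  have "\<kappa> h \<otimes>\<^bsub>L\<^esub> ?i \<otimes>\<^bsub>L\<^esub> ?b = inv\<^bsub>L\<^esub> ?a" 
    unfolding s[symmetric] \<kappa>_mult[OF h ih, symmetric] e by (rule hat_one)
  then have "upL (\<kappa> h \<otimes>\<^bsub>L\<^esub> ?i \<otimes>\<^bsub>L\<^esub> ?b) n = upL (inv\<^bsub>L\<^esub> ?a) n" by simp
  then have k: "upL (\<kappa> h) n \<otimes>\<^bsub>L\<^esub> upL ?i n \<otimes>\<^bsub>L\<^esub> upL ?b n = upL ?a (- n)"
    by (simp add: L.unit_pow_mult_base L.unit_pow_inv)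
  have "upL (\<kappa> h) (- n) \<otimes>\<^bsub>L\<^esub> (upL ?a (- n) \<otimes>\<^bsub>L\<^esub> upL ?b (- n))
    = (upL (\<kappa> h) (- n) \<otimes>\<^bsub>L\<^esub> upL (\<kappa> h) n) \<otimes>\<^bsub>L\<^esub> (upL ?b (- n) \<otimes>\<^bsub>L\<^esub> upL ?b n) \<otimes>\<^bsub>L\<^esub> upL ?i n"
    unfolding k[symmetric] by (simp add: L.m_ac del: L.unit_pow_neg_cancel)
  then show "upL ?i n = upL (\<kappa> h) (- n) \<otimes>\<^bsub>L\<^esub> (upL ?a (- n) \<otimes>\<^bsub>L\<^esub> upL ?b (- n))" by simp
qed

section \<open>The group algebra of the central extension\<close>

abbreviation Q :: "('k, 'k \<times> 'g \<Rightarrow> 'k) hopf_algebra" where "Q \<equiv> group_hopf_algebra L Ghat"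
abbreviation GA :: "('k, 'k \<times> 'g \<Rightarrow> 'k) module" where "GA \<equiv> twisted_group_algebra L Ghat (\<lambda>_. \<one>\<^bsub>L\<^esub>)"
abbreviation \<delta> :: "'k \<times> 'g \<Rightarrow> 'k \<times> 'g \<Rightarrow> 'k" where "\<delta> \<equiv> basis_vec L"

lemma Q_module_part: "carrier Q = carrier GA" "zero Q = zero GA" "add Q = add GA" "smult Q = smult GA"
  "monoid.mult Q = monoid.mult GA" "one Q = one GA"
  by (simp_all add: group_hopf_algebra_def Let_def)

sublocale Q: based_module L "carrier Ghat" Q
  by (rule L.based_moduleI) (simp add: free_on_def Q_module_part twisted_group_algebra_simps)

lemma Q_module: "module L Q" by (rule Q.module_axioms)
lemma \<delta>_closed [simp]: "h \<in> carrier Ghat \<Longrightarrow> \<delta> h \<in> carrier Q" by (rule Q.basis_vec_closed)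

lemma Q_mult_bilinear: "bilinear L Q Q Q (monoid.mult Q)"
  and Q_mult_\<delta>: "\<lbrakk>h \<in> carrier Ghat; h' \<in> carrier Ghat\<rbrakk> \<Longrightarrow> \<delta> h \<otimes>\<^bsub>Q\<^esub> \<delta> h' = \<delta> (h \<otimes>\<^bsub>Ghat\<^esub> h')"
proof -
  note t = L.twisted_group_algebra_bilinear[where G = Ghat and \<alpha> = "\<lambda>_. \<one>\<^bsub>L\<^esub>", OF hat_group L.one_closed]
  show "bilinear L Q Q Q (monoid.mult Q)"
    using t(1) by (simp add: bilinear_def module_hom_def Q_module_part)
  show "\<lbrakk>h \<in> carrier Ghat; h' \<in> carrier Ghat\<rbrakk> \<Longrightarrow> \<delta> h \<otimes>\<^bsub>Q\<^esub> \<delta> h' = \<delta> (h \<otimes>\<^bsub>Ghat\<^esub> h')"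
    using t(2)[of h h'] Q.smult_one[OF \<delta>_closed[OF Ghat.m_closed]] by (simp add: Q_module_part)
qed

lemma Q_one: "\<one>\<^bsub>Q\<^esub> = \<delta> \<one>\<^bsub>Ghat\<^esub>"
proof -
  have "\<one>\<^bsub>Q\<^esub> = inv\<^bsub>L\<^esub> \<one>\<^bsub>L\<^esub> \<odot>\<^bsub>Q\<^esub> \<delta> \<one>\<^bsub>Ghat\<^esub>"
    by (simp add: Q_module_part twisted_group_algebra_simps)
  then show ?thesis by simp
qed

abbreviation TQ where "TQ \<equiv> tensor_module L Q Q"
abbreviation ptQ where "ptQ \<equiv> pure_tensor L Q Q"

lemma TQ_module: "module L TQ" by (rule L.tensor_is_module[OF Q_module Q_module])
lemma ptQ_closed [simp]: "\<lbrakk>x \<in> carrier Q; y \<in> carrier Q\<rbrakk> \<Longrightarrow> ptQ x y \<in> carrier TQ"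
  by (rule L.pure_tensor_closed[OF Q_module Q_module])

lemma Q_comult: "comult Q \<in> module_hom L Q TQ" "h \<in> carrier Ghat \<Longrightarrow> comult Q (\<delta> h) = ptQ (\<delta> h) (\<delta> h)"
proof -
  have c: "tensor_module L GA GA = TQ" "pure_tensor L GA GA = ptQ"
    by (rule tensor_cong; simp add: Q_module_part)+
  have e: "comult Q = lin_ext L TQ (\<lambda>h. ptQ (\<delta> h) (\<delta> h))"
    unfolding c[symmetric] by (simp add: group_hopf_algebra_def Let_def lin_ext_def fun_eq_iff)
  show "comult Q \<in> module_hom L Q TQ" unfolding e by (rule Q.lin_ext_hom[OF TQ_module]) simp
  show "h \<in> carrier Ghat \<Longrightarrow> comult Q (\<delta> h) = ptQ (\<delta> h) (\<delta> h)"
    unfolding e by (rule Q.lin_ext_basis_vec[OF TQ_module]) simp_all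
qed

lemma Q_counit: "counit Q \<in> module_hom L Q RL" "h \<in> carrier Ghat \<Longrightarrow> counit Q (\<delta> h) = \<one>\<^bsub>L\<^esub>"
proof -
  have e: "counit Q p = lin_ext L RL (\<lambda>_. \<one>\<^bsub>L\<^esub>) p" if p: "p \<in> carrier Q" for p
  proof -
    have c: "p x \<in> carrier L" for x using p Q.carrier_iff by blast
    have "finsum RL v {x. p x \<noteq> \<zero>\<^bsub>L\<^esub>} = finsum L v {x. p x \<noteq> \<zero>\<^bsub>L\<^esub>}" for v
      by (simp add: finsum_def finprod_def)
    then show ?thesis using c by (simp add: group_hopf_algebra_def Let_def lin_ext_def)
  qed
  have h: "lin_ext L RL (\<lambda>_. \<one>\<^bsub>L\<^esub>) \<in> module_hom L Q RL" by (rule Q.lin_ext_hom[OF RL_module_L]) simp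
  show "counit Q \<in> module_hom L Q RL"
    by (rule module_homI) (simp_all only: e Q.M.a_closed Q.smult_closed module_hom_closedD[OF h] module_hom_add[OF h] module_hom_smult[OF h])
  show "h \<in> carrier Ghat \<Longrightarrow> counit Q (\<delta> h) = \<one>\<^bsub>L\<^esub>"
    by (subst e) (simp_all add: Q.lin_ext_basis_vec[OF RL_module_L])
qed

lemma Q_antipode: "antipode Q \<in> module_hom L Q Q" "h \<in> carrier Ghat \<Longrightarrow> antipode Q (\<delta> h) = \<delta> (inv\<^bsub>Ghat\<^esub> h)"
proof -
  have l: "lin_ext L GA = lin_ext L Q" by (rule lin_ext_cong) (simp_all add: Q_module_part)
  have e: "antipode Q = lin_ext L Q (\<lambda>h. \<delta> (inv\<^bsub>Ghat\<^esub> h))"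
    unfolding l[symmetric] by (simp add: group_hopf_algebra_def Let_def lin_ext_def fun_eq_iff)
  show "antipode Q \<in> module_hom L Q Q" unfolding e by (rule Q.lin_ext_hom[OF Q_module]) simp
  show "h \<in> carrier Ghat \<Longrightarrow> antipode Q (\<delta> h) = \<delta> (inv\<^bsub>Ghat\<^esub> h)"
    unfolding e by (rule Q.lin_ext_basis_vec[OF Q_module]) simp_all
qed

lemma Q_homI:
  assumes "module L N" "h \<in> module_hom L Q N" "h' \<in> module_hom L Q N"
    and "\<And>x. x \<in> carrier Ghat \<Longrightarrow> h (\<delta> x) = h' (\<delta> x)" "p \<in> carrier Q"
  shows "h p = h' p"
  by (rule hom_eqI[OF Q.generates_basis Q_module assms(1-3) _ assms(5)]) (auto intro: assms(4))

subsection \<open>The isomorphism\<close>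

text \<open>The component of index \<open>n\<close> of a group element, and the group element as an element of
  the extended algebra.\<close>

definition w :: "'k \<times> 'g \<Rightarrow> int \<Rightarrow> (('g \<times> nat \<Rightarrow> 'k) \<times> 'k \<Rightarrow> 'k) set"
  where "w h n = upL (\<kappa> h) n \<odot>\<^bsub>B\<^esub> u (snd h) n"

definition grouplike :: "'k \<times> 'g \<Rightarrow> (('g \<times> nat \<Rightarrow> 'k) \<times> 'k \<Rightarrow> 'k) set"
  where "grouplike h = (\<Oplus>\<^bsub>B\<^esub>n\<in>Z. w h n)"

lemma w_closed [simp]: "h \<in> carrier Ghat \<Longrightarrow> w h n \<in> carrier B"
  by (simp add: w_def)

lemma grouplike_closed [simp]: "h \<in> carrier Ghat \<Longrightarrow> grouplike h \<in> carrier B"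
  unfolding grouplike_def by (rule B.M.finsum_closed) auto

lemma w_periodic:
  assumes h: "h \<in> carrier Ghat" shows "w h (n mod int m) = w h n"
proof -
  let ?q = "n div int m" and ?r = "n mod int m"
  note [simp] = h f_unit_L
  have "upL (\<kappa> h) n = upL (\<kappa> h) ?r \<otimes>\<^bsub>L\<^esub> upL (\<kappa> h) (int m * ?q)" by (simp flip: L.unit_pow_add)
  moreover have "u (snd h) n = upL (f (snd h)) ?q \<odot>\<^bsub>B\<^esub> u (snd h) ?r"
    using u_shift[OF snd_closed[OF h], of ?r ?q] by simp
  ultimately have "w h n = (upL (\<kappa> h) ?r \<otimes>\<^bsub>L\<^esub> (upL (f (snd h)) (- ?q) \<otimes>\<^bsub>L\<^esub> upL (f (snd h)) ?q)) \<odot>\<^bsub>B\<^esub> u (snd h) ?r"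
    by (simp add: w_def \<kappa>_hat_pow B.smult_assoc1[symmetric] L.m_assoc del: L.unit_pow_neg_cancel)
  then show ?thesis by (simp add: w_def)
qed

text \<open>Components of different index annihilate each other, and in each component \<open>\<kappa>(h h') =
  \<kappa>(h) \<kappa>(h') \<alpha>\<close> matches the product of the \<open>u\<close>.\<close>

lemma grouplike_mult:
  assumes h: "h \<in> carrier Ghat" "h' \<in> carrier Ghat"
  shows "grouplike h \<otimes>\<^bsub>B\<^esub> grouplike h' = grouplike (h \<otimes>\<^bsub>Ghat\<^esub> h')"
proof -
  note [simp] = h \<alpha>_unit_L
  note left = bilinear_left[OF B_mult_bilinear] and right = bilinear_right[OF B_mult_bilinear]
  have smm: "(a \<odot>\<^bsub>B\<^esub> s) \<otimes>\<^bsub>B\<^esub> (b \<odot>\<^bsub>B\<^esub> t) = (a \<otimes>\<^bsub>L\<^esub> b) \<odot>\<^bsub>B\<^esub> (s \<otimes>\<^bsub>B\<^esub> t)"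
    if "a \<in> carrier L" "b \<in> carrier L" "s \<in> carrier B" "t \<in> carrier B" for a b s t
    using that bilinear_closed[OF B_mult_bilinear]
    by (simp add: module_hom_smult[OF left] module_hom_smult[OF right] B.smult_assoc1[symmetric] L.m_comm)
  have mc: "s \<otimes>\<^bsub>B\<^esub> t \<in> carrier B" if "s \<in> carrier B" "t \<in> carrier B" for s t
    using that by (rule bilinear_closed[OF B_mult_bilinear])
  have same: "w h n \<otimes>\<^bsub>B\<^esub> w h' n = w (h \<otimes>\<^bsub>Ghat\<^esub> h') n" for n
    by (simp add: w_def smm u_mult \<kappa>_mult snd_mult L.unit_pow_mult_base B.smult_assoc1[symmetric])
  have distinct: "w h n \<otimes>\<^bsub>B\<^esub> w h' n' = \<zero>\<^bsub>B\<^esub>" if "n \<in> Z" "n' \<in> Z" "n' \<noteq> n" for n n'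
  proof -
    have "n mod int m \<noteq> n' mod int m" using that Z_mod by blast
    then show ?thesis by (simp add: w_def smm u_mult_distinct)
  qed
  have "grouplike h \<otimes>\<^bsub>B\<^esub> grouplike h' = (\<Oplus>\<^bsub>B\<^esub>n\<in>Z. w h n \<otimes>\<^bsub>B\<^esub> grouplike h')"
    unfolding grouplike_def[of h] by (rule module_hom_finsum[OF B_module B_module left]) simp_all
  also have "\<dots> = (\<Oplus>\<^bsub>B\<^esub>n\<in>Z. w (h \<otimes>\<^bsub>Ghat\<^esub> h') n)"
  proof (rule B.M.finsum_cong'[OF refl])
    fix n assume n: "n \<in> Z"
    have "w h n \<otimes>\<^bsub>B\<^esub> grouplike h' = (\<Oplus>\<^bsub>B\<^esub>n'\<in>Z. w h n \<otimes>\<^bsub>B\<^esub> w h' n')"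
      unfolding grouplike_def by (rule module_hom_finsum[OF B_module B_module right]) simp_all
    also have "\<dots> = w h n \<otimes>\<^bsub>B\<^esub> w h' n"
      by (rule B.M.finsum_single[where i = n]) (use n distinct in \<open>auto simp: mc\<close>)
    finally show "w h n \<otimes>\<^bsub>B\<^esub> grouplike h' = w (h \<otimes>\<^bsub>Ghat\<^esub> h') n" by (simp add: same)
  qed auto
  finally show ?thesis by (simp add: grouplike_def)
qed

lemma grouplike_one: "grouplike \<one>\<^bsub>Ghat\<^esub> = \<one>\<^bsub>B\<^esub>"
proof -
  have "w \<one>\<^bsub>Ghat\<^esub> = (\<lambda>n. upL (\<alpha> (\<one>\<^bsub>G\<^esub>, \<one>\<^bsub>G\<^esub>)) (- n) \<odot>\<^bsub>B\<^esub> u \<one>\<^bsub>G\<^esub> n)"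
    by (rule ext) (simp add: w_def hat_one(2,3) L.unit_pow_inv \<alpha>_unit_L)
  then show ?thesis by (simp only: grouplike_def B_one_sum)
qed

text \<open>The components satisfy \<open>\<Delta> w\<^sub>n = \<Sum>\<^sub>a w\<^sub>a \<otimes>
  w\<^sub>n\<^sub>-\<^sub>a\<close>; summing over \<open>n\<close> for fixed \<open>a\<close>
  restores the whole element in the second leg.\<close>

lemma grouplike_comult:
  assumes h [simp]: "h \<in> carrier Ghat"
  shows "comult B (grouplike h) = ptB (grouplike h) (grouplike h)"
proof -
  let ?\<sigma> = "snd h"
  note left = bilinear_left[OF ptB_bilinear] and right = bilinear_right[OF ptB_bilinear]
  have 1: "comult B (w h n) = (\<Oplus>\<^bsub>TB\<^esub>a\<in>Z. ptB (w h a) (w h (n - a)))" for n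
  proof -
    have "comult B (w h n) = upL (\<kappa> h) n \<odot>\<^bsub>TB\<^esub> (\<Oplus>\<^bsub>TB\<^esub>a\<in>Z. ptB (u ?\<sigma> a) (u ?\<sigma> (n - a)))"
      by (simp add: w_def module_hom_smult[OF comultB_hom] comultB_u)
    also have "\<dots> = (\<Oplus>\<^bsub>TB\<^esub>a\<in>Z. upL (\<kappa> h) n \<odot>\<^bsub>TB\<^esub> ptB (u ?\<sigma> a) (u ?\<sigma> (n - a)))"
      by (intro TB.finsum_smult_ldistr) auto
    also have "\<dots> = (\<Oplus>\<^bsub>TB\<^esub>a\<in>Z. ptB (w h a) (w h (n - a)))"
      by (intro TB.M.finsum_cong')
        (auto simp: w_def module_hom_smult[OF left] module_hom_smult[OF right]
          TB.smult_assoc1[symmetric] L.unit_pow_add[symmetric])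
    finally show ?thesis .
  qed
  have shift: "(\<Oplus>\<^bsub>B\<^esub>n\<in>Z. w h (n - a)) = grouplike h" for a
    unfolding grouplike_def using m_pos by (intro B.M.finsum_residues_shift) (auto simp: w_periodic)
  have "comult B (grouplike h) = (\<Oplus>\<^bsub>TB\<^esub>n\<in>Z. comult B (w h n))"
    unfolding grouplike_def by (rule module_hom_finsum[OF B_module TB_module comultB_hom]) simp
  also have "\<dots> = (\<Oplus>\<^bsub>TB\<^esub>n\<in>Z. \<Oplus>\<^bsub>TB\<^esub>a\<in>Z. ptB (w h a) (w h (n - a)))" by (simp add: 1)
  also have "\<dots> = (\<Oplus>\<^bsub>TB\<^esub>a\<in>Z. \<Oplus>\<^bsub>TB\<^esub>n\<in>Z. ptB (w h a) (w h (n - a)))"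
    by (rule TB.M.finsum_swap) auto
  also have "\<dots> = (\<Oplus>\<^bsub>TB\<^esub>a\<in>Z. ptB (w h a) (grouplike h))"
  proof (rule TB.M.finsum_cong'[OF refl])
    show "(\<Oplus>\<^bsub>TB\<^esub>n\<in>Z. ptB (w h a) (w h (n - a))) = ptB (w h a) (grouplike h)" for a
      unfolding shift[of a, symmetric]
      by (rule module_hom_finsum[OF B_module TB_module right, symmetric]) simp_all
  qed auto
  also have "\<dots> = ptB (grouplike h) (grouplike h)"
    by (subst (2) grouplike_def, rule module_hom_finsum[OF B_module TB_module left, symmetric]) simp_all
  finally show ?thesis .
qed

lemma grouplike_counit:
  assumes h [simp]: "h \<in> carrier Ghat"
  shows "counit B (grouplike h) = \<one>\<^bsub>L\<^esub>"
proof -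
  interpret RL: module L RL by (rule RL_module_L)
  have c: "counit B (w h n) = upL (\<kappa> h) n \<otimes>\<^bsub>L\<^esub> counit H (U (snd h) n)" for n
    by (simp add: w_def module_hom_smult[OF counitB_hom]) (simp add: u_def counitB_\<iota>)
  have "counit B (grouplike h) = (\<Oplus>\<^bsub>RL\<^esub>n\<in>Z. counit B (w h n))"
    unfolding grouplike_def by (rule module_hom_finsum[OF B_module RL_module_L counitB_hom]) simp
  also have "\<dots> = counit B (w h 0)"
    using m_pos by (intro RL.M.finsum_single) (auto simp: c counit_U k_ops)
  also have "\<dots> = \<one>\<^bsub>L\<^esub>" using m_pos by (simp add: c counit_U k_ops)
  finally show ?thesis .
qed

lemma grouplike_antipode:
  assumes h [simp]: "h \<in> carrier Ghat"
  shows "antipode B (grouplike h) = grouplike (inv\<^bsub>Ghat\<^esub> h)"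
proof -
  let ?\<sigma> = "snd h"
  have 1: "antipode B (w h n) = w (inv\<^bsub>Ghat\<^esub> h) (0 - n)" for n
  proof -
    have "antipode B (w h n) = upL (\<kappa> h) n \<odot>\<^bsub>B\<^esub> \<iota> (U_inv ?\<sigma> (- n))"
      by (simp add: w_def module_hom_smult[OF antipodeB_hom]) (simp add: u_def antipodeB_\<iota> antipode_U)
    also have "\<iota> (U_inv ?\<sigma> (- n)) = (upL (\<alpha> (\<one>\<^bsub>G\<^esub>, \<one>\<^bsub>G\<^esub>)) n \<otimes>\<^bsub>L\<^esub> upL (\<alpha> (?\<sigma>, inv\<^bsub>G\<^esub> ?\<sigma>)) n) \<odot>\<^bsub>B\<^esub> u (inv\<^bsub>G\<^esub> ?\<sigma>) (- n)"
      by (simp add: U_inv_eq \<iota>_smult \<alpha>_unit u_def) (simp add: unit_pow_k_L \<alpha>_unit k_ops)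
    finally show ?thesis
      by (simp add: w_def hat_inv B.smult_assoc1[symmetric] \<alpha>_unit_L)
  qed
  have "antipode B (grouplike h) = (\<Oplus>\<^bsub>B\<^esub>n\<in>Z. antipode B (w h n))"
    unfolding grouplike_def by (rule module_hom_finsum[OF B_module B_module antipodeB_hom]) simp
  also have "\<dots> = grouplike (inv\<^bsub>Ghat\<^esub> h)"
    unfolding 1 grouplike_def using m_pos
    by (intro B.M.finsum_residues_reflect) (auto simp: w_periodic)
  finally show ?thesis .
qed

definition \<psi> :: "('k \<times> 'g \<Rightarrow> 'k) \<Rightarrow> (('g \<times> nat \<Rightarrow> 'k) \<times> 'k \<Rightarrow> 'k) set"
  where "\<psi> = lin_ext L B grouplike"

lemma \<psi>_hom: "\<psi> \<in> module_hom L Q B"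
  unfolding \<psi>_def by (rule Q.lin_ext_hom[OF B_module]) simp

lemma \<psi>_\<delta> [simp]: "h \<in> carrier Ghat \<Longrightarrow> \<psi> (\<delta> h) = grouplike h"
  unfolding \<psi>_def by (rule Q.lin_ext_basis_vec[OF B_module]) simp_all

lemma \<psi>_mult:
  assumes "p \<in> carrier Q" "q \<in> carrier Q"
  shows "\<psi> (p \<otimes>\<^bsub>Q\<^esub> q) = \<psi> p \<otimes>\<^bsub>B\<^esub> \<psi> q"
  by (rule bilinear_eqI[OF Q.generates_basis Q.generates_basis Q_module Q_module B_module
        bilinear_compose_hom[OF Q_mult_bilinear \<psi>_hom] bilinear_precompose[OF B_mult_bilinear \<psi>_hom \<psi>_hom] _ assms])
    (auto simp: Q_mult_\<delta> grouplike_mult)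

definition m_inv_L :: 'k where "m_inv_L = inv\<^bsub>L\<^esub> ([m] \<cdot>\<^bsub>L\<^esub> \<one>\<^bsub>L\<^esub>)"

lemma m_inv_L: "m_inv_L \<in> carrier L" "m_inv_L \<otimes>\<^bsub>L\<^esub> ([m] \<cdot>\<^bsub>L\<^esub> \<one>\<^bsub>L\<^esub>) = \<one>\<^bsub>L\<^esub>"
  using m_nonzero by (simp_all add: m_inv_L_def L.field_Units)

text \<open>The element \<open>g(\<sigma>)\<^sup>n u\<^sub>\<sigma> e\<^sub>n\<close> of the group algebra,
  with the idempotent \<open>e\<^sub>n = (1/m) \<Sum>\<^sub>z z\<^sup>-\<^sup>n z\<close> written
  out.\<close>

definition fourier :: "'g \<Rightarrow> int \<Rightarrow> 'k \<times> 'g \<Rightarrow> 'k"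
  where "fourier \<sigma> n = (\<Oplus>\<^bsub>Q\<^esub>z\<in>roots. (m_inv_L \<otimes>\<^bsub>L\<^esub> upL (\<kappa> (z, \<sigma>)) (- n)) \<odot>\<^bsub>Q\<^esub> \<delta> (z, \<sigma>))"

definition \<phi> :: "(('g \<times> nat \<Rightarrow> 'k) \<times> 'k \<Rightarrow> 'k) set \<Rightarrow> 'k \<times> 'g \<Rightarrow> 'k"
  where "\<phi> = tensor_lift k Q (\<lambda>x c. c \<odot>\<^bsub>Q\<^esub> lin_ext k Q (\<lambda>(\<sigma>, i). fourier \<sigma> (int i)) x)"

lemma hat_mem: "\<lbrakk>z \<in> roots; \<sigma> \<in> carrier G\<rbrakk> \<Longrightarrow> (z, \<sigma>) \<in> carrier Ghat"
  by (simp add: hat_carrier)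

lemma fourier_closed: "\<sigma> \<in> carrier G \<Longrightarrow> fourier \<sigma> n \<in> carrier Q"
  unfolding fourier_def by (rule Q.M.finsum_closed) (auto simp: m_inv_L hat_mem)

lemma \<phi>_hom: "\<phi> \<in> module_hom L B Q"
  and \<phi>_u: "\<lbrakk>\<sigma> \<in> carrier G; n \<in> Z\<rbrakk> \<Longrightarrow> \<phi> (u \<sigma> n) = fourier \<sigma> n"
proof -
  note Qk = module_restrict[OF Q_module]
  have h: "lin_ext k Q (\<lambda>(\<sigma>, i). fourier \<sigma> (int i)) \<in> module_hom k H Q"
    by (rule H.lin_ext_hom[OF Qk]) (auto simp: fourier_closed)
  show "\<phi> \<in> module_hom L B Q" unfolding \<phi>_def by (rule scalar_extension(1)[OF Q_module h])
  assume c: "\<sigma> \<in> carrier G" "n \<in> Z"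
  have "\<phi> (u \<sigma> n) = lin_ext k Q (\<lambda>(\<sigma>, i). fourier \<sigma> (int i)) (U \<sigma> n)"
    unfolding \<phi>_def u_def using c by (intro scalar_extension(2)[OF Q_module h]) simp
  also have "U \<sigma> n = basis_vec k (\<sigma>, nat n)" using c basis_vec_eq_U[of \<sigma> "nat n"] by (auto simp: nat_less_iff)
  also have "lin_ext k Q (\<lambda>(\<sigma>, i). fourier \<sigma> (int i)) \<dots> = fourier \<sigma> n"
    using c by (subst H.lin_ext_basis_vec[OF Qk]) (auto simp: fourier_closed)
  finally show "\<phi> (u \<sigma> n) = fourier \<sigma> n" .
qed

lemma \<kappa>_quotient:
  assumes "z \<in> roots" "z' \<in> roots" "\<sigma> \<in> carrier G"
  shows "upL (\<kappa> (z, \<sigma>)) a \<otimes>\<^bsub>L\<^esub> upL (\<kappa> (z', \<sigma>)) (- b)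
    = upL z a \<otimes>\<^bsub>L\<^esub> upL z' (- b) \<otimes>\<^bsub>L\<^esub> upL (g \<sigma>) (b - a)"
proof -
  note [simp] = roots_unit assms g_unit
  have "upL (g \<sigma>) (b - a) = upL (g \<sigma>) (- a) \<otimes>\<^bsub>L\<^esub> upL (g \<sigma>) b" by (simp flip: L.unit_pow_add)
  then show ?thesis by (simp add: \<kappa>_def L.unit_pow_mult_base L.unit_pow_inv L.m_ac)
qed

text \<open>Orthogonality of characters: the coefficient of \<open>(z', \<sigma>)\<close> in the image of
  \<open>(z, \<sigma>)\<close> is \<open>(1/m) \<Sum>\<^sub>n (z / z')\<^sup>n\<close>.\<close>

lemma \<phi>_\<psi>:
  assumes "p \<in> carrier Q"
  shows "\<phi> (\<psi> p) = p"
proof (rule Q_homI[OF Q_module module_hom_compose[OF \<psi>_hom \<phi>_hom] module_hom_id _ assms])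
  fix h assume h [simp]: "h \<in> carrier Ghat"
  then obtain z \<sigma> where e: "h = (z, \<sigma>)" and z: "z \<in> roots" and \<sigma> [simp]: "\<sigma> \<in> carrier G"
    by (auto simp: hat_carrier)
  note [simp] = hat_mem m_inv_L(1)
  define c where "c z' n = m_inv_L \<otimes>\<^bsub>L\<^esub> upL (z \<otimes>\<^bsub>L\<^esub> inv\<^bsub>L\<^esub> z') n" for z' n
  have cc: "c z' n \<in> carrier L" if "z' \<in> roots" for z' n
    using that z roots_unit by (simp add: c_def)
  have 1: "\<phi> (w h n) = (\<Oplus>\<^bsub>Q\<^esub>z'\<in>roots. c z' n \<odot>\<^bsub>Q\<^esub> \<delta> (z', \<sigma>))" if n: "n \<in> Z" for n
  proof -
    have "\<phi> (w h n) = upL (\<kappa> h) n \<odot>\<^bsub>Q\<^esub> fourier \<sigma> n"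
      using n by (simp add: w_def e module_hom_smult[OF \<phi>_hom] \<phi>_u z)
    also have "\<dots> = (\<Oplus>\<^bsub>Q\<^esub>z'\<in>roots. upL (\<kappa> h) n \<odot>\<^bsub>Q\<^esub> ((m_inv_L \<otimes>\<^bsub>L\<^esub> upL (\<kappa> (z', \<sigma>)) (- n)) \<odot>\<^bsub>Q\<^esub> \<delta> (z', \<sigma>)))"
      unfolding fourier_def using finite_roots by (intro Q.finsum_smult_ldistr) auto
    also have "\<dots> = (\<Oplus>\<^bsub>Q\<^esub>z'\<in>roots. c z' n \<odot>\<^bsub>Q\<^esub> \<delta> (z', \<sigma>))"
    proof (rule Q.M.finsum_cong'[OF refl])
      fix z' assume z': "z' \<in> roots"
      have "upL (\<kappa> h) n \<otimes>\<^bsub>L\<^esub> (m_inv_L \<otimes>\<^bsub>L\<^esub> upL (\<kappa> (z', \<sigma>)) (- n))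
        = m_inv_L \<otimes>\<^bsub>L\<^esub> (upL (\<kappa> (z, \<sigma>)) n \<otimes>\<^bsub>L\<^esub> upL (\<kappa> (z', \<sigma>)) (- n))"
        using z z' by (simp add: e L.m_ac)
      also have "\<dots> = c z' n"
        using z z' roots_unit by (simp add: \<kappa>_quotient c_def L.unit_pow_mult_base L.unit_pow_inv)
      finally show "upL (\<kappa> h) n \<odot>\<^bsub>Q\<^esub> ((m_inv_L \<otimes>\<^bsub>L\<^esub> upL (\<kappa> (z', \<sigma>)) (- n)) \<odot>\<^bsub>Q\<^esub> \<delta> (z', \<sigma>)) = c z' n \<odot>\<^bsub>Q\<^esub> \<delta> (z', \<sigma>)"
        using z' by (simp add: Q.smult_assoc1[symmetric])
    qed (auto simp: cc)
    finally show ?thesis .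
  qed
  have sum: "(\<Oplus>\<^bsub>L\<^esub>n\<in>Z. c z' n) = (if z' = z then \<one>\<^bsub>L\<^esub> else \<zero>\<^bsub>L\<^esub>)" if z': "z' \<in> roots" for z'
  proof -
    have zz: "z \<otimes>\<^bsub>L\<^esub> inv\<^bsub>L\<^esub> z' \<in> roots"
      using z z' roots_unit roots_unit_pow[OF z, of 1] roots_unit_pow[OF z', of "- 1"]
      by (simp add: roots_iff L.unit_pow_mult_base L.unit_pow_inv)
    have eq1: "z \<otimes>\<^bsub>L\<^esub> inv\<^bsub>L\<^esub> z' = \<one>\<^bsub>L\<^esub> \<longleftrightarrow> z' = z"
    proof
      assume "z \<otimes>\<^bsub>L\<^esub> inv\<^bsub>L\<^esub> z' = \<one>\<^bsub>L\<^esub>"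
      then have "(z \<otimes>\<^bsub>L\<^esub> inv\<^bsub>L\<^esub> z') \<otimes>\<^bsub>L\<^esub> z' = z'" using roots_unit[OF z'] by (simp add: L.Units_closed)
      then show "z' = z" using roots_unit[OF z'] roots_unit[OF z] by (simp add: L.Units_closed L.m_assoc)
    qed (use roots_unit[OF z'] in simp)
    have "(\<Oplus>\<^bsub>L\<^esub>n\<in>Z. c z' n) = m_inv_L \<otimes>\<^bsub>L\<^esub> (\<Oplus>\<^bsub>L\<^esub>n\<in>Z. upL (z \<otimes>\<^bsub>L\<^esub> inv\<^bsub>L\<^esub> z') n)"
      unfolding c_def using zz roots_unit by (intro L.finsum_rdistr[symmetric]) auto
    then show ?thesis using roots_sum_powers[OF zz] m_inv_L by (simp add: eq1)
  qed
  have "\<phi> (\<psi> (\<delta> h)) = (\<Oplus>\<^bsub>Q\<^esub>n\<in>Z. \<phi> (w h n))"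
    by (simp add: grouplike_def) (rule module_hom_finsum[OF B_module Q_module \<phi>_hom], simp)
  also have "\<dots> = (\<Oplus>\<^bsub>Q\<^esub>n\<in>Z. \<Oplus>\<^bsub>Q\<^esub>z'\<in>roots. c z' n \<odot>\<^bsub>Q\<^esub> \<delta> (z', \<sigma>))"
    by (rule Q.M.finsum_cong'[OF refl _ 1]) (auto intro!: Q.M.finsum_closed simp: cc)
  also have "\<dots> = (\<Oplus>\<^bsub>Q\<^esub>z'\<in>roots. \<Oplus>\<^bsub>Q\<^esub>n\<in>Z. c z' n \<odot>\<^bsub>Q\<^esub> \<delta> (z', \<sigma>))"
    by (rule Q.M.finsum_swap) (auto simp: cc finite_roots)
  also have "\<dots> = (\<Oplus>\<^bsub>Q\<^esub>z'\<in>roots. (if z' = z then \<one>\<^bsub>L\<^esub> else \<zero>\<^bsub>L\<^esub>) \<odot>\<^bsub>Q\<^esub> \<delta> (z', \<sigma>))"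
  proof (rule Q.M.finsum_cong'[OF refl])
    fix z' assume z': "z' \<in> roots"
    show "(\<Oplus>\<^bsub>Q\<^esub>n\<in>Z. c z' n \<odot>\<^bsub>Q\<^esub> \<delta> (z', \<sigma>)) = (if z' = z then \<one>\<^bsub>L\<^esub> else \<zero>\<^bsub>L\<^esub>) \<odot>\<^bsub>Q\<^esub> \<delta> (z', \<sigma>)"
      unfolding sum[OF z', symmetric] using z' by (intro Q.finsum_smult_left[symmetric]) (auto simp: cc)
  qed auto
  also have "\<dots> = (if z = z then \<one>\<^bsub>L\<^esub> else \<zero>\<^bsub>L\<^esub>) \<odot>\<^bsub>Q\<^esub> \<delta> (z, \<sigma>)"
    by (rule Q.M.finsum_single[where i = z]) (auto simp: finite_roots z)
  finally show "\<phi> (\<psi> (\<delta> h)) = \<delta> h" using z by (simp add: e)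
qed

text \<open>The dual orthogonality: the coefficient of \<open>u \<sigma> j\<close> in the image of \<open>u
  \<sigma> n\<close> is \<open>g(\<sigma>)\<^sup>n\<^sup>-\<^sup>j (1/m) \<Sum>\<^sub>z
  z\<^sup>j\<^sup>-\<^sup>n\<close>.\<close>

lemma \<psi>_\<phi>:
  assumes "s \<in> carrier B"
  shows "\<psi> (\<phi> s) = s"
proof (rule B_homI[OF B_module module_hom_compose[OF \<phi>_hom \<psi>_hom] module_hom_id _ assms])
  fix \<sigma> n assume \<sigma> [simp]: "\<sigma> \<in> carrier G" and n: "n \<in> Z"
  note [simp] = hat_mem m_inv_L(1)
  define c where "c z j = m_inv_L \<otimes>\<^bsub>L\<^esub> (upL z (j - n) \<otimes>\<^bsub>L\<^esub> upL (g \<sigma>) (n - j))" for z j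
  have cc: "c z j \<in> carrier L" if "z \<in> roots" for z j
    using that roots_unit g_unit by (simp add: c_def)
  have 1: "\<psi> ((m_inv_L \<otimes>\<^bsub>L\<^esub> upL (\<kappa> (z, \<sigma>)) (- n)) \<odot>\<^bsub>Q\<^esub> \<delta> (z, \<sigma>)) = (\<Oplus>\<^bsub>B\<^esub>j\<in>Z. c z j \<odot>\<^bsub>B\<^esub> u \<sigma> j)"
    if z: "z \<in> roots" for z
  proof -
    have k: "m_inv_L \<otimes>\<^bsub>L\<^esub> upL (\<kappa> (z, \<sigma>)) (- n) \<otimes>\<^bsub>L\<^esub> upL (\<kappa> (z, \<sigma>)) j = c z j" for j
    proof -
      have "upL z (j - n) = upL z j \<otimes>\<^bsub>L\<^esub> upL z (- n)"
        using roots_unit[OF z] by (simp flip: L.unit_pow_add)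
      moreover have "m_inv_L \<otimes>\<^bsub>L\<^esub> upL (\<kappa> (z, \<sigma>)) (- n) \<otimes>\<^bsub>L\<^esub> upL (\<kappa> (z, \<sigma>)) j
        = m_inv_L \<otimes>\<^bsub>L\<^esub> (upL (\<kappa> (z, \<sigma>)) j \<otimes>\<^bsub>L\<^esub> upL (\<kappa> (z, \<sigma>)) (- n))"
        using z by (simp add: L.m_ac)
      ultimately show ?thesis using z by (simp add: c_def \<kappa>_quotient)
    qed
    have "\<psi> ((m_inv_L \<otimes>\<^bsub>L\<^esub> upL (\<kappa> (z, \<sigma>)) (- n)) \<odot>\<^bsub>Q\<^esub> \<delta> (z, \<sigma>))
      = (m_inv_L \<otimes>\<^bsub>L\<^esub> upL (\<kappa> (z, \<sigma>)) (- n)) \<odot>\<^bsub>B\<^esub> (\<Oplus>\<^bsub>B\<^esub>j\<in>Z. w (z, \<sigma>) j)"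
      using z by (simp add: module_hom_smult[OF \<psi>_hom] grouplike_def)
    also have "\<dots> = (\<Oplus>\<^bsub>B\<^esub>j\<in>Z. (m_inv_L \<otimes>\<^bsub>L\<^esub> upL (\<kappa> (z, \<sigma>)) (- n)) \<odot>\<^bsub>B\<^esub> w (z, \<sigma>) j)"
      using z by (intro B.finsum_smult_ldistr) auto
    also have "\<dots> = (\<Oplus>\<^bsub>B\<^esub>j\<in>Z. c z j \<odot>\<^bsub>B\<^esub> u \<sigma> j)"
      using z by (intro B.M.finsum_cong') (auto simp: w_def B.smult_assoc1[symmetric] k cc)
    finally show ?thesis .
  qed
  have sum: "(\<Oplus>\<^bsub>L\<^esub>z\<in>roots. c z j) = (if j = n then \<one>\<^bsub>L\<^esub> else \<zero>\<^bsub>L\<^esub>)" if j: "j \<in> Z" for j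
  proof -
    have u: "upL (g \<sigma>) (n - j) \<in> carrier L" using g_unit by simp
    have s: "(\<Oplus>\<^bsub>L\<^esub>z\<in>roots. upL z (j - n)) \<in> carrier L" using roots_unit by (intro L.finsum_closed) auto
    have "(\<Oplus>\<^bsub>L\<^esub>z\<in>roots. c z j) = (\<Oplus>\<^bsub>L\<^esub>z\<in>roots. (m_inv_L \<otimes>\<^bsub>L\<^esub> upL (g \<sigma>) (n - j)) \<otimes>\<^bsub>L\<^esub> upL z (j - n))"
      using u roots_unit by (intro L.finsum_cong') (auto simp: c_def L.m_ac)
    also have "\<dots> = (m_inv_L \<otimes>\<^bsub>L\<^esub> upL (g \<sigma>) (n - j)) \<otimes>\<^bsub>L\<^esub> (\<Oplus>\<^bsub>L\<^esub>z\<in>roots. upL z (j - n))"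
      using u roots_unit finite_roots by (intro L.finsum_rdistr[symmetric]) auto
    also have "\<dots> = (if j = n then \<one>\<^bsub>L\<^esub> else \<zero>\<^bsub>L\<^esub>)"
    proof (cases "j = n")
      case True
      then show ?thesis using roots_sum[of 0] m_inv_L by simp
    next
      case False
      then have "(j - n) mod int m \<noteq> 0" using mod_diff_Z[of n j] n j by metis
      then show ?thesis using roots_sum[of "j - n"] False u by simp
    qed
    finally show ?thesis .
  qed
  have "\<psi> (\<phi> (u \<sigma> n)) = (\<Oplus>\<^bsub>B\<^esub>z\<in>roots. \<psi> ((m_inv_L \<otimes>\<^bsub>L\<^esub> upL (\<kappa> (z, \<sigma>)) (- n)) \<odot>\<^bsub>Q\<^esub> \<delta> (z, \<sigma>)))"
    unfolding \<phi>_u[OF \<sigma> n] fourier_def by (rule module_hom_finsum[OF Q_module B_module \<psi>_hom]) simp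
  also have "\<dots> = (\<Oplus>\<^bsub>B\<^esub>z\<in>roots. \<Oplus>\<^bsub>B\<^esub>j\<in>Z. c z j \<odot>\<^bsub>B\<^esub> u \<sigma> j)"
    by (rule B.M.finsum_cong'[OF refl _ 1]) (auto intro!: B.M.finsum_closed simp: cc)
  also have "\<dots> = (\<Oplus>\<^bsub>B\<^esub>j\<in>Z. \<Oplus>\<^bsub>B\<^esub>z\<in>roots. c z j \<odot>\<^bsub>B\<^esub> u \<sigma> j)"
    by (rule B.M.finsum_swap) (auto simp: cc finite_roots)
  also have "\<dots> = (\<Oplus>\<^bsub>B\<^esub>j\<in>Z. (if j = n then \<one>\<^bsub>L\<^esub> else \<zero>\<^bsub>L\<^esub>) \<odot>\<^bsub>B\<^esub> u \<sigma> j)"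
  proof (rule B.M.finsum_cong'[OF refl])
    fix j assume j: "j \<in> Z"
    show "(\<Oplus>\<^bsub>B\<^esub>z\<in>roots. c z j \<odot>\<^bsub>B\<^esub> u \<sigma> j) = (if j = n then \<one>\<^bsub>L\<^esub> else \<zero>\<^bsub>L\<^esub>) \<odot>\<^bsub>B\<^esub> u \<sigma> j"
      unfolding sum[OF j, symmetric] by (intro B.finsum_smult_left[symmetric]) (auto simp: cc finite_roots)
  qed auto
  also have "\<dots> = (if n = n then \<one>\<^bsub>L\<^esub> else \<zero>\<^bsub>L\<^esub>) \<odot>\<^bsub>B\<^esub> u \<sigma> n"
    by (rule B.M.finsum_single[where i = n]) (use n in auto)
  finally show "\<psi> (\<phi> (u \<sigma> n)) = u \<sigma> n" by simp
qed

text \<open>Every element is \<open>\<psi> p\<close>, so all compatibilities of \<open>\<phi>\<close> are read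
  off from those of \<open>\<psi>\<close>, where they need to be checked on group elements only.\<close>

theorem \<phi>_hopf_iso: "\<phi> \<in> hopf_iso L B Q"
proof -
  have \<phi>_closed: "\<phi> s \<in> carrier Q" if "s \<in> carrier B" for s using module_hom_closedD[OF \<phi>_hom that] .
  have \<psi>_closed: "\<psi> p \<in> carrier B" if "p \<in> carrier Q" for p using module_hom_closedD[OF \<psi>_hom that] .
  have bij: "bij_betw \<phi> (carrier B) (carrier Q)"
    by (rule bij_betwI[of _ _ _ \<psi>]) (auto simp: \<phi>_closed \<psi>_closed \<phi>_\<psi> \<psi>_\<phi>)
  have surj: "\<exists>p\<in>carrier Q. s = \<psi> p" if "s \<in> carrier B" for s
    using \<psi>_\<phi>[OF that] \<phi>_closed[OF that] by metis
  have "\<phi> \<in> ring_hom B Q"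
  proof (rule ring_hom_memI)
    show "\<phi> (s \<otimes>\<^bsub>B\<^esub> t) = \<phi> s \<otimes>\<^bsub>Q\<^esub> \<phi> t" if st: "s \<in> carrier B" "t \<in> carrier B" for s t
    proof -
      obtain p q where pq: "p \<in> carrier Q" "q \<in> carrier Q" "s = \<psi> p" "t = \<psi> q" using surj st by meson
      then show ?thesis
        using bilinear_closed[OF Q_mult_bilinear pq(1,2)] by (simp add: \<psi>_mult[symmetric] \<phi>_\<psi>)
    qed
    show "\<phi> (s \<oplus>\<^bsub>B\<^esub> t) = \<phi> s \<oplus>\<^bsub>Q\<^esub> \<phi> t" if "s \<in> carrier B" "t \<in> carrier B" for s t
      using module_hom_add[OF \<phi>_hom that] .
    show "\<phi> \<one>\<^bsub>B\<^esub> = \<one>\<^bsub>Q\<^esub>"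
      using \<phi>_\<psi>[of "\<one>\<^bsub>Q\<^esub>"] by (simp add: Q_one hat_one(1) grouplike_one)
  qed (rule \<phi>_closed)
  then have alg: "\<phi> \<in> algebra_hom L B Q" using \<phi>_hom by (simp add: algebra_hom_def)
  note tm = L.tensor_map_hom[OF B_module B_module Q_module Q_module \<phi>_hom \<phi>_hom]
  note tp = L.tensor_map_pure[OF B_module B_module Q_module Q_module \<phi>_hom \<phi>_hom]
  have \<phi>_grouplike: "\<phi> (grouplike h) = \<delta> h" if "h \<in> carrier Ghat" for h
    using \<phi>_\<psi>[of "\<delta> h"] that by simp
  have "comult Q (\<phi> s) = tensor_map L Q Q \<phi> \<phi> (comult B s) \<and> counit Q (\<phi> s) = counit B s \<and>
      antipode Q (\<phi> s) = \<phi> (antipode B s)" if s: "s \<in> carrier B" for s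
  proof -
    obtain p where p: "p \<in> carrier Q" "s = \<psi> p" using surj[OF s] by blast
    have "comult Q p = tensor_map L Q Q \<phi> \<phi> (comult B (\<psi> p))"
      by (rule Q_homI[OF TQ_module Q_comult(1) module_hom_compose[OF \<psi>_hom module_hom_compose[OF comultB_hom tm]] _ p(1)])
        (simp add: Q_comult grouplike_comult tp \<phi>_grouplike)
    moreover have "counit Q p = counit B (\<psi> p)"
      by (rule Q_homI[OF RL_module_L Q_counit(1) module_hom_compose[OF \<psi>_hom counitB_hom] _ p(1)])
        (simp add: Q_counit grouplike_counit)
    moreover have "antipode Q p = \<phi> (antipode B (\<psi> p))"
      by (rule Q_homI[OF Q_module Q_antipode(1) module_hom_compose[OF \<psi>_hom module_hom_compose[OF antipodeB_hom \<phi>_hom]] _ p(1)])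
        (simp add: Q_antipode grouplike_antipode \<phi>_grouplike)
    ultimately show ?thesis using p by (simp add: \<phi>_\<psi>)
  qed
  then show ?thesis using alg bij by (simp add: hopf_iso_def)
qed

end

theorem theorem1p2:
  fixes k kbar :: "'f ring" and K :: "'f set" and G :: "'g monoid"
    and \<alpha> :: "'g \<times> 'g \<Rightarrow> 'f" and f :: "'g \<Rightarrow> 'f" and m :: nat
  assumes "algebraic_closure kbar K" and "k = kbar\<lparr>carrier := K\<rparr>"
    and "group G" and "finite (carrier G)"
    and "\<alpha> \<in> carrier (cocycles2 G (units_of k))"
    and "m > 0"
    and "group.ord (cohomology2 G (units_of k)) (cohomology_class G (units_of k) \<alpha>) = m"
    and "f \<in> carrier G \<rightarrow> carrier (units_of k)"
    and "\<forall>\<sigma>\<in>carrier G. \<forall>\<tau>\<in>carrier G.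
      \<alpha> (\<sigma>, \<tau>) [^]\<^bsub>k\<^esub> m = f \<sigma> \<otimes>\<^bsub>k\<^esub> f \<tau> \<otimes>\<^bsub>k\<^esub> inv\<^bsub>k\<^esub> (f (\<sigma> \<otimes>\<^bsub>G\<^esub> \<tau>))"
  shows "\<exists>A :: ('f, 'g \<times> nat \<Rightarrow> 'f) hopf_algebra.
    hopf_algebra k A \<and> cocommutative k A \<and>
    vectorspace.fin_dim k A \<and> vectorspace.dim k A = m * order G \<and>
    (\<exists>\<pi> \<in> algebra_hom k A (twisted_group_algebra k G \<alpha>).
      \<pi> ` carrier A = carrier (twisted_group_algebra k G \<alpha>)) \<and>
    (\<not> characteristic k dvd order G \<longrightarrow> semisimple_ring A) \<and>
    (\<not> characteristic k dvd m \<longrightarrow>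
      (\<forall>g \<in> carrier G \<rightarrow> carrier (units_of kbar).
        (\<forall>\<sigma>\<in>carrier G. g \<sigma> [^]\<^bsub>kbar\<^esub> m = f \<sigma>) \<longrightarrow>
        hopf_iso kbar (base_change k kbar A) (group_hopf_algebra kbar (hat_group kbar G m \<alpha> g)) \<noteq> {}))"
proof -
  interpret closure: algebraic_closure kbar K by fact
  have K: "field k" unfolding assms(2)
    using closure.subfield_iff(2)[OF closure.subfield_axioms] .
  interpret K: field k by (rule K)
  interpret G: group G by fact
  have f: "f \<sigma> \<in> Units k" if "\<sigma> \<in> carrier G" for \<sigma>
    using assms(8) that by (auto simp: units_of_carrier)
  have \<alpha>: "\<alpha> (\<sigma>, \<tau>) \<in> Units k" if "\<sigma> \<in> carrier G" "\<tau> \<in> carrier G" for \<sigma> \<tau>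
    using assms(5) that by (auto simp: cocycles2_def cochains2_def product_group_def units_of_carrier)
  interpret tw: twisting k G \<alpha> f m
  proof
    show "finite (carrier G)" "0 < m" by fact+
    show "\<alpha> (\<sigma>, \<tau>) \<in> Units k" if "\<sigma> \<in> carrier G" "\<tau> \<in> carrier G" for \<sigma> \<tau> using \<alpha> that .
    show "f \<sigma> \<in> Units k" if "\<sigma> \<in> carrier G" for \<sigma> using f that .
    show "\<alpha> (\<rho>, \<sigma>) \<otimes>\<^bsub>k\<^esub> \<alpha> (\<rho> \<otimes>\<^bsub>G\<^esub> \<sigma>, \<tau>) = \<alpha> (\<sigma>, \<tau>) \<otimes>\<^bsub>k\<^esub> \<alpha> (\<rho>, \<sigma> \<otimes>\<^bsub>G\<^esub> \<tau>)"
      if "\<rho> \<in> carrier G" "\<sigma> \<in> carrier G" "\<tau> \<in> carrier G" for \<rho> \<sigma> \<tau>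
      using assms(5) that by (auto simp: cocycles2_def units_of_mult)
    show "\<alpha> (\<sigma>, \<tau>) [^]\<^bsub>k\<^esub> m \<otimes>\<^bsub>k\<^esub> f (\<sigma> \<otimes>\<^bsub>G\<^esub> \<tau>) = f \<sigma> \<otimes>\<^bsub>k\<^esub> f \<tau>"
      if st: "\<sigma> \<in> carrier G" "\<tau> \<in> carrier G" for \<sigma> \<tau>
    proof -
      have u: "f (\<sigma> \<otimes>\<^bsub>G\<^esub> \<tau>) \<in> Units k" using f st by simp
      then show ?thesis
        using assms(9) st K.Units_closed[OF f] K.Units_inv_closed[OF u] by (simp add: K.m_assoc)
    qed
  qed
  have ops: "monoid.mult k = monoid.mult kbar" "add k = add kbar" "one k = one kbar" "zero k = zero kbar"
    unfolding assms(2) by simp_all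
  have sub: "carrier k \<subseteq> carrier kbar" unfolding assms(2) using closure.subset by simp
  have "hopf_iso kbar (base_change k kbar tw.H) (group_hopf_algebra kbar (hat_group kbar G m \<alpha> g)) \<noteq> {}"
    if char: "\<not> characteristic k dvd m" and g: "g \<in> carrier G \<rightarrow> carrier (units_of kbar)"
      "\<forall>\<sigma>\<in>carrier G. g \<sigma> [^]\<^bsub>kbar\<^esub> m = f \<sigma>" for g
  proof -
    have "[m] \<cdot>\<^bsub>k\<^esub> \<one>\<^bsub>k\<^esub> \<noteq> \<zero>\<^bsub>k\<^esub>"
      using char K.add.pow_eq_id[of "\<one>\<^bsub>k\<^esub>" m] by (simp add: characteristic_def)
    moreover have "[m] \<cdot>\<^bsub>k\<^esub> \<one>\<^bsub>k\<^esub> = [m] \<cdot>\<^bsub>kbar\<^esub> \<one>\<^bsub>kbar\<^esub>"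
      by (simp add: add_pow_def nat_pow_def ops)
    ultimately have m1: "[m] \<cdot>\<^bsub>kbar\<^esub> \<one>\<^bsub>kbar\<^esub> \<noteq> \<zero>\<^bsub>kbar\<^esub>" by (simp add: ops)
    interpret ext: twisting_extension k kbar G \<alpha> f m g
      by unfold_locales
        (use g sub ops m1 closure.card_roots_of_unity[OF assms(6) m1] in \<open>auto simp: units_of_carrier\<close>)
    show ?thesis using ext.\<phi>_hopf_iso by blast
  qed
  then show ?thesis
    using tw.H_hopf_algebra tw.H_cocommutative tw.H_dim tw.proj_algebra_hom tw.proj_surj tw.H_semisimple
    by (intro exI[of _ tw.H]) blast
qed

end
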